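(* Let $p\ge2$ be an integer, $\mathfrak{q}=e^{i\pi/p}$, and let $\overline{\mathscr{U}}_{\mathfrak{q}}s\ell(2)$ be the $2p^3$-dimensional quantum group defined in the context. Let $\mathbb{C}_{\mathfrak{q}}^{*p}[\partial]=\mathbb{C}[\partial]/(\partial^p)$ and $\mathbb{C}_{\mathfrak{q}}^{p}[z]=\mathbb{C}[z]/(z^p)$, with the $\overline{\mathscr{U}}_{\mathfrak{q}}s\ell(2)$-actions and coactions $$E\triangleright z^n=-\mathfrak{q}^n[n]z^{n+1},\quad K\triangleright z^n=\mathfrak{q}^{2n}z^n,\quad F\triangleright z^n=[n]\mathfrak{q}^{1-n}z^{n-1},\quad \delta(z)=K^{-1}\otimes z-(\mathfrak{q}-\mathfrak{q}^{-1})EK^{-1}\otimes 1,$$ $$E\triangleright\partial^n=\mathfrak{q}^{1-n}[n]\partial^{n-1},\quad K\triangleright\partial^n=\mathfrak{q}^{-2n}\partial^n,\quad F\triangleright\partial^n=-\mathfrak{q}^n[n]\partial^{n+1},\quad \delta(\partial)=K^{-1}\otimes\partial+(\mathfrak{q}-\mathfrak{q}^{-1})F\otimes 1$$ ($\delta$ being extended as an algebra morphism). Then for every $n\geq1$ the alternating multiple braided products $$\mathsf{H}_{2n}=\mathbb{C}_{\mathfrak{q}}^{*p}[\partial_1]\bowtie\mathbb{C}_{\mathfrak{q}}^{p}[z_2]\bowtie\dots\bowtie\mathbb{C}_{\mathfrak{q}}^{*p}[\partial_{2n-1}]\bowtie\mathbb{C}_{\mathfrak{q}}^{p}[z_{2n}],$$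 $$\mathsf{H}_{2n+1}=\mathbb{C}_{\mathfrak{q}}^{*p}[\partial_1]\bowtie\mathbb{C}_{\mathfrak{q}}^{p}[z_2]\bowtie\dots\bowtie\mathbb{C}_{\mathfrak{q}}^{*p}[\partial_{2n-1}]\bowtie\mathbb{C}_{\mathfrak{q}}^{p}[z_{2n}]\bowtie\mathbb{C}_{\mathfrak{q}}^{*p}[\partial_{2n+1}]$$ (and their infinite versions) are Yetter--Drinfeld $\overline{\mathscr{U}}_{\mathfrak{q}}s\ell(2)$-module algebras, in which the multiplication is given by the relations $z_i^p=0$, $\partial_i^p=0$, $$\partial_i\,z_j=\mathfrak{q}-\mathfrak{q}^{-1}+\mathfrak{q}^{-2}z_j\,\partial_i\quad\text{for all odd } i\text{ and even } j,$$ $$z_i\,z_j=\mathfrak{q}^{-2}z_j\,z_i+(1-\mathfrak{q}^{-2})z_j^2,\qquad \partial_i\,\partial_j=\mathfrak{q}^2\partial_j\,\partial_i+(1-\mathfrak{q}^2)\partial_j^2,\qquad i\geq j$$ (with $i,j$ even in the relation for $z$ and odd in the relation for $\partial$).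
   Context: $\overline{\mathscr{U}}_{\mathfrak{q}}s\ell(2)$ is the Hopf algebra over $\mathbb{C}$ with generators $E,K,F$ and relations $KEK^{-1}=\mathfrak{q}^2E$, $KFK^{-1}=\mathfrak{q}^{-2}F$, $[E,F]=\frac{K-K^{-1}}{\mathfrak{q}-\mathfrak{q}^{-1}}$, $E^p=F^p=0$, $K^{2p}=1$, and $\Delta(E)=E\otimes K+1\otimes E$, $\Delta(K)=K\otimes K$, $\Delta(F)=F\otimes 1+K^{-1}\otimes F$, $\epsilon(E)=\epsilon(F)=0$, $\epsilon(K)=1$, $S(E)=-EK^{-1}$, $S(K)=K^{-1}$, $S(F)=-KF$. Also $[n]=\frac{\mathfrak{q}^n-\mathfrak{q}^{-n}}{\mathfrak{q}-\mathfrak{q}^{-1}}$. For a Hopf algebra $H$, write left coactions as $\delta(u)=u_{(-1)}\otimes u_{(0)}$ and coproducts as $\Delta(h)=h'\otimes h''$. A (left--left) Yetter--Drinfeld $H$-module algebra is an associative algebra $X$ that is a left $H$-module algebra and a left $H$-comodule algebra with $(h'\triangleright x)_{(-1)}h''\otimes(h'\triangleright x)_{(0)}=h'x_{(-1)}\otimes(h''\triangleright x_{(0)})$ for all $h\in H$, $x\in X$. Multiple braided product: for Yetter--Drinfeld $H$-module algebras $X_1,\dots,X_N$, $X_1\bowtie\dots\bowtie X_N$ is the tensor product $X_1\otimes\dots\otimes X_N$ with the diagonal action and codiagonal coaction of $H$ ($\delta(x_1\otimes\dots\otimes x_N)=x_{1(-1)}\cdots x_{N(-1)}\otimes x_{1(0)}\otimes\dots\otimes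 x_{N(0)}$) and with the multiplication determined as follows: writing $x[i]$ for $1\otimes\dots\otimes x\otimes\dots\otimes 1$ with $x\in X_i$ in position $i$, each $x\mapsto x[i]$ is an algebra morphism, $x_1[1]\cdots x_N[N]=x_1\otimes\dots\otimes x_N$, and $x[i]\,y[j]=(x_{(-1)}\triangleright y)[j]\;x_{(0)}[i]$ for $i>j$. Here $\partial_i$ and $z_i$ denote the generators in the $i$th factor. The infinite versions are inductive limits under the embeddings inserting units in additional factors. *)

theory Defs
  imports
    Complex_Main
    "HOL-Library.Poly_Mapping"
    "HOL-Computational_Algebra.Polynomial"
    "HOL-Algebra.Module"
begin

section \<open>Complex algebras\<close>

text \<open>
  Complex vector spaces and algebras are \<open>HOL-Algebra\<close> module records over the ring
  \<open>cx\<close>; for a record used only as a vector space, the fields \<open>mult\<close> and \<open>one\<close> are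
  irrelevant.  The locale \<^locale>\<open>algebra\<close> of the library is not usable, since it requires
  commutativity.
\<close>

type_synonym 'a calg = "(complex, 'a) module"

definition cx :: "complex calg" where
  "cx = \<lparr>carrier = UNIV, mult = (*), one = 1, zero = 0, add = (+), smult = (*)\<rparr>"

locale cx_algebra = module cx A + ring A for A (structure) +
  assumes smult_mult_left:
      "x \<in> carrier A \<Longrightarrow> y \<in> carrier A \<Longrightarrow> (c \<odot> x) \<otimes> y = c \<odot> (x \<otimes> y)"
    and smult_mult_right:
      "x \<in> carrier A \<Longrightarrow> y \<in> carrier A \<Longrightarrow> x \<otimes> (c \<odot> y) = c \<odot> (x \<otimes> y)"

definition lin_maps :: "(complex, 'a, 'm) module_scheme \<Rightarrow> (complex, 'b, 'n) module_scheme \<Rightarrow> ('a \<Rightarrow> 'b) set" where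
  "lin_maps V W = {f. f \<in> carrier V \<rightarrow> carrier W \<and>
     (\<forall>x\<in>carrier V. \<forall>y\<in>carrier V. f (x \<oplus>\<^bsub>V\<^esub> y) = f x \<oplus>\<^bsub>W\<^esub> f y) \<and>
     (\<forall>c. \<forall>x\<in>carrier V. f (c \<odot>\<^bsub>V\<^esub> x) = c \<odot>\<^bsub>W\<^esub> f x)}"

definition alg_homs :: "(complex, 'a, 'm) module_scheme \<Rightarrow> (complex, 'b, 'n) module_scheme \<Rightarrow> ('a \<Rightarrow> 'b) set" where
  "alg_homs A B = ring_hom A B \<inter> lin_maps A B"


section \<open>Quotients of free vector spaces\<close>

definition scal :: "complex \<Rightarrow> ('a \<Rightarrow>\<^sub>0 complex) \<Rightarrow> ('a \<Rightarrow>\<^sub>0 complex)" where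
  "scal c = Poly_Mapping.map ((*) c)"

definition cspan :: "('a \<Rightarrow>\<^sub>0 complex) set \<Rightarrow> ('a \<Rightarrow>\<^sub>0 complex) set" where
  "cspan = Modules.module.span scal"

definition lin_ext :: "(complex, 'b, 'm) module_scheme \<Rightarrow> ('a \<Rightarrow> 'b) \<Rightarrow> ('a \<Rightarrow>\<^sub>0 complex) \<Rightarrow> 'b" where
  "lin_ext M f r = (\<Oplus>\<^bsub>M\<^esub>k\<in>Poly_Mapping.keys r. Poly_Mapping.lookup r k \<odot>\<^bsub>M\<^esub> f k)"

definition cls :: "'a set \<Rightarrow> ('a \<Rightarrow>\<^sub>0 complex) set \<Rightarrow> ('a \<Rightarrow>\<^sub>0 complex) \<Rightarrow> ('a \<Rightarrow>\<^sub>0 complex) set" where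
  "cls S R r = {s. Poly_Mapping.keys s \<subseteq> S \<and> s - r \<in> cspan R}"

definition rep :: "'a set \<Rightarrow> 'a" where
  "rep X = (SOME r. r \<in> X)"

text \<open>
  \<open>free_quot S R m e\<close> is the free vector space on \<open>S\<close> modulo the span of \<open>R\<close>;
  \<open>m\<close> and \<open>e\<close> are a multiplication and a unit given on representatives.
\<close>

definition free_quot ::
  "'a set \<Rightarrow> ('a \<Rightarrow>\<^sub>0 complex) set \<Rightarrow>
   (('a \<Rightarrow>\<^sub>0 complex) \<Rightarrow> ('a \<Rightarrow>\<^sub>0 complex) \<Rightarrow> ('a \<Rightarrow>\<^sub>0 complex)) \<Rightarrow> ('a \<Rightarrow>\<^sub>0 complex) \<Rightarrow>
   ('a \<Rightarrow>\<^sub>0 complex) set calg" where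
  "free_quot S R m e =
    \<lparr>carrier = cls S R ` {r. Poly_Mapping.keys r \<subseteq> S},
     mult = (\<lambda>X Y. cls S R (m (rep X) (rep Y))),
     one = cls S R e,
     zero = cls S R 0,
     add = (\<lambda>X Y. cls S R (rep X + rep Y)),
     smult = (\<lambda>c X. cls S R (scal c (rep X)))\<rparr>"


section \<open>Tensor product of two algebras\<close>

definition bilin_rels :: "(complex, 'a, 'm) module_scheme \<Rightarrow> (complex, 'b, 'n) module_scheme \<Rightarrow> ('a \<times> 'b \<Rightarrow>\<^sub>0 complex) set" where
  "bilin_rels V W =
     {Poly_Mapping.single (v \<oplus>\<^bsub>V\<^esub> v', w) 1 - Poly_Mapping.single (v, w) 1 - Poly_Mapping.single (v', w) 1
        | v v' w. v \<in> carrier V \<and> v' \<in> carrier V \<and> w \<in> carrier W} \<union>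
     {Poly_Mapping.single (v, w \<oplus>\<^bsub>W\<^esub> w') 1 - Poly_Mapping.single (v, w) 1 - Poly_Mapping.single (v, w') 1
        | v w w'. v \<in> carrier V \<and> w \<in> carrier W \<and> w' \<in> carrier W} \<union>
     {Poly_Mapping.single (c \<odot>\<^bsub>V\<^esub> v, w) 1 - Poly_Mapping.single (v, w) c
        | c v w. v \<in> carrier V \<and> w \<in> carrier W} \<union>
     {Poly_Mapping.single (v, c \<odot>\<^bsub>W\<^esub> w) 1 - Poly_Mapping.single (v, w) c
        | c v w. v \<in> carrier V \<and> w \<in> carrier W}"

definition tensor :: "(complex, 'a, 'm) module_scheme \<Rightarrow> (complex, 'b, 'n) module_scheme \<Rightarrow> ('a \<times> 'b \<Rightarrow>\<^sub>0 complex) set calg" where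
  "tensor V W = free_quot (carrier V \<times> carrier W) (bilin_rels V W)
     (\<lambda>r s. \<Sum>(a, b)\<in>Poly_Mapping.keys r. \<Sum>(a', b')\<in>Poly_Mapping.keys s.
        Poly_Mapping.single (a \<otimes>\<^bsub>V\<^esub> a', b \<otimes>\<^bsub>W\<^esub> b')
          (Poly_Mapping.lookup r (a, b) * Poly_Mapping.lookup s (a', b')))
     (Poly_Mapping.single (\<one>\<^bsub>V\<^esub>, \<one>\<^bsub>W\<^esub>) 1)"

definition tens :: "(complex, 'a, 'm) module_scheme \<Rightarrow> (complex, 'b, 'n) module_scheme \<Rightarrow> 'a \<Rightarrow> 'b \<Rightarrow> ('a \<times> 'b \<Rightarrow>\<^sub>0 complex) set" where
  "tens V W v w = cls (carrier V \<times> carrier W) (bilin_rels V W) (Poly_Mapping.single (v, w) 1)"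

text \<open>
  Sweedler notation: for bilinear \<open>f\<close>, \<open>sweedler M f t\<close> is the image of \<open>t\<close> under the
  linear map \<open>a \<otimes> b \<mapsto> f a b\<close> into \<open>M\<close>.
\<close>

definition sweedler :: "(complex, 'c, 'm) module_scheme \<Rightarrow> ('a \<Rightarrow> 'b \<Rightarrow> 'c) \<Rightarrow> ('a \<times> 'b \<Rightarrow>\<^sub>0 complex) set \<Rightarrow> 'c" where
  "sweedler M f t = lin_ext M (\<lambda>(a, b). f a b) (rep t)"


section \<open>Hopf algebras and Yetter--Drinfeld module algebras\<close>

record 'h hopf = "(complex, 'h) module" +
  comult :: "'h \<Rightarrow> ('h \<times> 'h \<Rightarrow>\<^sub>0 complex) set"
  counit :: "'h \<Rightarrow> complex"
  antipode :: "'h \<Rightarrow> 'h"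

locale hopf_algebra = cx_algebra H for H :: "('h, 'm) hopf_scheme" (structure) +
  assumes comult_hom: "comult H \<in> alg_homs H (tensor H H)"
    and counit_hom: "counit H \<in> alg_homs H cx"
    and antipode_linear: "antipode H \<in> lin_maps H H"
    and coassoc: "h \<in> carrier H \<Longrightarrow>
      sweedler (tensor H (tensor H H))
        (\<lambda>a b. sweedler (tensor H (tensor H H)) (\<lambda>a' a''. tens H (tensor H H) a' (tens H H a'' b)) (comult H a))
        (comult H h) =
      sweedler (tensor H (tensor H H)) (\<lambda>a b. tens H (tensor H H) a (comult H b)) (comult H h)"
    and counit_left: "h \<in> carrier H \<Longrightarrow> sweedler H (\<lambda>a b. counit H a \<odot> b) (comult H h) = h"
    and counit_right: "h \<in> carrier H \<Longrightarrow> sweedler H (\<lambda>a b. counit H b \<odot> a) (comult H h) = h"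
    and antipode_left: "h \<in> carrier H \<Longrightarrow>
      sweedler H (\<lambda>a b. antipode H a \<otimes> b) (comult H h) = counit H h \<odot> \<one>"
    and antipode_right: "h \<in> carrier H \<Longrightarrow>
      sweedler H (\<lambda>a b. a \<otimes> antipode H b) (comult H h) = counit H h \<odot> \<one>"

record ('h, 'x) yd = "(complex, 'x) module" +
  act :: "'h \<Rightarrow> 'x \<Rightarrow> 'x"
  coact :: "'x \<Rightarrow> ('h \<times> 'x \<Rightarrow>\<^sub>0 complex) set"

definition mk_yd :: "'x calg \<Rightarrow> ('h \<Rightarrow> 'x \<Rightarrow> 'x) \<Rightarrow> ('x \<Rightarrow> ('h \<times> 'x \<Rightarrow>\<^sub>0 complex) set) \<Rightarrow> ('h, 'x) yd" where
  "mk_yd A a d =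
    \<lparr>carrier = carrier A, mult = mult A, one = one A, zero = zero A, add = add A, smult = smult A,
     act = a, coact = d\<rparr>"

locale yd_algebra = H: hopf_algebra H + X: cx_algebra X
  for H :: "('h, 'm) hopf_scheme" and X :: "('h, 'x, 'n) yd_scheme" +
  assumes act_linear_right: "h \<in> carrier H \<Longrightarrow> act X h \<in> lin_maps X X"
    and act_linear_left: "x \<in> carrier X \<Longrightarrow> (\<lambda>h. act X h x) \<in> lin_maps H X"
    and act_one: "x \<in> carrier X \<Longrightarrow> act X \<one>\<^bsub>H\<^esub> x = x"
    and act_mult: "g \<in> carrier H \<Longrightarrow> h \<in> carrier H \<Longrightarrow> x \<in> carrier X \<Longrightarrow>
      act X (g \<otimes>\<^bsub>H\<^esub> h) x = act X g (act X h x)"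
    and module_alg_mult: "h \<in> carrier H \<Longrightarrow> x \<in> carrier X \<Longrightarrow> y \<in> carrier X \<Longrightarrow>
      act X h (x \<otimes>\<^bsub>X\<^esub> y) = sweedler X (\<lambda>h' h''. act X h' x \<otimes>\<^bsub>X\<^esub> act X h'' y) (comult H h)"
    and module_alg_one: "h \<in> carrier H \<Longrightarrow> act X h \<one>\<^bsub>X\<^esub> = counit H h \<odot>\<^bsub>X\<^esub> \<one>\<^bsub>X\<^esub>"
    and comodule_alg: "coact X \<in> alg_homs X (tensor H X)"
    and coact_coassoc: "x \<in> carrier X \<Longrightarrow>
      sweedler (tensor H (tensor H X))
        (\<lambda>a x0. sweedler (tensor H (tensor H X)) (\<lambda>a' a''. tens H (tensor H X) a' (tens H X a'' x0)) (comult H a))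
        (coact X x) =
      sweedler (tensor H (tensor H X)) (\<lambda>a x0. tens H (tensor H X) a (coact X x0)) (coact X x)"
    and coact_counit: "x \<in> carrier X \<Longrightarrow>
      sweedler X (\<lambda>a x0. counit H a \<odot>\<^bsub>X\<^esub> x0) (coact X x) = x"
    and yetter_drinfeld: "h \<in> carrier H \<Longrightarrow> x \<in> carrier X \<Longrightarrow>
      sweedler (tensor H X)
        (\<lambda>h' h''. sweedler (tensor H X) (\<lambda>a x0. tens H X (a \<otimes>\<^bsub>H\<^esub> h'') x0) (coact X (act X h' x)))
        (comult H h) =
      sweedler (tensor H X)
        (\<lambda>h' h''. sweedler (tensor H X) (\<lambda>a x0. tens H X (h' \<otimes>\<^bsub>H\<^esub> a) (act X h'' x0)) (coact X x))
        (comult H h)"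


section \<open>Multiple braided products\<close>

text \<open>
  The tensor product of a list of spaces; the pure tensor of \<open>x\<^sub>1, \<dots>, x\<^sub>N\<close> is the class of
  the list \<open>[x\<^sub>1, \<dots>, x\<^sub>N]\<close>.  Factor \<open>i\<close> is at list position \<open>i - 1\<close>.
\<close>

abbreviation pure_lists :: "('a, 'x, 'm) module_scheme list \<Rightarrow> 'x list set" where
  "pure_lists Xs \<equiv> listset (map carrier Xs)"

definition multilin_rels :: "(complex, 'x, 'm) module_scheme list \<Rightarrow> ('x list \<Rightarrow>\<^sub>0 complex) set" where
  "multilin_rels Xs =
     {Poly_Mapping.single (xs[i := a \<oplus>\<^bsub>Xs ! i\<^esub> b]) 1 - Poly_Mapping.single (xs[i := a]) 1
        - Poly_Mapping.single (xs[i := b]) 1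
        | xs i a b. xs \<in> pure_lists Xs \<and> i < length Xs \<and> a \<in> carrier (Xs ! i) \<and> b \<in> carrier (Xs ! i)} \<union>
     {Poly_Mapping.single (xs[i := c \<odot>\<^bsub>Xs ! i\<^esub> a]) 1 - Poly_Mapping.single (xs[i := a]) c
        | xs i a c. xs \<in> pure_lists Xs \<and> i < length Xs \<and> a \<in> carrier (Xs ! i)}"

definition mtens :: "(complex, 'x, 'm) module_scheme list \<Rightarrow> 'x list \<Rightarrow> ('x list \<Rightarrow>\<^sub>0 complex) set" where
  "mtens Xs xs = cls (pure_lists Xs) (multilin_rels Xs) (Poly_Mapping.single xs 1)"

text \<open>The multiplication is left unspecified here; see \<open>braided_mult\<close> below.\<close>

definition mtensor :: "(complex, 'x, 'm) module_scheme list \<Rightarrow> ('x list \<Rightarrow>\<^sub>0 complex) set calg" where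
  "mtensor Xs = free_quot (pure_lists Xs) (multilin_rels Xs) undefined (Poly_Mapping.single (map one Xs) 1)"

definition mcons :: "(complex, 'x, 'm) module_scheme \<Rightarrow> (complex, 'x, 'm) module_scheme list \<Rightarrow>
    'x \<Rightarrow> ('x list \<Rightarrow>\<^sub>0 complex) set \<Rightarrow> ('x list \<Rightarrow>\<^sub>0 complex) set" where
  "mcons X Xs x t = lin_ext (mtensor (X # Xs)) (\<lambda>xs. mtens (X # Xs) (x # xs)) (rep t)"

fun diag_act_pure :: "('h, 'm) hopf_scheme \<Rightarrow> ('h, 'x, 'n) yd_scheme list \<Rightarrow> 'h \<Rightarrow> 'x list \<Rightarrow> ('x list \<Rightarrow>\<^sub>0 complex) set" where
  "diag_act_pure H [] h [] = counit H h \<odot>\<^bsub>mtensor ([] :: ('h, 'x, 'n) yd_scheme list)\<^esub> mtens ([] :: ('h, 'x, 'n) yd_scheme list) []"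
| "diag_act_pure H (X # Xs) h (x # xs) =
     sweedler (mtensor (X # Xs)) (\<lambda>h' h''. mcons X Xs (act X h' x) (diag_act_pure H Xs h'' xs)) (comult H h)"

definition diag_act :: "('h, 'm) hopf_scheme \<Rightarrow> ('h, 'x, 'n) yd_scheme list \<Rightarrow> 'h \<Rightarrow>
    ('x list \<Rightarrow>\<^sub>0 complex) set \<Rightarrow> ('x list \<Rightarrow>\<^sub>0 complex) set" where
  "diag_act H Xs h t = lin_ext (mtensor Xs) (diag_act_pure H Xs h) (rep t)"

fun codiag_coact_pure :: "('h, 'm) hopf_scheme \<Rightarrow> ('h, 'x, 'n) yd_scheme list \<Rightarrow> 'x list \<Rightarrow>
    ('h \<times> ('x list \<Rightarrow>\<^sub>0 complex) set \<Rightarrow>\<^sub>0 complex) set" where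
  "codiag_coact_pure H [] [] =
     tens H (mtensor ([] :: ('h, 'x, 'n) yd_scheme list)) \<one>\<^bsub>H\<^esub> (mtens ([] :: ('h, 'x, 'n) yd_scheme list) [])"
| "codiag_coact_pure H (X # Xs) (x # xs) =
     sweedler (tensor H (mtensor (X # Xs)))
       (\<lambda>a x0. sweedler (tensor H (mtensor (X # Xs)))
          (\<lambda>b t. tens H (mtensor (X # Xs)) (a \<otimes>\<^bsub>H\<^esub> b) (mcons X Xs x0 t))
          (codiag_coact_pure H Xs xs))
       (coact X x)"

definition codiag_coact :: "('h, 'm) hopf_scheme \<Rightarrow> ('h, 'x, 'n) yd_scheme list \<Rightarrow>
    ('x list \<Rightarrow>\<^sub>0 complex) set \<Rightarrow> ('h \<times> ('x list \<Rightarrow>\<^sub>0 complex) set \<Rightarrow>\<^sub>0 complex) set" where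
  "codiag_coact H Xs t = lin_ext (tensor H (mtensor Xs)) (codiag_coact_pure H Xs) (rep t)"

text \<open>\<open>at_pos Xs i x\<close> is \<open>x[i + 1] = 1 \<otimes> \<dots> \<otimes> x \<otimes> \<dots> \<otimes> 1\<close>.\<close>

definition at_pos :: "(complex, 'x, 'm) module_scheme list \<Rightarrow> nat \<Rightarrow> 'x \<Rightarrow> ('x list \<Rightarrow>\<^sub>0 complex) set" where
  "at_pos Xs i x = mtens Xs ((map one Xs)[i := x])"

text \<open>
  The conditions that determine the braided multiplication \<open>m\<close>.  Its values outside the
  carrier are fixed arbitrarily, so that \<open>m\<close> is unique as a function.
\<close>

definition is_braided_mult :: "('h, 'm) hopf_scheme \<Rightarrow> ('h, 'x, 'n) yd_scheme list \<Rightarrow>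
    (('x list \<Rightarrow>\<^sub>0 complex) set \<Rightarrow> ('x list \<Rightarrow>\<^sub>0 complex) set \<Rightarrow> ('x list \<Rightarrow>\<^sub>0 complex) set) \<Rightarrow> bool" where
  "is_braided_mult H Xs m \<longleftrightarrow>
    (let A = (mtensor Xs)\<lparr>mult := m\<rparr> in
      cx_algebra A \<and>
      (\<forall>i<length Xs. at_pos Xs i \<in> alg_homs (Xs ! i) A) \<and>
      (\<forall>xs\<in>pure_lists Xs.
         foldr (\<lambda>i t. at_pos Xs i (xs ! i) \<otimes>\<^bsub>A\<^esub> t) [0..<length Xs] \<one>\<^bsub>A\<^esub> = mtens Xs xs) \<and>
      (\<forall>i<length Xs. \<forall>j<i. \<forall>x\<in>carrier (Xs ! i). \<forall>y\<in>carrier (Xs ! j).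
         at_pos Xs i x \<otimes>\<^bsub>A\<^esub> at_pos Xs j y =
         sweedler A (\<lambda>h x0. at_pos Xs j (act (Xs ! j) h y) \<otimes>\<^bsub>A\<^esub> at_pos Xs i x0) (coact (Xs ! i) x)) \<and>
      (\<forall>s t. s \<notin> carrier A \<or> t \<notin> carrier A \<longrightarrow> m s t = undefined))"

definition braided_mult :: "('h, 'm) hopf_scheme \<Rightarrow> ('h, 'x, 'n) yd_scheme list \<Rightarrow>
    ('x list \<Rightarrow>\<^sub>0 complex) set \<Rightarrow> ('x list \<Rightarrow>\<^sub>0 complex) set \<Rightarrow> ('x list \<Rightarrow>\<^sub>0 complex) set" where
  "braided_mult H Xs = (THE m. is_braided_mult H Xs m)"

definition braided_product :: "('h, 'm) hopf_scheme \<Rightarrow> ('h, 'x, 'n) yd_scheme list \<Rightarrow>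
    ('h, ('x list \<Rightarrow>\<^sub>0 complex) set) yd" where
  "braided_product H Xs =
     mk_yd ((mtensor Xs)\<lparr>mult := braided_mult H Xs\<rparr>) (diag_act H Xs) (codiag_coact H Xs)"

text \<open>The embedding inserting units in the additional factors \<open>Ys\<close>.\<close>

definition unit_emb :: "(complex, 'x, 'm) module_scheme list \<Rightarrow> (complex, 'x, 'm) module_scheme list \<Rightarrow>
    ('x list \<Rightarrow>\<^sub>0 complex) set \<Rightarrow> ('x list \<Rightarrow>\<^sub>0 complex) set" where
  "unit_emb Xs Ys t = lin_ext (mtensor (Xs @ Ys)) (\<lambda>xs. mtens (Xs @ Ys) (xs @ map one Ys)) (rep t)"


section \<open>Inductive limits\<close>

text \<open>
  The limit of \<open>A N\<close> for \<open>N\<close> in an infinite set \<open>J\<close> of naturals, along maps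
  \<open>\<phi> M N : A M \<rightarrow> A N\<close> for \<open>M \<le> N\<close> in \<open>J\<close>.
\<close>

definition lim_class :: "nat set \<Rightarrow> (nat \<Rightarrow> ('a, 'x, 'm) module_scheme) \<Rightarrow> (nat \<Rightarrow> nat \<Rightarrow> 'x \<Rightarrow> 'x) \<Rightarrow>
    nat \<Rightarrow> 'x \<Rightarrow> (nat \<times> 'x) set" where
  "lim_class J A \<phi> M x = {(N, y). N \<in> J \<and> y \<in> carrier (A N) \<and>
     (\<exists>K\<in>J. M \<le> K \<and> N \<le> K \<and> \<phi> M K x = \<phi> N K y)}"

definition lim_op2 :: "nat set \<Rightarrow> (nat \<Rightarrow> ('a, 'x, 'm) module_scheme) \<Rightarrow> (nat \<Rightarrow> nat \<Rightarrow> 'x \<Rightarrow> 'x) \<Rightarrow>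
    (nat \<Rightarrow> 'x \<Rightarrow> 'x \<Rightarrow> 'x) \<Rightarrow> (nat \<times> 'x) set \<Rightarrow> (nat \<times> 'x) set \<Rightarrow> (nat \<times> 'x) set" where
  "lim_op2 J A \<phi> f S T =
     (let (M, x) = rep S; (N, y) = rep T; K = max M N in
      lim_class J A \<phi> K (f K (\<phi> M K x) (\<phi> N K y)))"

definition lim_op1 :: "nat set \<Rightarrow> (nat \<Rightarrow> ('a, 'x, 'm) module_scheme) \<Rightarrow> (nat \<Rightarrow> nat \<Rightarrow> 'x \<Rightarrow> 'x) \<Rightarrow>
    (nat \<Rightarrow> 'x \<Rightarrow> 'x) \<Rightarrow> (nat \<times> 'x) set \<Rightarrow> (nat \<times> 'x) set" where
  "lim_op1 J A \<phi> f S = (let (M, x) = rep S in lim_class J A \<phi> M (f M x))"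

definition lim_alg :: "nat set \<Rightarrow> (nat \<Rightarrow> (complex, 'x, 'm) module_scheme) \<Rightarrow> (nat \<Rightarrow> nat \<Rightarrow> 'x \<Rightarrow> 'x) \<Rightarrow>
    (nat \<times> 'x) set calg" where
  "lim_alg J A \<phi> =
    \<lparr>carrier = {lim_class J A \<phi> N x | N x. N \<in> J \<and> x \<in> carrier (A N)},
     mult = lim_op2 J A \<phi> (\<lambda>N. mult (A N)),
     one = lim_class J A \<phi> (Inf J) \<one>\<^bsub>A (Inf J)\<^esub>,
     zero = lim_class J A \<phi> (Inf J) \<zero>\<^bsub>A (Inf J)\<^esub>,
     add = lim_op2 J A \<phi> (\<lambda>N. add (A N)),
     smult = (\<lambda>c. lim_op1 J A \<phi> (\<lambda>N. smult (A N) c))\<rparr>"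

definition ind_lim :: "('h, 'm) hopf_scheme \<Rightarrow> nat set \<Rightarrow> (nat \<Rightarrow> ('h, 'x, 'n) yd_scheme) \<Rightarrow>
    (nat \<Rightarrow> nat \<Rightarrow> 'x \<Rightarrow> 'x) \<Rightarrow> ('h, (nat \<times> 'x) set) yd" where
  "ind_lim H J A \<phi> =
     mk_yd (lim_alg J A \<phi>)
       (\<lambda>h. lim_op1 J A \<phi> (\<lambda>N. act (A N) h))
       (\<lambda>S. let (M, x) = rep S in
          sweedler (tensor H (lim_alg J A \<phi>))
            (\<lambda>h x0. tens H (lim_alg J A \<phi>) h (lim_class J A \<phi> M x0)) (coact (A M) x))"


section \<open>Generators and relations\<close>

text \<open>The free algebra on \<open>'g\<close> is \<open>'g list \<Rightarrow>\<^sub>0 complex\<close> with concatenation of words.\<close>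

instantiation list :: (type) monoid_add
begin
definition zero_list :: "'a list" where "zero_list = []"
definition plus_list :: "'a list \<Rightarrow> 'a list \<Rightarrow> 'a list" where "plus_list = (@)"
instance by standard (simp_all add: zero_list_def plus_list_def)
end

abbreviation gen :: "'g \<Rightarrow> 'g list \<Rightarrow>\<^sub>0 complex" where
  "gen g \<equiv> Poly_Mapping.single [g] 1"

abbreviation const :: "complex \<Rightarrow> 'g list \<Rightarrow>\<^sub>0 complex" where
  "const c \<equiv> Poly_Mapping.single [] c"

text \<open>The span of \<open>two_sided G R\<close> is the two-sided ideal generated by \<open>R\<close> in the free algebra on \<open>G\<close>.\<close>

definition two_sided :: "'g set \<Rightarrow> ('g list \<Rightarrow>\<^sub>0 complex) set \<Rightarrow> ('g list \<Rightarrow>\<^sub>0 complex) set" where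
  "two_sided G R = {Poly_Mapping.single u 1 * r * Poly_Mapping.single v 1 | u r v.
     u \<in> lists G \<and> r \<in> R \<and> v \<in> lists G}"

definition word_eval :: "('a, 'm) monoid_scheme \<Rightarrow> ('g \<Rightarrow> 'a) \<Rightarrow> 'g list \<Rightarrow> 'a" where
  "word_eval A x w = foldr (\<lambda>g a. x g \<otimes>\<^bsub>A\<^esub> a) w \<one>\<^bsub>A\<^esub>"

definition free_eval :: "(complex, 'a, 'm) module_scheme \<Rightarrow> ('g \<Rightarrow> 'a) \<Rightarrow> ('g list \<Rightarrow>\<^sub>0 complex) \<Rightarrow> 'a" where
  "free_eval A x f = lin_ext A (word_eval A x) f"

text \<open>
  \<open>A\<close> is the algebra with generators \<open>x g\<close>, \<open>g \<in> G\<close>, and defining relations \<open>r = 0\<close>, \<open>r \<in> R\<close>: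
  evaluation at \<open>x\<close> is onto, and its kernel is the ideal generated by \<open>R\<close>.
\<close>

definition presented_by :: "(complex, 'a, 'm) module_scheme \<Rightarrow> 'g set \<Rightarrow> ('g \<Rightarrow> 'a) \<Rightarrow> ('g list \<Rightarrow>\<^sub>0 complex) set \<Rightarrow> bool" where
  "presented_by A G x R \<longleftrightarrow>
     x ` G \<subseteq> carrier A \<and>
     free_eval A x ` {f. Poly_Mapping.keys f \<subseteq> lists G} = carrier A \<and>
     (\<forall>f. Poly_Mapping.keys f \<subseteq> lists G \<longrightarrow>
        (free_eval A x f = \<zero>\<^bsub>A\<^esub> \<longleftrightarrow> f \<in> cspan (two_sided G R)))"


section \<open>The restricted quantum group\<close>

definition qq :: "nat \<Rightarrow> complex" where
  "qq p = exp (\<i> * of_real pi / of_nat p)"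

definition qint :: "nat \<Rightarrow> nat \<Rightarrow> complex" where
  "qint p n = (qq p ^ n - inverse (qq p) ^ n) / (qq p - inverse (qq p))"

datatype ugen = gE | gK | gF

text \<open>\<open>K\<^sup>-\<^sup>1\<close> is the word \<open>K\<^bsup>2p-1\<^esup>\<close>, by the relation \<open>K\<^bsup>2p\<^esup> = 1\<close>.\<close>

definition Kinv :: "nat \<Rightarrow> ugen list \<Rightarrow>\<^sub>0 complex" where
  "Kinv p = gen gK ^ (2 * p - 1)"

definition u_relators :: "nat \<Rightarrow> (ugen list \<Rightarrow>\<^sub>0 complex) set" where
  "u_relators p =
    {gen gK * gen gE * Kinv p - const (qq p ^ 2) * gen gE,
     gen gK * gen gF * Kinv p - const (inverse (qq p) ^ 2) * gen gF,
     gen gE * gen gF - gen gF * gen gE - const (1 / (qq p - inverse (qq p))) * (gen gK - Kinv p),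
     gen gE ^ p,
     gen gF ^ p,
     gen gK ^ (2 * p) - 1}"

definition u_cls :: "nat \<Rightarrow> (ugen list \<Rightarrow>\<^sub>0 complex) \<Rightarrow> (ugen list \<Rightarrow>\<^sub>0 complex) set" where
  "u_cls p = cls UNIV (two_sided UNIV (u_relators p))"

definition u_alg :: "nat \<Rightarrow> (ugen list \<Rightarrow>\<^sub>0 complex) set calg" where
  "u_alg p = free_quot UNIV (two_sided UNIV (u_relators p)) (*) 1"

primrec u_comult_gen :: "nat \<Rightarrow> ugen \<Rightarrow> ((ugen list \<Rightarrow>\<^sub>0 complex) set \<times> (ugen list \<Rightarrow>\<^sub>0 complex) set \<Rightarrow>\<^sub>0 complex) set" where
  "u_comult_gen p gE =
     tens (u_alg p) (u_alg p) (u_cls p (gen gE)) (u_cls p (gen gK))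
     \<oplus>\<^bsub>tensor (u_alg p) (u_alg p)\<^esub> tens (u_alg p) (u_alg p) (u_cls p 1) (u_cls p (gen gE))"
| "u_comult_gen p gK = tens (u_alg p) (u_alg p) (u_cls p (gen gK)) (u_cls p (gen gK))"
| "u_comult_gen p gF =
     tens (u_alg p) (u_alg p) (u_cls p (gen gF)) (u_cls p 1)
     \<oplus>\<^bsub>tensor (u_alg p) (u_alg p)\<^esub> tens (u_alg p) (u_alg p) (u_cls p (Kinv p)) (u_cls p (gen gF))"

primrec u_counit_gen :: "ugen \<Rightarrow> complex" where
  "u_counit_gen gE = 0"
| "u_counit_gen gK = 1"
| "u_counit_gen gF = 0"

primrec u_antipode_gen :: "nat \<Rightarrow> ugen \<Rightarrow> (ugen list \<Rightarrow>\<^sub>0 complex) set" where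
  "u_antipode_gen p gE = u_cls p (- (gen gE * Kinv p))"
| "u_antipode_gen p gK = u_cls p (Kinv p)"
| "u_antipode_gen p gF = u_cls p (- (gen gK * gen gF))"

text \<open>\<open>\<Delta>\<close> and \<open>\<epsilon>\<close> extend as algebra morphisms, \<open>S\<close> as an antimorphism.\<close>

definition Uq :: "nat \<Rightarrow> (ugen list \<Rightarrow>\<^sub>0 complex) set hopf" where
  "Uq p =
    \<lparr>carrier = carrier (u_alg p), mult = mult (u_alg p), one = one (u_alg p),
     zero = zero (u_alg p), add = add (u_alg p), smult = smult (u_alg p),
     comult = (\<lambda>u. free_eval (tensor (u_alg p) (u_alg p)) (u_comult_gen p) (rep u)),
     counit = (\<lambda>u. free_eval cx u_counit_gen (rep u)),
     antipode = (\<lambda>u. lin_ext (u_alg p) (\<lambda>w. word_eval (u_alg p) (u_antipode_gen p) (rev w)) (rep u))\<rparr>"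


section \<open>The two truncated polynomial algebras\<close>

text \<open>\<open>\<complex>[x]/(x\<^sup>p)\<close>, each class being represented by its remainder.\<close>

definition trunc_poly :: "nat \<Rightarrow> complex poly calg" where
  "trunc_poly p =
    \<lparr>carrier = {f. degree f < p}, mult = (\<lambda>f g. (f * g) mod monom 1 p), one = 1,
     zero = 0, add = (+), smult = Polynomial.smult\<rparr>"

definition xpow :: "nat \<Rightarrow> nat \<Rightarrow> complex poly" where
  "xpow p n = monom 1 n mod monom 1 p"

text \<open>
  The action is given by the images \<open>a g n\<close> of \<open>x\<^sup>n\<close>, \<open>n < p\<close>, under the generators \<open>g\<close>,
  the coaction by \<open>\<delta>(x) = d\<close>.
\<close>

definition trunc_yd :: "nat \<Rightarrow> (ugen \<Rightarrow> nat \<Rightarrow> complex poly) \<Rightarrow>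
    ((ugen list \<Rightarrow>\<^sub>0 complex) set \<times> complex poly \<Rightarrow>\<^sub>0 complex) set \<Rightarrow>
    ((ugen list \<Rightarrow>\<^sub>0 complex) set, complex poly) yd" where
  "trunc_yd p a d =
     mk_yd (trunc_poly p)
       (\<lambda>u f. lin_ext (trunc_poly p)
          (\<lambda>w. foldr (\<lambda>g f'. \<Sum>n<p. Polynomial.smult (coeff f' n) (a g n)) w f) (rep u))
       (\<lambda>f. \<Oplus>\<^bsub>tensor (Uq p) (trunc_poly p)\<^esub>n\<in>{..<p}.
          coeff f n \<odot>\<^bsub>tensor (Uq p) (trunc_poly p)\<^esub> (d [^]\<^bsub>tensor (Uq p) (trunc_poly p)\<^esub> n))"

text \<open>The exponent \<open>n - 1\<close> is truncated at \<open>n = 0\<close>, where the coefficient vanishes.\<close>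

primrec z_act :: "nat \<Rightarrow> ugen \<Rightarrow> nat \<Rightarrow> complex poly" where
  "z_act p gE n = Polynomial.smult (- (qq p ^ n * qint p n)) (xpow p (n + 1))"
| "z_act p gK n = Polynomial.smult (qq p ^ (2 * n)) (xpow p n)"
| "z_act p gF n = Polynomial.smult (qint p n * qq p powi (1 - int n)) (xpow p (n - 1))"

primrec d_act :: "nat \<Rightarrow> ugen \<Rightarrow> nat \<Rightarrow> complex poly" where
  "d_act p gE n = Polynomial.smult (qq p powi (1 - int n) * qint p n) (xpow p (n - 1))"
| "d_act p gK n = Polynomial.smult (inverse (qq p) ^ (2 * n)) (xpow p n)"
| "d_act p gF n = Polynomial.smult (- (qq p ^ n * qint p n)) (xpow p (n + 1))"

definition Cz :: "nat \<Rightarrow> ((ugen list \<Rightarrow>\<^sub>0 complex) set, complex poly) yd" where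
  "Cz p = trunc_yd p (z_act p)
     (tens (Uq p) (trunc_poly p) (u_cls p (Kinv p)) (xpow p 1)
      \<oplus>\<^bsub>tensor (Uq p) (trunc_poly p)\<^esub>
      (- (qq p - inverse (qq p))) \<odot>\<^bsub>tensor (Uq p) (trunc_poly p)\<^esub>
        tens (Uq p) (trunc_poly p) (u_cls p (gen gE * Kinv p)) 1)"

definition Cd :: "nat \<Rightarrow> ((ugen list \<Rightarrow>\<^sub>0 complex) set, complex poly) yd" where
  "Cd p = trunc_yd p (d_act p)
     (tens (Uq p) (trunc_poly p) (u_cls p (Kinv p)) (xpow p 1)
      \<oplus>\<^bsub>tensor (Uq p) (trunc_poly p)\<^esub>
      (qq p - inverse (qq p)) \<odot>\<^bsub>tensor (Uq p) (trunc_poly p)\<^esub>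
        tens (Uq p) (trunc_poly p) (u_cls p (gen gF)) 1)"


section \<open>The alternating products\<close>

definition factors :: "nat \<Rightarrow> nat \<Rightarrow> nat \<Rightarrow> ((ugen list \<Rightarrow>\<^sub>0 complex) set, complex poly) yd list" where
  "factors p M N = map (\<lambda>i. if odd i then Cd p else Cz p) [Suc M..<Suc N]"

definition HH :: "nat \<Rightarrow> nat \<Rightarrow> ((ugen list \<Rightarrow>\<^sub>0 complex) set, (complex poly list \<Rightarrow>\<^sub>0 complex) set) yd" where
  "HH p N = braided_product (Uq p) (factors p 0 N)"

text \<open>\<open>\<partial>\<^sub>i\<close> for odd \<open>i\<close> and \<open>z\<^sub>i\<close> for even \<open>i\<close>, in the \<open>N\<close>-fold product.\<close>

definition HH_gen :: "nat \<Rightarrow> nat \<Rightarrow> nat \<Rightarrow> (complex poly list \<Rightarrow>\<^sub>0 complex) set" where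
  "HH_gen p N i = at_pos (factors p 0 N) (i - 1) (xpow p 1)"

definition HH_emb :: "nat \<Rightarrow> nat \<Rightarrow> nat \<Rightarrow> (complex poly list \<Rightarrow>\<^sub>0 complex) set \<Rightarrow> (complex poly list \<Rightarrow>\<^sub>0 complex) set" where
  "HH_emb p M N = unit_emb (factors p 0 M) (factors p M N)"

definition HH_inf :: "nat \<Rightarrow> nat set \<Rightarrow>
    ((ugen list \<Rightarrow>\<^sub>0 complex) set, (nat \<times> (complex poly list \<Rightarrow>\<^sub>0 complex) set) set) yd" where
  "HH_inf p J = ind_lim (Uq p) J (HH p) (HH_emb p)"

definition HH_inf_gen :: "nat \<Rightarrow> nat set \<Rightarrow> nat \<Rightarrow> (nat \<times> (complex poly list \<Rightarrow>\<^sub>0 complex) set) set" where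
  "HH_inf_gen p J i =
     (let N = (LEAST N. N \<in> J \<and> i \<le> N) in lim_class J (HH p) (HH_emb p) N (HH_gen p N i))"

definition HH_relators :: "nat \<Rightarrow> nat set \<Rightarrow> (nat list \<Rightarrow>\<^sub>0 complex) set" where
  "HH_relators p I =
     {gen i ^ p | i. i \<in> I} \<union>
     {gen i * gen j - (const (qq p - inverse (qq p)) + const (inverse (qq p) ^ 2) * gen j * gen i)
        | i j. i \<in> I \<and> j \<in> I \<and> odd i \<and> even j} \<union>
     {gen i * gen j - (const (inverse (qq p) ^ 2) * gen j * gen i + const (1 - inverse (qq p) ^ 2) * gen j ^ 2)
        | i j. i \<in> I \<and> j \<in> I \<and> even i \<and> even j \<and> i \<ge> j} \<union>
     {gen i * gen j - (const (qq p ^ 2) * gen j * gen i + const (1 - qq p ^ 2) * gen j ^ 2)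
        | i j. i \<in> I \<and> j \<in> I \<and> odd i \<and> odd j \<and> i \<ge> j}"

end

(* Idea.  Write delta(x_i) = K^-1 (x) x_i + T_i (x) 1 for the generator x_i of the i-th factor.  Suppose that
  operators y_i (i > k) and E, K, F on a space W satisfy the asserted relations and the commutation relations
  of E, K, F with left multiplications.  Then so do x_k (x) 1, the operators K^-1 (x) y_i + T_i (x) 1 and the
  coproducts of E, K, F on X_k (x) W; nilpotency comes from the q-binomial theorem at a root of unity.  Hence
  the relations hold for operators on the iterated tensor product, which is generated by its unit.
  Conversely, for elements b_i of an algebra B that satisfy the relations, the linear map
  f_1 (x) ... (x) f_N |-> f_1(b_1) ... f_N(b_N) carries these operators to the left multiplications by the b_i.
  For B the operators themselves, this map is the multiplication of the braided product; for B presented by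
  the relations it gives the presentation, for B another braided product the uniqueness, and for
  B = U (x) A the coaction.  The Yetter-Drinfeld axioms are consequences of relations between operators, so
  that it is enough to check them on generators.  In the inductive limits every relation lives at a
  finite level. *)

theory Submission
 imports Defs
begin

text \<open>The obstacle is that the multiplication is given only by a definite description: neither
  its existence nor its associativity is at hand, so no ring calculation can be made in the product
  at the outset. Composition of operators is associative, and the operator of an element is
  recovered from its value at the unit; the algebra generated by the operators is therefore a
  faithful model of the product sought, and its multiplication is transported to the tensor product.
  The relations between operators are verified in a single algebra that contains two commuting
  copies of the quantum group, standing for the two tensor factors. The same identities there serve
  for the operators on the iterated tensor product, for the coaction and for the Yetter-Drinfeld
  condition. The truncations survive because q^2 is a primitive p-th root of unity: all inner
  coefficients of the Gaussian binomial formula for a p-th power vanish. The inverse of K is the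
  power 2p - 1 of K, so algebra morphisms respect it.\<close>

abbreviation (input) "keys \<equiv> Poly_Mapping.keys"
abbreviation (input) "single \<equiv> Poly_Mapping.single"

section \<open>Complex vector spaces as module records\<close>

lemma cx_simps [simp]:
 "carrier cx = UNIV" "mult cx = (*)" "one cx = 1" "zero cx = 0" "add cx = (+)" "smult cx = (*)"
 by (simp_all add: cx_def)

lemma cring_cx: "cring cx"
proof -
 have "\<exists>y. x + y = 0 \<and> y + x = 0" for x :: complex
  by (rule exI[of _ "- x"]) simp
 then show ?thesis
  by unfold_locales (auto simp: algebra_simps Units_def)
qed

text \<open>A vector space without a ring structure: \<open>mtensor\<close> has an unspecified
  multiplication until the braided product is constructed, and its linear algebra is needed for that
  construction.\<close>

locale cvec = fixes V (structure) assumes cmod: "module cx V"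

sublocale cvec \<subseteq> abelian_group V
 using cmod by (simp add: module_def)

context cvec
begin

lemma sm_closed [simp, intro]: "x \<in> carrier V ==> c \<odot> x \<in> carrier V"
 using module.smult_closed[OF cmod] by simp

lemma sm_add: "x \<in> carrier V ==> (a + b) \<odot> x = a \<odot> x \<oplus> b \<odot> x"
 using module.smult_l_distr[OF cmod] by simp

lemma sm_distr: "x \<in> carrier V ==> y \<in> carrier V ==> c \<odot> (x \<oplus> y) = c \<odot> x \<oplus> c \<odot> y"
 using module.smult_r_distr[OF cmod] by simp

lemma sm_sm: "x \<in> carrier V ==> a \<odot> (b \<odot> x) = (a * b) \<odot> x"
 using module.smult_assoc1[OF cmod] by simp

lemma sm_one [simp]: "x \<in> carrier V ==> 1 \<odot> x = x"
 using module.smult_one[OF cmod] by simp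

lemma sm_0 [simp]: "x \<in> carrier V ==> 0 \<odot> x = \<zero>"
 using module.smult_l_null[OF cmod] by simp

lemma sm_zero [simp]: "c \<odot> \<zero> = \<zero>"
 using module.smult_r_null[OF cmod] by simp

lemma sm_neg: "x \<in> carrier V ==> (-1) \<odot> x = \<ominus> x"
 using sm_add[of x "-1" 1] minus_equality[of "(-1) \<odot> x" x] by simp

lemma diff_zero_iff: "x \<in> carrier V ==> y \<in> carrier V ==> x \<ominus> y = \<zero> \<longleftrightarrow> x = y"
 by (metis a_minus_def add.inv_closed minus_equality minus_minus r_neg)

lemma finsum_sm:
 "finite A ==> (!!i. i \<in> A ==> f i \<in> carrier V) ==> c \<odot> finsum V f A = (\<Oplus>i\<in>A. c \<odot> f i)"
 using module.finsum_smult_ldistr[OF cmod, of A c f] by auto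

lemma finsum_single_nonzero:
 assumes "finite A" "j \<in> A" "!!i. i \<in> A ==> f i \<in> carrier V" "!!i. i \<in> A ==> i \<noteq> j ==> f i = \<zero>"
 shows "finsum V f A = f j"
proof -
 have "finsum V f A = finsum V f (insert j (A - {j}))" using assms(2) by (simp add: insert_absorb)
 also have "... = f j \<oplus> finsum V f (A - {j})" using assms by (subst finsum_insert) auto
 also have "finsum V f (A - {j}) = \<zero>" using assms by (intro add.finprod_one_eqI) auto
 finally show ?thesis using assms by simp
qed

end

sublocale cx_algebra \<subseteq> cvec A ..

context cx_algebra
begin
declare smult_mult_left [simp] smult_mult_right [simp]
end

text \<open>Additive inverses are not asked for: (-1) \<odot> x is one, because scaling by 0 gives
  zero.\<close>

lemma cvecI:
 fixes V (structure)
 assumes "!!x y. x \<in> carrier V ==> y \<in> carrier V ==> x \<oplus> y \<in> carrier V" "\<zero> \<in> carrier V"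
  "!!x y z. x \<in> carrier V ==> y \<in> carrier V ==> z \<in> carrier V ==> (x \<oplus> y) \<oplus> z = x \<oplus> (y \<oplus> z)"
  "!!x y. x \<in> carrier V ==> y \<in> carrier V ==> x \<oplus> y = y \<oplus> x"
  "!!x. x \<in> carrier V ==> \<zero> \<oplus> x = x"
  "!!c x. x \<in> carrier V ==> c \<odot> x \<in> carrier V"
  "!!c x y. x \<in> carrier V ==> y \<in> carrier V ==> c \<odot> (x \<oplus> y) = c \<odot> x \<oplus> c \<odot> y"
  "!!a b x. x \<in> carrier V ==> (a + b) \<odot> x = a \<odot> x \<oplus> b \<odot> x"
  "!!a b x. x \<in> carrier V ==> (a * b) \<odot> x = a \<odot> (b \<odot> x)"
  "!!x. x \<in> carrier V ==> 1 \<odot> x = x"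
  "!!x. x \<in> carrier V ==> 0 \<odot> x = \<zero>"
 shows "cvec V"
proof -
 have "\<exists>y\<in>carrier V. y \<oplus> x = \<zero>" if "x \<in> carrier V" for x
  using assms(8)[of x "-1" 1] assms(6)[of x "-1"] assms(10,11)[of x] that by auto
 then have "abelian_group V"
  by (intro abelian_groupI) (use assms in auto)
 then show ?thesis unfolding cvec_def
  by (intro moduleI cring_cx) (use assms in auto)
qed

lemma cx_algebraI:
 fixes A (structure)
 assumes "cvec A"
  "!!x y. x \<in> carrier A ==> y \<in> carrier A ==> x \<otimes> y \<in> carrier A" "\<one> \<in> carrier A"
  "!!x y z. x \<in> carrier A ==> y \<in> carrier A ==> z \<in> carrier A ==> (x \<otimes> y) \<otimes> z = x \<otimes> (y \<otimes> z)"
  "!!x. x \<in> carrier A ==> \<one> \<otimes> x = x" "!!x. x \<in> carrier A ==> x \<otimes> \<one> = x"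
  "!!x y z. x \<in> carrier A ==> y \<in> carrier A ==> z \<in> carrier A ==> (x \<oplus> y) \<otimes> z = x \<otimes> z \<oplus> y \<otimes> z"
  "!!x y z. x \<in> carrier A ==> y \<in> carrier A ==> z \<in> carrier A ==> z \<otimes> (x \<oplus> y) = z \<otimes> x \<oplus> z \<otimes> y"
  "!!c x y. x \<in> carrier A ==> y \<in> carrier A ==> (c \<odot> x) \<otimes> y = c \<odot> (x \<otimes> y)"
  "!!c x y. x \<in> carrier A ==> y \<in> carrier A ==> x \<otimes> (c \<odot> y) = c \<odot> (x \<otimes> y)"
 shows "cx_algebra A"
proof -
 interpret V: cvec A by fact
 interpret module cx A by (rule V.cmod)
 interpret ring A
  by (rule ringI) (use assms in \<open>auto intro!: V.abelian_group_axioms monoidI\<close>)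
 show ?thesis by unfold_locales (use assms in auto)
qed


text \<open>The same algebra occurs inside several records, such as \<open>u_alg p\<close> and the
  Hopf algebra \<open>Uq p\<close>, or an algebra and its extension by an action and a coaction.
  Notions that read only the shared fields agree on such records.\<close>

definition same_mod :: "(complex, 'a, 'm) module_scheme => (complex, 'a, 'n) module_scheme => bool" where
 "same_mod A B \<longleftrightarrow> carrier A = carrier B \<and> zero A = zero B \<and> add A = add B \<and> smult A = smult B"

definition same_alg :: "(complex, 'a, 'm) module_scheme => (complex, 'a, 'n) module_scheme => bool" where
 "same_alg A B \<longleftrightarrow> same_mod A B \<and> mult A = mult B \<and> one A = one B"

lemma same_alg_mod: "same_alg A B ==> same_mod A B" by (simp add: same_alg_def)

lemma cvec_cong:
 assumes "same_mod A B" "cvec B" shows "cvec A"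
proof -
 interpret B: cvec B by fact
 have [simp]: "carrier A = carrier B" "zero A = zero B" "add A = add B" "smult A = smult B"
  using assms(1) by (auto simp: same_mod_def)
 show ?thesis
  by (intro cvecI) (auto simp: B.a_assoc B.sm_distr B.sm_add B.sm_sm intro: B.a_comm)
qed

lemma cx_algebra_cong:
 assumes "same_alg A B" "cx_algebra B" shows "cx_algebra A"
proof -
 interpret B: cx_algebra B by fact
 have [simp]: "carrier A = carrier B" "zero A = zero B" "add A = add B" "smult A = smult B"
  "mult A = mult B" "one A = one B"
  using assms(1) by (auto simp: same_alg_def same_mod_def)
 have "cvec A" using B.cvec_axioms assms(1) by (intro cvec_cong[of A B] same_alg_mod)
 then show ?thesis
  by (rule cx_algebraI) (auto simp: B.m_assoc B.l_distr B.r_distr)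
qed

lemma finsum_cong_mod: "same_mod A B ==> finsum A = finsum B"
 unfolding finsum_def finprod_def foldD_def same_mod_def by (elim conjE) (simp only: monoid.simps partial_object.simps)

lemma lin_ext_cong_mod: "same_mod A B ==> lin_ext A = lin_ext B"
 by (auto simp: lin_ext_def fun_eq_iff finsum_cong_mod[of A B]) (simp add: same_mod_def)

lemma sweedler_cong_mod: "same_mod A B ==> sweedler A = sweedler B"
 unfolding sweedler_def[abs_def] by (simp add: lin_ext_cong_mod[of A B])

lemma lin_maps_cong_mod: "same_mod A A' ==> same_mod B B' ==> lin_maps A B = lin_maps A' B'"
 by (simp add: lin_maps_def same_mod_def)

lemma alg_homs_cong: "same_alg A A' ==> same_alg B B' ==> alg_homs A B = alg_homs A' B'"
 using lin_maps_cong_mod[of A A' B B']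
 by (simp add: alg_homs_def ring_hom_def same_mod_def same_alg_def)

lemma word_eval_cong: "same_alg A A' ==> word_eval A = word_eval A'"
 by (simp add: word_eval_def[abs_def] same_alg_def)

lemma free_eval_cong: "same_alg A A' ==> free_eval A = free_eval A'"
 by (simp add: free_eval_def[abs_def] word_eval_cong[of A A'] lin_ext_cong_mod[of A A'] same_alg_mod)


section \<open>Linear maps and algebra morphisms\<close>

lemma lin_mapsI:
 assumes "!!x. x \<in> carrier V ==> f x \<in> carrier W"
  "!!x y. x \<in> carrier V ==> y \<in> carrier V ==> f (x \<oplus>\<^bsub>V\<^esub> y) = f x \<oplus>\<^bsub>W\<^esub> f y"
  "!!c x. x \<in> carrier V ==> f (c \<odot>\<^bsub>V\<^esub> x) = c \<odot>\<^bsub>W\<^esub> f x"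
 shows "f \<in> lin_maps V W"
 using assms by (auto simp: lin_maps_def)

lemma lin_closed: "f \<in> lin_maps V W ==> x \<in> carrier V ==> f x \<in> carrier W"
 and lin_add: "f \<in> lin_maps V W ==> x \<in> carrier V ==> y \<in> carrier V ==> f (x \<oplus>\<^bsub>V\<^esub> y) = f x \<oplus>\<^bsub>W\<^esub> f y"
 and lin_sm: "f \<in> lin_maps V W ==> x \<in> carrier V ==> f (c \<odot>\<^bsub>V\<^esub> x) = c \<odot>\<^bsub>W\<^esub> f x"
 by (auto simp: lin_maps_def)

lemma lin_zero:
 assumes "f \<in> lin_maps V W" "cvec V" "cvec W"
 shows "f \<zero>\<^bsub>V\<^esub> = \<zero>\<^bsub>W\<^esub>"
proof -
 interpret V: cvec V by fact
 interpret W: cvec W by fact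
 have "f (0 \<odot>\<^bsub>V\<^esub> \<zero>\<^bsub>V\<^esub>) = 0 \<odot>\<^bsub>W\<^esub> f \<zero>\<^bsub>V\<^esub>" using assms(1) by (rule lin_sm) simp
 then show ?thesis using lin_closed[OF assms(1) V.zero_closed] by simp
qed

lemma lin_cong: "f \<in> lin_maps V W ==> cvec V ==> (!!x. x \<in> carrier V ==> f x = g x) ==> g \<in> lin_maps V W"
 by (rule lin_mapsI) (metis lin_closed, metis lin_add abelian_monoid.a_closed abelian_group.axioms(1)
   cvec_def module.axioms(2), metis lin_sm cvec.sm_closed)

lemma lin_comp: "f \<in> lin_maps V W ==> g \<in> lin_maps W X ==> (\<lambda>x. g (f x)) \<in> lin_maps V X"
 by (rule lin_mapsI) (simp_all add: lin_closed lin_add lin_sm)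

lemma lin_id: "(\<lambda>x. x) \<in> lin_maps V V"
 by (auto simp: lin_maps_def)

lemma lin_finsum:
 assumes "f \<in> lin_maps V W" "cvec V" "cvec W" "finite A" "!!i. i \<in> A ==> g i \<in> carrier V"
 shows "f (finsum V g A) = (\<Oplus>\<^bsub>W\<^esub>i\<in>A. f (g i))"
proof -
 interpret V: cvec V by fact
 interpret W: cvec W by fact
 note f = lin_closed[OF assms(1)] lin_add[OF assms(1)] lin_zero[OF assms(1-3)]
 show ?thesis using assms(4,5)
 proof (induction A rule: finite_induct)
  case empty then show ?case by (simp add: f)
 next
  case (insert a A)
  then have "g \<in> A \<rightarrow> carrier V" "g a \<in> carrier V" by auto
  with insert show ?case by (simp add: f V.finsum_insert W.finsum_insert Pi_def)
 qed
qed

lemma alg_homsI: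
 assumes "f \<in> lin_maps A B"
  "!!x y. x \<in> carrier A ==> y \<in> carrier A ==> f (x \<otimes>\<^bsub>A\<^esub> y) = f x \<otimes>\<^bsub>B\<^esub> f y"
  "f \<one>\<^bsub>A\<^esub> = \<one>\<^bsub>B\<^esub>"
 shows "f \<in> alg_homs A B"
 using assms by (auto simp: alg_homs_def ring_hom_def lin_maps_def)

lemma hom_lin: "f \<in> alg_homs A B ==> f \<in> lin_maps A B"
 and hom_mult: "f \<in> alg_homs A B ==> x \<in> carrier A ==> y \<in> carrier A ==> f (x \<otimes>\<^bsub>A\<^esub> y) = f x \<otimes>\<^bsub>B\<^esub> f y"
 and hom_one: "f \<in> alg_homs A B ==> f \<one>\<^bsub>A\<^esub> = \<one>\<^bsub>B\<^esub>"
 by (auto simp: alg_homs_def ring_hom_def)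

lemma hom_closed: "f \<in> alg_homs A B ==> x \<in> carrier A ==> f x \<in> carrier B"
 and hom_add: "f \<in> alg_homs A B ==> x \<in> carrier A ==> y \<in> carrier A ==> f (x \<oplus>\<^bsub>A\<^esub> y) = f x \<oplus>\<^bsub>B\<^esub> f y"
 and hom_sm: "f \<in> alg_homs A B ==> x \<in> carrier A ==> f (c \<odot>\<^bsub>A\<^esub> x) = c \<odot>\<^bsub>B\<^esub> f x"
 by (rule lin_closed[OF hom_lin] lin_add[OF hom_lin] lin_sm[OF hom_lin]; assumption)+

lemma hom_comp: "f \<in> alg_homs A B ==> g \<in> alg_homs B C ==> (\<lambda>x. g (f x)) \<in> alg_homs A C"
 by (rule alg_homsI, rule lin_comp[OF hom_lin hom_lin]) (simp_all add: hom_mult hom_one hom_closed)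

lemma hom_cong:
 assumes "f \<in> alg_homs A B" "cx_algebra A" "!!x. x \<in> carrier A ==> f x = g x"
 shows "g \<in> alg_homs A B"
proof -
 interpret A: cx_algebra A by fact
 show ?thesis using assms(1)
  by (intro alg_homsI lin_cong[OF hom_lin[OF assms(1)] A.cvec_axioms])
   (auto simp: assms(3)[symmetric] hom_mult hom_one)
qed

lemma hom_pow:
 assumes "f \<in> alg_homs A B" "cx_algebra A" "cx_algebra B" "x \<in> carrier A"
 shows "f (x [^]\<^bsub>A\<^esub> (n::nat)) = f x [^]\<^bsub>B\<^esub> n"
proof -
 interpret A: cx_algebra A by fact
 interpret B: cx_algebra B by fact
 show ?thesis using assms
  by (induction n) (auto simp: hom_one hom_mult)
qed


section \<open>Free vector spaces and their quotients\<close>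

lemma lookup_scal [simp]: "Poly_Mapping.lookup (scal c r) k = c * Poly_Mapping.lookup r k"
 by (simp add: scal_def Poly_Mapping.map.rep_eq when_def)

lemma scal_single [simp]: "scal c (single k d) = single k (c * d)"
 by (rule poly_mapping_eqI) (simp add: lookup_single when_def)

global_interpretation fv: vector_space scal
 rewrites "Modules.module.span scal = cspan"
 by unfold_locales
  (auto intro!: poly_mapping_eqI simp: lookup_add algebra_simps cspan_def)

lemma keys_scal: "keys (scal c r) \<subseteq> keys r"
 by (auto simp: in_keys_iff)

lemma keys_diff_subset: "keys (r - s) \<subseteq> keys r \<union> keys (s :: 'a \<Rightarrow>\<^sub>0 complex)"
 by (auto simp: in_keys_iff lookup_minus)

lemma pm_expand: "r = (\<Sum>k\<in>keys r. single k (Poly_Mapping.lookup r k))"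
proof (rule poly_mapping_eqI)
 fix k
 show "Poly_Mapping.lookup r k = Poly_Mapping.lookup (\<Sum>k\<in>keys r. single k (Poly_Mapping.lookup r k)) k"
  by (simp add: lookup_sum lookup_single when_def sum.delta in_keys_iff)
qed

lemma pm_induct [consumes 1, case_names zero add]:
 assumes "keys r \<subseteq> S" "P 0"
  "!!k c r. k \<in> S ==> keys r \<subseteq> S ==> P r ==> P (single k c + r)"
 shows "P (r :: 'a \<Rightarrow>\<^sub>0 'b::comm_monoid_add)"
proof -
 have "P (\<Sum>k\<in>A. single k (Poly_Mapping.lookup r k)) \<and>
   keys (\<Sum>k\<in>A. single k (Poly_Mapping.lookup r k)) \<subseteq> S"
  if "finite A" "A \<subseteq> S" for A using that
 proof (induction A rule: finite_induct)
  case (insert a A)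
  then show ?case
   using keys_add[of "single a (Poly_Mapping.lookup r a)" "\<Sum>k\<in>A. single k (Poly_Mapping.lookup r k)"]
   by (auto intro!: assms(3) split: if_splits)
 qed (simp add: assms(2))
 from this[of "keys r"] show ?thesis using pm_expand[of r] assms(1) by simp
qed

context cvec
begin

lemma lin_ext_superset:
 assumes "finite B" "keys r \<subseteq> B" "!!k. k \<in> B ==> f k \<in> carrier V"
 shows "lin_ext V f r = (\<Oplus>k\<in>B. Poly_Mapping.lookup r k \<odot> f k)"
 unfolding lin_ext_def using assms
 by (intro add.finprod_mono_neutral_cong_left) (auto simp: in_keys_iff)

lemma lin_ext_0 [simp]: "lin_ext V f 0 = \<zero>"
 by (simp add: lin_ext_def)

lemma lin_ext_add:
 assumes "!!k. k \<in> S ==> f k \<in> carrier V" "keys r \<subseteq> S" "keys s \<subseteq> S"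
 shows "lin_ext V f (r + s) = lin_ext V f r \<oplus> lin_ext V f s"
proof -
 let ?B = "keys r \<union> keys s"
 have f: "!!k. k \<in> ?B ==> f k \<in> carrier V" using assms by auto
 have *: "lin_ext V f t = (\<Oplus>k\<in>?B. Poly_Mapping.lookup t k \<odot> f k)" if "keys t \<subseteq> ?B" for t
  using that f by (intro lin_ext_superset) auto
 show ?thesis using f keys_add[of r s]
  by (subst (1 2 3) *) (auto simp: lookup_add sm_add Pi_def simp flip: finsum_addf intro!: finsum_cong')
qed

lemma lin_ext_single:
 "f k \<in> carrier V ==> lin_ext V f (single k c) = c \<odot> f k"
 by (cases "c = 0") (simp_all add: lin_ext_def finsum_insert)

lemma lin_ext_scal:
 assumes "!!k. k \<in> S ==> f k \<in> carrier V" "keys r \<subseteq> S"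
 shows "lin_ext V f (scal c r) = c \<odot> lin_ext V f r"
proof -
 have f: "!!k. k \<in> keys r ==> f k \<in> carrier V" using assms by auto
 have "lin_ext V f (scal c r) = (\<Oplus>k\<in>keys r. Poly_Mapping.lookup (scal c r) k \<odot> f k)"
  using f by (intro lin_ext_superset keys_scal) auto
 also have "... = (\<Oplus>k\<in>keys r. c \<odot> (Poly_Mapping.lookup r k \<odot> f k))"
  using f by (intro finsum_cong') (auto simp: sm_sm)
 also have "... = c \<odot> lin_ext V f r"
  unfolding lin_ext_def using f by (subst finsum_sm) auto
 finally show ?thesis .
qed

lemma lin_ext_closed:
 "(!!k. k \<in> S ==> f k \<in> carrier V) ==> keys r \<subseteq> S ==> lin_ext V f r \<in> carrier V"
 unfolding lin_ext_def by (intro finsum_closed) auto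

lemma lin_ext_diff:
 assumes "!!k. k \<in> S ==> f k \<in> carrier V" "keys r \<subseteq> S" "keys s \<subseteq> S"
 shows "lin_ext V f (r - s) = lin_ext V f r \<ominus> lin_ext V f s"
proof -
 have 1: "r - s = r + scal (-1) s" by (rule poly_mapping_eqI) (simp add: lookup_minus lookup_add)
 have "keys (scal (-1) s) \<subseteq> S" using assms keys_scal[of "-1" s] by blast
 then show ?thesis using assms lin_ext_closed[of S f s]
  unfolding 1 a_minus_def by (simp only: lin_ext_add[of S] lin_ext_scal[of S] sm_neg)
qed

lemma lin_ext_cong_fun:
 "(!!k. k \<in> S ==> f k = g k) ==> (!!k. k \<in> S ==> f k \<in> carrier V) ==> keys r \<subseteq> S ==>
   lin_ext V f r = lin_ext V g r"
 unfolding lin_ext_def by (rule finsum_cong') (simp_all add: subset_iff Pi_def)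

lemma lin_ext_span_zero:
 assumes "!!k. k \<in> S ==> f k \<in> carrier V"
  "!!r. r \<in> R ==> keys r \<subseteq> S \<and> lin_ext V f r = \<zero>"
  "r \<in> cspan R"
 shows "keys r \<subseteq> S \<and> lin_ext V f r = \<zero>"
 using assms(3)
proof (induction rule: fv.span_induct_alt)
 case (step c x y)
 have "keys (scal c x + y) \<subseteq> S"
  using step assms(2)[OF step(1)] keys_add[of "scal c x" y] keys_scal[of c x] by blast
 then show ?case using step assms(1) assms(2)[OF step(1)] keys_scal[of c x]
  by (subst lin_ext_add[of S]) (auto simp: lin_ext_scal[of S])
qed (simp_all)

end

lemma lin_lin_ext:
 assumes "F \<in> lin_maps V W" "cvec V" "cvec W" "!!k. k \<in> keys r ==> f k \<in> carrier V"
 shows "F (lin_ext V f r) = lin_ext W (\<lambda>k. F (f k)) r"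
proof -
 interpret V: cvec V by fact
 interpret W: cvec W by fact
 show ?thesis unfolding lin_ext_def using assms
  by (subst lin_finsum[OF assms(1-3)]) (auto simp: lin_sm[OF assms(1)] lin_closed[OF assms(1)] intro!: W.finsum_cong')
qed

lemma span_diff_refl [simp]: "r - r \<in> cspan R" by (simp add: fv.span_zero)

lemma cls_self: "keys r \<subseteq> S ==> r \<in> cls S R r"
 by (simp add: cls_def fv.span_zero)

lemma cls_eq_iff:
 assumes "keys r \<subseteq> S"
 shows "cls S R r = cls S R s \<longleftrightarrow> r - s \<in> cspan R"
proof
 assume "cls S R r = cls S R s"
 then have "r \<in> cls S R s" using cls_self[OF assms, of R] by simp
 then show "r - s \<in> cspan R" by (simp add: cls_def)
next
 assume *: "r - s \<in> cspan R"
 have "t - r \<in> cspan R \<longleftrightarrow> t - s \<in> cspan R" for t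
  using fv.span_add[OF * , of "t - r"] fv.span_diff[OF _ *, of "t - s"] by auto
 then show "cls S R r = cls S R s" by (simp add: cls_def)
qed

lemma rep_cls:
 assumes "keys r \<subseteq> S"
 shows "keys (rep (cls S R r)) \<subseteq> S" "rep (cls S R r) - r \<in> cspan R"
  "cls S R (rep (cls S R r)) = cls S R r"
proof -
 have "rep (cls S R r) \<in> cls S R r"
  unfolding rep_def using cls_self[OF assms] by (rule someI)
 then show 1: "keys (rep (cls S R r)) \<subseteq> S" "rep (cls S R r) - r \<in> cspan R"
  by (auto simp: cls_def)
 then show "cls S R (rep (cls S R r)) = cls S R r" by (subst cls_eq_iff) auto
qed

text \<open>The linear structure is treated once for all quotients; words, pairs of elements and
  braided products are given their multiplications separately.\<close>

locale fquot =
 fixes S :: "'a set" and R :: "('a \<Rightarrow>\<^sub>0 complex) set" and m e Q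
 assumes R_keys: "!!r. r \<in> R ==> keys r \<subseteq> S"
 defines "Q \<equiv> free_quot S R m e"
begin

abbreviation "kl \<equiv> cls S R"

lemma carrier_Q: "carrier Q = kl ` {r. keys r \<subseteq> S}"
 and zero_Q: "zero Q = kl 0" and one_Q: "one Q = kl e"
 by (simp_all add: Q_def free_quot_def)

lemma kl_closed [simp]: "keys r \<subseteq> S ==> kl r \<in> carrier Q"
 by (auto simp: carrier_Q)

lemma rep_keys: "X \<in> carrier Q ==> keys (rep X) \<subseteq> S"
 and kl_rep: "X \<in> carrier Q ==> kl (rep X) = X"
 by (auto simp: carrier_Q rep_cls(3) dest: subsetD[OF rep_cls(1)])

lemma carrierE:
 assumes "X \<in> carrier Q"
 obtains r where "keys r \<subseteq> S" "X = kl r"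
 using assms by (auto simp: carrier_Q)

lemma keys_add': "keys r \<subseteq> S ==> keys s \<subseteq> S ==> keys (r + s) \<subseteq> S"
 using keys_add[of r s] by blast

lemma add_Q:
 assumes "keys r \<subseteq> S" "keys s \<subseteq> S"
 shows "kl r \<oplus>\<^bsub>Q\<^esub> kl s = kl (r + s)"
proof -
 have "(rep (kl r) - r) + (rep (kl s) - s) \<in> cspan R"
  by (intro fv.span_add rep_cls assms)
 then have "rep (kl r) + rep (kl s) - (r + s) \<in> cspan R" by (simp add: algebra_simps)
 then show ?thesis unfolding Q_def free_quot_def using assms
  by (simp add: cls_eq_iff keys_add' rep_cls)
qed

lemma smult_Q:
 assumes "keys r \<subseteq> S"
 shows "c \<odot>\<^bsub>Q\<^esub> kl r = kl (scal c r)"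
proof -
 have "scal c (rep (kl r) - r) \<in> cspan R"
  by (intro fv.span_scale rep_cls assms)
 then have "scal c (rep (kl r)) - scal c r \<in> cspan R" by (simp add: fv.scale_right_diff_distrib)
 then show ?thesis unfolding Q_def free_quot_def
  using assms rep_cls(1)[OF assms] keys_scal[of c "rep (kl r)"] by (simp add: cls_eq_iff subset_trans[of _ _ S])
qed

lemma keys_scal': "keys r \<subseteq> S ==> keys (scal c r) \<subseteq> S"
 using keys_scal[of c r] by blast

lemma cvec_Q: "cvec Q"
 by (rule cvecI; (elim carrierE)?)
  (simp_all add: add_Q smult_Q zero_Q keys_add' keys_scal' add.assoc fv.scale_right_distrib fv.scale_left_distrib, simp add: add.commute)

sublocale Q: cvec Q by (rule cvec_Q)

lemma kl_zero_iff: "keys r \<subseteq> S ==> kl r = \<zero>\<^bsub>Q\<^esub> \<longleftrightarrow> r \<in> cspan R"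
 by (simp add: zero_Q cls_eq_iff)

lemma kl_lin_ext:
 assumes "keys r \<subseteq> S"
 shows "lin_ext Q (\<lambda>k. kl (single k 1)) r = kl r"
proof (rule pm_induct[OF assms])
 fix k c r assume "k \<in> S" "keys r \<subseteq> S" "lin_ext Q (\<lambda>k. kl (single k 1)) r = kl r"
 then show "lin_ext Q (\<lambda>k. kl (single k 1)) (single k c + r) = kl (single k c + r)"
  by (subst Q.lin_ext_add[of S]) (auto simp: Q.lin_ext_single smult_Q add_Q)
qed (simp add: zero_Q)

text \<open>The representative chosen by \<open>rep\<close> differs from any other by a combination
  of relators, on which the linear extension of \<open>f\<close> vanishes.\<close>

lemma lin_from_Q:
 assumes "cvec M" "!!k. k \<in> S ==> f k \<in> carrier M" "!!r. r \<in> R ==> lin_ext M f r = \<zero>\<^bsub>M\<^esub>"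
 shows "(\<lambda>X. lin_ext M f (rep X)) \<in> lin_maps Q M"
  and "!!r. keys r \<subseteq> S ==> lin_ext M f (rep (kl r)) = lin_ext M f r"
proof -
 interpret M: cvec M by fact
 show *: "lin_ext M f (rep (kl r)) = lin_ext M f r" if "keys r \<subseteq> S" for r
 proof -
  have "lin_ext M f (rep (kl r) - r) = \<zero>\<^bsub>M\<^esub>"
   using M.lin_ext_span_zero[of S f R "rep (kl r) - r"] assms R_keys rep_cls(2)[OF that] by auto
  then show ?thesis using that rep_cls(1)[OF that] M.lin_ext_closed[of S f, OF assms(2)]
   by (subst (asm) M.lin_ext_diff[of S f, OF assms(2)]) (auto simp: M.diff_zero_iff)
 qed
 show "(\<lambda>X. lin_ext M f (rep X)) \<in> lin_maps Q M"
  by (rule lin_mapsI)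
   ((elim carrierE)?, simp only: * add_Q smult_Q keys_add' keys_scal',
   blast intro: M.lin_ext_closed[of S f, OF assms(2)] M.lin_ext_add[of S f, OF assms(2)]
     M.lin_ext_scal[of S f, OF assms(2)])+
qed

text \<open>The means to evaluate definitions written with \<open>rep\<close>: it suffices to
  exhibit a linear map with the prescribed values on basis elements. Compatibility of the formula
  with the relators is inherited from that map.\<close>

lemma lin_ext_Q_eq:
 assumes "F \<in> lin_maps Q M" "cvec M" "!!k. k \<in> S ==> F (kl (single k 1)) = f k" "X \<in> carrier Q"
 shows "lin_ext M f (rep X) = F X"
proof -
 interpret M: cvec M by fact
 have k: "keys (rep X) \<subseteq> S" using assms(4) by (rule rep_keys)
 have "F X = F (lin_ext Q (\<lambda>k. kl (single k 1)) (rep X))"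
  using k kl_rep[OF assms(4)] by (simp add: kl_lin_ext)
 also have "... = lin_ext M (\<lambda>k. F (kl (single k 1))) (rep X)"
  using k by (intro lin_lin_ext[OF assms(1) cvec_Q assms(2)]) auto
 also have "... = lin_ext M f (rep X)"
  using k assms(3) lin_closed[OF assms(1)] by (intro M.lin_ext_cong_fun[of S]) (auto simp flip: assms(3))
 finally show ?thesis by simp
qed

lemma lin_Q_ext:
 assumes "F \<in> lin_maps Q M" "G \<in> lin_maps Q M" "cvec M"
  "!!k. k \<in> S ==> F (kl (single k 1)) = G (kl (single k 1))" "X \<in> carrier Q"
 shows "F X = G X"
proof -
 have "F X = lin_ext M (\<lambda>k. F (kl (single k 1))) (rep X)"
  by (rule lin_ext_Q_eq[symmetric]) (use assms in auto)
 also have "... = G X"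
  by (rule lin_ext_Q_eq) (use assms in auto)
 finally show ?thesis .
qed

end


section \<open>Presented algebras\<close>

lemma plus_list_append [simp]: "(u :: 'g list) + v = u @ v" "(0 :: 'g list) = []"
 by (simp_all add: plus_list_def zero_list_def)

lemma scal_mult_left: "scal c r * s = scal c (r * (s :: 'g list \<Rightarrow>\<^sub>0 complex))"
 by (simp add: scal_def mult_map_scale_conv_mult mult.assoc)

lemma single_nil_commute: "single [] c * s = s * single ([] :: 'g list) (c :: complex)"
 by (rule pm_induct[of s UNIV]) (simp_all add: distrib_left distrib_right mult_single mult.commute)

lemma mult_scal: "r * scal c s = scal c (r * (s :: 'g list \<Rightarrow>\<^sub>0 complex))"
 by (simp add: scal_def mult_map_scale_conv_mult) (simp only: single_nil_commute mult.assoc)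

lemma keys_mult_lists:
 assumes "keys r \<subseteq> lists G" "keys s \<subseteq> lists G"
 shows "keys (r * s :: 'g list \<Rightarrow>\<^sub>0 complex) \<subseteq> lists G"
proof
 fix k assume "k \<in> keys (r * s)"
 then obtain a b where "k = a @ b" "a \<in> keys r" "b \<in> keys s"
  using keys_mult[of r s] by auto
 then show "k \<in> lists G" using assms by auto
qed

context cx_algebra
begin

lemma word_eval_closed: "x ` G \<subseteq> carrier A ==> w \<in> lists G ==> word_eval A x w \<in> carrier A"
 by (induction w) (auto simp: word_eval_def)

lemma word_eval_append:
 "x ` G \<subseteq> carrier A ==> u \<in> lists G ==> v \<in> lists G ==>
   word_eval A x (u @ v) = word_eval A x u \<otimes> word_eval A x v"
proof (induction u)
 case Nil
 then show ?case using word_eval_closed[of x G v] by (simp add: word_eval_def)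
next
 case (Cons a u)
 then show ?case using word_eval_closed[of x G v] word_eval_closed[of x G u]
  by (auto simp: word_eval_def m_assoc image_subset_iff)
qed

context
 fixes x :: "'g => 'a" and G :: "'g set"
 assumes x: "x ` G \<subseteq> carrier A"
begin

lemma free_eval_closed: "keys f \<subseteq> lists G ==> free_eval A x f \<in> carrier A"
 unfolding free_eval_def by (rule lin_ext_closed[of "lists G"]) (auto intro: word_eval_closed[OF x])

lemma free_eval_add:
 "keys f \<subseteq> lists G ==> keys g \<subseteq> lists G ==> free_eval A x (f + g) = free_eval A x f \<oplus> free_eval A x g"
 unfolding free_eval_def by (rule lin_ext_add[of "lists G"]) (auto intro: word_eval_closed[OF x])

lemma free_eval_diff:
 "keys f \<subseteq> lists G ==> keys g \<subseteq> lists G ==> free_eval A x (f - g) = free_eval A x f \<ominus> free_eval A x g"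
 unfolding free_eval_def by (rule lin_ext_diff[of "lists G"]) (auto intro: word_eval_closed[OF x])

lemma free_eval_scal:
 "keys f \<subseteq> lists G ==> free_eval A x (scal c f) = c \<odot> free_eval A x f"
 unfolding free_eval_def by (rule lin_ext_scal[of "lists G"]) (auto intro: word_eval_closed[OF x])

lemma free_eval_single: "w \<in> lists G ==> free_eval A x (single w c) = c \<odot> word_eval A x w"
 unfolding free_eval_def by (rule lin_ext_single) (auto intro: word_eval_closed[OF x])

lemma free_eval_gen: "g \<in> G ==> free_eval A x (gen g) = x g"
 using x by (subst free_eval_single) (auto simp: word_eval_def image_subset_iff)

lemma free_eval_const: "free_eval A x (const c) = c \<odot> \<one>"
 by (subst free_eval_single) (auto simp: word_eval_def)

lemma free_eval_mult:
 assumes f: "keys f \<subseteq> lists G" and g: "keys g \<subseteq> lists G"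
 shows "free_eval A x (f * g) = free_eval A x f \<otimes> free_eval A x g"
proof -
 have 1: "free_eval A x (single u c * g) = free_eval A x (single u c) \<otimes> free_eval A x g"
  if u: "u \<in> lists G" for u c
  using g
 proof (induction g rule: pm_induct)
  case (add v d s)
  have "keys (single v d) \<subseteq> lists G" "keys (single u c) \<subseteq> lists G"
   "keys (single (u @ v) (c * d)) \<subseteq> lists G"
   using add(1) u by (auto split: if_splits)
  then show ?case using add u keys_mult_lists[of "single u c" G s]
   by (simp add: distrib_left mult_single free_eval_add free_eval_single word_eval_append[OF x]
     r_distr word_eval_closed[OF x] free_eval_closed sm_sm mult.commute)
 qed (simp_all add: free_eval_def x u word_eval_closed[OF x] lin_ext_single)
 show ?thesis using f
 proof (induction f rule: pm_induct)
  case (add v d s)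
  have "keys (single v d) \<subseteq> lists G" using add(1) by auto
  then show ?case using add 1[of v d] keys_mult_lists[OF _ g, of s] keys_mult_lists[OF _ g, of "single v d"] g
   by (simp add: distrib_right free_eval_add l_distr free_eval_closed)
 qed (simp add: free_eval_def free_eval_closed[OF g, unfolded free_eval_def])
qed

lemma free_eval_one: "free_eval A x 1 = \<one>"
 using free_eval_const[of 1] by (simp flip: single_one)

lemma free_eval_0 [simp]: "free_eval A x 0 = \<zero>"
 by (simp add: free_eval_def)

lemma free_eval_pow: "keys f \<subseteq> lists G ==> keys (f ^ n) \<subseteq> lists G \<and> free_eval A x (f ^ n) = free_eval A x f [^] n"
proof (induction n)
 case (Suc n)
 then have "keys (f ^ Suc n) \<subseteq> lists G" using keys_mult_lists[of f G "f ^ n"] by simp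
 moreover have "free_eval A x f [^] Suc n = free_eval A x f \<otimes> free_eval A x f [^] n"
  using free_eval_closed[of f] Suc.prems by (simp only: nat_pow_Suc2)
 ultimately show ?case using Suc by (simp add: free_eval_mult)
qed (simp add: free_eval_one)

lemmas free_eval_simps = free_eval_add free_eval_diff free_eval_scal free_eval_gen free_eval_const free_eval_mult
 free_eval_one free_eval_pow[THEN conjunct2] free_eval_pow[THEN conjunct1] free_eval_closed keys_mult_lists

end
end

lemma hom_word_eval:
 assumes "h \<in> alg_homs A B" "cx_algebra A" "cx_algebra B" "x ` G \<subseteq> carrier A" "w \<in> lists G"
 shows "h (word_eval A x w) = word_eval B (\<lambda>g. h (x g)) w"
 using assms(5)
proof (induction w)
 case Nil then show ?case by (simp add: word_eval_def hom_one[OF assms(1)])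
next
 case (Cons a w)
 then show ?case using assms(4) cx_algebra.word_eval_closed[OF assms(2,4), of w] hom_mult[OF assms(1)]
  by (auto simp: word_eval_def image_subset_iff)
qed

lemma hom_free_eval:
 assumes "h \<in> alg_homs A B" "cx_algebra A" "cx_algebra B" "x ` G \<subseteq> carrier A" "keys f \<subseteq> lists G"
 shows "h (free_eval A x f) = free_eval B (\<lambda>g. h (x g)) f"
proof -
 interpret A: cx_algebra A by fact
 interpret B: cx_algebra B by fact
 have xw: "x ` (\<lambda>g. g) ` G \<subseteq> carrier A" using assms(4) by auto
 have hx: "(\<lambda>g. h (x g)) ` G \<subseteq> carrier B" using assms(4) hom_closed[OF assms(1)] by auto
 have "h (free_eval A x f) = lin_ext B (\<lambda>w. h (word_eval A x w)) f"
  unfolding free_eval_def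
  by (rule lin_lin_ext[OF hom_lin[OF assms(1)] A.cvec_axioms B.cvec_axioms])
   (use assms(5) A.word_eval_closed[OF assms(4)] in blast)
 also have "... = free_eval B (\<lambda>g. h (x g)) f"
  unfolding free_eval_def
  by (rule B.lin_ext_cong_fun[of "lists G"])
   (auto simp: hom_word_eval[OF assms(1-4)] assms(5) B.word_eval_closed[OF hx] dest!: subsetD[OF assms(5)])
 finally show ?thesis .
qed

lemma free_eval_fun_cong:
 assumes "cx_algebra B" "y ` G \<subseteq> carrier B" "keys f \<subseteq> lists G" "!!g. g \<in> G ==> y g = y' g"
 shows "free_eval B y f = free_eval B y' f"
proof -
 interpret B: cx_algebra B by fact
 have "word_eval B y w = word_eval B y' w" if "w \<in> lists G" for w
  using that assms(4) by (induction w) (auto simp: word_eval_def)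
 then show ?thesis unfolding free_eval_def
  by (rule B.lin_ext_cong_fun[OF _ B.word_eval_closed[OF assms(2)] assms(3)])
qed

text \<open>The surjectivity half of \<open>presented_by\<close>, which is what induction over words
  and uniqueness of morphisms rest on.\<close>

definition generated_by :: "(complex, 'a, 'm) module_scheme => 'g set => ('g => 'a) => bool" where
 "generated_by A G x \<longleftrightarrow> x ` G \<subseteq> carrier A \<and> free_eval A x ` {f. keys f \<subseteq> lists G} = carrier A"

lemma presented_generated: "presented_by A G x R ==> generated_by A G x"
 by (simp add: presented_by_def generated_by_def)

text \<open>Words are evaluated from the right, so multiplication by a generator on the left
  suffices; zero is reached as 0 times the unit.\<close>

lemma generated_induct [consumes 3, case_names one mult add smult]:
 assumes "generated_by A G x" "cx_algebra A" "a \<in> carrier A"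
  "P \<one>\<^bsub>A\<^esub>" "!!g a. g \<in> G ==> a \<in> carrier A ==> P a ==> P (x g \<otimes>\<^bsub>A\<^esub> a)"
  "!!a b. a \<in> carrier A ==> b \<in> carrier A ==> P a ==> P b ==> P (a \<oplus>\<^bsub>A\<^esub> b)"
  "!!c a. a \<in> carrier A ==> P a ==> P (c \<odot>\<^bsub>A\<^esub> a)"
 shows "P a"
proof -
 interpret A: cx_algebra A by fact
 have x: "x ` G \<subseteq> carrier A" using assms(1) by (simp add: generated_by_def)
 have w: "P (word_eval A x w)" if "w \<in> lists G" for w
  using that
 proof (induction w)
  case (Cons g w)
  then show ?case using assms(5)[of g "word_eval A x w"] A.word_eval_closed[OF x, of w] by (auto simp: word_eval_def)
 qed (simp add: word_eval_def assms(4))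
 obtain f where f: "keys f \<subseteq> lists G" "a = free_eval A x f"
  using assms(1,3) unfolding generated_by_def by blast
 have "P (free_eval A x f)" using f(1)
 proof (induction f rule: pm_induct)
  case zero
  show ?case using assms(7)[of "\<one>\<^bsub>A\<^esub>" 0] assms(4) by (simp add: A.free_eval_0[OF x])
 next
  case (add k c r)
  have "keys (single k c) \<subseteq> lists G" using add by auto
  then show ?case using add w[of k] A.word_eval_closed[OF x]
   by (simp add: A.free_eval_add[OF x] A.free_eval_single[OF x] assms(6,7) A.free_eval_closed[OF x])
 qed
 then show ?thesis using f by simp
qed

lemma generated_hom_ext:
 assumes "generated_by A G x" "cx_algebra A" "cx_algebra B" "f \<in> alg_homs A B" "h \<in> alg_homs A B"
  "!!g. g \<in> G ==> f (x g) = h (x g)" "a \<in> carrier A"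
 shows "f a = h a"
proof -
 interpret A: cx_algebra A by fact
 interpret B: cx_algebra B by fact
 have x: "x g \<in> carrier A" if "g \<in> G" for g using assms(1) that by (auto simp: generated_by_def)
 show ?thesis using assms(1,2,7)
  by (induction rule: generated_induct)
   (simp_all add: hom_one[OF assms(4)] hom_one[OF assms(5)] hom_mult[OF assms(4)] hom_mult[OF assms(5)]
    hom_add[OF assms(4)] hom_add[OF assms(5)] hom_sm[OF assms(4)] hom_sm[OF assms(5)] assms(6) x)
qed

text \<open>One quotient for two uses: with all letters it is the quantum group, with a set of
  indices as letters it is the algebra defined by the asserted relations.\<close>

definition pres_alg :: "'g set => ('g list \<Rightarrow>\<^sub>0 complex) set => ('g list \<Rightarrow>\<^sub>0 complex) set calg" where
 "pres_alg G R = free_quot (lists G) (two_sided G R) (*) 1"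

locale pres =
 fixes G :: "'g set" and R :: "('g list \<Rightarrow>\<^sub>0 complex) set"
 assumes rel_keys: "!!r. r \<in> R ==> keys r \<subseteq> lists G"
begin

lemma two_sided_keys: "r \<in> two_sided G R ==> keys r \<subseteq> lists G"
proof -
 assume "r \<in> two_sided G R"
 then obtain u s v where *: "r = single u 1 * s * single v 1"
  "u \<in> lists G" "s \<in> R" "v \<in> lists G" by (auto simp: two_sided_def)
 then show ?thesis unfolding *(1) by (intro keys_mult_lists rel_keys[OF *(3)]) auto
qed

sublocale fq: fquot "lists G" "two_sided G R" "(*)" 1 "pres_alg G R"
 by unfold_locales (simp_all add: two_sided_keys pres_alg_def)

text \<open>Multiplying u r v by a word only lengthens \<open>u\<close> or \<open>v\<close>, so the
  product has the same shape.\<close>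

lemma ideal_single:
 assumes "x \<in> cspan (two_sided G R)" "w \<in> lists G"
 shows "single w 1 * x \<in> cspan (two_sided G R)" "x * single w 1 \<in> cspan (two_sided G R)"
proof -
 have "single w 1 * x \<in> cspan (two_sided G R) \<and> x * single w 1 \<in> cspan (two_sided G R)"
  using assms(1)
 proof (induction rule: fv.span_induct_alt)
  case (step c x y)
  from step(1) obtain u r v where x: "x = single u 1 * r * single v 1"
   and uv: "u \<in> lists G" "r \<in> R" "v \<in> lists G" by (auto simp: two_sided_def)
  have "single w 1 * x = single (w @ u) 1 * r * single v 1"
   by (simp add: x mult_single flip: mult.assoc)
  moreover have "x * single w 1 = single u 1 * r * single (v @ w) 1"
   by (simp add: x mult_single mult.assoc)
  ultimately have "single w 1 * x \<in> two_sided G R" "x * single w 1 \<in> two_sided G R"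
   using uv assms(2) append_in_lists_conv[of w u G] append_in_lists_conv[of v w G] unfolding two_sided_def by blast+
  then show ?case using step(2)
   by (auto simp: distrib_left distrib_right mult_scal scal_mult_left intro!: fv.span_add fv.span_scale intro: fv.span_base)
 qed (simp add: fv.span_zero)
 then show "single w 1 * x \<in> cspan (two_sided G R)" "x * single w 1 \<in> cspan (two_sided G R)"
  by auto
qed

lemma ideal:
 assumes "x \<in> cspan (two_sided G R)" "keys t \<subseteq> lists G"
 shows "t * x \<in> cspan (two_sided G R)" "x * t \<in> cspan (two_sided G R)"
proof -
 have *: "single k c = scal c (single k 1)" for k :: "'g list" and c by simp
 have "t * x \<in> cspan (two_sided G R) \<and> x * t \<in> cspan (two_sided G R)"
 proof (rule pm_induct[OF assms(2)])
  fix k c r assume "k \<in> lists G" "r * x \<in> cspan (two_sided G R) \<and> x * r \<in> cspan (two_sided G R)"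
  then show "(single k c + r) * x \<in> cspan (two_sided G R) \<and> x * (single k c + r) \<in> cspan (two_sided G R)"
   by (subst (1 2) *) (auto simp: distrib_left distrib_right mult_scal scal_mult_left simp del: scal_single
     intro!: fv.span_add fv.span_scale ideal_single[OF assms(1)])
 qed (simp add: fv.span_zero)
 then show "t * x \<in> cspan (two_sided G R)" "x * t \<in> cspan (two_sided G R)" by auto
qed

lemma mult_kl:
 assumes "keys r \<subseteq> lists G" "keys s \<subseteq> lists G"
 shows "fq.kl r \<otimes>\<^bsub>pres_alg G R\<^esub> fq.kl s = fq.kl (r * s)"
proof -
 let ?r = "rep (fq.kl r)" and ?s = "rep (fq.kl s)"
 have "(?r - r) * ?s + r * (?s - s) \<in> cspan (two_sided G R)"
  by (intro fv.span_add ideal rep_cls assms)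
 then have "?r * ?s - r * s \<in> cspan (two_sided G R)" by (simp add: algebra_simps)
 then show ?thesis unfolding pres_alg_def free_quot_def using assms
  by (simp add: cls_eq_iff keys_mult_lists rep_cls)
qed

lemma one_kl: "\<one>\<^bsub>pres_alg G R\<^esub> = fq.kl 1" by (rule fq.one_Q)

lemma keys_one_lists: "keys (1 :: 'g list \<Rightarrow>\<^sub>0 complex) \<subseteq> lists G" by simp

lemma cx_algebra_pres: "cx_algebra (pres_alg G R)"
 by (rule cx_algebraI[OF fq.cvec_Q]; (elim fq.carrierE)?)
  (simp_all add: mult_kl one_kl fq.add_Q fq.smult_Q fq.keys_add' fq.keys_scal' keys_mult_lists keys_one_lists
   mult.assoc distrib_left distrib_right scal_mult_left mult_scal)

sublocale P: cx_algebra "pres_alg G R" by (rule cx_algebra_pres)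

lemma gen_closed: "g \<in> G ==> fq.kl (gen g) \<in> carrier (pres_alg G R)"
 by (rule fq.kl_closed) auto

lemma gens_closed: "(\<lambda>g. fq.kl (gen g)) ` G \<subseteq> carrier (pres_alg G R)"
 using gen_closed by auto

lemma word_eval_pres: "w \<in> lists G ==> word_eval (pres_alg G R) (\<lambda>g. fq.kl (gen g)) w = fq.kl (single w 1)"
proof (induction w)
 case (Cons g w)
 have "keys (gen g) \<subseteq> lists G" "keys (single w (1::complex)) \<subseteq> lists G"
  using Cons by auto
 then show ?case using Cons by (simp add: word_eval_def mult_kl mult_single)
qed (simp add: word_eval_def one_kl flip: single_one)

lemma free_eval_pres:
 assumes "keys f \<subseteq> lists G"
 shows "free_eval (pres_alg G R) (\<lambda>g. fq.kl (gen g)) f = fq.kl f"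
proof -
 have "free_eval (pres_alg G R) (\<lambda>g. fq.kl (gen g)) f = lin_ext (pres_alg G R) (\<lambda>k. fq.kl (single k 1)) f"
  unfolding free_eval_def using assms P.word_eval_closed[OF gens_closed]
  by (intro fq.Q.lin_ext_cong_fun[of "lists G"]) (auto simp: word_eval_pres)
 then show ?thesis using fq.kl_lin_ext[OF assms] by simp
qed

lemma presented_pres: "presented_by (pres_alg G R) G (\<lambda>g. fq.kl (gen g)) R"
 unfolding presented_by_def using gens_closed
 by (auto simp: free_eval_pres fq.kl_zero_iff elim!: fq.carrierE)

lemma free_eval_ideal_zero:
 assumes "cx_algebra B" "y ` G \<subseteq> carrier B" "!!r. r \<in> R ==> free_eval B y r = \<zero>\<^bsub>B\<^esub>"
  "r \<in> cspan (two_sided G R)"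
 shows "free_eval B y r = \<zero>\<^bsub>B\<^esub>"
proof -
 interpret B: cx_algebra B by fact
 have "free_eval B y r = \<zero>\<^bsub>B\<^esub>" if r: "r \<in> two_sided G R" for r
 proof -
  from r obtain u s v where *: "r = single u 1 * s * single v 1"
   "u \<in> lists G" "s \<in> R" "v \<in> lists G" by (auto simp: two_sided_def)
  then have "keys (single u (1::complex)) \<subseteq> lists G"
   "keys (single v (1::complex)) \<subseteq> lists G" by auto
  then show ?thesis using * rel_keys
   by (simp add: B.free_eval_simps[OF assms(2)] B.free_eval_single[OF assms(2)] assms(3) B.word_eval_closed[OF assms(2)])
 qed
 with two_sided_keys assms(4) show ?thesis
  unfolding free_eval_def
  using B.lin_ext_span_zero[of "lists G" "word_eval B y" "two_sided G R" r] B.word_eval_closed[OF assms(2)] by blast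
qed

lemma pres_hom:
 assumes "cx_algebra B" "y ` G \<subseteq> carrier B" "!!r. r \<in> R ==> free_eval B y r = \<zero>\<^bsub>B\<^esub>"
 shows "(\<lambda>X. free_eval B y (rep X)) \<in> alg_homs (pres_alg G R) B"
  and "!!r. keys r \<subseteq> lists G ==> free_eval B y (rep (fq.kl r)) = free_eval B y r"
proof -
 interpret B: cx_algebra B by fact
 have w: "!!w. w \<in> lists G ==> word_eval B y w \<in> carrier B" by (rule B.word_eval_closed[OF assms(2)])
 have z: "!!r. r \<in> two_sided G R ==> lin_ext B (word_eval B y) r = \<zero>\<^bsub>B\<^esub>"
  using free_eval_ideal_zero[OF assms] fv.span_base unfolding free_eval_def by blast
 note L = fq.lin_from_Q[of B "word_eval B y", OF B.cvec_axioms w z, folded free_eval_def]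
 show 2: "!!r. keys r \<subseteq> lists G ==> free_eval B y (rep (fq.kl r)) = free_eval B y r" by (rule L)
 show "(\<lambda>X. free_eval B y (rep X)) \<in> alg_homs (pres_alg G R) B"
  by (rule alg_homsI[OF L(1)])
   (auto elim!: fq.carrierE simp: 2 mult_kl keys_mult_lists B.free_eval_simps[OF assms(2)] one_kl)
qed

end

section \<open>Tensor products\<close>

definition bilin :: "(complex, 'a, 'm) module_scheme => (complex, 'b, 'n) module_scheme =>
  (complex, 'c, 'k) module_scheme => ('a => 'b => 'c) => bool" where
 "bilin V W M f \<longleftrightarrow> (\<forall>w\<in>carrier W. (\<lambda>v. f v w) \<in> lin_maps V M) \<and> (\<forall>v\<in>carrier V. f v \<in> lin_maps W M)"

lemma bilinI:
 assumes "!!w. w \<in> carrier W ==> (\<lambda>v. f v w) \<in> lin_maps V M" "!!v. v \<in> carrier V ==> f v \<in> lin_maps W M"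
 shows "bilin V W M f"
 using assms by (simp add: bilin_def)

lemma bilinD:
 assumes "bilin V W M f"
 shows "w \<in> carrier W ==> (\<lambda>v. f v w) \<in> lin_maps V M" "v \<in> carrier V ==> f v \<in> lin_maps W M"
  "v \<in> carrier V ==> w \<in> carrier W ==> f v w \<in> carrier M"
 using assms by (auto simp: bilin_def lin_maps_def)

text \<open>Bilinear extension of an operation on basis elements. The multiplication of
  representatives in \<open>tensor\<close> is an instance, and the bookkeeping with supports is
  confined to this operation.\<close>

definition bmul :: "('k => 'l => 'n) => ('k \<Rightarrow>\<^sub>0 complex) => ('l \<Rightarrow>\<^sub>0 complex) => ('n \<Rightarrow>\<^sub>0 complex)" where
 "bmul op r s = (\<Sum>k\<in>keys r. \<Sum>l\<in>keys s.
   single (op k l) (Poly_Mapping.lookup r k * Poly_Mapping.lookup s l))"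

lemma bmul_superset:
 assumes "finite B" "finite C" "keys r \<subseteq> B" "keys s \<subseteq> C"
 shows "bmul op r s = (\<Sum>k\<in>B. \<Sum>l\<in>C. single (op k l) (Poly_Mapping.lookup r k * Poly_Mapping.lookup s l))"
proof -
 have "bmul op r s = (\<Sum>k\<in>keys r. \<Sum>l\<in>C. single (op k l) (Poly_Mapping.lookup r k * Poly_Mapping.lookup s l))"
  unfolding bmul_def using assms by (intro sum.cong refl sum.mono_neutral_left) (auto simp: in_keys_iff)
 also have "... = (\<Sum>k\<in>B. \<Sum>l\<in>C. single (op k l) (Poly_Mapping.lookup r k * Poly_Mapping.lookup s l))"
  using assms by (intro sum.mono_neutral_left) (auto simp: in_keys_iff)
 finally show ?thesis .
qed

lemma bmul_add_left: "bmul op (r + r') s = bmul op r s + bmul op r' s"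
 using keys_add[of r r']
 by (subst (1 2 3) bmul_superset[of "keys r \<union> keys r'" "keys s"])
  (auto simp: lookup_add distrib_right single_add sum.distrib)

lemma bmul_add_right: "bmul op r (s + s') = bmul op r s + bmul op r s'"
 using keys_add[of s s']
 by (subst (1 2 3) bmul_superset[of "keys r" "keys s \<union> keys s'"])
  (auto simp: lookup_add distrib_left single_add sum.distrib)

lemma bmul_scal_left: "bmul op (scal c r) s = scal c (bmul op r s)"
 using keys_scal[of c r]
 by (subst (1 2) bmul_superset[of "keys r" "keys s"])
  (auto simp: fv.scale_sum_right mult.assoc)

lemma bmul_scal_right: "bmul op r (scal c s) = scal c (bmul op r s)"
 using keys_scal[of c s]
 by (subst (1 2) bmul_superset[of "keys r" "keys s"])
  (auto simp: fv.scale_sum_right algebra_simps)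

lemma bmul_single: "bmul op (single k c) (single l d) = single (op k l) (c * d)"
 by (subst bmul_superset[of "{k}" "{l}"]) auto

lemma bmul_0 [simp]: "bmul op 0 s = 0" "bmul op r 0 = 0"
 by (simp_all add: bmul_def)

lemma bmul_diff_left: "bmul op (r - r') s = bmul op r s - bmul op r' s"
 using bmul_add_left[of op "r - r'" r' s] by (simp add: algebra_simps)

lemma bmul_diff_right: "bmul op r (s - s') = bmul op r s - bmul op r s'"
 using bmul_add_right[of op r "s - s'" s'] by (simp add: algebra_simps)

lemma keys_bmul:
 assumes "keys r \<subseteq> S" "keys s \<subseteq> S'" "!!k l. k \<in> S ==> l \<in> S' ==> op k l \<in> S''"
 shows "keys (bmul op r s) \<subseteq> S''"
proof -
 have 1: "keys (bmul op (single k c) s) \<subseteq> S''" if "k \<in> S" for k c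
  using assms(2)
 proof (induction s rule: pm_induct)
  case (add l d s)
  then show ?case using keys_add[of "single (op k l) (c * d)" "bmul op (single k c) s"] assms(3) that
   by (auto simp: bmul_add_right bmul_single split: if_splits)
 qed simp
 show ?thesis using assms(1)
 proof (induction r rule: pm_induct)
  case (add l d r)
  then show ?case using keys_add[of "bmul op (single l d) s" "bmul op r s"] 1[of l d]
   by (auto simp: bmul_add_left)
 qed simp
qed

locale tensor_spaces = V: cvec V + W: cvec W
 for V :: "(complex, 'a, 'm) module_scheme" and W :: "(complex, 'b, 'n) module_scheme"
begin

abbreviation "TVW \<equiv> tensor V W"

lemma bilin_rels_keys: "r \<in> bilin_rels V W ==> keys r \<subseteq> carrier V \<times> carrier W"
 unfolding bilin_rels_def
 by (elim UnE) (auto dest!: subsetD[OF keys_diff_subset] split: if_splits)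

sublocale T: fquot "carrier V \<times> carrier W" "bilin_rels V W" "(\<lambda>r s. \<Sum>(a, b)\<in>keys r. \<Sum>(a', b')\<in>keys s.
    single (a \<otimes>\<^bsub>V\<^esub> a', b \<otimes>\<^bsub>W\<^esub> b')
     (Poly_Mapping.lookup r (a, b) * Poly_Mapping.lookup s (a', b')))" "(single (\<one>\<^bsub>V\<^esub>, \<one>\<^bsub>W\<^esub>) 1)" TVW
 by unfold_locales (simp_all add: bilin_rels_keys tensor_def)

lemma tens_eq: "tens V W v w = T.kl (single (v, w) 1)"
 by (simp add: tens_def)

lemma tens_closed: "v \<in> carrier V ==> w \<in> carrier W ==> tens V W v w \<in> carrier TVW"
 unfolding tens_eq by (rule T.kl_closed) auto

lemma tens_add_left: "v \<in> carrier V ==> v' \<in> carrier V ==> w \<in> carrier W ==>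
  tens V W (v \<oplus>\<^bsub>V\<^esub> v') w = tens V W v w \<oplus>\<^bsub>TVW\<^esub> tens V W v' w"
 unfolding tens_eq
 by (subst T.add_Q, simp, simp, subst cls_eq_iff, simp)
  (rule fv.span_base, unfold bilin_rels_def, rule UnI1, rule UnI1, rule UnI1, unfold diff_diff_eq[symmetric], blast)

lemma tens_add_right: "v \<in> carrier V ==> w \<in> carrier W ==> w' \<in> carrier W ==>
  tens V W v (w \<oplus>\<^bsub>W\<^esub> w') = tens V W v w \<oplus>\<^bsub>TVW\<^esub> tens V W v w'"
 unfolding tens_eq
 by (subst T.add_Q, simp, simp, subst cls_eq_iff, simp)
  (rule fv.span_base, unfold bilin_rels_def, rule UnI1, rule UnI1, rule UnI2, unfold diff_diff_eq[symmetric], blast)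

lemma tens_sm_left: "v \<in> carrier V ==> w \<in> carrier W ==>
  tens V W (c \<odot>\<^bsub>V\<^esub> v) w = c \<odot>\<^bsub>TVW\<^esub> tens V W v w"
 unfolding tens_eq
 by (subst T.smult_Q, simp, subst cls_eq_iff, simp)
  (rule fv.span_base, unfold bilin_rels_def scal_single mult_1_right, rule UnI1, rule UnI2, blast)

lemma tens_sm_right: "v \<in> carrier V ==> w \<in> carrier W ==>
  tens V W v (c \<odot>\<^bsub>W\<^esub> w) = c \<odot>\<^bsub>TVW\<^esub> tens V W v w"
 unfolding tens_eq
 by (subst T.smult_Q, simp, subst cls_eq_iff, simp)
  (rule fv.span_base, unfold bilin_rels_def scal_single mult_1_right, rule UnI2, blast)

lemma bilin_tens: "bilin V W TVW (tens V W)"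
 by (intro bilinI lin_mapsI) (simp_all add: tens_closed tens_add_left tens_add_right tens_sm_left tens_sm_right)

lemma sweedler_lin:
 assumes M: "cvec M" and f: "bilin V W M f"
 shows "sweedler M f \<in> lin_maps TVW M"
  and "!!v w. v \<in> carrier V ==> w \<in> carrier W ==> sweedler M f (tens V W v w) = f v w"
proof -
 interpret M: cvec M by fact
 note [simp] = bilinD(3)[OF f] lin_add[OF bilinD(1)[OF f]] lin_add[OF bilinD(2)[OF f]]
  lin_sm[OF bilinD(1)[OF f]] lin_sm[OF bilinD(2)[OF f]]
 have fc: "!!k. k \<in> carrier V \<times> carrier W ==> (case k of (a, b) => f a b) \<in> carrier M" by auto
 note d = M.lin_ext_diff[of "carrier V \<times> carrier W" "\<lambda>(a, b). f a b", OF fc]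
 have s: "lin_ext M (\<lambda>(a, b). f a b) (single (v, w) c) = c \<odot>\<^bsub>M\<^esub> f v w"
  if "v \<in> carrier V" "w \<in> carrier W" for v w c
  using that by (subst M.lin_ext_single) auto
 have k: "keys (single (v, w) c - single (v', w') d) \<subseteq> carrier V \<times> carrier W"
  if "v \<in> carrier V" "w \<in> carrier W" "v' \<in> carrier V" "w' \<in> carrier W" for v w c v' w' and d :: complex
  using that by (intro subset_trans[OF keys_diff_subset]) auto
 have z: "!!x y. x \<in> carrier M ==> y \<in> carrier M ==> x \<oplus>\<^bsub>M\<^esub> y \<ominus>\<^bsub>M\<^esub> x \<ominus>\<^bsub>M\<^esub> y = \<zero>\<^bsub>M\<^esub>"
  by (simp add: a_minus_def M.a_assoc M.a_lcomm[of _ "\<ominus>\<^bsub>M\<^esub> _"] M.r_neg M.r_neg1 M.r_neg2)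
 have "lin_ext M (\<lambda>(a, b). f a b) r = \<zero>\<^bsub>M\<^esub>" if "r \<in> bilin_rels V W" for r
  using that unfolding bilin_rels_def
  by (elim UnE CollectE exE conjE; simp only:; subst d)
   (auto simp: k s d z M.diff_zero_iff)
 note L = T.lin_from_Q[of M "\<lambda>(a, b). f a b", OF M fc this]
 show "sweedler M f \<in> lin_maps TVW M" using L(1) by (simp add: sweedler_def[abs_def])
 show "!!v w. v \<in> carrier V ==> w \<in> carrier W ==> sweedler M f (tens V W v w) = f v w"
  by (simp add: sweedler_def tens_eq L(2) M.lin_ext_single)
qed

lemma sweedler_eq:
 assumes "F \<in> lin_maps TVW M" "cvec M"
  "!!v w. v \<in> carrier V ==> w \<in> carrier W ==> F (tens V W v w) = f v w" "t \<in> carrier TVW"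
 shows "sweedler M f t = F t"
 unfolding sweedler_def
 by (rule T.lin_ext_Q_eq[OF assms(1,2) _ assms(4)]) (use assms(3) in \<open>auto simp: tens_eq\<close>)

lemma tensor_ext:
 assumes "F \<in> lin_maps TVW M" "G \<in> lin_maps TVW M" "cvec M"
  "!!v w. v \<in> carrier V ==> w \<in> carrier W ==> F (tens V W v w) = G (tens V W v w)" "t \<in> carrier TVW"
 shows "F t = G t"
 by (rule T.lin_Q_ext[OF assms(1-3) _ assms(5)]) (use assms(4) in \<open>auto simp: tens_eq\<close>)

lemma sweedler_id: "t \<in> carrier TVW ==> sweedler TVW (tens V W) t = t"
 by (rule sweedler_eq[OF lin_id T.cvec_Q]) auto

lemma sweedler_cong:
 assumes M: "cvec M" and f: "bilin V W M f"
  and "!!v w. v \<in> carrier V ==> w \<in> carrier W ==> f v w = g v w" "t \<in> carrier TVW"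
 shows "sweedler M f t = sweedler M g t"
 by (rule sweedler_eq[symmetric, OF sweedler_lin(1)[OF M f] M])
  (use assms sweedler_lin(2)[OF M f] in auto)

lemma lin_sweedler:
 assumes "F \<in> lin_maps M N" "cvec M" "cvec N" "bilin V W M f" "t \<in> carrier TVW"
 shows "F (sweedler M f t) = sweedler N (\<lambda>a b. F (f a b)) t"
 by (rule sweedler_eq[symmetric, OF lin_comp[OF sweedler_lin(1)[OF assms(2,4)] assms(1)] assms(3)])
  (simp_all add: sweedler_lin(2)[OF assms(2,4)] assms(5))

text \<open>Scalars and zero have no case of their own: a coefficient is absorbed into the left
  entry of a pure tensor, and zero is the tensor of two zeros.\<close>

lemma tensor_induct [consumes 1, case_names tens add]:
 assumes "t \<in> carrier TVW"
  "!!v w. v \<in> carrier V ==> w \<in> carrier W ==> P (tens V W v w)"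
  "!!s t. s \<in> carrier TVW ==> t \<in> carrier TVW ==> P s ==> P t ==> P (s \<oplus>\<^bsub>TVW\<^esub> t)"
 shows "P t"
proof -
 obtain r where r: "keys r \<subseteq> carrier V \<times> carrier W" "t = T.kl r"
  using assms(1) by (rule T.carrierE)
 have sg: "P (T.kl (single k c))" if kk: "k \<in> carrier V \<times> carrier W" for k c
 proof -
  obtain v w where k: "k = (v, w)" "v \<in> carrier V" "w \<in> carrier W" using kk by auto
  have "T.kl (single k c) = tens V W (c \<odot>\<^bsub>V\<^esub> v) w"
   using k by (simp add: tens_sm_left) (simp add: tens_eq T.smult_Q)
  then show ?thesis using k assms(2) by simp
 qed
 from r(1) have "P (T.kl r)"
 proof (induction r rule: pm_induct)
  case zero
  have "T.kl 0 = tens V W \<zero>\<^bsub>V\<^esub> \<zero>\<^bsub>W\<^esub>"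
   using tens_sm_left[of "\<zero>\<^bsub>V\<^esub>" "\<zero>\<^bsub>W\<^esub>" 0] by (simp add: tens_closed flip: T.zero_Q)
  then show ?case using assms(2) by simp
 next
  case (add k c r)
  have "keys (single k c) \<subseteq> carrier V \<times> carrier W" using add by auto
  then show ?case using add sg[of k c] assms(3)[of "T.kl (single k c)" "T.kl r"]
   by (simp add: T.add_Q)
 qed
 then show ?thesis using r by simp
qed

end

lemma tensor_spacesI: "cvec V ==> cvec W ==> tensor_spaces V W"
 by (simp add: tensor_spaces_def)

lemma bilin_rels_cong: "same_mod V V' ==> same_mod W W' ==> bilin_rels V W = bilin_rels V' W'"
 by (simp add: bilin_rels_def same_mod_def)

lemma tens_cong: "same_mod V V' ==> same_mod W W' ==> tens V W = tens V' W'"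
 using bilin_rels_cong[of V V' W W'] by (simp add: tens_def[abs_def] same_mod_def)

lemma tensor_cong_mod: "same_mod V V' ==> same_mod W W' ==> same_mod (tensor V W) (tensor V' W')"
 using bilin_rels_cong[of V V' W W'] by (simp add: tensor_def free_quot_def same_mod_def)

lemma tensor_cong: "same_alg V V' ==> same_alg W W' ==> tensor V W = tensor V' W'"
 using bilin_rels_cong[of V V' W W'] by (simp add: tensor_def same_mod_def same_alg_def)

locale tensor_algs = V: cx_algebra V + W: cx_algebra W
 for V :: "(complex, 'a, 'm) module_scheme" and W :: "(complex, 'b, 'n) module_scheme"

sublocale tensor_algs \<subseteq> tensor_spaces V W ..

context tensor_algs
begin

definition "opVW = (\<lambda>(a, b) (a', b'). (a \<otimes>\<^bsub>V\<^esub> a', b \<otimes>\<^bsub>W\<^esub> b'))"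

lemma mult_rep: "X \<otimes>\<^bsub>TVW\<^esub> Y = T.kl (bmul opVW (rep X) (rep Y))"
 by (simp add: tensor_def free_quot_def bmul_def opVW_def case_prod_beta)

lemma keys_op:
 "keys r \<subseteq> carrier V \<times> carrier W ==> keys s \<subseteq> carrier V \<times> carrier W ==>
   keys (bmul opVW r s) \<subseteq> carrier V \<times> carrier W"
 by (rule keys_bmul) (auto simp: opVW_def)

text \<open>By distributivity in each factor, the product of a bilinearity relator with a pure
  tensor is again a single bilinearity relator.\<close>

lemma rel_op:
 assumes "x \<in> bilin_rels V W" "k \<in> carrier V \<times> carrier W"
 shows "bmul opVW x (single k 1) \<in> cspan (bilin_rels V W)"
  "bmul opVW (single k 1) x \<in> cspan (bilin_rels V W)"
proof -
 obtain a b where k: "k = (a, b)" "a \<in> carrier V" "b \<in> carrier W" using assms(2) by auto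
 have *: "!!u. u \<in> bilin_rels V W ==> u \<in> cspan (bilin_rels V W)" by (rule fv.span_base)
 show "bmul opVW x (single k 1) \<in> cspan (bilin_rels V W)"
  using assms(1) k(2,3) unfolding k(1)
  by (intro *) (unfold bilin_rels_def, elim UnE CollectE exE conjE;
    simp add: bmul_diff_left bmul_single opVW_def V.l_distr W.l_distr; blast)
 show "bmul opVW (single k 1) x \<in> cspan (bilin_rels V W)"
  using assms(1) k(2,3) unfolding k(1)
  by (intro *) (unfold bilin_rels_def, elim UnE CollectE exE conjE;
    simp add: bmul_diff_right bmul_single opVW_def V.r_distr W.r_distr; blast)
qed

lemma span_op:
 assumes "x \<in> cspan (bilin_rels V W)" "keys s \<subseteq> carrier V \<times> carrier W"
 shows "bmul opVW x s \<in> cspan (bilin_rels V W)" "bmul opVW s x \<in> cspan (bilin_rels V W)"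
proof -
 have "bmul opVW x s \<in> cspan (bilin_rels V W) \<and> bmul opVW s x \<in> cspan (bilin_rels V W)"
  using assms(1)
 proof (induction rule: fv.span_induct_alt)
  case (step c x y)
  have "bmul opVW x s \<in> cspan (bilin_rels V W) \<and> bmul opVW s x \<in> cspan (bilin_rels V W)"
   using assms(2)
  proof (induction s rule: pm_induct)
   case (add k c r)
   have "single k c = scal c (single k 1)" by simp
   then show ?case using add rel_op[OF step(1), of k]
    by (simp only: bmul_add_left bmul_add_right bmul_scal_left bmul_scal_right)
     (auto intro!: fv.span_add fv.span_scale)
  qed (simp add: fv.span_zero)
  then show ?case using step
   by (simp only: bmul_add_left bmul_add_right bmul_scal_left bmul_scal_right)
    (auto intro!: fv.span_add fv.span_scale)
 qed (simp add: fv.span_zero)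
 then show "bmul opVW x s \<in> cspan (bilin_rels V W)" "bmul opVW s x \<in> cspan (bilin_rels V W)" by auto
qed

lemma mult_kl:
 assumes "keys r \<subseteq> carrier V \<times> carrier W" "keys s \<subseteq> carrier V \<times> carrier W"
 shows "T.kl r \<otimes>\<^bsub>TVW\<^esub> T.kl s = T.kl (bmul opVW r s)"
proof -
 let ?r = "rep (T.kl r)" and ?s = "rep (T.kl s)"
 have "bmul opVW (?r - r) ?s + bmul opVW r (?s - s) \<in> cspan (bilin_rels V W)"
  by (intro fv.span_add span_op rep_cls assms)
 then have "bmul opVW ?r ?s - bmul opVW r s \<in> cspan (bilin_rels V W)"
  by (simp add: bmul_diff_left bmul_diff_right)
 then show ?thesis unfolding mult_rep using assms
  by (simp add: cls_eq_iff keys_op rep_cls)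
qed

lemma tens_mult:
 "a \<in> carrier V ==> b \<in> carrier W ==> a' \<in> carrier V ==> b' \<in> carrier W ==>
   tens V W a b \<otimes>\<^bsub>TVW\<^esub> tens V W a' b' = tens V W (a \<otimes>\<^bsub>V\<^esub> a') (b \<otimes>\<^bsub>W\<^esub> b')"
 unfolding tens_eq by (subst mult_kl) (simp_all add: bmul_single opVW_def)

lemma one_tens: "\<one>\<^bsub>TVW\<^esub> = tens V W \<one>\<^bsub>V\<^esub> \<one>\<^bsub>W\<^esub>"
 unfolding tens_eq by (rule T.one_Q)

lemma mult_bilin:
 "X \<in> carrier TVW ==> Y \<in> carrier TVW ==> X \<otimes>\<^bsub>TVW\<^esub> Y \<in> carrier TVW"
 "X \<in> carrier TVW ==> Y \<in> carrier TVW ==> Z \<in> carrier TVW ==> (X \<oplus>\<^bsub>TVW\<^esub> Y) \<otimes>\<^bsub>TVW\<^esub> Z = X \<otimes>\<^bsub>TVW\<^esub> Z \<oplus>\<^bsub>TVW\<^esub> Y \<otimes>\<^bsub>TVW\<^esub> Z"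
 "X \<in> carrier TVW ==> Y \<in> carrier TVW ==> Z \<in> carrier TVW ==> Z \<otimes>\<^bsub>TVW\<^esub> (X \<oplus>\<^bsub>TVW\<^esub> Y) = Z \<otimes>\<^bsub>TVW\<^esub> X \<oplus>\<^bsub>TVW\<^esub> Z \<otimes>\<^bsub>TVW\<^esub> Y"
 "X \<in> carrier TVW ==> Y \<in> carrier TVW ==> (c \<odot>\<^bsub>TVW\<^esub> X) \<otimes>\<^bsub>TVW\<^esub> Y = c \<odot>\<^bsub>TVW\<^esub> (X \<otimes>\<^bsub>TVW\<^esub> Y)"
 "X \<in> carrier TVW ==> Y \<in> carrier TVW ==> X \<otimes>\<^bsub>TVW\<^esub> (c \<odot>\<^bsub>TVW\<^esub> Y) = c \<odot>\<^bsub>TVW\<^esub> (X \<otimes>\<^bsub>TVW\<^esub> Y)"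
 by (elim T.carrierE; simp add: mult_kl T.add_Q T.smult_Q keys_op T.keys_add' T.keys_scal'
   bmul_add_left bmul_add_right bmul_scal_left bmul_scal_right)+

lemma cx_algebra_tensor: "cx_algebra TVW"
proof (rule cx_algebraI[OF T.cvec_Q])
 show one: "\<one>\<^bsub>TVW\<^esub> \<in> carrier TVW" unfolding one_tens by (rule tens_closed) auto
 show "\<one>\<^bsub>TVW\<^esub> \<otimes>\<^bsub>TVW\<^esub> x = x" "x \<otimes>\<^bsub>TVW\<^esub> \<one>\<^bsub>TVW\<^esub> = x" if "x \<in> carrier TVW" for x
  using that one by (induction rule: tensor_induct)
   (simp_all add: one_tens tens_mult mult_bilin)
 show "x \<otimes>\<^bsub>TVW\<^esub> y \<otimes>\<^bsub>TVW\<^esub> z = x \<otimes>\<^bsub>TVW\<^esub> (y \<otimes>\<^bsub>TVW\<^esub> z)"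
  if x: "x \<in> carrier TVW" and y: "y \<in> carrier TVW" and z: "z \<in> carrier TVW" for x y z
  using x
 proof (induction rule: tensor_induct)
  case (tens a b)
  note ab = tens tens_closed[OF tens]
  show ?case using y
  proof (induction rule: tensor_induct)
   case (tens a' b')
   note ab' = tens tens_closed[OF tens]
   show ?case using z
    by (induction rule: tensor_induct)
     (use ab ab' in \<open>simp_all add: tens_closed tens_mult V.m_assoc W.m_assoc mult_bilin\<close>)
  qed (use ab z in \<open>simp add: mult_bilin\<close>)
 qed (use y z in \<open>simp add: mult_bilin\<close>)
qed (simp_all add: mult_bilin)

sublocale TA: cx_algebra TVW by (rule cx_algebra_tensor)

lemma tensor_homI:
 assumes F: "F \<in> lin_maps TVW C" and C: "cx_algebra C"
  and "F (tens V W \<one>\<^bsub>V\<^esub> \<one>\<^bsub>W\<^esub>) = \<one>\<^bsub>C\<^esub>"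
  and m: "!!a b a' b'. a \<in> carrier V ==> b \<in> carrier W ==> a' \<in> carrier V ==> b' \<in> carrier W ==>
   F (tens V W (a \<otimes>\<^bsub>V\<^esub> a') (b \<otimes>\<^bsub>W\<^esub> b')) = F (tens V W a b) \<otimes>\<^bsub>C\<^esub> F (tens V W a' b')"
 shows "F \<in> alg_homs TVW C"
proof (rule alg_homsI[OF F])
 interpret C: cx_algebra C by fact
 show "F \<one>\<^bsub>TVW\<^esub> = \<one>\<^bsub>C\<^esub>" using assms(3) by (simp add: one_tens)
 show "F (x \<otimes>\<^bsub>TVW\<^esub> y) = F x \<otimes>\<^bsub>C\<^esub> F y" if x: "x \<in> carrier TVW" and y: "y \<in> carrier TVW" for x y
  using x
 proof (induction rule: tensor_induct)
  case (tens a b)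
  note ab = tens tens_closed[OF tens]
  show ?case using y
   by (induction rule: tensor_induct)
    (use ab in \<open>simp_all add: tens_mult m TA.r_distr C.r_distr lin_add[OF F] lin_closed[OF F]\<close>)
 qed (use y in \<open>simp add: TA.l_distr C.l_distr lin_add[OF F] lin_closed[OF F]\<close>)
qed

lemma tensor_hom:
 assumes f: "f \<in> alg_homs V C" and g: "g \<in> alg_homs W C" and C: "cx_algebra C"
  and comm: "!!a b. a \<in> carrier V ==> b \<in> carrier W ==> f a \<otimes>\<^bsub>C\<^esub> g b = g b \<otimes>\<^bsub>C\<^esub> f a"
 shows "sweedler C (\<lambda>a b. f a \<otimes>\<^bsub>C\<^esub> g b) \<in> alg_homs TVW C"
  and "!!a b. a \<in> carrier V ==> b \<in> carrier W ==> sweedler C (\<lambda>a b. f a \<otimes>\<^bsub>C\<^esub> g b) (tens V W a b) = f a \<otimes>\<^bsub>C\<^esub> g b"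
proof -
 interpret C: cx_algebra C by fact
 note [simp] = hom_closed[OF f] hom_closed[OF g] hom_add[OF f] hom_add[OF g] hom_sm[OF f] hom_sm[OF g]
  hom_mult[OF f] hom_mult[OF g] hom_one[OF f] hom_one[OF g]
 have b: "bilin V W C (\<lambda>a b. f a \<otimes>\<^bsub>C\<^esub> g b)"
  by (intro bilinI lin_mapsI) (simp_all add: C.l_distr C.r_distr)
 note L = sweedler_lin[OF C.cvec_axioms b]
 show "!!a b. a \<in> carrier V ==> b \<in> carrier W ==> sweedler C (\<lambda>a b. f a \<otimes>\<^bsub>C\<^esub> g b) (tens V W a b) = f a \<otimes>\<^bsub>C\<^esub> g b"
  by (rule L(2))
 have m: "f a \<otimes>\<^bsub>C\<^esub> f a' \<otimes>\<^bsub>C\<^esub> (g b \<otimes>\<^bsub>C\<^esub> g b') = f a \<otimes>\<^bsub>C\<^esub> g b \<otimes>\<^bsub>C\<^esub> (f a' \<otimes>\<^bsub>C\<^esub> g b')"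
  if ab: "a \<in> carrier V" "b \<in> carrier W" "a' \<in> carrier V" "b' \<in> carrier W" for a b a' b'
 proof -
  have "f a \<otimes>\<^bsub>C\<^esub> f a' \<otimes>\<^bsub>C\<^esub> (g b \<otimes>\<^bsub>C\<^esub> g b') = f a \<otimes>\<^bsub>C\<^esub> ((f a' \<otimes>\<^bsub>C\<^esub> g b) \<otimes>\<^bsub>C\<^esub> g b')"
   using ab by (simp add: C.m_assoc)
  also have "... = f a \<otimes>\<^bsub>C\<^esub> ((g b \<otimes>\<^bsub>C\<^esub> f a') \<otimes>\<^bsub>C\<^esub> g b')" using ab by (simp add: comm)
  also have "... = f a \<otimes>\<^bsub>C\<^esub> g b \<otimes>\<^bsub>C\<^esub> (f a' \<otimes>\<^bsub>C\<^esub> g b')" using ab by (simp add: C.m_assoc)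
  finally show ?thesis .
 qed
 show "sweedler C (\<lambda>a b. f a \<otimes>\<^bsub>C\<^esub> g b) \<in> alg_homs TVW C"
  by (rule tensor_homI[OF L(1) C]) (simp_all add: L(2) m)
qed

lemma tens_left_hom: "(\<lambda>a. tens V W a \<one>\<^bsub>W\<^esub>) \<in> alg_homs V TVW"
 by (intro alg_homsI lin_mapsI) (simp_all add: tens_closed tens_add_left tens_sm_left tens_mult one_tens)

lemma tens_right_hom: "(\<lambda>b. tens V W \<one>\<^bsub>V\<^esub> b) \<in> alg_homs W TVW"
 by (intro alg_homsI lin_mapsI) (simp_all add: tens_closed tens_add_right tens_sm_right tens_mult one_tens)

end

lemma tensor_algsI: "cx_algebra V ==> cx_algebra W ==> tensor_algs V W"
 by (simp add: tensor_algs_def)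


section \<open>Endomorphism algebras\<close>

text \<open>Operators are taken extensional, so that equality in \<open>End V\<close> is equality of
  functions and the laws of an algebra hold literally.\<close>

definition End :: "(complex, 'a, 'm) module_scheme => ('a => 'a) calg" where
 "End V = \<lparr>carrier = lin_maps V V \<inter> extensional (carrier V), mult = compose (carrier V),
   one = restrict (\<lambda>x. x) (carrier V), zero = restrict (\<lambda>x. \<zero>\<^bsub>V\<^esub>) (carrier V),
   add = (\<lambda>f g. restrict (\<lambda>x. f x \<oplus>\<^bsub>V\<^esub> g x) (carrier V)),
   smult = (\<lambda>c f. restrict (\<lambda>x. c \<odot>\<^bsub>V\<^esub> f x) (carrier V))\<rparr>"

lemma end_simps:
 "x \<in> carrier V ==> (f \<otimes>\<^bsub>End V\<^esub> g) x = f (g x)"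
 "x \<in> carrier V ==> \<one>\<^bsub>End V\<^esub> x = x"
 "x \<in> carrier V ==> \<zero>\<^bsub>End V\<^esub> x = \<zero>\<^bsub>V\<^esub>"
 "x \<in> carrier V ==> (f \<oplus>\<^bsub>End V\<^esub> g) x = f x \<oplus>\<^bsub>V\<^esub> g x"
 "x \<in> carrier V ==> (c \<odot>\<^bsub>End V\<^esub> f) x = c \<odot>\<^bsub>V\<^esub> f x"
 by (simp_all add: End_def compose_def)

lemma end_carrier: "f \<in> carrier (End V) \<longleftrightarrow> f \<in> lin_maps V V \<and> f \<in> extensional (carrier V)"
 by (simp add: End_def)

lemma end_lin: "f \<in> carrier (End V) ==> f \<in> lin_maps V V"
 by (simp add: end_carrier)

lemma end_ext:
 "f \<in> carrier (End V) ==> g \<in> carrier (End V) ==> (!!x. x \<in> carrier V ==> f x = g x) ==> f = g"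
 unfolding end_carrier by (metis extensionalityI)

lemma restrict_end: "cvec V ==> f \<in> lin_maps V V ==> restrict f (carrier V) \<in> carrier (End V)"
 unfolding end_carrier by (auto intro: lin_cong)

lemma cx_algebra_end:
 assumes "cvec V" shows "cx_algebra (End V)"
proof -
 interpret V: cvec V by fact
 have lin: "f \<in> carrier (End V) ==> x \<in> carrier V ==> f x \<in> carrier V"
  "f \<in> carrier (End V) ==> x \<in> carrier V ==> y \<in> carrier V ==> f (x \<oplus>\<^bsub>V\<^esub> y) = f x \<oplus>\<^bsub>V\<^esub> f y"
  "f \<in> carrier (End V) ==> x \<in> carrier V ==> f (c \<odot>\<^bsub>V\<^esub> x) = c \<odot>\<^bsub>V\<^esub> f x" for f x y c
  by (auto simp: lin_closed lin_add lin_sm dest!: end_lin)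
 have ext: "f \<otimes>\<^bsub>End V\<^esub> g \<in> extensional (carrier V)" "\<one>\<^bsub>End V\<^esub> \<in> extensional (carrier V)"
  "\<zero>\<^bsub>End V\<^esub> \<in> extensional (carrier V)" "f \<oplus>\<^bsub>End V\<^esub> g \<in> extensional (carrier V)"
  "c \<odot>\<^bsub>End V\<^esub> f \<in> extensional (carrier V)" for f g c
  by (simp_all add: End_def)
 have cl: "f \<in> carrier (End V) ==> g \<in> carrier (End V) ==> f \<otimes>\<^bsub>End V\<^esub> g \<in> carrier (End V)"
  "\<one>\<^bsub>End V\<^esub> \<in> carrier (End V)" "\<zero>\<^bsub>End V\<^esub> \<in> carrier (End V)"
  "f \<in> carrier (End V) ==> g \<in> carrier (End V) ==> f \<oplus>\<^bsub>End V\<^esub> g \<in> carrier (End V)"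
  "f \<in> carrier (End V) ==> c \<odot>\<^bsub>End V\<^esub> f \<in> carrier (End V)" for f g c
  using ext by (auto simp: end_carrier[where f = "_ \<otimes>\<^bsub>End V\<^esub> _"] end_carrier[where f = "_ \<oplus>\<^bsub>End V\<^esub> _"]
   end_carrier[where f = "_ \<odot>\<^bsub>End V\<^esub> _"] end_carrier[where f = "\<one>\<^bsub>End V\<^esub>"] end_carrier[where f = "\<zero>\<^bsub>End V\<^esub>"]
   intro!: lin_mapsI simp: end_simps lin V.sm_distr V.sm_sm V.a_ac mult.commute)
 show ?thesis
  by (intro cx_algebraI cvecI cl; (assumption | rule end_ext[where V = V]; (intro cl; assumption)?))
   (simp_all add: end_simps lin V.sm_distr V.sm_sm V.sm_add V.a_ac cl)
qed

lemma end_hom: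
 assumes "cvec V" "cx_algebra A"
  "!!a. a \<in> carrier A ==> r a \<in> lin_maps V V" "!!x. x \<in> carrier V ==> (\<lambda>a. r a x) \<in> lin_maps A V"
  "!!a b x. a \<in> carrier A ==> b \<in> carrier A ==> x \<in> carrier V ==> r (a \<otimes>\<^bsub>A\<^esub> b) x = r a (r b x)"
  "!!x. x \<in> carrier V ==> r \<one>\<^bsub>A\<^esub> x = x"
 shows "(\<lambda>a. restrict (r a) (carrier V)) \<in> alg_homs A (End V)"
proof -
 interpret V: cvec V by fact
 interpret A: cx_algebra A by fact
 interpret E: cx_algebra "End V" by (rule cx_algebra_end) fact
 note [simp] = restrict_end[OF assms(1) assms(3)]
 show ?thesis
  by (intro alg_homsI lin_mapsI; (rule end_ext[where V = V])?)
   (simp_all add: end_simps lin_add[OF assms(4)] lin_sm[OF assms(4)] assms(5,6) lin_closed[OF assms(3)])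
qed

lemma end_eval_lin: "x \<in> carrier V ==> (\<lambda>f. f x) \<in> lin_maps (End V) V"
 by (intro lin_mapsI) (auto simp: end_simps lin_closed dest: end_lin)

definition lmul :: "(complex, 'a, 'm) module_scheme => 'a => 'a => 'a" where
 "lmul A a = restrict (\<lambda>x. a \<otimes>\<^bsub>A\<^esub> x) (carrier A)"

lemma lmul_apply: "x \<in> carrier A ==> lmul A a x = a \<otimes>\<^bsub>A\<^esub> x"
 by (simp add: lmul_def)

lemma lmul_hom:
 assumes "cx_algebra A" shows "lmul A \<in> alg_homs A (End A)"
proof -
 interpret A: cx_algebra A by fact
 show ?thesis unfolding lmul_def[abs_def]
  by (rule end_hom) (auto intro!: lin_mapsI assms simp: A.cvec_axioms A.r_distr A.l_distr A.m_assoc)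
qed

text \<open>A vector space \<open>T\<close> with a bilinear map \<open>\<tau>\<close> that makes it a tensor product of \<open>V\<close> and \<open>W\<close>;
 \<open>\<sigma>\<close> is the isomorphism to the standard one.\<close>

locale tprod = tensor_spaces V W + T': cvec T'
 for V :: "(complex, 'a, 'm) module_scheme" and W :: "(complex, 'b, 'n) module_scheme"
  and T' :: "(complex, 'c, 'k) module_scheme" and \<tau> \<sigma> +
 assumes \<tau>: "bilin V W T' \<tau>" and \<sigma>: "\<sigma> \<in> lin_maps T' TVW"
  and \<sigma>\<tau>: "!!v w. v \<in> carrier V ==> w \<in> carrier W ==> \<sigma> (\<tau> v w) = tens V W v w"
  and \<tau>\<sigma>: "!!x. x \<in> carrier T' ==> sweedler T' \<tau> (\<sigma> x) = x"
begin

lemmas \<tau>_simps = bilinD(3)[OF \<tau>] lin_add[OF bilinD(1)[OF \<tau>]] lin_add[OF bilinD(2)[OF \<tau>]]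
 lin_sm[OF bilinD(1)[OF \<tau>]] lin_sm[OF bilinD(2)[OF \<tau>]]

lemma tp_ext:
 assumes "F \<in> lin_maps T' M" "G \<in> lin_maps T' M" "cvec M"
  "!!v w. v \<in> carrier V ==> w \<in> carrier W ==> F (\<tau> v w) = G (\<tau> v w)" "x \<in> carrier T'"
 shows "F x = G x"
proof -
 note S = sweedler_lin[OF T'.cvec_axioms \<tau>]
 have "F (sweedler T' \<tau> t) = G (sweedler T' \<tau> t)" if "t \<in> carrier TVW" for t
  by (rule tensor_ext[OF lin_comp[OF S(1) assms(1)] lin_comp[OF S(1) assms(2)] assms(3) _ that])
   (simp add: S(2) assms(4))
 from this[of "\<sigma> x"] show ?thesis using \<tau>\<sigma> lin_closed[OF \<sigma>] assms(5) by simp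
qed

lemma tp_lin:
 assumes "cvec M" "bilin V W M f"
 shows "(\<lambda>x. sweedler M f (\<sigma> x)) \<in> lin_maps T' M"
  and "!!v w. v \<in> carrier V ==> w \<in> carrier W ==> sweedler M f (\<sigma> (\<tau> v w)) = f v w"
 using lin_comp[OF \<sigma> sweedler_lin(1)[OF assms]] sweedler_lin(2)[OF assms] by (simp_all add: \<sigma>\<tau>)

lemma tp_induct [consumes 1, case_names tens add]:
 assumes "t \<in> carrier T'"
  "!!v w. v \<in> carrier V ==> w \<in> carrier W ==> P (\<tau> v w)"
  "!!s t. s \<in> carrier T' ==> t \<in> carrier T' ==> P s ==> P t ==> P (s \<oplus>\<^bsub>T'\<^esub> t)"
 shows "P t"
proof -
 note S = sweedler_lin[OF T'.cvec_axioms \<tau>]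
 have "P (sweedler T' \<tau> s)" if "s \<in> carrier TVW" for s
  using that by (induction rule: tensor_induct)
   (simp_all add: S(2) assms(2,3) lin_add[OF S(1)] lin_closed[OF S(1)])
 from this[of "\<sigma> t"] show ?thesis using \<tau>\<sigma> lin_closed[OF \<sigma>] assms(1) by simp
qed

definition "opL f = restrict (\<lambda>x. sweedler T' (\<lambda>v w. \<tau> (f v) w) (\<sigma> x)) (carrier T')"
definition "opR g = restrict (\<lambda>x. sweedler T' (\<lambda>v w. \<tau> v (g w)) (\<sigma> x)) (carrier T')"

lemma bilin_opL: "f \<in> carrier (End V) ==> bilin V W T' (\<lambda>v w. \<tau> (f v) w)"
 by (intro bilinI lin_mapsI) (simp_all add: \<tau>_simps lin_closed[OF end_lin] lin_add[OF end_lin] lin_sm[OF end_lin])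

lemma bilin_opR: "g \<in> carrier (End W) ==> bilin V W T' (\<lambda>v w. \<tau> v (g w))"
 by (intro bilinI lin_mapsI) (simp_all add: \<tau>_simps lin_closed[OF end_lin] lin_add[OF end_lin] lin_sm[OF end_lin])

lemma opL_closed: "f \<in> carrier (End V) ==> opL f \<in> carrier (End T')"
 and opL_\<tau>: "f \<in> carrier (End V) ==> v \<in> carrier V ==> w \<in> carrier W ==> opL f (\<tau> v w) = \<tau> (f v) w"
 using tp_lin[OF T'.cvec_axioms bilin_opL, of f] unfolding opL_def
 by (simp_all add: restrict_end T'.cvec_axioms \<tau>_simps)

lemma opR_closed: "g \<in> carrier (End W) ==> opR g \<in> carrier (End T')"
 and opR_\<tau>: "g \<in> carrier (End W) ==> v \<in> carrier V ==> w \<in> carrier W ==> opR g (\<tau> v w) = \<tau> v (g w)"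
 using tp_lin[OF T'.cvec_axioms bilin_opR, of g] unfolding opR_def
 by (simp_all add: restrict_end T'.cvec_axioms \<tau>_simps)

lemma end_tp_ext:
 assumes "F \<in> carrier (End T')" "G \<in> carrier (End T')"
  "!!v w. v \<in> carrier V ==> w \<in> carrier W ==> F (\<tau> v w) = G (\<tau> v w)"
 shows "F = G"
 by (rule end_ext[OF assms(1,2)], rule tp_ext[OF end_lin[OF assms(1)] end_lin[OF assms(2)] T'.cvec_axioms assms(3)])

sublocale EV: cx_algebra "End V" by (rule cx_algebra_end) (rule V.cvec_axioms)
sublocale EW: cx_algebra "End W" by (rule cx_algebra_end) (rule W.cvec_axioms)
sublocale ET: cx_algebra "End T'" by (rule cx_algebra_end) (rule T'.cvec_axioms)

lemma opL_hom: "opL \<in> alg_homs (End V) (End T')"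
 by (intro alg_homsI lin_mapsI; (rule end_tp_ext)?)
  (simp_all add: opL_closed opL_\<tau> end_simps \<tau>_simps lin_closed[OF end_lin])

lemma opR_hom: "opR \<in> alg_homs (End W) (End T')"
 by (intro alg_homsI lin_mapsI; (rule end_tp_ext)?)
  (simp_all add: opR_closed opR_\<tau> end_simps \<tau>_simps lin_closed[OF end_lin])

lemma opLR_comm:
 "f \<in> carrier (End V) ==> g \<in> carrier (End W) ==> opL f \<otimes>\<^bsub>End T'\<^esub> opR g = opR g \<otimes>\<^bsub>End T'\<^esub> opL f"
 by (rule end_tp_ext) (simp_all add: opL_closed opL_\<tau> opR_closed opR_\<tau> end_simps \<tau>_simps lin_closed[OF end_lin])

end

lemma tprod_tensor: "cvec V ==> cvec W ==> tprod V W (tensor V W) (tens V W) (\<lambda>x. x)"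
proof -
 assume "cvec V" "cvec W"
 then interpret tensor_spaces V W by (rule tensor_spacesI)
 show ?thesis by unfold_locales (simp_all add: bilin_tens lin_id sweedler_id)
qed


section \<open>A root-of-unity binomial theorem\<close>

text \<open>The Gaussian binomial coefficient, by its Pascal rule. Without division the definition
  makes sense when \<open>w\<close> is a root of unity.\<close>

fun gbinom :: "complex => nat => nat => complex" where
 "gbinom w n 0 = 1"
| "gbinom w 0 (Suc k) = 0"
| "gbinom w (Suc n) (Suc k) = gbinom w n k + w ^ Suc k * gbinom w n (Suc k)"

lemma gbinom_zero: "n < k ==> gbinom w n k = 0"
 by (induction w n k rule: gbinom.induct) auto

text \<open>The ratio of neighbouring coefficients, cleared of the denominator 1 - w^(k+1), which
  may vanish at a root of unity.\<close>

lemma gbinom_ratio: "k \<le> n ==> (1 - w ^ Suc k) * gbinom w n (Suc k) = (1 - w ^ (n - k)) * gbinom w n k"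
proof (induction n arbitrary: k)
 case 0 then show ?case by simp
next
 case (Suc n)
 \<comment> \<open>The absorption identity for the next row; comparing it with the Pascal rule for
   the right-hand side gives the ratio for \<open>Suc n\<close>.\<close>
 have step: "(1 - w ^ Suc j) * gbinom w (Suc n) (Suc j) = (1 - w ^ Suc n) * gbinom w n j" if "j \<le> n" for j
 proof -
  have "(1 - w ^ Suc j) * gbinom w (Suc n) (Suc j)
    = (1 - w ^ Suc j) * gbinom w n j + w ^ Suc j * ((1 - w ^ Suc j) * gbinom w n (Suc j))"
   by (simp add: algebra_simps)
  also have "... = (1 - w ^ Suc j) * gbinom w n j + w ^ Suc j * ((1 - w ^ (n - j)) * gbinom w n j)"
   by (simp only: Suc.IH[OF that])
  also have "w ^ Suc j * ((1 - w ^ (n - j)) * gbinom w n j) = (w ^ Suc j - w ^ Suc n) * gbinom w n j"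
   using that by (simp add: algebra_simps flip: power_add)
  finally show ?thesis by (simp add: algebra_simps)
 qed
 show ?case
 proof (cases k)
  case 0
  then show ?thesis using step[of 0] by simp
 next
  case (Suc j)
  have j: "j \<le> n" using Suc Suc.prems by simp
  show ?thesis
  proof (cases "j = n")
   case True
   then show ?thesis using Suc by (simp add: gbinom_zero)
  next
   case False
   have "(1 - w ^ Suc k) * gbinom w (Suc n) (Suc k) = (1 - w ^ Suc n) * gbinom w n (Suc j)"
    using step[of "Suc j"] Suc False j by simp
   also have "... = (1 - w ^ Suc j) * gbinom w n (Suc j) + (w ^ Suc j - w ^ Suc n) * gbinom w n (Suc j)"
    by (simp add: algebra_simps)
   also have "w ^ Suc n = w ^ Suc j * w ^ (n - j)" using j by (simp flip: power_add)
   also have "(1 - w ^ Suc j) * gbinom w n (Suc j) = (1 - w ^ (n - j)) * gbinom w n j" by (rule Suc.IH[OF j])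
   finally show ?thesis using Suc j by (simp add: algebra_simps)
  qed
 qed
qed

text \<open>After multiplication by 1 - w^k the coefficient equals 1 - w^p times a coefficient of
  the preceding row, hence 0, and 1 - w^k can be cancelled.\<close>

lemma gbinom_root:
 assumes "w ^ p = 1" "w ^ k \<noteq> 1" "0 < k" "k < p"
 shows "gbinom w p k = 0"
proof -
 obtain j r where j: "k = Suc j" and r: "p = Suc r" using assms by (metis Suc_pred less_trans)
 have "(1 - w ^ Suc j) * gbinom w p (Suc j)
   = (1 - w ^ Suc j) * gbinom w r j + w ^ Suc j * ((1 - w ^ Suc j) * gbinom w r (Suc j))"
  using r by (simp add: algebra_simps)
 also have "(1 - w ^ Suc j) * gbinom w r (Suc j) = (1 - w ^ (r - j)) * gbinom w r j"
  using j r assms(4) by (intro gbinom_ratio) simp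
 also have "(1 - w ^ Suc j) * gbinom w r j + w ^ Suc j * ((1 - w ^ (r - j)) * gbinom w r j)
   = (1 - w ^ (Suc j + (r - j))) * gbinom w r j"
  by (simp add: algebra_simps power_add)
 also have "Suc j + (r - j) = p" using j r assms(4) by simp
 finally show ?thesis using assms(1,2) j by simp
qed

context cx_algebra
begin

lemma qcomm_pow:
 assumes "a \<in> carrier A" "b \<in> carrier A" "b \<otimes> a = w \<odot> (a \<otimes> b)"
 shows "b \<otimes> a [^] (n::nat) = w ^ n \<odot> (a [^] n \<otimes> b)"
proof (induction n)
 case (Suc n)
 have "b \<otimes> a [^] Suc n = (b \<otimes> a [^] n) \<otimes> a" using assms by (simp add: m_assoc)
 also have "... = w ^ n \<odot> (a [^] n \<otimes> (b \<otimes> a))" using Suc assms(1,2) by (simp add: m_assoc)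
 also have "... = w ^ Suc n \<odot> (a [^] Suc n \<otimes> b)" using assms by (simp add: m_assoc sm_sm mult.commute)
 finally show ?case .
qed (use assms in simp)

text \<open>The scalar is a power of \<open>w\<close>; it stays anonymous because the aim is the
  vanishing of powers.\<close>

lemma qcomm_prod_pow:
 assumes "a \<in> carrier A" "b \<in> carrier A" "b \<otimes> a = w \<odot> (a \<otimes> b)"
 shows "\<exists>c. (a \<otimes> b) [^] (n::nat) = c \<odot> (a [^] n \<otimes> b [^] n)"
proof (induction n)
 case 0 show ?case by (rule exI[of _ 1]) simp
next
 case (Suc n)
 then obtain c where c: "(a \<otimes> b) [^] n = c \<odot> (a [^] n \<otimes> b [^] n)" by blast
 have "(a \<otimes> b) [^] Suc n = (a \<otimes> b) \<otimes> (a \<otimes> b) [^] n"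
  using assms(1,2) by (metis nat_pow_Suc2 m_closed)
 also have "... = c \<odot> (a \<otimes> ((b \<otimes> a [^] n) \<otimes> b [^] n))" using c assms(1,2) by (simp add: m_assoc)
 also have "... = (c * w ^ n) \<odot> ((a \<otimes> a [^] n) \<otimes> (b \<otimes> b [^] n))"
  using assms by (simp add: qcomm_pow m_assoc sm_sm del: nat_pow_Suc)
 also have "... = (c * w ^ n) \<odot> (a [^] Suc n \<otimes> b [^] Suc n)"
  using assms(1,2) by (metis nat_pow_Suc2)
 finally show ?case by blast
qed

lemma qcomm_prod_pow_zero:
 assumes "a \<in> carrier A" "b \<in> carrier A" "b \<otimes> a = w \<odot> (a \<otimes> b)" "a [^] (n::nat) = \<zero> \<or> b [^] n = \<zero>"
 shows "(a \<otimes> b) [^] n = \<zero>"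
 using qcomm_prod_pow[OF assms(1-3), of n] assms(1,2,4) by auto

lemma smult_pow: "a \<in> carrier A ==> (c \<odot> a) [^] (n::nat) = c ^ n \<odot> (a [^] n)"
 by (induction n) (simp_all add: sm_sm mult.commute)

lemma qbinomial:
 assumes a: "a \<in> carrier A" and b: "b \<in> carrier A" and ba: "b \<otimes> a = w \<odot> (a \<otimes> b)"
 shows "(a \<oplus> b) [^] (n::nat) = (\<Oplus>k\<in>{..n}. gbinom w n k \<odot> (a [^] k \<otimes> b [^] (n - k)))"
proof (induction n)
 case 0 show ?case by simp
next
 case (Suc n)
 define X where "X k = a [^] k \<otimes> b [^] (Suc n - k)" for k :: nat
 have X [simp]: "X k \<in> carrier A" for k using a b by (simp add: X_def)
 let ?Y = "\<lambda>k. gbinom w n k \<odot> (a [^] k \<otimes> b [^] (n - k))"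
 have Y: "?Y \<in> {..n} \<rightarrow> carrier A" using a b by auto
 have b1: "b \<otimes> b [^] (n - k) = b [^] (Suc n - k)" if "k \<le> n" for k
  using that b by (metis Suc_diff_le nat_pow_Suc2)
 have A1: "a \<otimes> ?Y k = gbinom w n k \<odot> X (Suc k)" for k
 proof -
  have "a \<otimes> ?Y k = gbinom w n k \<odot> ((a \<otimes> a [^] k) \<otimes> b [^] (n - k))" using a b by (simp add: m_assoc)
  then show ?thesis using a by (metis X_def diff_Suc_Suc nat_pow_Suc2)
 qed
 have B1: "b \<otimes> ?Y k = (w ^ k * gbinom w n k) \<odot> X k" if "k \<le> n" for k
 proof -
  have "b \<otimes> ?Y k = gbinom w n k \<odot> ((b \<otimes> a [^] k) \<otimes> b [^] (n - k))" using a b by (simp add: m_assoc)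
  also have "... = (gbinom w n k * w ^ k) \<odot> (a [^] k \<otimes> (b \<otimes> b [^] (n - k)))"
   using a b by (simp add: qcomm_pow[OF a b ba] m_assoc sm_sm)
  finally show ?thesis using b1[OF that] by (simp add: X_def mult.commute)
 qed
 have "(a \<oplus> b) [^] Suc n = (a \<oplus> b) \<otimes> (a \<oplus> b) [^] n" using a b by (metis nat_pow_Suc2 a_closed)
 also have "... = a \<otimes> finsum A ?Y {..n} \<oplus> b \<otimes> finsum A ?Y {..n}"
  using Suc.IH a b Y finsum_closed[OF Y] by (simp add: l_distr)
 also have "a \<otimes> finsum A ?Y {..n} = (\<Oplus>k\<in>{..n}. gbinom w n k \<odot> X (Suc k))"
  using a Y by (subst finsum_rdistr) (auto simp: A1 simp del: smult_mult_right)
 also have "b \<otimes> finsum A ?Y {..n} = (\<Oplus>k\<in>{..n}. (w ^ k * gbinom w n k) \<odot> X k)"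
  using b Y by (subst finsum_rdistr) (auto simp: B1 simp del: smult_mult_right intro!: finsum_cong')
 also have "... = (\<Oplus>k\<in>{..Suc n}. (w ^ k * gbinom w n k) \<odot> X k)"
  by (subst finsum_Suc) (auto simp: gbinom_zero intro!: l_zero[symmetric] finsum_closed)
 also have "... = (\<Oplus>k\<in>{..n}. (w ^ Suc k * gbinom w n (Suc k)) \<odot> X (Suc k)) \<oplus> X 0"
  by (subst finsum_Suc2) auto
 also have "(\<Oplus>k\<in>{..n}. gbinom w n k \<odot> X (Suc k)) \<oplus> ((\<Oplus>k\<in>{..n}. (w ^ Suc k * gbinom w n (Suc k)) \<odot> X (Suc k)) \<oplus> X 0)
   = (\<Oplus>k\<in>{..n}. gbinom w (Suc n) (Suc k) \<odot> X (Suc k)) \<oplus> X 0"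
  by (subst a_assoc[symmetric]) (auto simp: sm_add simp flip: finsum_addf intro!: finsum_closed)
 also have "... = (\<Oplus>k\<in>{..Suc n}. gbinom w (Suc n) k \<odot> X k)"
  by (subst finsum_Suc2) auto
 finally show ?case by (simp only: X_def)
qed

lemma root_binomial:
 assumes a: "a \<in> carrier A" and b: "b \<in> carrier A" and ba: "b \<otimes> a = w \<odot> (a \<otimes> b)"
  and w: "w ^ p = 1" "!!k. 0 < k ==> k < p ==> w ^ k \<noteq> 1"
  and z: "a [^] (p::nat) = \<zero>" "b [^] p = \<zero>"
 shows "(a \<oplus> b) [^] p = \<zero>"
proof -
 have "gbinom w p k \<odot> (a [^] k \<otimes> b [^] (p - k)) = \<zero>" if "k \<le> p" for k
 proof (cases "k = 0 \<or> k = p")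
  case True then show ?thesis using a b z by auto
 next
  case False
  then show ?thesis using that a b gbinom_root[OF w(1) w(2)[of k]] by simp
 qed
 then show ?thesis using a b
  by (subst qbinomial[OF a b ba]) (rule add.finprod_one_eqI, simp)
qed


text \<open>\<open>Lc\<close> turns a sum of scalar multiples in \<open>A\<close> into a formal linear combination of elements of \<open>A\<close>,
 so that like terms are collected by a computation with complex coefficients.\<close>

definition Lc :: "('a \<Rightarrow>\<^sub>0 complex) => 'a" where "Lc = lin_ext A (\<lambda>x. x)"
definition Lk :: "('a \<Rightarrow>\<^sub>0 complex) => bool" where "Lk r \<longleftrightarrow> keys r \<subseteq> carrier A"

lemma Lk_simps: "m \<in> carrier A ==> Lk (single m c)" "Lk r ==> Lk s ==> Lk (r + s)" "Lk 0"
 using keys_add[of r s] by (auto simp: Lk_def)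

lemma Lc_single: "m \<in> carrier A ==> c \<odot> m = Lc (single m c)"
 by (simp add: Lc_def lin_ext_single)

lemma Lc_add: "Lk r ==> Lk s ==> Lc r \<oplus> Lc s = Lc (r + s)"
 unfolding Lc_def Lk_def by (rule lin_ext_add[symmetric, of "carrier A"]) auto

lemma Lc_zero: "\<zero> = Lc 0" by (simp add: Lc_def)

lemma Lc_eqI: "(!!k. Poly_Mapping.lookup r k = Poly_Mapping.lookup s k) ==> Lc r = Lc s"
 by (metis poly_mapping_eqI)

text \<open>Appending \<open>\<one>\<close> gives every letter a right neighbour, and prefixing the
  scalar 1 gives every term a coefficient. Rules in the form of \<open>cont\<close> then apply even
  to the last two letters of a word, and every term has the shape c \<odot> m.\<close>

lemma scale_one_eqI: "1 \<odot> (a \<otimes> \<one>) = 1 \<odot> (b \<otimes> \<one>) ==> a \<in> carrier A ==> b \<in> carrier A ==> a = b"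
 by simp

text \<open>A relation between two letters, made applicable at any place of a right-nested
  word.\<close>

lemma cont: "a \<otimes> b = r ==> a \<in> carrier A ==> b \<in> carrier A ==> x \<in> carrier A ==> a \<otimes> (b \<otimes> x) = r \<otimes> x"
 by (metis m_assoc)

lemmas nf = m_assoc l_distr r_distr sm_distr sm_sm
lemmas Lfold = Lc_single Lc_add Lk_simps Lc_zero

end

text \<open>A delta function kept opaque: comparing coefficients becomes a polynomial identity in
  which the values \<open>kdelta m k\<close> are independent unknowns.\<close>

definition kdelta :: "'a => 'a => complex" where "kdelta m k = of_bool (m = k)"

lemma lookup_single_delta: "Poly_Mapping.lookup (single m c) k = c * kdelta m k"
 by (simp add: lookup_single when_def kdelta_def)

lemmas Llook = lookup_add lookup_single_delta lookup_zero


section \<open>The relations of the quantum group and of the braided products\<close>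

text \<open>\<open>q\<close>, its inverse \<open>s\<close> and \<open>g\<close> are separate
  letters, so that scalar identities are computed from rules for these three letters instead of from
  the exponential.\<close>

locale uq =
 fixes p :: nat and q s g :: complex
 assumes p2: "p \<ge> 2" and q_def: "q = qq p" and s_def: "s = inverse q" and g_def: "g = 1 / (q - s)"
begin

lemma q_nz: "q \<noteq> 0" by (simp add: q_def qq_def)
lemma qs: "q * s = 1" using q_nz by (simp add: s_def)

lemma q_pow: "q ^ n = cis (real n * pi / real p)"
 by (simp add: q_def qq_def DeMoivre cis_conv_exp exp_of_nat_mult[symmetric] mult_ac)

lemma q2p: "q ^ (2 * p) = 1"
 using p2 by (simp add: q_pow)

text \<open>q^2 is the root of unity with angle 2 pi / p; if its n-th power were trivial,
  \<open>p\<close> would divide \<open>n\<close>.\<close>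

lemma q2_ne_1: "0 < n ==> n < p ==> (q ^ 2) ^ n \<noteq> 1"
proof
 assume n: "0 < n" "n < p" and "(q ^ 2) ^ n = 1"
 then have "q ^ (2 * n) = 1" by (simp add: power_mult)
 then have "cos (2 * real n * pi / real p) = 1"
  by (simp add: q_pow complex_eq_iff)
 then obtain k :: int where "2 * real n * pi / real p = of_int k * 2 * pi"
  using cos_one_2pi_int by blast
 then have "real n = of_int k * real p" using p2 by (simp add: field_simps)
 then have "real_of_int (int n) = real_of_int (k * int p)" by simp
 then have "int n = k * int p" by (simp only: of_int_eq_iff)
 then have "int p dvd int n" by simp
 with n show False by (auto dest: zdvd_imp_le)
qed

lemma s_pow: "s ^ n = inverse (q ^ n)" by (simp add: s_def power_inverse)

lemma roots: "(q ^ 2) ^ p = 1" "(s ^ 2) ^ p = 1" "0 < n ==> n < p ==> (s ^ 2) ^ n \<noteq> 1"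
proof -
 have *: "(s ^ 2) ^ n = inverse ((q ^ 2) ^ n)" for n by (simp add: s_def power_inverse)
 show "(q ^ 2) ^ p = 1" using q2p by (simp add: power_mult)
 then show "(s ^ 2) ^ p = 1" by (simp only: *) simp
 show "0 < n ==> n < p ==> (s ^ 2) ^ n \<noteq> 1" using q2_ne_1[of n] by (simp only: *) simp
qed

lemma gc: "g * (q - s) = 1"
proof -
 have "q ^ 2 \<noteq> 1" using q2_ne_1[of 1] p2 by simp
 moreover have "q * (q - s) = q ^ 2 - 1" using qs by (simp add: algebra_simps power2_eq_square)
 ultimately have "q - s \<noteq> 0" by auto
 then show ?thesis by (simp add: g_def)
qed

text \<open>Oriented consequences of q s = 1 and g (q - s) = 1. They remove q s, g q and g s^2 from
  all monomials, so that scalars can be compared after expansion.\<close>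

lemma scalar_rules:
 "q * s = 1" "q * (s * x) = x" "s * q = 1" "s * (q * x) = x" "g * q = 1 + g * s" "g * (q * x) = x + g * (s * x)"
 "g * (s * s) = g - s" "g * (s * (s * x)) = g * x - s * x" "x ^ 2 = x * x" "x ^ 4 = x * x * x * x"
proof -
 show *: "q * s = 1" "s * q = 1" using qs by (simp_all add: mult.commute)
 show "q * (s * x) = x" "s * (q * x) = x" using * by (simp_all flip: mult.assoc)
 have "g * q = 1 + g * s" using gc by (simp add: algebra_simps)
 then show "g * q = 1 + g * s" "g * (q * x) = x + g * (s * x)"
  by (simp_all only: mult.assoc[symmetric] distrib_right mult_1_left)
 have "g * (s * s) = g * (q * s) - s" using arg_cong[OF \<open>g * q = 1 + g * s\<close>, of "\<lambda>t. t * s"] by (simp add: algebra_simps)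
 then show "g * (s * s) = g - s" using * by simp
 then show "g * (s * (s * x)) = g * x - s * x" by (simp only: mult.assoc[symmetric] left_diff_distrib)
qed (simp_all add: power2_eq_square power4_eq_xxxx mult.assoc)

text \<open>The inverse of K as a positive power, hence a word in K: any algebra morphism carries it
  along.\<close>

definition kinv :: "(complex, 'a, 'm) module_scheme => 'a => 'a" where
 "kinv B k = k [^]\<^bsub>B\<^esub> (2 * p - 1)"

text \<open>The conjugation relations appear without an inverse, as K E = q^2 E K and K F = q^(-2) F
  K, which suits the rewriting of words; \<open>ucond_free_eval\<close> relates this form to the
  defining relators.\<close>

definition ucond :: "(complex, 'a, 'm) module_scheme => (ugen => 'a) => bool" where
 "ucond B u \<longleftrightarrow> range u \<subseteq> carrier B \<and>
   u gK \<otimes>\<^bsub>B\<^esub> u gE = q ^ 2 \<odot>\<^bsub>B\<^esub> (u gE \<otimes>\<^bsub>B\<^esub> u gK) \<and>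
   u gK \<otimes>\<^bsub>B\<^esub> u gF = s ^ 2 \<odot>\<^bsub>B\<^esub> (u gF \<otimes>\<^bsub>B\<^esub> u gK) \<and>
   u gE \<otimes>\<^bsub>B\<^esub> u gF = u gF \<otimes>\<^bsub>B\<^esub> u gE \<oplus>\<^bsub>B\<^esub> (g \<odot>\<^bsub>B\<^esub> u gK \<oplus>\<^bsub>B\<^esub> (- g) \<odot>\<^bsub>B\<^esub> kinv B (u gK)) \<and>
   u gE [^]\<^bsub>B\<^esub> p = \<zero>\<^bsub>B\<^esub> \<and> u gF [^]\<^bsub>B\<^esub> p = \<zero>\<^bsub>B\<^esub> \<and> u gK [^]\<^bsub>B\<^esub> (2 * p) = \<one>\<^bsub>B\<^esub>"

definition zrel :: "(complex, 'a, 'm) module_scheme => 'a => 'a => bool" where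
 "zrel B x y \<longleftrightarrow> x \<otimes>\<^bsub>B\<^esub> y = s ^ 2 \<odot>\<^bsub>B\<^esub> (y \<otimes>\<^bsub>B\<^esub> x) \<oplus>\<^bsub>B\<^esub> (1 - s ^ 2) \<odot>\<^bsub>B\<^esub> (y \<otimes>\<^bsub>B\<^esub> y)"

definition drel :: "(complex, 'a, 'm) module_scheme => 'a => 'a => bool" where
 "drel B x y \<longleftrightarrow> x \<otimes>\<^bsub>B\<^esub> y = q ^ 2 \<odot>\<^bsub>B\<^esub> (y \<otimes>\<^bsub>B\<^esub> x) \<oplus>\<^bsub>B\<^esub> (1 - q ^ 2) \<odot>\<^bsub>B\<^esub> (y \<otimes>\<^bsub>B\<^esub> y)"

definition dzrel :: "(complex, 'a, 'm) module_scheme => 'a => 'a => bool" where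
 "dzrel B x y \<longleftrightarrow> x \<otimes>\<^bsub>B\<^esub> y = (q - s) \<odot>\<^bsub>B\<^esub> \<one>\<^bsub>B\<^esub> \<oplus>\<^bsub>B\<^esub> s ^ 2 \<odot>\<^bsub>B\<^esub> (y \<otimes>\<^bsub>B\<^esub> x)"

definition hcond :: "(complex, 'a, 'm) module_scheme => nat set => (nat => 'a) => bool" where
 "hcond B I y \<longleftrightarrow> (\<forall>i\<in>I. y i \<in> carrier B \<and> y i [^]\<^bsub>B\<^esub> p = \<zero>\<^bsub>B\<^esub>) \<and>
   (\<forall>i\<in>I. \<forall>j\<in>I. odd i --> even j --> dzrel B (y i) (y j)) \<and>
   (\<forall>i\<in>I. \<forall>j\<in>I. even i --> even j --> i \<ge> j --> zrel B (y i) (y j)) \<and>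
   (\<forall>i\<in>I. \<forall>j\<in>I. odd i --> odd j --> i \<ge> j --> drel B (y i) (y j))"

text \<open>The rule h x = (h' \<triangleright> x) h'' of a smash product at x = z: it combines the
  coproducts of K, E, F with E \<triangleright> z = -q z^2 and F \<triangleright> z = 1. For
  \<partial> the values are E \<triangleright> \<partial> = 1 and F \<triangleright> \<partial> = -q
  \<partial>^2, which gives \<open>dcross\<close>.\<close>

definition zcross :: "(complex, 'a, 'm) module_scheme => (ugen => 'a) => 'a => bool" where
 "zcross B u z \<longleftrightarrow> u gK \<otimes>\<^bsub>B\<^esub> z = q ^ 2 \<odot>\<^bsub>B\<^esub> (z \<otimes>\<^bsub>B\<^esub> u gK) \<and>
   u gE \<otimes>\<^bsub>B\<^esub> z = (- q) \<odot>\<^bsub>B\<^esub> (z \<otimes>\<^bsub>B\<^esub> z \<otimes>\<^bsub>B\<^esub> u gK) \<oplus>\<^bsub>B\<^esub> z \<otimes>\<^bsub>B\<^esub> u gE \<and>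
   u gF \<otimes>\<^bsub>B\<^esub> z = \<one>\<^bsub>B\<^esub> \<oplus>\<^bsub>B\<^esub> s ^ 2 \<odot>\<^bsub>B\<^esub> (z \<otimes>\<^bsub>B\<^esub> u gF)"

definition dcross :: "(complex, 'a, 'm) module_scheme => (ugen => 'a) => 'a => bool" where
 "dcross B u z \<longleftrightarrow> u gK \<otimes>\<^bsub>B\<^esub> z = s ^ 2 \<odot>\<^bsub>B\<^esub> (z \<otimes>\<^bsub>B\<^esub> u gK) \<and>
   u gE \<otimes>\<^bsub>B\<^esub> z = u gK \<oplus>\<^bsub>B\<^esub> z \<otimes>\<^bsub>B\<^esub> u gE \<and>
   u gF \<otimes>\<^bsub>B\<^esub> z = (- q) \<odot>\<^bsub>B\<^esub> (z \<otimes>\<^bsub>B\<^esub> z) \<oplus>\<^bsub>B\<^esub> q ^ 2 \<odot>\<^bsub>B\<^esub> (z \<otimes>\<^bsub>B\<^esub> u gF)"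

definition scond :: "(complex, 'a, 'm) module_scheme => nat set => (nat => 'a) => (ugen => 'a) => bool" where
 "scond B I y u \<longleftrightarrow> ucond B u \<and> hcond B I y \<and>
   (\<forall>i\<in>I. if odd i then dcross B u (y i) else zcross B u (y i))"

text \<open>The element T_i of the quantum group that stands beside the unit in the coaction of x_i:
  (q - s) F for \<partial> and -(q - s) E K^(-1) for z.\<close>

definition twist :: "(complex, 'a, 'm) module_scheme => (ugen => 'a) => nat => 'a" where
 "twist B u i = (if odd i then (q - s) \<odot>\<^bsub>B\<^esub> u gF else (s - q) \<odot>\<^bsub>B\<^esub> (u gE \<otimes>\<^bsub>B\<^esub> kinv B (u gK)))"

definition coact_gen :: "(complex, 'a, 'm) module_scheme => (ugen => 'a) => (nat => 'a) => nat => 'a" where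
 "coact_gen B u y i = kinv B (u gK) \<otimes>\<^bsub>B\<^esub> y i \<oplus>\<^bsub>B\<^esub> twist B u i"

text \<open>The coproduct with the tensor sign replaced by a product: \<open>u\<close> and
  \<open>v\<close> are the two tensor factors, realised as commuting copies of the quantum group
  inside one algebra.\<close>

primrec comult_gen :: "(complex, 'a, 'm) module_scheme => (ugen => 'a) => (ugen => 'a) => ugen => 'a" where
 "comult_gen B u v gE = u gE \<otimes>\<^bsub>B\<^esub> v gK \<oplus>\<^bsub>B\<^esub> v gE"
| "comult_gen B u v gK = u gK \<otimes>\<^bsub>B\<^esub> v gK"
| "comult_gen B u v gF = u gF \<oplus>\<^bsub>B\<^esub> kinv B (u gK) \<otimes>\<^bsub>B\<^esub> v gF"

context
 fixes C :: "(complex, 'a, 'm) module_scheme" (structure)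
 assumes C: "cx_algebra C"
begin

interpretation C: cx_algebra C by (rule C)

lemma kinv_qcomm:
 assumes "k \<in> carrier C" "j \<in> carrier C" "k \<otimes> j = \<one>" "j \<otimes> k = \<one>"
  and kx: "k \<otimes> x = c \<odot> (x \<otimes> k)" "c' * c = 1" "x \<in> carrier C"
 shows "j \<otimes> x = c' \<odot> (x \<otimes> j)"
proof -
 have xk: "x \<otimes> k = c' \<odot> (k \<otimes> x)" using assms by (simp add: C.sm_sm)
 have "j \<otimes> x = j \<otimes> (x \<otimes> (k \<otimes> j))" using assms by simp
 also have "... = j \<otimes> (x \<otimes> k) \<otimes> j" using assms(1,2,7) by (simp add: C.m_assoc)
 also have "... = c' \<odot> ((j \<otimes> k) \<otimes> (x \<otimes> j))"
  unfolding xk using assms(1,2,7) by (simp add: C.m_assoc)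
 finally show ?thesis using assms by simp
qed

lemma ucondD:
 assumes "ucond C u"
 shows "u a \<in> carrier C" "kinv C (u gK) \<in> carrier C"
  "u gK \<otimes> kinv C (u gK) = \<one>" "kinv C (u gK) \<otimes> u gK = \<one>"
  "kinv C (u gK) \<otimes> u gE = s ^ 2 \<odot> (u gE \<otimes> kinv C (u gK))"
  "kinv C (u gK) \<otimes> u gF = q ^ 2 \<odot> (u gF \<otimes> kinv C (u gK))"
proof -
 show u: "u a \<in> carrier C" for a using assms by (auto simp: ucond_def)
 show j: "kinv C (u gK) \<in> carrier C" by (simp add: kinv_def u)
 have e: "2 * p = Suc (2 * p - 1)" using p2 by simp
 have kp: "u gK [^] (2 * p) = \<one>" using assms by (simp add: ucond_def)
 have "u gK \<otimes> u gK [^] (2 * p - 1) = u gK [^] Suc (2 * p - 1)" "u gK [^] (2 * p - 1) \<otimes> u gK = u gK [^] Suc (2 * p - 1)"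
  using u by (metis C.nat_pow_Suc2, simp)
 then show kj: "u gK \<otimes> kinv C (u gK) = \<one>" and jk: "kinv C (u gK) \<otimes> u gK = \<one>"
  using kp e by (simp_all add: kinv_def)
 note * = kinv_qcomm[OF u[of gK] j kj jk]
 have sq: "s ^ 2 * q ^ 2 = 1" "q ^ 2 * s ^ 2 = 1" using qs by (metis mult.commute power_mult_distrib power_one)+
 show "kinv C (u gK) \<otimes> u gE = s ^ 2 \<odot> (u gE \<otimes> kinv C (u gK))"
  "kinv C (u gK) \<otimes> u gF = q ^ 2 \<odot> (u gF \<otimes> kinv C (u gK))"
  using assms *[of "u gE", OF _ sq(1)] *[of "u gF", OF _ sq(2)] u by (auto simp: ucond_def)
qed

lemma kinv_comm:
 assumes "k \<in> carrier C" "x \<in> carrier C" "k \<otimes> x = x \<otimes> k"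
 shows "kinv C k \<otimes> x = x \<otimes> kinv C k"
 unfolding kinv_def using assms by (intro C.group_commutes_pow)

end

lemma kinv_hom:
 assumes "h \<in> alg_homs B C" "cx_algebra B" "cx_algebra C" "k \<in> carrier B"
 shows "h (kinv B k) = kinv C (h k)"
 by (simp add: kinv_def hom_pow[OF assms])

end

section \<open>Two commuting copies of the quantum group in one algebra\<close>

locale upair = uq p q s g + C: cx_algebra C
 for p q s g and C :: "(complex, 'a, 'm) module_scheme" (structure) +
 fixes u v :: "ugen => 'a"
 assumes u: "ucond C u" and v: "ucond C v" and uv: "!!a b. v a \<otimes> u b = u b \<otimes> v a"
begin

abbreviation "E \<equiv> u gE" abbreviation "K \<equiv> u gK" abbreviation "F \<equiv> u gF" abbreviation "J \<equiv> kinv C (u gK)"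
abbreviation "e \<equiv> v gE" abbreviation "k \<equiv> v gK" abbreviation "f \<equiv> v gF" abbreviation "j \<equiv> kinv C (v gK)"

lemma C: "cx_algebra C" ..

lemmas U = ucondD[OF C u] and V = ucondD[OF C v]

lemma closed [simp]: "u a \<in> carrier C" "J \<in> carrier C" "v a \<in> carrier C" "j \<in> carrier C"
 by (simp_all add: U V)

lemma vJ: "v a \<otimes> J = J \<otimes> v a"
 by (rule kinv_comm[OF C, symmetric]) (simp_all add: uv)

lemma ju: "j \<otimes> u a = u a \<otimes> j"
 by (rule kinv_comm[OF C]) (simp_all add: uv)

lemma jJ: "j \<otimes> J = J \<otimes> j"
 by (rule kinv_comm[OF C]) (simp_all add: vJ)

lemma rel_u: "E \<otimes> F = F \<otimes> E \<oplus> (g \<odot> K \<oplus> (- g) \<odot> J)" "K \<otimes> E = q ^ 2 \<odot> (E \<otimes> K)" "K \<otimes> F = s ^ 2 \<odot> (F \<otimes> K)"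
 and rel_v: "e \<otimes> f = f \<otimes> e \<oplus> (g \<odot> k \<oplus> (- g) \<odot> j)" "k \<otimes> e = q ^ 2 \<odot> (e \<otimes> k)" "k \<otimes> f = s ^ 2 \<odot> (f \<otimes> k)"
 using u v by (simp_all add: ucond_def)

text \<open>Rewriting rules on right-nested products, moving the first copy of the quantum group to the left.\<close>

lemmas pair_rules = C.nf rel_u[THEN C.cont] rel_v[THEN C.cont] U(3-6)[THEN C.cont] V(3-6)[THEN C.cont]
 uv[THEN C.cont] vJ[THEN C.cont] ju[THEN C.cont] jJ[THEN C.cont]

lemma kinv_prod: "kinv C (K \<otimes> k) = J \<otimes> j"
 unfolding kinv_def by (rule C.pow_mult_distrib) (simp_all add: uv)

lemma comult_KE: "(K \<otimes> k) \<otimes> (E \<otimes> k \<oplus> e) = q ^ 2 \<odot> ((E \<otimes> k \<oplus> e) \<otimes> (K \<otimes> k))"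
 by (rule C.scale_one_eqI; simp add: pair_rules del: C.r_one C.sm_one;
   (simp only: C.Lfold C.m_closed C.one_closed closed, rule C.Lc_eqI, simp only: Llook, (simp add: scalar_rules algebra_simps))?)

lemma comult_KF: "(K \<otimes> k) \<otimes> (F \<oplus> J \<otimes> f) = s ^ 2 \<odot> ((F \<oplus> J \<otimes> f) \<otimes> (K \<otimes> k))"
 by (rule C.scale_one_eqI; simp add: pair_rules del: C.r_one C.sm_one;
   (simp only: C.Lfold C.m_closed C.one_closed closed, rule C.Lc_eqI, simp only: Llook, (simp add: scalar_rules algebra_simps))?)

lemma comult_EF: "(E \<otimes> k \<oplus> e) \<otimes> (F \<oplus> J \<otimes> f) = (F \<oplus> J \<otimes> f) \<otimes> (E \<otimes> k \<oplus> e) \<oplus> (g \<odot> (K \<otimes> k) \<oplus> (- g) \<odot> (J \<otimes> j))"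
 by (rule C.scale_one_eqI; simp add: pair_rules del: C.r_one C.sm_one;
   (simp only: C.Lfold C.m_closed C.one_closed closed, rule C.Lc_eqI, simp only: Llook, (simp add: scalar_rules algebra_simps))?)

text \<open>The quadratic relations are word computations. For the nilpotency of the images of E and
  F, the two summands of each coproduct commute up to q^2, so the binomial theorem at a root of
  unity applies.\<close>

lemma ucond_comult: "ucond C (comult_gen C u v)"
proof -
 have "range (comult_gen C u v) \<subseteq> carrier C"
  by (rule image_subsetI, rename_tac x, case_tac x) auto
 \<comment> \<open>The summand \<open>e\<close> comes first because the binomial theorem moves the
   second summand past the first: E k e = q^2 e E k.\<close>
 moreover have "(e \<oplus> E \<otimes> k) [^] p = \<zero>"
 proof (rule C.root_binomial[where w = "q ^ 2"])
  show "E \<otimes> k \<otimes> e = q ^ 2 \<odot> (e \<otimes> (E \<otimes> k))" by (simp add: C.m_assoc rel_v uv[THEN C.cont])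
  show "(E \<otimes> k) [^] p = \<zero>" using u
   by (intro C.qcomm_prod_pow_zero[where w = 1]) (auto simp: uv ucond_def)
 qed (use roots q2_ne_1 v in \<open>auto simp: ucond_def\<close>)
 then have "(E \<otimes> k \<oplus> e) [^] p = \<zero>" by (simp add: C.a_comm)
 moreover have "(F \<oplus> J \<otimes> f) [^] p = \<zero>"
 proof (rule C.root_binomial[where w = "q ^ 2"])
  show "J \<otimes> f \<otimes> F = q ^ 2 \<odot> (F \<otimes> (J \<otimes> f))" by (simp add: C.m_assoc U uv U(3-6)[THEN C.cont])
  show "(J \<otimes> f) [^] p = \<zero>" using v
   by (intro C.qcomm_prod_pow_zero[where w = 1]) (auto simp: vJ ucond_def)
 qed (use roots q2_ne_1 u in \<open>auto simp: ucond_def\<close>)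
 moreover have "(K \<otimes> k) [^] (2 * p) = \<one>"
  using u v by (subst C.pow_mult_distrib) (simp_all add: uv ucond_def)
 ultimately show ?thesis
  unfolding ucond_def comult_gen.simps kinv_prod using comult_KE comult_KF comult_EF by blast
qed

end

text \<open>\<open>y\<close> belongs to the right tensor factor and therefore commutes with the copy
  \<open>u\<close>. Its image under the coaction with values in that copy is \<open>zc\<close> or
  \<open>dc\<close>, according to whether it is a z or a \<partial>.\<close>

locale upair_elem = upair +
 fixes y :: 'a
 assumes y [simp]: "y \<in> carrier C" and uy: "!!b. y \<otimes> u b = u b \<otimes> y"
begin

lemma yJ: "y \<otimes> J = J \<otimes> y"
 by (rule kinv_comm[OF C, symmetric]) (simp_all add: uy)

lemmas elem_rules = pair_rules uy[THEN C.cont] yJ[THEN C.cont]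

abbreviation "zc \<equiv> J \<otimes> y \<oplus> (s - q) \<odot> (E \<otimes> J)"
abbreviation "dc \<equiv> J \<otimes> y \<oplus> (q - s) \<odot> F"

lemma zcross_coact:
 assumes "zcross C v y"
 shows "zcross C (comult_gen C u v) zc"
proof -
 note R = assms[unfolded zcross_def, THEN conjunct1, THEN C.cont] assms[unfolded zcross_def, THEN conjunct2, THEN conjunct1, THEN C.cont]
  assms[unfolded zcross_def, THEN conjunct2, THEN conjunct2, THEN C.cont]
 show ?thesis unfolding zcross_def comult_gen.simps
  by (intro conjI; rule C.scale_one_eqI; simp add: elem_rules R del: C.r_one C.sm_one;
   (simp only: C.Lfold C.m_closed C.one_closed closed y, rule C.Lc_eqI, simp only: Llook, (simp add: scalar_rules algebra_simps))?)
qed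

lemma dcross_coact:
 assumes "dcross C v y"
 shows "dcross C (comult_gen C u v) dc"
proof -
 note R = assms[unfolded dcross_def, THEN conjunct1, THEN C.cont] assms[unfolded dcross_def, THEN conjunct2, THEN conjunct1, THEN C.cont]
  assms[unfolded dcross_def, THEN conjunct2, THEN conjunct2, THEN C.cont]
 show ?thesis unfolding dcross_def comult_gen.simps
  by (intro conjI; rule C.scale_one_eqI; simp add: elem_rules R del: C.r_one C.sm_one;
   (simp only: C.Lfold C.m_closed C.one_closed closed y, rule C.Lc_eqI, simp only: Llook, (simp add: scalar_rules algebra_simps))?)
qed

text \<open>The two summands of the coaction commute up to s^2 or q^2, so the p-th power of the sum
  reduces to the p-th powers of the summands.\<close>

lemma coact_pow_zero:
 assumes "y [^] p = \<zero>"
 shows "zc [^] p = \<zero>" "dc [^] p = \<zero>"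
proof -
 have Jy: "(J \<otimes> y) [^] p = \<zero>"
  using assms by (intro C.qcomm_prod_pow_zero[where w = 1]) (auto simp: yJ)
 have EJ: "(E \<otimes> J) [^] p = \<zero>"
  using u by (intro C.qcomm_prod_pow_zero[where w = "s ^ 2"]) (auto simp: U ucond_def)
 have "((s - q) \<odot> (E \<otimes> J) \<oplus> J \<otimes> y) [^] p = \<zero>"
 proof (rule C.root_binomial[where w = "s ^ 2"])
  show "J \<otimes> y \<otimes> ((s - q) \<odot> (E \<otimes> J)) = s ^ 2 \<odot> ((s - q) \<odot> (E \<otimes> J) \<otimes> (J \<otimes> y))"
   by (simp add: C.m_assoc uy[THEN C.cont] yJ U(3-6)[THEN C.cont] C.sm_sm mult.commute)
 qed (use Jy EJ roots in \<open>auto simp: C.smult_pow\<close>)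
 then show "zc [^] p = \<zero>" by (simp add: C.a_comm)
 have F: "F [^] p = \<zero>" using u by (simp add: ucond_def)
 have "((q - s) \<odot> F \<oplus> J \<otimes> y) [^] p = \<zero>"
 proof (rule C.root_binomial[where w = "q ^ 2"])
  show "J \<otimes> y \<otimes> ((q - s) \<odot> F) = q ^ 2 \<odot> ((q - s) \<odot> F \<otimes> (J \<otimes> y))"
   by (simp add: C.m_assoc uy U(3-6)[THEN C.cont] C.sm_sm mult.commute)
 qed (use Jy F roots q2_ne_1 in \<open>auto simp: C.smult_pow\<close>)
 then show "dc [^] p = \<zero>" by (simp add: C.a_comm)
qed

end

locale upair_elem2 = upair_elem +
 fixes y'
 assumes y'_closed: "y' \<in> carrier C" and uy': "!!b. y' \<otimes> u b = u b \<otimes> y'"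
begin

sublocale B: upair_elem p q s g C u v y' by unfold_locales (simp_all add: y'_closed uy')

lemmas rules2 = elem_rules B.uy[THEN C.cont] B.yJ[THEN C.cont]

lemma zrel_coact:
 assumes "zrel C y y'"
 shows "zrel C zc B.zc"
 unfolding zrel_def
 by (rule C.scale_one_eqI; simp add: rules2 assms[unfolded zrel_def, THEN C.cont] del: C.r_one C.sm_one;
   (simp only: C.Lfold C.m_closed C.one_closed closed y B.y, rule C.Lc_eqI, simp only: Llook, simp add: scalar_rules algebra_simps)?)

lemma drel_coact:
 assumes "drel C y y'"
 shows "drel C dc B.dc"
 unfolding drel_def
 by (rule C.scale_one_eqI; simp add: rules2 assms[unfolded drel_def, THEN C.cont] del: C.r_one C.sm_one;
   (simp only: C.Lfold C.m_closed C.one_closed closed y B.y, rule C.Lc_eqI, simp only: Llook, simp add: scalar_rules algebra_simps)?)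

lemma dzrel_coact:
 assumes "dzrel C y y'"
 shows "dzrel C dc B.zc"
 unfolding dzrel_def
 by (rule C.scale_one_eqI; simp add: rules2 assms[unfolded dzrel_def, THEN C.cont] del: C.r_one C.sm_one;
   (simp only: C.Lfold C.m_closed C.one_closed closed y B.y, rule C.Lc_eqI, simp only: Llook, simp add: scalar_rules algebra_simps)?)

end

context upair
begin

text \<open>The reason why the coaction extends to an algebra morphism: the images of the generators
  obey the relations of the generators.\<close>

lemma hcond_coact:
 assumes h: "hcond C I y" and yu: "!!i b. i \<in> I ==> y i \<otimes> u b = u b \<otimes> y i"
 shows "hcond C I (coact_gen C u y)"
proof -
 have yc: "y i \<in> carrier C" "y i [^] p = \<zero>" if "i \<in> I" for i
  using h that by (auto simp: hcond_def)
 have e: "upair_elem p q s g C u v (y i)" if "i \<in> I" for i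
  using that by unfold_locales (simp_all add: yc yu)
 have e2: "upair_elem2 p q s g C u v (y i) (y i')" if "i \<in> I" "i' \<in> I" for i i'
  using that by (intro upair_elem2.intro e) (unfold_locales, simp_all add: yc yu)
 have eq: "coact_gen C u y i = (if odd i then J \<otimes> y i \<oplus> (q - s) \<odot> F else J \<otimes> y i \<oplus> (s - q) \<odot> (E \<otimes> J))" for i
  by (simp add: coact_gen_def twist_def)
 show ?thesis
  unfolding hcond_def eq
  using h upair_elem.coact_pow_zero[OF e] upair_elem2.zrel_coact[OF e2] upair_elem2.drel_coact[OF e2] upair_elem2.dzrel_coact[OF e2]
  by (auto simp: hcond_def yc)
qed

text \<open>The Yetter-Drinfeld compatibility in operator form: coaction and coproduct preserve the
  commutation relations of the smash product.\<close>

lemma smash: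
 assumes y: "scond C I y v" and yu: "!!i b. i \<in> I ==> y i \<otimes> u b = u b \<otimes> y i"
 shows "scond C I (coact_gen C u y) (comult_gen C u v)"
proof -
 have h: "hcond C I y" using y by (simp add: scond_def)
 have yc: "y i \<in> carrier C" if "i \<in> I" for i using h that by (auto simp: hcond_def)
 have e: "upair_elem p q s g C u v (y i)" if "i \<in> I" for i
  using that by unfold_locales (simp_all add: yc yu)
 have eq: "coact_gen C u y i = (if odd i then J \<otimes> y i \<oplus> (q - s) \<odot> F else J \<otimes> y i \<oplus> (s - q) \<odot> (E \<otimes> J))" for i
  by (simp add: coact_gen_def twist_def)
 have "hcond C I (coact_gen C u y)" by (rule hcond_coact[OF h yu])
 then show ?thesis
  unfolding scond_def eq
  using ucond_comult y upair_elem.zcross_coact[OF e] upair_elem.dcross_coact[OF e]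
  by (auto simp: scond_def)
qed

end

text \<open>\<open>x\<close> is the generator of the left tensor factor. It commutes with all of the
  right factor, and it meets the copy \<open>u\<close> through the action on its own factor.\<close>

locale upair_head = upair_elem +
 fixes x :: 'a
 assumes x_closed [simp]: "x \<in> carrier C" and vx: "!!b. v b \<otimes> x = x \<otimes> v b" and yx: "y \<otimes> x = x \<otimes> y"
begin

lemmas head_rules = elem_rules vx[THEN C.cont] yx[THEN C.cont]

lemma qs2: "s ^ 2 * q ^ 2 = 1" "q ^ 2 * s ^ 2 = 1"
 using qs by (metis mult.commute power_mult_distrib power_one)+

context
 assumes xz: "zcross C u x"
begin

lemma xz_rules: "K \<otimes> x = q ^ 2 \<odot> (x \<otimes> K)"
  "E \<otimes> x = (- q) \<odot> (x \<otimes> x \<otimes> K) \<oplus> x \<otimes> E"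
  "F \<otimes> x = \<one> \<oplus> s ^ 2 \<odot> (x \<otimes> F)" "J \<otimes> x = s ^ 2 \<odot> (x \<otimes> J)"
 using xz kinv_qcomm[OF C closed(1,2) U(3,4) _ qs2(1) x_closed] by (simp_all add: zcross_def)

lemma zcross_head: "zcross C (comult_gen C u v) x"
 unfolding zcross_def comult_gen.simps
  by (intro conjI; rule C.scale_one_eqI; simp add: head_rules xz_rules[THEN C.cont] del: C.r_one C.sm_one;
   (simp only: C.Lfold C.m_closed C.one_closed closed y x_closed, rule C.Lc_eqI, simp only: Llook, simp add: scalar_rules algebra_simps)?)

lemma zrel_head: "zrel C zc x"
 unfolding zrel_def
  by (rule C.scale_one_eqI; simp add: head_rules xz_rules[THEN C.cont] del: C.r_one C.sm_one;
   (simp only: C.Lfold C.m_closed C.one_closed closed y x_closed, rule C.Lc_eqI, simp only: Llook, simp add: scalar_rules algebra_simps)?)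

lemma dzrel_head: "dzrel C dc x"
 unfolding dzrel_def
  by (rule C.scale_one_eqI; simp add: head_rules xz_rules[THEN C.cont] del: C.r_one C.sm_one;
   (simp only: C.Lfold C.m_closed C.one_closed closed y x_closed, rule C.Lc_eqI, simp only: Llook, simp add: scalar_rules algebra_simps)?)

end

context
 assumes xd: "dcross C u x"
begin

lemma xd_rules: "K \<otimes> x = s ^ 2 \<odot> (x \<otimes> K)"
  "E \<otimes> x = K \<oplus> x \<otimes> E"
  "F \<otimes> x = (- q) \<odot> (x \<otimes> x) \<oplus> q ^ 2 \<odot> (x \<otimes> F)" "J \<otimes> x = q ^ 2 \<odot> (x \<otimes> J)"
 using xd kinv_qcomm[OF C closed(1,2) U(3,4) _ qs2(2) x_closed] by (simp_all add: dcross_def)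

lemma dcross_head: "dcross C (comult_gen C u v) x"
 unfolding dcross_def comult_gen.simps
  by (intro conjI; rule C.scale_one_eqI; simp add: head_rules xd_rules[THEN C.cont] del: C.r_one C.sm_one;
   (simp only: C.Lfold C.m_closed C.one_closed closed y x_closed, rule C.Lc_eqI, simp only: Llook, simp add: scalar_rules algebra_simps)?)

lemma drel_head: "drel C dc x"
 unfolding drel_def
  by (rule C.scale_one_eqI; simp add: head_rules xd_rules[THEN C.cont] del: C.r_one C.sm_one;
   (simp only: C.Lfold C.m_closed C.one_closed closed y x_closed, rule C.Lc_eqI, simp only: Llook, simp add: scalar_rules algebra_simps)?)

text \<open>Here \<partial> belongs to the earlier factor and z to a later one. The asserted
  relation has \<partial> on the left for either order of the indices, so this case stands beside
  \<open>dzrel_head\<close>.\<close>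

lemma dzrel_head': "dzrel C x zc"
 unfolding dzrel_def
  by (rule C.scale_one_eqI; simp add: head_rules xd_rules[THEN C.cont] del: C.r_one C.sm_one;
   (simp only: C.Lfold C.m_closed C.one_closed closed y x_closed, rule C.Lc_eqI, simp only: Llook, simp add: scalar_rules algebra_simps)?)

end
end

context upair
begin

lemma smash_head:
 assumes y: "scond C I y v" and yu: "!!i b. i \<in> I ==> y i \<otimes> u b = u b \<otimes> y i"
  and x: "scond C {M} (\<lambda>_. x) u" and vx: "!!b. v b \<otimes> x = x \<otimes> v b" and yx: "!!i. i \<in> I ==> y i \<otimes> x = x \<otimes> y i"
  and I: "!!i. i \<in> I ==> M < i"
 shows "scond C (insert M I) (\<lambda>i. if i = M then x else coact_gen C u y i) (comult_gen C u v)"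
proof -
 note sm = smash[OF y yu]
 have xc: "x \<in> carrier C" "x [^] p = \<zero>" using x by (auto simp: scond_def hcond_def)
 have yc: "y i \<in> carrier C" if "i \<in> I" for i
  using y that by (auto simp: scond_def hcond_def)
 have e: "upair_head p q s g C u v (y i) x" if "i \<in> I" for i
  using that by unfold_locales (simp_all add: yc yu xc vx yx)
 \<comment> \<open>The relations between \<open>x\<close> and the coproducts must hold even when
   \<open>I\<close> is empty; the unit then serves as the element of the right factor.\<close>
 have e1: "upair_head p q s g C u v \<one> x"
  by unfold_locales (simp_all add: xc vx)
 have eq: "coact_gen C u y i = (if odd i then J \<otimes> y i \<oplus> (q - s) \<odot> F else J \<otimes> y i \<oplus> (s - q) \<odot> (E \<otimes> J))" for i
  by (simp add: coact_gen_def twist_def)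
 have xs: "if odd M then dcross C u x else zcross C u x"
  "even M ==> zrel C x x" "odd M ==> drel C x x" using x by (auto simp: scond_def hcond_def)
 have IM: "i \<noteq> M" "\<not> i \<le> M" if "i \<in> I" for i using I[OF that] by auto
 note rels = upair_head.zrel_head[OF e] upair_head.drel_head[OF e] upair_head.dzrel_head[OF e] upair_head.dzrel_head'[OF e]
 have "hcond C (insert M I) (\<lambda>i. if i = M then x else coact_gen C u y i)"
  using sm xs rels xc unfolding hcond_def scond_def
  by (auto simp: IM eq dest: IM split: if_splits)
 moreover have "if odd M then dcross C (comult_gen C u v) x else zcross C (comult_gen C u v) x"
  using xs(1) upair_head.zcross_head[OF e1] upair_head.dcross_head[OF e1] by auto
 ultimately show ?thesis using sm unfolding scond_def by auto
qed

end


section \<open>The quantum group\<close>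

lemma cx_algebra_cx: "cx_algebra cx"
proof -
 interpret cring cx by (rule cring_cx)
 have "cvec cx" unfolding cvec_def
  by (rule moduleI) (auto simp: cring_cx abelian_group_axioms algebra_simps)
 then show ?thesis by (rule cx_algebraI) (auto simp: algebra_simps)
qed

lemma cx_pow [simp]: "x [^]\<^bsub>cx\<^esub> (n::nat) = x ^ n"
proof -
 interpret cx_algebra cx by (rule cx_algebra_cx)
 show ?thesis by (induction n) simp_all
qed

lemma generated_cong: "same_alg A B ==> generated_by A G x \<longleftrightarrow> generated_by B G x"
 unfolding generated_by_def by (simp add: free_eval_cong[of A B]) (simp add: same_alg_def same_mod_def)

lemma presented_cong: "same_alg A B ==> presented_by A G x R \<longleftrightarrow> presented_by B G x R"
 unfolding presented_by_def by (simp add: free_eval_cong[of A B]) (simp add: same_alg_def same_mod_def)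

text \<open>Turns the antimorphism S into a morphism, so that the universal property of the
  presentation applies to it.\<close>

definition opp :: "(complex, 'a, 'm) module_scheme => (complex, 'a, 'm) module_scheme" where
 "opp A = A\<lparr>mult := \<lambda>x y. y \<otimes>\<^bsub>A\<^esub> x\<rparr>"

lemma opp_simps [simp]: "carrier (opp A) = carrier A" "one (opp A) = one A" "zero (opp A) = zero A"
 "add (opp A) = add A" "smult (opp A) = smult A" "x \<otimes>\<^bsub>opp A\<^esub> y = y \<otimes>\<^bsub>A\<^esub> x"
 by (simp_all add: opp_def)

lemma opp_same_mod: "same_mod (opp A) A" by (simp add: same_mod_def)

lemma cx_algebra_opp: "cx_algebra A ==> cx_algebra (opp A)"
proof -
 assume "cx_algebra A"
 then interpret A: cx_algebra A .
 show ?thesis by (rule cx_algebraI[OF cvec_cong[OF opp_same_mod A.cvec_axioms]])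
  (auto simp: A.l_distr A.r_distr A.m_assoc)
qed

lemma opp_pow: "cx_algebra A ==> x \<in> carrier A ==> x [^]\<^bsub>opp A\<^esub> (n::nat) = x [^]\<^bsub>A\<^esub> n"
proof -
 assume "cx_algebra A" and x: "x \<in> carrier A"
 then interpret A: cx_algebra A by simp
 interpret O: cx_algebra "opp A" by (rule cx_algebra_opp) (rule A.cx_algebra_axioms)
 show ?thesis using x A.nat_pow_Suc2[OF x] by (induction n) simp_all
qed

lemma opp_word_eval:
 assumes "cx_algebra A" "range y \<subseteq> carrier A"
 shows "word_eval (opp A) y w = word_eval A y (rev w)"
proof -
 interpret A: cx_algebra A by fact
 show ?thesis
 proof (induction w)
  case (Cons a w)
  have "y a \<in> carrier A" using assms(2) by auto
  then show ?case using Cons A.word_eval_append[OF assms(2), of "rev w" "[a]"] by (simp add: word_eval_def)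
 qed (simp add: word_eval_def)
qed

section \<open>Presentation and structure maps of the quantum group\<close>

context uq
begin

abbreviation (input) "H \<equiv> Uq p"

lemma hom_ucond:
 assumes h: "h \<in> alg_homs A B" and A: "cx_algebra A" and B: "cx_algebra B" and u: "ucond A u"
 shows "ucond B (\<lambda>a. h (u a))"
proof -
 interpret A: cx_algebra A by fact
 interpret B: cx_algebra B by fact
 have c: "u a \<in> carrier A" for a using u by (auto simp: ucond_def)
 note [simp] = c hom_closed[OF h c] ucondD(2)[OF A u] kinv_hom[OF h A B c, symmetric]
  hom_mult[OF h, symmetric] hom_add[OF h, symmetric] hom_sm[OF h, symmetric] hom_one[OF h, symmetric] hom_pow[OF h A B, symmetric]
  lin_zero[OF hom_lin[OF h] A.cvec_axioms B.cvec_axioms, symmetric]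
 show ?thesis using u unfolding ucond_def by auto
qed

lemma hom_rels:
 assumes h: "h \<in> alg_homs A B" and A: "cx_algebra A" and B: "cx_algebra B" and xy: "x \<in> carrier A" "y \<in> carrier A"
 shows "zrel A x y ==> zrel B (h x) (h y)" "drel A x y ==> drel B (h x) (h y)" "dzrel A x y ==> dzrel B (h x) (h y)"
  "x [^]\<^bsub>A\<^esub> p = \<zero>\<^bsub>A\<^esub> ==> h x [^]\<^bsub>B\<^esub> p = \<zero>\<^bsub>B\<^esub>"
proof -
 interpret A: cx_algebra A by fact
 interpret B: cx_algebra B by fact
 note r = hom_mult[OF h, symmetric] hom_add[OF h, symmetric] hom_sm[OF h, symmetric] hom_one[OF h, symmetric]
 show "zrel A x y ==> zrel B (h x) (h y)" "drel A x y ==> drel B (h x) (h y)" "dzrel A x y ==> dzrel B (h x) (h y)"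
  unfolding zrel_def drel_def dzrel_def by (simp_all only: r xy A.m_closed A.sm_closed A.a_closed A.one_closed)
 show "x [^]\<^bsub>A\<^esub> p = \<zero>\<^bsub>A\<^esub> ==> h x [^]\<^bsub>B\<^esub> p = \<zero>\<^bsub>B\<^esub>"
  by (simp flip: hom_pow[OF h A B xy(1)] add: lin_zero[OF hom_lin[OF h] A.cvec_axioms B.cvec_axioms])
qed

lemma hom_hcond:
 assumes h: "h \<in> alg_homs A B" and A: "cx_algebra A" and B: "cx_algebra B" and y: "hcond A I y"
 shows "hcond B I (\<lambda>i. h (y i))"
 using y hom_rels[OF h A B] hom_closed[OF h] unfolding hcond_def by meson

lemma hom_cross:
 assumes h: "h \<in> alg_homs A B" and A: "cx_algebra A" and B: "cx_algebra B" and u: "range u \<subseteq> carrier A" and z: "z \<in> carrier A"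
 shows "zcross A u z ==> zcross B (\<lambda>a. h (u a)) (h z)" "dcross A u z ==> dcross B (\<lambda>a. h (u a)) (h z)"
proof -
 interpret A: cx_algebra A by fact
 interpret B: cx_algebra B by fact
 have c: "u a \<in> carrier A" for a using u by auto
 note [simp] = c z hom_closed[OF h c]
  hom_mult[OF h, symmetric] hom_add[OF h, symmetric] hom_sm[OF h, symmetric] hom_one[OF h, symmetric] hom_pow[OF h A B, symmetric]
 show "zcross A u z ==> zcross B (\<lambda>a. h (u a)) (h z)" "dcross A u z ==> dcross B (\<lambda>a. h (u a)) (h z)"
  unfolding zcross_def dcross_def by auto
qed

lemma hom_scond:
 assumes h: "h \<in> alg_homs A B" and A: "cx_algebra A" and B: "cx_algebra B" and y: "scond A I y u"
 shows "scond B I (\<lambda>i. h (y i)) (\<lambda>a. h (u a))"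
 using y hom_ucond[OF h A B, of u] hom_hcond[OF h A B, of I y] hom_cross[OF h A B, of u]
 unfolding scond_def by (auto simp: ucond_def hcond_def)

text \<open>The relators conjugate by K with K^(2p-1) as the inverse. Both sides contain K^(2p) = 1,
  so it may be assumed; then the power is a genuine inverse and conjugation can be undone.\<close>

lemma ucond_free_eval:
 assumes B: "cx_algebra B" and u: "range u \<subseteq> carrier B"
 shows "ucond B u \<longleftrightarrow> (\<forall>r\<in>u_relators p. free_eval B u r = \<zero>\<^bsub>B\<^esub>)"
  and "free_eval B u (Kinv p) = kinv B (u gK)"
proof -
 interpret B: cx_algebra B by fact
 have c [simp]: "u a \<in> carrier B" for a using u by auto
 have j [simp]: "kinv B (u gK) \<in> carrier B" by (simp add: kinv_def)
 have x: "u ` UNIV \<subseteq> carrier B" by fact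
 note fe = B.free_eval_simps[OF x, simplified]
 show K: "free_eval B u (Kinv p) = kinv B (u gK)"
  by (simp add: Kinv_def kinv_def fe)
 have q': "qq p = q" "inverse q = s" "1 / (q - s) = g" by (simp_all add: q_def s_def g_def)
 have e: "free_eval B u (gen gK * gen gE * Kinv p - const (qq p ^ 2) * gen gE)
   = u gK \<otimes>\<^bsub>B\<^esub> u gE \<otimes>\<^bsub>B\<^esub> kinv B (u gK) \<ominus>\<^bsub>B\<^esub> q ^ 2 \<odot>\<^bsub>B\<^esub> u gE"
  "free_eval B u (gen gK * gen gF * Kinv p - const (inverse (qq p) ^ 2) * gen gF)
   = u gK \<otimes>\<^bsub>B\<^esub> u gF \<otimes>\<^bsub>B\<^esub> kinv B (u gK) \<ominus>\<^bsub>B\<^esub> s ^ 2 \<odot>\<^bsub>B\<^esub> u gF"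
  "free_eval B u (gen gE * gen gF - gen gF * gen gE - const (1 / (qq p - inverse (qq p))) * (gen gK - Kinv p))
   = u gE \<otimes>\<^bsub>B\<^esub> u gF \<ominus>\<^bsub>B\<^esub> u gF \<otimes>\<^bsub>B\<^esub> u gE \<ominus>\<^bsub>B\<^esub> g \<odot>\<^bsub>B\<^esub> (u gK \<ominus>\<^bsub>B\<^esub> kinv B (u gK))"
  "free_eval B u (gen gK ^ (2 * p) - 1) = u gK [^]\<^bsub>B\<^esub> (2 * p) \<ominus>\<^bsub>B\<^esub> \<one>\<^bsub>B\<^esub>"
  by (simp_all add: fe q' K)
 have R: "(\<forall>r\<in>u_relators p. free_eval B u r = \<zero>\<^bsub>B\<^esub>) \<longleftrightarrow>
   u gK \<otimes>\<^bsub>B\<^esub> u gE \<otimes>\<^bsub>B\<^esub> kinv B (u gK) = q ^ 2 \<odot>\<^bsub>B\<^esub> u gE \<and>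
   u gK \<otimes>\<^bsub>B\<^esub> u gF \<otimes>\<^bsub>B\<^esub> kinv B (u gK) = s ^ 2 \<odot>\<^bsub>B\<^esub> u gF \<and>
   u gE \<otimes>\<^bsub>B\<^esub> u gF \<ominus>\<^bsub>B\<^esub> u gF \<otimes>\<^bsub>B\<^esub> u gE = g \<odot>\<^bsub>B\<^esub> (u gK \<ominus>\<^bsub>B\<^esub> kinv B (u gK)) \<and>
   u gE [^]\<^bsub>B\<^esub> p = \<zero>\<^bsub>B\<^esub> \<and> u gF [^]\<^bsub>B\<^esub> p = \<zero>\<^bsub>B\<^esub> \<and> u gK [^]\<^bsub>B\<^esub> (2 * p) = \<one>\<^bsub>B\<^esub>"
  unfolding u_relators_def by (simp add: e B.diff_zero_iff) (simp add: fe)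
 have ef: "u gE \<otimes>\<^bsub>B\<^esub> u gF \<ominus>\<^bsub>B\<^esub> u gF \<otimes>\<^bsub>B\<^esub> u gE = g \<odot>\<^bsub>B\<^esub> (u gK \<ominus>\<^bsub>B\<^esub> kinv B (u gK)) \<longleftrightarrow>
   u gE \<otimes>\<^bsub>B\<^esub> u gF = u gF \<otimes>\<^bsub>B\<^esub> u gE \<oplus>\<^bsub>B\<^esub> (g \<odot>\<^bsub>B\<^esub> u gK \<oplus>\<^bsub>B\<^esub> (- g) \<odot>\<^bsub>B\<^esub> kinv B (u gK))"
 proof -
  have "g \<odot>\<^bsub>B\<^esub> (u gK \<ominus>\<^bsub>B\<^esub> kinv B (u gK)) = g \<odot>\<^bsub>B\<^esub> u gK \<oplus>\<^bsub>B\<^esub> (- g) \<odot>\<^bsub>B\<^esub> kinv B (u gK)"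
   by (simp add: a_minus_def B.sm_distr B.sm_sm flip: B.sm_neg)
  moreover have "a \<ominus>\<^bsub>B\<^esub> b = c \<longleftrightarrow> a = b \<oplus>\<^bsub>B\<^esub> c" if "a \<in> carrier B" "b \<in> carrier B" "c \<in> carrier B" for a b c
   using that by (metis B.a_comm B.add.inv_solve_right B.minus_eq)
  ultimately show ?thesis by simp
 qed
 show "ucond B u \<longleftrightarrow> (\<forall>r\<in>u_relators p. free_eval B u r = \<zero>\<^bsub>B\<^esub>)"
 proof (cases "u gK [^]\<^bsub>B\<^esub> (2 * p) = \<one>\<^bsub>B\<^esub>")
  case True
  have e: "2 * p = Suc (2 * p - 1)" using p2 by simp
  have "u gK \<otimes>\<^bsub>B\<^esub> u gK [^]\<^bsub>B\<^esub> (2 * p - 1) = u gK [^]\<^bsub>B\<^esub> Suc (2 * p - 1)"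
   "u gK [^]\<^bsub>B\<^esub> (2 * p - 1) \<otimes>\<^bsub>B\<^esub> u gK = u gK [^]\<^bsub>B\<^esub> Suc (2 * p - 1)"
   using c by (metis B.nat_pow_Suc2, simp)
  then have kj: "u gK \<otimes>\<^bsub>B\<^esub> kinv B (u gK) = \<one>\<^bsub>B\<^esub>" "kinv B (u gK) \<otimes>\<^bsub>B\<^esub> u gK = \<one>\<^bsub>B\<^esub>"
   using True e by (simp_all add: kinv_def)
  have "u gK \<otimes>\<^bsub>B\<^esub> x \<otimes>\<^bsub>B\<^esub> kinv B (u gK) = c \<odot>\<^bsub>B\<^esub> x \<longleftrightarrow> u gK \<otimes>\<^bsub>B\<^esub> x = c \<odot>\<^bsub>B\<^esub> (x \<otimes>\<^bsub>B\<^esub> u gK)"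
   if x: "x \<in> carrier B" for x c
  proof
   assume "u gK \<otimes>\<^bsub>B\<^esub> x \<otimes>\<^bsub>B\<^esub> kinv B (u gK) = c \<odot>\<^bsub>B\<^esub> x"
   then have "u gK \<otimes>\<^bsub>B\<^esub> x \<otimes>\<^bsub>B\<^esub> (kinv B (u gK) \<otimes>\<^bsub>B\<^esub> u gK) = c \<odot>\<^bsub>B\<^esub> (x \<otimes>\<^bsub>B\<^esub> u gK)"
    using x by (simp flip: B.m_assoc)
   then show "u gK \<otimes>\<^bsub>B\<^esub> x = c \<odot>\<^bsub>B\<^esub> (x \<otimes>\<^bsub>B\<^esub> u gK)" using x kj by simp
  next
   assume "u gK \<otimes>\<^bsub>B\<^esub> x = c \<odot>\<^bsub>B\<^esub> (x \<otimes>\<^bsub>B\<^esub> u gK)"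
   then show "u gK \<otimes>\<^bsub>B\<^esub> x \<otimes>\<^bsub>B\<^esub> kinv B (u gK) = c \<odot>\<^bsub>B\<^esub> x" using x kj by (simp add: B.m_assoc)
  qed
  then show ?thesis unfolding R ef ucond_def using u by auto
 qed (auto simp: R ucond_def)
qed

sublocale pr: pres "UNIV :: ugen set" "u_relators p" by unfold_locales simp

lemma u_alg_eq: "u_alg p = pres_alg UNIV (u_relators p)"
 by (simp add: u_alg_def pres_alg_def)

lemma u_cls_eq: "u_cls p r = pr.fq.kl r"
 by (simp add: u_cls_def)

lemma same_Uq: "same_alg H (u_alg p)"
 by (simp add: same_alg_def same_mod_def Uq_def)

lemma same_Uq': "same_alg (u_alg p) H"
 by (simp add: same_alg_def same_mod_def Uq_def)

lemma cx_algebra_Uq: "cx_algebra H"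
 using cx_algebra_cong[OF same_Uq] pr.cx_algebra_pres by (simp add: u_alg_eq)

sublocale H: cx_algebra "H" by (rule cx_algebra_Uq)

abbreviation ug :: "ugen => (ugen list \<Rightarrow>\<^sub>0 complex) set" where "ug a \<equiv> u_cls p (gen a)"

lemma presented_Uq: "presented_by H UNIV ug (u_relators p)"
 using pr.presented_pres by (simp add: presented_cong[OF same_Uq] u_alg_eq u_cls_eq)

lemma generated_Uq: "generated_by H UNIV ug"
 by (rule presented_generated[OF presented_Uq])

lemma ug_closed [simp]: "ug a \<in> carrier H"
 using generated_Uq by (auto simp: generated_by_def)

lemma ucond_Uq: "ucond H ug"
proof -
 have "free_eval H ug r = \<zero>\<^bsub>H\<^esub>" if "r \<in> u_relators p" for r
 proof -
  have "single [] 1 * r * single [] 1 \<in> two_sided UNIV (u_relators p)"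
   using that unfolding two_sided_def by blast
  moreover have "single ([] :: ugen list) (1 :: complex) = 1" by (simp flip: single_one)
  ultimately have "r \<in> cspan (two_sided UNIV (u_relators p))"
   by (intro fv.span_base) simp
  then show ?thesis using presented_Uq by (simp add: presented_by_def)
 qed
 then show ?thesis by (subst ucond_free_eval) (auto simp: cx_algebra_Uq)
qed

abbreviation "UJ \<equiv> kinv H (ug gK)"

lemma u_cls_eval: "u_cls p r = free_eval H ug r"
 using pr.free_eval_pres[of r] by (simp add: free_eval_cong[OF same_Uq] u_alg_eq u_cls_eq)

lemma u_cls_Kinv: "u_cls p (Kinv p) = UJ"
 using ucond_free_eval(2)[OF cx_algebra_Uq, of ug] by (simp add: u_cls_eval[of "Kinv p"] image_subset_iff)

lemma u_cls_1: "u_cls p 1 = \<one>\<^bsub>H\<^esub>"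
 by (simp add: u_cls_eval[of 1] H.free_eval_one[of ug UNIV] image_subset_iff)

lemma u_cls_mult: "u_cls p (r * r') = u_cls p r \<otimes>\<^bsub>H\<^esub> u_cls p r'"
 by (simp add: u_cls_eval[of "r * r'"] u_cls_eval[of r] u_cls_eval[of r'] H.free_eval_mult[of ug UNIV] image_subset_iff)

lemma UJ_closed [simp]: "UJ \<in> carrier H"
 by (rule ucondD(2)[OF cx_algebra_Uq ucond_Uq])

text \<open>The morphism out of the quantum group with given images of the generators. Coproduct,
  counit and antipode are all of this form, the antipode with values in the opposite
  algebra.\<close>

definition uhom :: "(complex, 'a, 'm) module_scheme => (ugen => 'a) => (ugen list \<Rightarrow>\<^sub>0 complex) set => 'a" where
 "uhom B y X = free_eval B y (rep X)"

lemma uhom: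
 assumes "cx_algebra B" "ucond B y"
 shows "uhom B y \<in> alg_homs H B" "uhom B y (ug a) = y a"
proof -
 interpret B: cx_algebra B by fact
 have y: "y ` UNIV \<subseteq> carrier B" using assms(2) by (simp add: ucond_def)
 note z = ucond_free_eval(1)[OF assms(1) y, THEN iffD1, OF assms(2), THEN bspec]
 note h = pr.pres_hom[OF assms(1) y z]
 show "uhom B y \<in> alg_homs H B"
  using h(1) alg_homs_cong[OF same_Uq, of B B] by (simp add: u_alg_eq uhom_def[abs_def] same_alg_def same_mod_def)
 show "uhom B y (ug a) = y a"
  using h(2)[of "gen a"] B.free_eval_gen[OF y] by (simp add: uhom_def u_cls_eq)
qed

lemma uhom_unique:
 assumes "cx_algebra B" "f \<in> alg_homs H B" "h \<in> alg_homs H B" "!!a. f (ug a) = h (ug a)" "x \<in> carrier H"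
 shows "f x = h x"
 by (rule generated_hom_ext[OF generated_Uq cx_algebra_Uq assms(1-3)]) (use assms in auto)

sublocale UU: tensor_algs "H" "H" by unfold_locales

abbreviation "UT \<equiv> tensor H H"

lemma tensor_left_ucond:
 assumes "cx_algebra B"
 shows "ucond (tensor H B) (\<lambda>a. tens H B (ug a) \<one>\<^bsub>B\<^esub>)"
  "kinv (tensor H B) (tens H B (ug gK) \<one>\<^bsub>B\<^esub>) = tens H B UJ \<one>\<^bsub>B\<^esub>"
proof -
 interpret T: tensor_algs "H" B by (rule tensor_algsI[OF cx_algebra_Uq assms])
 show "ucond (tensor H B) (\<lambda>a. tens H B (ug a) \<one>\<^bsub>B\<^esub>)"
  by (rule hom_ucond[OF T.tens_left_hom cx_algebra_Uq T.cx_algebra_tensor ucond_Uq])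
 show "kinv (tensor H B) (tens H B (ug gK) \<one>\<^bsub>B\<^esub>) = tens H B UJ \<one>\<^bsub>B\<^esub>"
  by (rule kinv_hom[OF T.tens_left_hom cx_algebra_Uq T.cx_algebra_tensor ug_closed, symmetric])
qed

abbreviation "UL \<equiv> (\<lambda>a. tens H H (ug a) \<one>\<^bsub>H\<^esub>)"
abbreviation "UR \<equiv> (\<lambda>a. tens H H \<one>\<^bsub>H\<^esub> (ug a))"

text \<open>The pair formed by the two embeddings of the quantum group into its tensor square; it
  yields the coproduct itself.\<close>

sublocale UP: upair p q s g UT UL UR
 by unfold_locales (auto simp: tensor_left_ucond cx_algebra_Uq UU.tens_mult
   intro: hom_ucond[OF UU.tens_right_hom cx_algebra_Uq UU.cx_algebra_tensor ucond_Uq])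

lemma comult_gen_values:
 "comult_gen UT UL UR gE = tens H H (ug gE) (ug gK) \<oplus>\<^bsub>UT\<^esub> tens H H \<one>\<^bsub>H\<^esub> (ug gE)"
 "comult_gen UT UL UR gK = tens H H (ug gK) (ug gK)"
 "comult_gen UT UL UR gF = tens H H (ug gF) \<one>\<^bsub>H\<^esub> \<oplus>\<^bsub>UT\<^esub> tens H H UJ (ug gF)"
 by (simp_all add: UU.tens_mult tensor_left_ucond(2)[OF cx_algebra_Uq])

lemma tensor_u_alg: "tensor (u_alg p) (u_alg p) = UT" "tens (u_alg p) (u_alg p) = tens H H"
 by (rule tensor_cong, (rule same_Uq')+, rule tens_cong, (rule same_Uq'[THEN same_alg_mod])+)

lemma comult_eq: "comult H = uhom UT (comult_gen UT UL UR)"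
proof -
 have "u_comult_gen p = comult_gen UT UL UR"
  by (rule ext, rename_tac a, case_tac a)
   (simp_all only: u_comult_gen.simps comult_gen_values tensor_u_alg u_cls_1 u_cls_Kinv)
 moreover have "comult H = (\<lambda>u. free_eval (tensor (u_alg p) (u_alg p)) (u_comult_gen p) (rep u))"
  by (simp add: Uq_def)
 ultimately show ?thesis by (simp only: uhom_def[abs_def] tensor_u_alg)
qed

lemma comult_hom': "comult H \<in> alg_homs H UT"
 and comult_ug: "comult H (ug a) = comult_gen UT UL UR a"
 using uhom[OF UU.cx_algebra_tensor UP.ucond_comult] by (simp_all only: comult_eq)

lemma comult_UJ: "comult H UJ = tens H H UJ UJ"
proof -
 have "comult H UJ = kinv UT (tens H H (ug gK) (ug gK))"
  by (simp add: kinv_hom[OF comult_hom' cx_algebra_Uq UU.cx_algebra_tensor] comult_ug UU.tens_mult)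
 also have "... = kinv UT (UL gK) \<otimes>\<^bsub>UT\<^esub> kinv UT (UR gK)"
  using UP.kinv_prod by (simp add: UU.tens_mult)
 also have "... = tens H H UJ UJ"
  by (simp add: UU.tens_mult tensor_left_ucond(2)[OF cx_algebra_Uq] kinv_hom[OF UU.tens_right_hom cx_algebra_Uq UU.cx_algebra_tensor, symmetric])
 finally show ?thesis .
qed

lemma ucond_counit: "ucond cx u_counit_gen"
 using p2 by (auto simp: ucond_def kinv_def)

lemma counit_eq: "counit H = uhom cx u_counit_gen"
 by (simp add: Uq_def uhom_def[abs_def])

lemma counit_hom': "counit H \<in> alg_homs H cx"
 and counit_ug: "counit H (ug a) = u_counit_gen a"
 using uhom[OF cx_algebra_cx ucond_counit] by (simp_all only: counit_eq)

lemma counit_UJ: "counit H UJ = 1"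
 by (simp add: kinv_hom[OF counit_hom' cx_algebra_Uq cx_algebra_cx] counit_ug) (simp add: kinv_def)

lemma antipode_gen_values:
 "u_antipode_gen p gE = (- 1) \<odot>\<^bsub>H\<^esub> (ug gE \<otimes>\<^bsub>H\<^esub> UJ)" "u_antipode_gen p gK = UJ"
 "u_antipode_gen p gF = (- 1) \<odot>\<^bsub>H\<^esub> (ug gK \<otimes>\<^bsub>H\<^esub> ug gF)"
proof -
 have n: "u_cls p (- r) = (- 1) \<odot>\<^bsub>H\<^esub> u_cls p r" for r
 proof -
  have "- r = scal (- 1) r" by (rule poly_mapping_eqI) simp
  then show ?thesis unfolding u_cls_eval[of "- r"] u_cls_eval[of r]
   using H.free_eval_scal[of ug UNIV r "-1"] by (simp add: image_subset_iff)
 qed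
 show "u_antipode_gen p gE = (- 1) \<odot>\<^bsub>H\<^esub> (ug gE \<otimes>\<^bsub>H\<^esub> UJ)" "u_antipode_gen p gK = UJ"
  "u_antipode_gen p gF = (- 1) \<odot>\<^bsub>H\<^esub> (ug gK \<otimes>\<^bsub>H\<^esub> ug gF)"
  by (simp_all only: u_antipode_gen.simps n u_cls_mult u_cls_Kinv)
qed

text \<open>S(K) is K^(-1), whose own inverse is K, so \<open>ug gK\<close> and \<open>UJ\<close>
  trade places in the relations. The p-th powers of E K^(-1) and K F vanish because the factors
  commute up to a scalar.\<close>

lemma ucond_antipode: "ucond (opp H) (u_antipode_gen p)"
proof -
 note U = ucondD[OF cx_algebra_Uq ucond_Uq]
 have rel: "ug gE \<otimes>\<^bsub>H\<^esub> ug gF = ug gF \<otimes>\<^bsub>H\<^esub> ug gE \<oplus>\<^bsub>H\<^esub> (g \<odot>\<^bsub>H\<^esub> ug gK \<oplus>\<^bsub>H\<^esub> (- g) \<odot>\<^bsub>H\<^esub> UJ)"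
  "ug gK \<otimes>\<^bsub>H\<^esub> ug gE = q ^ 2 \<odot>\<^bsub>H\<^esub> (ug gE \<otimes>\<^bsub>H\<^esub> ug gK)"
  "ug gK \<otimes>\<^bsub>H\<^esub> ug gF = s ^ 2 \<odot>\<^bsub>H\<^esub> (ug gF \<otimes>\<^bsub>H\<^esub> ug gK)"
  and pw: "ug gE [^]\<^bsub>H\<^esub> p = \<zero>\<^bsub>H\<^esub>" "ug gF [^]\<^bsub>H\<^esub> p = \<zero>\<^bsub>H\<^esub>" "ug gK [^]\<^bsub>H\<^esub> (2 * p) = \<one>\<^bsub>H\<^esub>"
  using ucond_Uq by (simp_all add: ucond_def)
 note rules = H.nf rel[THEN H.cont] U(3-6)[THEN H.cont]
 have JJ: "UJ [^]\<^bsub>H\<^esub> (2 * p) = \<one>\<^bsub>H\<^esub>" "kinv H UJ = ug gK"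
 proof -
  have "UJ [^]\<^bsub>H\<^esub> n \<otimes>\<^bsub>H\<^esub> ug gK [^]\<^bsub>H\<^esub> n = \<one>\<^bsub>H\<^esub>" for n :: nat
   by (subst H.pow_mult_distrib[symmetric]) (simp_all add: U)
  from this[of "2 * p"] show 1: "UJ [^]\<^bsub>H\<^esub> (2 * p) = \<one>\<^bsub>H\<^esub>" using pw by simp
  have e: "2 * p = Suc (2 * p - 1)" using p2 by simp
  have "UJ [^]\<^bsub>H\<^esub> (2 * p) = kinv H UJ \<otimes>\<^bsub>H\<^esub> UJ"
   by (subst e) (simp only: H.nat_pow_Suc kinv_def[of _ UJ])
  then have "kinv H UJ \<otimes>\<^bsub>H\<^esub> UJ = \<one>\<^bsub>H\<^esub>" using 1 by simp
  then have "kinv H UJ \<otimes>\<^bsub>H\<^esub> (UJ \<otimes>\<^bsub>H\<^esub> ug gK) = ug gK"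
   by (simp add: kinv_def[of _ UJ] flip: H.m_assoc)
  then show "kinv H UJ = ug gK" by (simp add: U(4) kinv_def[of _ UJ])
 qed
 have K: "kinv (opp H) UJ = ug gK"
  using JJ(2) by (simp add: kinv_def[of "opp _"] kinv_def[of "H" UJ] opp_pow[OF cx_algebra_Uq])
 have ran: "range (u_antipode_gen p) \<subseteq> carrier H"
  by (rule image_subsetI, rename_tac a, case_tac a) (simp_all only: antipode_gen_values H.sm_closed H.m_closed ug_closed UJ_closed)
 have EJ: "(ug gE \<otimes>\<^bsub>H\<^esub> UJ) [^]\<^bsub>H\<^esub> p = \<zero>\<^bsub>H\<^esub>" "(ug gK \<otimes>\<^bsub>H\<^esub> ug gF) [^]\<^bsub>H\<^esub> p = \<zero>\<^bsub>H\<^esub>"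
 proof -
  show "(ug gE \<otimes>\<^bsub>H\<^esub> UJ) [^]\<^bsub>H\<^esub> p = \<zero>\<^bsub>H\<^esub>"
   by (rule H.qcomm_prod_pow_zero[where w = "s ^ 2"]) (simp_all add: U pw)
  have "q ^ 2 * s ^ 2 = 1" using qs by (metis power_mult_distrib power_one)
  then show "(ug gK \<otimes>\<^bsub>H\<^esub> ug gF) [^]\<^bsub>H\<^esub> p = \<zero>\<^bsub>H\<^esub>"
   by (intro H.qcomm_prod_pow_zero[where w = "q ^ 2"]) (simp_all add: rel pw H.sm_sm)
 qed
 show ?thesis
  unfolding ucond_def opp_simps antipode_gen_values K
 proof (intro conjI)
  show "(- 1) \<odot>\<^bsub>H\<^esub> (ug gE \<otimes>\<^bsub>H\<^esub> UJ) \<otimes>\<^bsub>H\<^esub> UJ = q\<^sup>2 \<odot>\<^bsub>H\<^esub> (UJ \<otimes>\<^bsub>H\<^esub> ((- 1) \<odot>\<^bsub>H\<^esub> (ug gE \<otimes>\<^bsub>H\<^esub> UJ)))"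
   by (rule H.scale_one_eqI; simp add: rules del: H.r_one H.sm_one;
    (simp only: H.Lfold H.m_closed H.one_closed ug_closed UJ_closed, rule H.Lc_eqI, simp only: Llook, simp add: scalar_rules algebra_simps)?)
  show "(- 1) \<odot>\<^bsub>H\<^esub> (ug gK \<otimes>\<^bsub>H\<^esub> ug gF) \<otimes>\<^bsub>H\<^esub> UJ = s\<^sup>2 \<odot>\<^bsub>H\<^esub> (UJ \<otimes>\<^bsub>H\<^esub> ((- 1) \<odot>\<^bsub>H\<^esub> (ug gK \<otimes>\<^bsub>H\<^esub> ug gF)))"
   by (rule H.scale_one_eqI; simp add: rules del: H.r_one H.sm_one;
    (simp only: H.Lfold H.m_closed H.one_closed ug_closed UJ_closed, rule H.Lc_eqI, simp only: Llook, simp add: scalar_rules algebra_simps)?)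
  show "(- 1) \<odot>\<^bsub>H\<^esub> (ug gK \<otimes>\<^bsub>H\<^esub> ug gF) \<otimes>\<^bsub>H\<^esub> ((- 1) \<odot>\<^bsub>H\<^esub> (ug gE \<otimes>\<^bsub>H\<^esub> UJ)) =
   (- 1) \<odot>\<^bsub>H\<^esub> (ug gE \<otimes>\<^bsub>H\<^esub> UJ) \<otimes>\<^bsub>H\<^esub> ((- 1) \<odot>\<^bsub>H\<^esub> (ug gK \<otimes>\<^bsub>H\<^esub> ug gF)) \<oplus>\<^bsub>H\<^esub> (g \<odot>\<^bsub>H\<^esub> UJ \<oplus>\<^bsub>H\<^esub> (- g) \<odot>\<^bsub>H\<^esub> ug gK)"
   by (rule H.scale_one_eqI; simp add: rules del: H.r_one H.sm_one;
    (simp only: H.Lfold H.m_closed H.one_closed ug_closed UJ_closed, rule H.Lc_eqI, simp only: Llook, simp add: scalar_rules algebra_simps)?)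
 qed (use ran in \<open>simp_all add: opp_pow[OF cx_algebra_Uq] H.smult_pow EJ JJ\<close>)
qed

lemma antipode_eq: "antipode H = uhom (opp H) (u_antipode_gen p)"
proof -
 have ran: "range (u_antipode_gen p) \<subseteq> carrier H"
  using ucond_antipode by (simp add: ucond_def)
 have L: "same_mod (opp H) (u_alg p)"
  by (simp add: same_mod_def Uq_def)
 have "antipode H = (\<lambda>u. lin_ext (u_alg p) (\<lambda>w. word_eval (u_alg p) (u_antipode_gen p) (rev w)) (rep u))"
  by (simp add: Uq_def)
 then show ?thesis
  by (simp only: lin_ext_cong_mod[OF L] uhom_def[abs_def] free_eval_def opp_word_eval[OF cx_algebra_Uq ran, abs_def] word_eval_cong[OF same_Uq])
qed

lemma antipode_hom: "antipode H \<in> alg_homs H (opp H)"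
 and antipode_ug: "antipode H (ug a) = u_antipode_gen p a"
 using uhom[OF cx_algebra_opp[OF cx_algebra_Uq] ucond_antipode] by (simp_all only: antipode_eq)

lemma antipode_UJ: "antipode H UJ = ug gK"
proof -
 note U = ucondD[OF cx_algebra_Uq ucond_Uq]
 have c: "antipode H UJ \<in> carrier H" using hom_closed[OF antipode_hom, of UJ] by simp
 have "antipode H (ug gK \<otimes>\<^bsub>H\<^esub> UJ) = antipode H UJ \<otimes>\<^bsub>H\<^esub> UJ"
  using hom_mult[OF antipode_hom, of "ug gK" UJ] by (simp add: antipode_ug antipode_gen_values u_cls_Kinv)
 then have "antipode H UJ \<otimes>\<^bsub>H\<^esub> UJ = \<one>\<^bsub>H\<^esub>"
  using hom_one[OF antipode_hom] by (simp add: U)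
 then have "antipode H UJ \<otimes>\<^bsub>H\<^esub> (UJ \<otimes>\<^bsub>H\<^esub> ug gK) = ug gK"
  using c by (simp flip: H.m_assoc)
 then show ?thesis using c by (simp add: U)
qed

end


context uq
begin

subsection \<open>Hopf algebra axioms\<close>

text \<open>The map \<Delta> \<otimes> id at a \<otimes> b, in the form in which the coassociativity
  axioms contain it. With \<open>X\<close> arbitrary the same facts serve for the coproduct itself
  and for every coaction.\<close>

definition assl :: "(complex, 'x, 'n) module_scheme => (ugen list \<Rightarrow>\<^sub>0 complex) set => 'x => _" where
 "assl X a b = sweedler (tensor H (tensor H X))
   (\<lambda>a' a''. tens H (tensor H X) a' (tens H X a'' b)) (comult H a)"

context
 fixes X :: "(complex, 'x, 'n) module_scheme"
 assumes X: "cx_algebra X"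
begin

interpretation X: cx_algebra X by (rule X)
interpretation T: tensor_algs "H" X by unfold_locales
interpretation T3: tensor_algs "H" "tensor H X" by (rule tensor_algsI[OF cx_algebra_Uq T.cx_algebra_tensor])

abbreviation "TX \<equiv> tensor H X"
abbreviation "T3X \<equiv> tensor H TX"

lemma assl_bilin: "bilin H H T3X (\<lambda>a' a''. tens H TX a' (tens H X a'' b))" if "b \<in> carrier X"
 using that by (intro bilinI lin_mapsI)
  (simp_all add: T.tens_closed T3.tens_closed T.tens_add_left T.tens_sm_left T3.tens_add_left T3.tens_add_right T3.tens_sm_left T3.tens_sm_right)

lemma assl_values:
 assumes b: "b \<in> carrier X"
 shows "assl X (ug gE) b = tens H TX (ug gE) (tens H X (ug gK) b) \<oplus>\<^bsub>T3X\<^esub> tens H TX \<one>\<^bsub>H\<^esub> (tens H X (ug gE) b)"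
  "assl X (ug gK) b = tens H TX (ug gK) (tens H X (ug gK) b)"
  "assl X (ug gF) b = tens H TX (ug gF) (tens H X \<one>\<^bsub>H\<^esub> b) \<oplus>\<^bsub>T3X\<^esub> tens H TX UJ (tens H X (ug gF) b)"
  "assl X UJ b = tens H TX UJ (tens H X UJ b)"
  "assl X \<one>\<^bsub>H\<^esub> b = tens H TX \<one>\<^bsub>H\<^esub> (tens H X \<one>\<^bsub>H\<^esub> b)"
  "assl X (ug gE \<otimes>\<^bsub>H\<^esub> UJ) b = tens H TX (ug gE \<otimes>\<^bsub>H\<^esub> UJ) (tens H X \<one>\<^bsub>H\<^esub> b) \<oplus>\<^bsub>T3X\<^esub> tens H TX UJ (tens H X (ug gE \<otimes>\<^bsub>H\<^esub> UJ) b)"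
proof -
 note S = UU.sweedler_lin[OF T3.T.cvec_Q assl_bilin[OF b]]
 note [simp] = UU.tens_closed lin_add[OF S(1)] S(2) ucondD(3,4)[OF cx_algebra_Uq ucond_Uq]
 show "assl X (ug gE) b = tens H TX (ug gE) (tens H X (ug gK) b) \<oplus>\<^bsub>T3X\<^esub> tens H TX \<one>\<^bsub>H\<^esub> (tens H X (ug gE) b)"
  "assl X (ug gK) b = tens H TX (ug gK) (tens H X (ug gK) b)"
  "assl X (ug gF) b = tens H TX (ug gF) (tens H X \<one>\<^bsub>H\<^esub> b) \<oplus>\<^bsub>T3X\<^esub> tens H TX UJ (tens H X (ug gF) b)"
  "assl X UJ b = tens H TX UJ (tens H X UJ b)"
  unfolding assl_def comult_ug comult_gen_values comult_UJ by simp_all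
 show "assl X \<one>\<^bsub>H\<^esub> b = tens H TX \<one>\<^bsub>H\<^esub> (tens H X \<one>\<^bsub>H\<^esub> b)"
  unfolding assl_def hom_one[OF comult_hom'] UU.one_tens by simp
 have "comult H (ug gE \<otimes>\<^bsub>H\<^esub> UJ) =
   tens H H (ug gE \<otimes>\<^bsub>H\<^esub> UJ) \<one>\<^bsub>H\<^esub> \<oplus>\<^bsub>UT\<^esub> tens H H UJ (ug gE \<otimes>\<^bsub>H\<^esub> UJ)"
  unfolding hom_mult[OF comult_hom' ug_closed UJ_closed] comult_ug comult_gen_values comult_UJ
  by (simp add: UU.TA.l_distr UU.tens_mult)
 then show "assl X (ug gE \<otimes>\<^bsub>H\<^esub> UJ) b = tens H TX (ug gE \<otimes>\<^bsub>H\<^esub> UJ) (tens H X \<one>\<^bsub>H\<^esub> b) \<oplus>\<^bsub>T3X\<^esub> tens H TX UJ (tens H X (ug gE \<otimes>\<^bsub>H\<^esub> UJ) b)"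
  unfolding assl_def by simp
qed

lemma assl_hom:
 "sweedler T3X (assl X) \<in> alg_homs TX T3X"
 "a \<in> carrier H ==> b \<in> carrier X ==> sweedler T3X (assl X) (tens H X a b) = assl X a b"
proof -
 \<comment> \<open>The map \<Delta> \<otimes> id is assembled from two commuting morphisms:
   \<open>?F\<close> puts the legs of the coproduct into the first two slots, \<open>?G\<close> puts
   \<open>b\<close> into the third. This makes it an algebra morphism.\<close>
 let ?F = "sweedler T3X (\<lambda>a b. tens H TX a \<one>\<^bsub>TX\<^esub> \<otimes>\<^bsub>T3X\<^esub> tens H TX \<one>\<^bsub>H\<^esub> (tens H X b \<one>\<^bsub>X\<^esub>))"
 let ?G = "\<lambda>b. tens H TX \<one>\<^bsub>H\<^esub> (tens H X \<one>\<^bsub>H\<^esub> b)"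
 note F = UU.tensor_hom[OF T3.tens_left_hom hom_comp[OF T.tens_left_hom T3.tens_right_hom] T3.cx_algebra_tensor]
 have F1: "?F \<in> alg_homs UT T3X" by (rule F) (simp add: T3.tens_mult T.tens_closed)
 have F2: "?F (tens H H a b) = tens H TX a (tens H X b \<one>\<^bsub>X\<^esub>)"
  if "a \<in> carrier H" "b \<in> carrier H" for a b
  using that by (subst F(2)) (simp_all add: T3.tens_mult T.tens_closed)
 have G: "?G \<in> alg_homs X T3X" by (rule hom_comp[OF T.tens_right_hom T3.tens_right_hom])
 note [simp] = hom_closed[OF F1] hom_closed[OF G]
 have FG': "?G b \<otimes>\<^bsub>T3X\<^esub> ?F t = sweedler T3X (\<lambda>a' a''. tens H TX a' (tens H X a'' b)) t \<and>
   ?F t \<otimes>\<^bsub>T3X\<^esub> ?G b = sweedler T3X (\<lambda>a' a''. tens H TX a' (tens H X a'' b)) t"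
  if t: "t \<in> carrier UT" and b: "b \<in> carrier X" for t b
  using t
 proof (induction rule: UU.tensor_induct)
  case (tens v w)
  then show ?case using b
   by (simp add: F2 T3.tens_mult T.tens_mult T.tens_closed UU.sweedler_lin(2)[OF T3.T.cvec_Q assl_bilin])
 next
  case (add s t)
  then show ?case using b hom_add[OF F1]
   by (simp add: T3.TA.l_distr T3.TA.r_distr lin_add[OF UU.sweedler_lin(1)[OF T3.T.cvec_Q assl_bilin]])
 qed
 have FG: "?F t \<otimes>\<^bsub>T3X\<^esub> ?G b = ?G b \<otimes>\<^bsub>T3X\<^esub> ?F t \<and>
   ?F t \<otimes>\<^bsub>T3X\<^esub> ?G b = sweedler T3X (\<lambda>a' a''. tens H TX a' (tens H X a'' b)) t"
  if t: "t \<in> carrier UT" and b: "b \<in> carrier X" for t b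
  using FG'[OF t b] by simp
 have c: "!!a. a \<in> carrier H ==> comult H a \<in> carrier UT" by (rule hom_closed[OF comult_hom'])
 note L = T.tensor_hom[OF hom_comp[OF comult_hom' F1] G T3.cx_algebra_tensor, OF FG[OF c, THEN conjunct1]]
 have e: "sweedler T3X (assl X) t = sweedler T3X (\<lambda>a b. ?F (comult H a) \<otimes>\<^bsub>T3X\<^esub> ?G b) t" if t: "t \<in> carrier TX" for t
  by (rule T.sweedler_eq[OF hom_lin[OF L(1)] T3.T.cvec_Q _ t])
   (simp_all add: L(2) FG[OF c, THEN conjunct2] assl_def)
 show "sweedler T3X (assl X) \<in> alg_homs TX T3X"
  by (rule hom_cong[OF L(1) T.cx_algebra_tensor e[symmetric]])
 show "a \<in> carrier H ==> b \<in> carrier X ==> sweedler T3X (assl X) (tens H X a b) = assl X a b"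
  using e[OF T.tens_closed] L(2) FG[OF c, THEN conjunct2] by (simp add: assl_def)
qed

lemma tens_coact_hom:
 assumes d: "d \<in> alg_homs X TX"
 shows "sweedler T3X (\<lambda>a x. tens H TX a (d x)) \<in> alg_homs TX T3X"
  "a \<in> carrier H ==> b \<in> carrier X ==>
    sweedler T3X (\<lambda>a x. tens H TX a (d x)) (tens H X a b) = tens H TX a (d b)"
proof -
 note [simp] = hom_closed[OF d]
 note L = T.tensor_hom[OF T3.tens_left_hom hom_comp[OF d T3.tens_right_hom] T3.cx_algebra_tensor]
 have comm: "!!a b. a \<in> carrier H ==> b \<in> carrier X ==>
   tens H TX a \<one>\<^bsub>TX\<^esub> \<otimes>\<^bsub>T3X\<^esub> tens H TX \<one>\<^bsub>H\<^esub> (d b) = tens H TX \<one>\<^bsub>H\<^esub> (d b) \<otimes>\<^bsub>T3X\<^esub> tens H TX a \<one>\<^bsub>TX\<^esub>"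
  and v: "!!a b. a \<in> carrier H ==> b \<in> carrier X ==>
   tens H TX a \<one>\<^bsub>TX\<^esub> \<otimes>\<^bsub>T3X\<^esub> tens H TX \<one>\<^bsub>H\<^esub> (d b) = tens H TX a (d b)"
  by (simp_all add: T3.tens_mult)
 note L' = L(1)[OF comm] L(2)[OF comm]
 have e: "sweedler T3X (\<lambda>a x. tens H TX a (d x)) t
   = sweedler T3X (\<lambda>a b. tens H TX a \<one>\<^bsub>TX\<^esub> \<otimes>\<^bsub>T3X\<^esub> tens H TX \<one>\<^bsub>H\<^esub> (d b)) t" if t: "t \<in> carrier TX" for t
  by (rule T.sweedler_eq[OF hom_lin[OF L'(1)] T3.T.cvec_Q _ t]) (simp_all add: L'(2) v)
 show "sweedler T3X (\<lambda>a x. tens H TX a (d x)) \<in> alg_homs TX T3X"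
  by (rule hom_cong[OF L'(1) T.cx_algebra_tensor e[symmetric]])
 show "a \<in> carrier H ==> b \<in> carrier X ==>
    sweedler T3X (\<lambda>a x. tens H TX a (d x)) (tens H X a b) = tens H TX a (d b)"
  using e[OF T.tens_closed] by (simp add: L'(2) v)
qed

text \<open>Both sides are composites of algebra morphisms, so agreement on generators
  propagates.\<close>

lemma coassoc_from_gens:
 assumes d: "d \<in> alg_homs X TX" and gen: "generated_by X I x"
  and eq: "!!i. i \<in> I ==> sweedler T3X (assl X) (d (x i)) = sweedler T3X (\<lambda>a x. tens H TX a (d x)) (d (x i))"
  and y: "y \<in> carrier X"
 shows "sweedler T3X (assl X) (d y) = sweedler T3X (\<lambda>a x. tens H TX a (d x)) (d y)"
 by (rule generated_hom_ext[OF gen X T3.cx_algebra_tensor hom_comp[OF d assl_hom(1)] hom_comp[OF d tens_coact_hom(1)[OF d]] eq y])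

lemma counit_act_hom:
 "sweedler X (\<lambda>a x. counit H a \<odot>\<^bsub>X\<^esub> x) \<in> alg_homs TX X"
 "a \<in> carrier H ==> b \<in> carrier X ==> sweedler X (\<lambda>a x. counit H a \<odot>\<^bsub>X\<^esub> x) (tens H X a b) = counit H a \<odot>\<^bsub>X\<^esub> b"
proof -
 note [simp] = hom_add[OF counit_hom'] hom_sm[OF counit_hom'] hom_mult[OF counit_hom'] hom_one[OF counit_hom']
 have b: "bilin H X X (\<lambda>a x. counit H a \<odot>\<^bsub>X\<^esub> x)"
  by (intro bilinI lin_mapsI) (simp_all add: X.sm_add X.sm_distr X.sm_sm mult.commute)
 note L = T.sweedler_lin[OF X.cvec_axioms b]
 show "a \<in> carrier H ==> b \<in> carrier X ==> sweedler X (\<lambda>a x. counit H a \<odot>\<^bsub>X\<^esub> x) (tens H X a b) = counit H a \<odot>\<^bsub>X\<^esub> b" for a b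
  by (rule L(2))
 show "sweedler X (\<lambda>a x. counit H a \<odot>\<^bsub>X\<^esub> x) \<in> alg_homs TX X"
  by (rule T.tensor_homI[OF L(1) X]) (simp_all add: L(2) X.sm_sm mult.commute)
qed

end

lemma counit_left_Uq: "h \<in> carrier H ==> sweedler H (\<lambda>a b. counit H a \<odot>\<^bsub>H\<^esub> b) (comult H h) = h"
proof (rule uhom_unique[OF cx_algebra_Uq hom_comp[OF comult_hom' counit_act_hom(1)[OF cx_algebra_Uq]]])
 note C = counit_act_hom[OF cx_algebra_Uq]
 show "sweedler H (\<lambda>a b. counit H a \<odot>\<^bsub>H\<^esub> b) (comult H (ug a)) = ug a" for a
  by (cases a) (simp_all only: comult_ug comult_gen_values hom_add[OF C(1)] UU.tens_closed C(2) ug_closed UJ_closed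
    H.one_closed counit_ug u_counit_gen.simps hom_one[OF counit_hom'] counit_UJ cx_simps H.sm_one H.sm_0 H.l_zero H.r_zero)
qed (auto simp: alg_homs_def ring_hom_def lin_maps_def)

lemma counit_right_Uq: "h \<in> carrier H ==> sweedler H (\<lambda>a b. counit H b \<odot>\<^bsub>H\<^esub> a) (comult H h) = h"
proof -
 note [simp] = hom_add[OF counit_hom'] hom_sm[OF counit_hom'] hom_mult[OF counit_hom'] hom_one[OF counit_hom']
 have b: "bilin H H H (\<lambda>a b. counit H b \<odot>\<^bsub>H\<^esub> a)"
  by (intro bilinI lin_mapsI) (simp_all add: H.sm_add H.sm_distr H.sm_sm mult.commute)
 note L = UU.sweedler_lin[OF H.cvec_axioms b]
 have C: "sweedler H (\<lambda>a b. counit H b \<odot>\<^bsub>H\<^esub> a) \<in> alg_homs UT H"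
  by (rule UU.tensor_homI[OF L(1) cx_algebra_Uq]) (simp_all add: L(2) H.sm_sm mult.commute)
 show "h \<in> carrier H ==> sweedler H (\<lambda>a b. counit H b \<odot>\<^bsub>H\<^esub> a) (comult H h) = h"
 proof (rule uhom_unique[OF cx_algebra_Uq hom_comp[OF comult_hom' C]])
  show "sweedler H (\<lambda>a b. counit H b \<odot>\<^bsub>H\<^esub> a) (comult H (ug a)) = ug a" for a
   by (cases a) (simp_all only: comult_ug comult_gen_values hom_add[OF C(1)] UU.tens_closed L(2) ug_closed UJ_closed
    H.one_closed counit_ug u_counit_gen.simps hom_one[OF counit_hom'] counit_UJ cx_simps H.sm_one H.sm_0 H.l_zero H.r_zero)
 qed (auto simp: alg_homs_def ring_hom_def lin_maps_def)
qed

lemma antipode_closed [simp]: "a \<in> carrier H ==> antipode H a \<in> carrier H"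
 using hom_closed[OF antipode_hom] by simp

lemma antipode_lin: "antipode H \<in> lin_maps H H"
 using hom_lin[OF antipode_hom] by (simp add: lin_maps_def)

lemma antipode_mult: "a \<in> carrier H ==> b \<in> carrier H ==>
  antipode H (a \<otimes>\<^bsub>H\<^esub> b) = antipode H b \<otimes>\<^bsub>H\<^esub> antipode H a"
 using hom_mult[OF antipode_hom] by simp

lemma antipode_one: "antipode H \<one>\<^bsub>H\<^esub> = \<one>\<^bsub>H\<^esub>"
 using hom_one[OF antipode_hom] by simp

lemma bilin_antipode:
 "bilin H H H (\<lambda>a b. antipode H a \<otimes>\<^bsub>H\<^esub> b)"
 "bilin H H H (\<lambda>a b. a \<otimes>\<^bsub>H\<^esub> antipode H b)"
 by (intro bilinI lin_mapsI; simp add: lin_add[OF antipode_lin] lin_sm[OF antipode_lin] H.l_distr H.r_distr)+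

text \<open>The map taking h to S(h') h'' is not an algebra morphism, so an identity on generators
  does not extend by itself. But S reverses products: in the image of a product the inner factor
  collapses to its counit, a scalar that can be pulled out.\<close>

lemma antipode_axioms:
 assumes "h \<in> carrier H"
 shows "sweedler H (\<lambda>a b. antipode H a \<otimes>\<^bsub>H\<^esub> b) (comult H h) = counit H h \<odot>\<^bsub>H\<^esub> \<one>\<^bsub>H\<^esub>"
  (is "?L h = _")
  and "sweedler H (\<lambda>a b. a \<otimes>\<^bsub>H\<^esub> antipode H b) (comult H h) = counit H h \<odot>\<^bsub>H\<^esub> \<one>\<^bsub>H\<^esub>"
  (is "?R h = _")
proof -
 let ?l = "\<lambda>a b. antipode H a \<otimes>\<^bsub>H\<^esub> b" and ?r = "\<lambda>a b. a \<otimes>\<^bsub>H\<^esub> antipode H b"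
 note SL = UU.sweedler_lin[OF H.cvec_axioms bilin_antipode(1)] and SR = UU.sweedler_lin[OF H.cvec_axioms bilin_antipode(2)]
 note c = hom_closed[OF comult_hom']
 note e = hom_add[OF counit_hom'] hom_sm[OF counit_hom'] hom_mult[OF counit_hom'] hom_one[OF counit_hom']
 note U = ucondD[OF cx_algebra_Uq ucond_Uq]
 have neg: "(- 1) \<odot>\<^bsub>H\<^esub> x \<oplus>\<^bsub>H\<^esub> x = \<zero>\<^bsub>H\<^esub>" "x \<oplus>\<^bsub>H\<^esub> (- 1) \<odot>\<^bsub>H\<^esub> x = \<zero>\<^bsub>H\<^esub>" if "x \<in> carrier H" for x
  using that by (simp_all add: H.sm_neg H.l_neg H.r_neg)
 have gL: "?L (ug a) = counit H (ug a) \<odot>\<^bsub>H\<^esub> \<one>\<^bsub>H\<^esub>" for a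
  by (cases a) (simp_all add: comult_ug comult_gen_values lin_add[OF SL(1)] UU.tens_closed SL(2) antipode_ug antipode_gen_values
    antipode_one antipode_UJ counit_ug U H.m_assoc neg del: u_antipode_gen.simps comult_gen.simps)
 have gR: "?R (ug a) = counit H (ug a) \<odot>\<^bsub>H\<^esub> \<one>\<^bsub>H\<^esub>" for a
 proof (cases a)
  case gF
  have "UJ \<otimes>\<^bsub>H\<^esub> (ug gK \<otimes>\<^bsub>H\<^esub> ug gF) = ug gF" by (simp add: U flip: H.m_assoc)
  then show ?thesis using gF
   by (simp add: comult_ug comult_gen_values lin_add[OF SR(1)] UU.tens_closed SR(2) antipode_ug antipode_gen_values
    antipode_one antipode_UJ counit_ug U neg del: u_antipode_gen.simps comult_gen.simps)
 qed (simp_all add: comult_ug comult_gen_values lin_add[OF SR(1)] UU.tens_closed SR(2) antipode_ug antipode_gen_values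
    antipode_one antipode_UJ counit_ug U H.m_assoc neg del: u_antipode_gen.simps comult_gen.simps)
 have multL: "sweedler H ?l (s \<otimes>\<^bsub>UT\<^esub> t) = c \<odot>\<^bsub>H\<^esub> sweedler H ?l t"
  if s: "s \<in> carrier UT" "sweedler H ?l s = c \<odot>\<^bsub>H\<^esub> \<one>\<^bsub>H\<^esub>" and t: "t \<in> carrier UT" for s t c
  using t
 proof (induction rule: UU.tensor_induct)
  case (tens a b)
  have "sweedler H ?l (s \<otimes>\<^bsub>UT\<^esub> tens H H a b) = antipode H a \<otimes>\<^bsub>H\<^esub> sweedler H ?l s \<otimes>\<^bsub>H\<^esub> b"
   using s(1)
  proof (induction rule: UU.tensor_induct)
   case (tens a' b')
   then show ?case using \<open>a \<in> _\<close> \<open>b \<in> _\<close> by (simp add: UU.tens_mult SL(2) antipode_mult H.m_assoc)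
  qed (use \<open>a \<in> _\<close> \<open>b \<in> _\<close> in \<open>simp add: UU.TA.l_distr UU.tens_closed lin_add[OF SL(1)] lin_closed[OF SL(1)] H.l_distr H.r_distr\<close>)
  then show ?case using s tens by (simp add: SL(2))
 qed (use s in \<open>simp add: UU.TA.r_distr lin_add[OF SL(1)] lin_closed[OF SL(1)] H.sm_distr\<close>)
 have multR: "sweedler H ?r (t \<otimes>\<^bsub>UT\<^esub> s) = c \<odot>\<^bsub>H\<^esub> sweedler H ?r t"
  if s: "s \<in> carrier UT" "sweedler H ?r s = c \<odot>\<^bsub>H\<^esub> \<one>\<^bsub>H\<^esub>" and t: "t \<in> carrier UT" for s t c
  using t
 proof (induction rule: UU.tensor_induct)
  case (tens a b)
  have "sweedler H ?r (tens H H a b \<otimes>\<^bsub>UT\<^esub> s) = a \<otimes>\<^bsub>H\<^esub> sweedler H ?r s \<otimes>\<^bsub>H\<^esub> antipode H b"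
   using s(1)
  proof (induction rule: UU.tensor_induct)
   case (tens a' b')
   then show ?case using \<open>a \<in> _\<close> \<open>b \<in> _\<close> by (simp add: UU.tens_mult SR(2) antipode_mult H.m_assoc)
  qed (use \<open>a \<in> _\<close> \<open>b \<in> _\<close> in \<open>simp add: UU.TA.r_distr UU.tens_closed lin_add[OF SR(1)] lin_closed[OF SR(1)] H.l_distr H.r_distr\<close>)
  then show ?case using s tens by (simp add: SR(2))
 qed (use s in \<open>simp add: UU.TA.l_distr lin_add[OF SR(1)] lin_closed[OF SR(1)] H.sm_distr\<close>)
 have "?L h = counit H h \<odot>\<^bsub>H\<^esub> \<one>\<^bsub>H\<^esub> \<and> ?R h = counit H h \<odot>\<^bsub>H\<^esub> \<one>\<^bsub>H\<^esub>"
  using generated_Uq cx_algebra_Uq assms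
 proof (induction rule: generated_induct)
  case one
  then show ?case by (simp add: hom_one[OF comult_hom'] UU.one_tens SL(2) SR(2) antipode_one e)
 next
  case (mult a h)
  show ?case
  proof
   have "?L (ug a \<otimes>\<^bsub>H\<^esub> h) = counit H (ug a) \<odot>\<^bsub>H\<^esub> ?L h"
    unfolding hom_mult[OF comult_hom' ug_closed mult(2)] by (rule multL[OF c gL c]) (simp_all add: mult)
   then show "?L (ug a \<otimes>\<^bsub>H\<^esub> h) = counit H (ug a \<otimes>\<^bsub>H\<^esub> h) \<odot>\<^bsub>H\<^esub> \<one>\<^bsub>H\<^esub>"
    using mult by (simp add: e H.sm_sm)
   \<comment> \<open>With S on the right leg the inner factor is the coproduct of \<open>h\<close>:
     the induction hypothesis collapses it, and the generator is what remains.\<close>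
   have "?R (ug a \<otimes>\<^bsub>H\<^esub> h) = counit H h \<odot>\<^bsub>H\<^esub> ?R (ug a)"
    unfolding hom_mult[OF comult_hom' ug_closed mult(2)] by (rule multR[OF c _ c]) (simp_all add: mult)
   then show "?R (ug a \<otimes>\<^bsub>H\<^esub> h) = counit H (ug a \<otimes>\<^bsub>H\<^esub> h) \<odot>\<^bsub>H\<^esub> \<one>\<^bsub>H\<^esub>"
    using mult by (simp add: e H.sm_sm gR mult.commute)
  qed
 qed (simp_all add: hom_add[OF comult_hom'] hom_sm[OF comult_hom'] c lin_add[OF SL(1)] lin_add[OF SR(1)] lin_sm[OF SL(1)] lin_sm[OF SR(1)]
   e H.sm_add H.sm_sm)
 then show "?L h = counit H h \<odot>\<^bsub>H\<^esub> \<one>\<^bsub>H\<^esub>" "?R h = counit H h \<odot>\<^bsub>H\<^esub> \<one>\<^bsub>H\<^esub>" by auto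
qed

lemma coassoc_Uq:
 assumes "h \<in> carrier H"
 shows "sweedler (tensor H UT) (assl H) (comult H h)
   = sweedler (tensor H UT) (\<lambda>a b. tens H UT a (comult H b)) (comult H h)"
proof (rule coassoc_from_gens[OF cx_algebra_Uq comult_hom' generated_Uq _ assms])
 fix a
 interpret T3: tensor_algs "H" UT by (rule tensor_algsI[OF cx_algebra_Uq UU.cx_algebra_tensor])
 note L = assl_hom[OF cx_algebra_Uq] and R = tens_coact_hom[OF cx_algebra_Uq comult_hom']
 show "sweedler (tensor H UT) (assl H) (comult H (ug a))
   = sweedler (tensor H UT) (\<lambda>a b. tens H UT a (comult H b)) (comult H (ug a))"
  by (cases a) (simp_all add: comult_ug comult_gen_values hom_add[OF L(1)] hom_add[OF R(1)] UU.tens_closed L(2) R(2)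
   assl_values[OF cx_algebra_Uq] hom_one[OF comult_hom'] UU.one_tens comult_UJ T3.tens_add_right T3.tens_closed T3.T.Q.a_assoc del: comult_gen.simps)
qed

lemma hopf_Uq: "hopf_algebra H"
 by (intro hopf_algebra.intro hopf_algebra_axioms.intro cx_algebra_Uq comult_hom' counit_hom' antipode_lin
   counit_left_Uq counit_right_Uq antipode_axioms coassoc_Uq[unfolded assl_def])

end

section \<open>A criterion for Yetter--Drinfeld module algebras\<close>

text \<open>Compatibility of the action with products is required for multiplication by generators,
  as relations between operators on \<open>X\<close>; the coaction is prescribed on generators as
  well. The remaining axioms are derived from this.\<close>

locale yd_data = uq p q s g + X: cx_algebra X
 for p q s g and X :: "((ugen list \<Rightarrow>\<^sub>0 complex) set, 'x, 'n) yd_scheme" +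
 fixes I :: "nat set" and x :: "nat => 'x"
 assumes gen: "generated_by X I x"
  and act_lin: "h \<in> carrier H ==> act X h \<in> lin_maps X X"
  and act_lin': "y \<in> carrier X ==> (\<lambda>h. act X h y) \<in> lin_maps H X"
  and act_1: "y \<in> carrier X ==> act X \<one>\<^bsub>H\<^esub> y = y"
  and act_m: "h \<in> carrier H ==> h' \<in> carrier H ==> y \<in> carrier X ==>
   act X (h \<otimes>\<^bsub>H\<^esub> h') y = act X h (act X h' y)"
  and sm: "scond (End X) I (\<lambda>i. lmul X (x i)) (\<lambda>a. restrict (act X (ug a)) (carrier X))"
  and act_unit: "act X (ug a) \<one>\<^bsub>X\<^esub> = counit H (ug a) \<odot>\<^bsub>X\<^esub> \<one>\<^bsub>X\<^esub>"
  and coact_hom: "coact X \<in> alg_homs X (tensor H X)"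
  and coact_x: "i \<in> I ==> coact X (x i) =
   coact_gen (tensor H X) (\<lambda>a. tens H X (ug a) \<one>\<^bsub>X\<^esub>) (\<lambda>i. tens H X \<one>\<^bsub>H\<^esub> (x i)) i"
begin

abbreviation "TX' \<equiv> tensor H X"

lemma X: "cx_algebra X" ..

sublocale T: tensor_algs "H" X by unfold_locales

lemma x_closed [simp]: "i \<in> I ==> x i \<in> carrier X"
 using gen by (auto simp: generated_by_def)

lemma act_closed [simp]: "h \<in> carrier H ==> y \<in> carrier X ==> act X h y \<in> carrier X"
 by (rule lin_closed[OF act_lin])

lemma act_one: "h \<in> carrier H ==> act X h \<one>\<^bsub>X\<^esub> = counit H h \<odot>\<^bsub>X\<^esub> \<one>\<^bsub>X\<^esub>"
 using generated_Uq cx_algebra_Uq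
proof (induction rule: generated_induct)
 case one then show ?case by (simp add: act_1 hom_one[OF counit_hom'])
qed (simp_all add: act_m act_unit lin_add[OF act_lin'] lin_sm[OF act_lin'] lin_sm[OF act_lin] hom_mult[OF counit_hom'] hom_add[OF counit_hom']
   hom_sm[OF counit_hom'] X.sm_add X.sm_sm mult.commute)

abbreviation "rho \<equiv> \<lambda>h. restrict (act X h) (carrier X)"

lemma rho_hom: "rho \<in> alg_homs H (End X)"
 by (rule end_hom[OF X.cvec_axioms cx_algebra_Uq act_lin act_lin' act_m act_1])

lemma EX: "cx_algebra (End X)" by (rule cx_algebra_end[OF X.cvec_axioms])

abbreviation "AE \<equiv> act X (ug gE)" abbreviation "AK \<equiv> act X (ug gK)"
abbreviation "AF \<equiv> act X (ug gF)" abbreviation "AJ \<equiv> act X UJ"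

lemma rho_UJ: "kinv (End X) (rho (ug gK)) = rho UJ"
 using kinv_hom[OF rho_hom cx_algebra_Uq EX ug_closed] by simp

lemma act_rules:
 assumes i: "i \<in> I" and y: "y \<in> carrier X"
 shows "AK (x i \<otimes>\<^bsub>X\<^esub> y) = (if odd i then s ^ 2 else q ^ 2) \<odot>\<^bsub>X\<^esub> (x i \<otimes>\<^bsub>X\<^esub> AK y)"
  "AJ (x i \<otimes>\<^bsub>X\<^esub> y) = (if odd i then q ^ 2 else s ^ 2) \<odot>\<^bsub>X\<^esub> (x i \<otimes>\<^bsub>X\<^esub> AJ y)"
  "AE (x i \<otimes>\<^bsub>X\<^esub> y) = (if odd i then AK y else (- q) \<odot>\<^bsub>X\<^esub> (x i \<otimes>\<^bsub>X\<^esub> (x i \<otimes>\<^bsub>X\<^esub> AK y))) \<oplus>\<^bsub>X\<^esub> x i \<otimes>\<^bsub>X\<^esub> AE y"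
  "AF (x i \<otimes>\<^bsub>X\<^esub> y) = (if odd i then (- q) \<odot>\<^bsub>X\<^esub> (x i \<otimes>\<^bsub>X\<^esub> (x i \<otimes>\<^bsub>X\<^esub> y)) else y) \<oplus>\<^bsub>X\<^esub>
    (if odd i then q ^ 2 else s ^ 2) \<odot>\<^bsub>X\<^esub> (x i \<otimes>\<^bsub>X\<^esub> AF y)"
proof -
 interpret E: cx_algebra "End X" by (rule EX)
 have c: "rho (ug a) \<in> carrier (End X)" "rho UJ \<in> carrier (End X)" "lmul X (x i) \<in> carrier (End X)" for a
  using hom_closed[OF rho_hom] hom_closed[OF lmul_hom[OF X]] i by simp_all
 note app = end_simps[OF y] end_simps[OF act_closed] end_simps[OF X.m_closed] lmul_apply
 have uc: "ucond (End X) (\<lambda>a. rho (ug a))" using sm by (simp add: scond_def)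
 note U = ucondD[OF EX uc, unfolded rho_UJ]
 have sq: "s ^ 2 * q ^ 2 = 1" "q ^ 2 * s ^ 2 = 1" using qs by (metis mult.commute power_mult_distrib power_one)+
 have cr: "if odd i then dcross (End X) (\<lambda>a. rho (ug a)) (lmul X (x i)) else zcross (End X) (\<lambda>a. rho (ug a)) (lmul X (x i))"
  using sm i by (simp add: scond_def)
 have J: "rho UJ \<otimes>\<^bsub>End X\<^esub> lmul X (x i) = (if odd i then q ^ 2 else s ^ 2) \<odot>\<^bsub>End X\<^esub> (lmul X (x i) \<otimes>\<^bsub>End X\<^esub> rho UJ)"
  using cr by (intro kinv_qcomm[OF EX c(1) c(2) U(3,4) _ _ c(3), where c = "if odd i then s ^ 2 else q ^ 2"])
   (auto simp: dcross_def zcross_def sq split: if_splits)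
 have at: "!!f g. f = g ==> f y = g y" by simp
 show "AK (x i \<otimes>\<^bsub>X\<^esub> y) = (if odd i then s ^ 2 else q ^ 2) \<odot>\<^bsub>X\<^esub> (x i \<otimes>\<^bsub>X\<^esub> AK y)"
  "AE (x i \<otimes>\<^bsub>X\<^esub> y) = (if odd i then AK y else (- q) \<odot>\<^bsub>X\<^esub> (x i \<otimes>\<^bsub>X\<^esub> (x i \<otimes>\<^bsub>X\<^esub> AK y))) \<oplus>\<^bsub>X\<^esub> x i \<otimes>\<^bsub>X\<^esub> AE y"
  "AF (x i \<otimes>\<^bsub>X\<^esub> y) = (if odd i then (- q) \<odot>\<^bsub>X\<^esub> (x i \<otimes>\<^bsub>X\<^esub> (x i \<otimes>\<^bsub>X\<^esub> y)) else y) \<oplus>\<^bsub>X\<^esub>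
    (if odd i then q ^ 2 else s ^ 2) \<odot>\<^bsub>X\<^esub> (x i \<otimes>\<^bsub>X\<^esub> AF y)"
  using cr i y by (auto simp: dcross_def zcross_def app X.m_assoc split: if_splits dest!: at)
 show "AJ (x i \<otimes>\<^bsub>X\<^esub> y) = (if odd i then q ^ 2 else s ^ 2) \<odot>\<^bsub>X\<^esub> (x i \<otimes>\<^bsub>X\<^esub> AJ y)"
  using at[OF J] i y by (simp add: app)
qed

lemma unit_rules: "AK \<one>\<^bsub>X\<^esub> = \<one>\<^bsub>X\<^esub>" "AJ \<one>\<^bsub>X\<^esub> = \<one>\<^bsub>X\<^esub>" "AE \<one>\<^bsub>X\<^esub> = \<zero>\<^bsub>X\<^esub>" "AF \<one>\<^bsub>X\<^esub> = \<zero>\<^bsub>X\<^esub>"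
 by (simp_all add: act_one counit_ug counit_UJ)

text \<open>A representation of the smash product of \<open>X\<close> and the quantum group: it suffices to know the
 commutation relations of the generators.\<close>

lemma smash_rep:
 fixes C :: "(complex, 'c, 'k) module_scheme"
 assumes C: "cx_algebra C" and l: "l \<in> alg_homs X C" and r: "r \<in> alg_homs H C"
  and cr: "!!i. i \<in> I ==> if odd i then dcross C (\<lambda>a. r (ug a)) (l (x i)) else zcross C (\<lambda>a. r (ug a)) (l (x i))"
  and h: "h \<in> carrier H" and y: "y \<in> carrier X"
 shows "r h \<otimes>\<^bsub>C\<^esub> l y = sweedler C (\<lambda>h' h''. l (act X h' y) \<otimes>\<^bsub>C\<^esub> r h'') (comult H h)"
proof -
 interpret C: cx_algebra C by fact
 have lc [simp]: "!!y. y \<in> carrier X ==> l y \<in> carrier C" by (rule hom_closed[OF l])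
 have rc [simp]: "!!h. h \<in> carrier H ==> r h \<in> carrier C" by (rule hom_closed[OF r])
 note lr = hom_mult[OF l] hom_add[OF l] hom_sm[OF l] hom_one[OF l] hom_mult[OF r] hom_add[OF r] hom_sm[OF r] hom_one[OF r]
 note al = lin_add[OF act_lin] lin_sm[OF act_lin]
 have uc: "ucond C (\<lambda>a. r (ug a))" by (rule hom_ucond[OF r cx_algebra_Uq C ucond_Uq])
 note U = ucondD[OF C uc]
 have rJ: "kinv C (r (ug gK)) = r UJ" by (rule kinv_hom[OF r cx_algebra_Uq C ug_closed, symmetric])
 have sq: "s ^ 2 * q ^ 2 = 1" "q ^ 2 * s ^ 2 = 1" using qs by (metis mult.commute power_mult_distrib power_one)+
 have cK: "r (ug gK) \<otimes>\<^bsub>C\<^esub> l (x i) = (if odd i then s ^ 2 else q ^ 2) \<odot>\<^bsub>C\<^esub> (l (x i) \<otimes>\<^bsub>C\<^esub> r (ug gK))"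
  and cE: "r (ug gE) \<otimes>\<^bsub>C\<^esub> l (x i) = (if odd i then r (ug gK) else (- q) \<odot>\<^bsub>C\<^esub> (l (x i) \<otimes>\<^bsub>C\<^esub> l (x i) \<otimes>\<^bsub>C\<^esub> r (ug gK))) \<oplus>\<^bsub>C\<^esub> l (x i) \<otimes>\<^bsub>C\<^esub> r (ug gE)"
  and cF: "r (ug gF) \<otimes>\<^bsub>C\<^esub> l (x i) = (if odd i then (- q) \<odot>\<^bsub>C\<^esub> (l (x i) \<otimes>\<^bsub>C\<^esub> l (x i)) else \<one>\<^bsub>C\<^esub>) \<oplus>\<^bsub>C\<^esub> (if odd i then q ^ 2 else s ^ 2) \<odot>\<^bsub>C\<^esub> (l (x i) \<otimes>\<^bsub>C\<^esub> r (ug gF))"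
  if "i \<in> I" for i
  using cr[OF that] by (auto simp: dcross_def zcross_def split: if_splits)
 have cJ: "r UJ \<otimes>\<^bsub>C\<^esub> l (x i) = (if odd i then q ^ 2 else s ^ 2) \<odot>\<^bsub>C\<^esub> (l (x i) \<otimes>\<^bsub>C\<^esub> r UJ)" if "i \<in> I" for i
  using cK[OF that] that by (intro kinv_qcomm[OF C rc[OF ug_closed] _ U(3,4)[unfolded rJ] _ _ lc[OF x_closed], where c = "if odd i then s ^ 2 else q ^ 2"])
   (auto simp: sq)
 have K: "r (ug gK) \<otimes>\<^bsub>C\<^esub> l y = l (AK y) \<otimes>\<^bsub>C\<^esub> r (ug gK)" if "y \<in> carrier X" for y
  using gen X that
  by (induction rule: generated_induct)
   (simp_all add: unit_rules act_rules lr al C.l_distr C.r_distr C.m_assoc cK[THEN C.cont])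
 have E: "r (ug gE) \<otimes>\<^bsub>C\<^esub> l y = l (AE y) \<otimes>\<^bsub>C\<^esub> r (ug gK) \<oplus>\<^bsub>C\<^esub> l y \<otimes>\<^bsub>C\<^esub> r (ug gE)" if "y \<in> carrier X" for y
  using gen X that
 proof (induction rule: generated_induct)
  case (add a b)
  then show ?case by (simp add: lr al C.l_distr C.r_distr C.a_assoc C.a_lcomm)
 qed (simp_all add: unit_rules act_rules lr al C.l_distr C.r_distr C.m_assoc cE[THEN C.cont] K C.sm_distr C.a_assoc
    lin_zero[OF hom_lin[OF l] X.cvec_axioms C.cvec_axioms])
 have F: "r (ug gF) \<otimes>\<^bsub>C\<^esub> l y = l (AF y) \<oplus>\<^bsub>C\<^esub> l (AJ y) \<otimes>\<^bsub>C\<^esub> r (ug gF)" if "y \<in> carrier X" for y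
  using gen X that
 proof (induction rule: generated_induct)
  case (add a b)
  then show ?case by (simp add: lr al C.l_distr C.r_distr C.a_assoc C.a_lcomm)
 qed (simp_all add: unit_rules act_rules lr al C.l_distr C.r_distr C.m_assoc cF[THEN C.cont] C.sm_distr C.a_assoc
    lin_zero[OF hom_lin[OF l] X.cvec_axioms C.cvec_axioms])
 define B where "B y = (\<lambda>h' h''. l (act X h' y) \<otimes>\<^bsub>C\<^esub> r h'')" for y
 have bil: "bilin H H C (B y)" if "y \<in> carrier X" for y
  unfolding B_def using that
  by (intro bilinI lin_mapsI) (simp_all add: lr lin_add[OF act_lin'] lin_sm[OF act_lin'] C.l_distr C.r_distr)
 note S = UU.sweedler_lin[OF C.cvec_axioms bil]
 have cc: "!!h. h \<in> carrier H ==> comult H h \<in> carrier UT" by (rule hom_closed[OF comult_hom'])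
 have gens: "r (ug a) \<otimes>\<^bsub>C\<^esub> l y = sweedler C (B y) (comult H (ug a))" if "y \<in> carrier X" for a y
  by (cases a; simp add: that K E F comult_ug comult_gen_values lin_add[OF S(1)] UU.tens_closed S(2) del: comult_gen.simps;
    simp add: that B_def lr act_1)
 \<comment> \<open>Multiplying from the right by u \<otimes> v replaces \<open>y\<close> by
   \<open>act X u y\<close> and appends \<open>r v\<close>, so the case of a generator, at that
   element, gives the claim.\<close>
 have step: "sweedler C (B y) (comult H (ug a) \<otimes>\<^bsub>UT\<^esub> t) = r (ug a) \<otimes>\<^bsub>C\<^esub> sweedler C (B y) t"
  if y: "y \<in> carrier X" and t: "t \<in> carrier UT" for a y t
  using t
 proof (induction rule: UU.tensor_induct)
  case (tens u v)
  have "sweedler C (B y) (s \<otimes>\<^bsub>UT\<^esub> tens H H u v) = sweedler C (B (act X u y)) s \<otimes>\<^bsub>C\<^esub> r v" if "s \<in> carrier UT" for s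
   using that
  proof (induction rule: UU.tensor_induct)
   case (tens u' v')
   then show ?case using \<open>u \<in> _\<close> \<open>v \<in> _\<close> y by (simp add: UU.tens_mult S(2)) (simp add: B_def act_m lr C.m_assoc)
  qed (use \<open>u \<in> _\<close> \<open>v \<in> _\<close> y in \<open>simp add: UU.TA.l_distr UU.tens_closed lin_add[OF S(1)] lin_closed[OF S(1)] C.l_distr\<close>)
  from this[OF cc[OF ug_closed]] show ?case using tens y gens[of "act X u y" a, symmetric]
   by (simp add: S(2)) (simp add: B_def C.m_assoc)
 qed (use y cc[OF ug_closed] in \<open>simp add: UU.TA.r_distr lin_add[OF S(1)] lin_closed[OF S(1)] C.r_distr\<close>)
 have "\<forall>y\<in>carrier X. r h \<otimes>\<^bsub>C\<^esub> l y = sweedler C (B y) (comult H h)"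
  using generated_Uq cx_algebra_Uq h
 proof (induction rule: generated_induct)
  case one
  show ?case by (simp add: hom_one[OF comult_hom'] UU.one_tens S(2)) (simp add: B_def act_1 lr)
 next
  case (mult a h)
  then show ?case by (simp add: hom_mult[OF comult_hom'] step cc lr C.m_assoc)
 qed (simp_all add: lr hom_add[OF comult_hom'] hom_sm[OF comult_hom'] lin_add[OF S(1)] lin_sm[OF S(1)] cc C.l_distr)
 then show ?thesis using y by (simp add: B_def)
qed

text \<open>The smash-product rule for the left multiplications and the action operators on
  \<open>X\<close> itself, evaluated at \<open>z\<close>.\<close>

lemma module_alg:
 assumes h: "h \<in> carrier H" and y: "y \<in> carrier X" and z: "z \<in> carrier X"
 shows "act X h (y \<otimes>\<^bsub>X\<^esub> z) = sweedler X (\<lambda>h' h''. act X h' y \<otimes>\<^bsub>X\<^esub> act X h'' z) (comult H h)"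
proof -
 interpret E: cx_algebra "End X" by (rule EX)
 have lc: "!!y. y \<in> carrier X ==> lmul X y \<in> carrier (End X)" by (rule hom_closed[OF lmul_hom[OF X]])
 have rc: "!!h. h \<in> carrier H ==> rho h \<in> carrier (End X)" by (rule hom_closed[OF rho_hom])
 have b: "bilin H H (End X) (\<lambda>h' h''. lmul X (act X h' y) \<otimes>\<^bsub>End X\<^esub> rho h'')"
  using y lc rc by (intro bilinI lin_mapsI)
   (simp_all add: lin_add[OF act_lin'] lin_sm[OF act_lin'] hom_add[OF lmul_hom[OF X]] hom_sm[OF lmul_hom[OF X]] hom_add[OF rho_hom] hom_sm[OF rho_hom] E.l_distr E.r_distr)
 have "rho h \<otimes>\<^bsub>End X\<^esub> lmul X y = sweedler (End X) (\<lambda>h' h''. lmul X (act X h' y) \<otimes>\<^bsub>End X\<^esub> rho h'') (comult H h)"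
  by (rule smash_rep[OF EX lmul_hom[OF X] rho_hom _ h y]) (use sm in \<open>simp add: scond_def\<close>)
 then have "(rho h \<otimes>\<^bsub>End X\<^esub> lmul X y) z = (sweedler (End X) (\<lambda>h' h''. lmul X (act X h' y) \<otimes>\<^bsub>End X\<^esub> rho h'') (comult H h)) z"
  by simp
 also have "... = sweedler X (\<lambda>h' h''. (lmul X (act X h' y) \<otimes>\<^bsub>End X\<^esub> rho h'') z) (comult H h)"
  by (rule UU.lin_sweedler[OF end_eval_lin[OF z] E.cvec_axioms X.cvec_axioms b hom_closed[OF comult_hom' h]])
 also have "... = sweedler X (\<lambda>h' h''. act X h' y \<otimes>\<^bsub>X\<^esub> act X h'' z) (comult H h)"
 proof (rule UU.sweedler_cong[OF X.cvec_axioms _ _ hom_closed[OF comult_hom' h], symmetric])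
  show "bilin H H X (\<lambda>h' h''. act X h' y \<otimes>\<^bsub>X\<^esub> act X h'' z)"
   using y z by (intro bilinI lin_mapsI) (simp_all add: lin_add[OF act_lin'] lin_sm[OF act_lin'] X.l_distr X.r_distr)
 qed (use y z in \<open>simp add: end_simps lmul_apply\<close>)
 finally show ?thesis using y z by (simp add: end_simps lmul_apply)
qed

lemma coassoc_X:
 assumes "y \<in> carrier X"
 shows "sweedler (tensor H TX') (assl X) (coact X y)
   = sweedler (tensor H TX') (\<lambda>a b. tens H TX' a (coact X b)) (coact X y)"
proof (rule coassoc_from_gens[OF X coact_hom gen _ assms])
 fix i assume i: "i \<in> I"
 interpret T3: tensor_algs "H" TX' by (rule tensor_algsI[OF cx_algebra_Uq T.cx_algebra_tensor])
 note L = assl_hom[OF X] and R = tens_coact_hom[OF X coact_hom]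
 note JT = tensor_left_ucond(2)[OF X]
 show "sweedler (tensor H TX') (assl X) (coact X (x i))
   = sweedler (tensor H TX') (\<lambda>a b. tens H TX' a (coact X b)) (coact X (x i))"
  using i by (cases "odd i") (simp_all add: coact_x coact_gen_def twist_def JT T.tens_mult hom_add[OF L(1)] hom_add[OF R(1)] hom_sm[OF L(1)] hom_sm[OF R(1)]
   T.tens_closed L(2) R(2) assl_values[OF X] hom_one[OF coact_hom] T.one_tens T3.tens_add_right T3.tens_sm_right T3.tens_closed
   T3.T.Q.a_assoc T3.T.Q.a_comm T3.T.Q.a_lcomm T3.T.Q.sm_distr)
qed

lemma counit_X:
 assumes "y \<in> carrier X"
 shows "sweedler X (\<lambda>a x0. counit H a \<odot>\<^bsub>X\<^esub> x0) (coact X y) = y"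
proof -
 note C = counit_act_hom[OF X]
 note JT = tensor_left_ucond(2)[OF X]
 have "(\<lambda>y. y) \<in> alg_homs X X" by (auto simp: alg_homs_def ring_hom_def lin_maps_def)
 then show ?thesis
 proof (rule generated_hom_ext[OF gen X X hom_comp[OF coact_hom C(1)] _ _ assms])
  fix i assume i: "i \<in> I"
  show "sweedler X (\<lambda>a x0. counit H a \<odot>\<^bsub>X\<^esub> x0) (coact X (x i)) = x i"
   using i by (cases "odd i") (simp_all add: coact_x coact_gen_def twist_def JT T.tens_mult hom_add[OF C(1)] hom_sm[OF C(1)]
     T.tens_closed C(2) counit_ug counit_UJ hom_mult[OF counit_hom'])
 qed
qed

text \<open>Both sides are the value at 1 \<otimes> 1 of one operator identity on H \<otimes> X: the
  smash-product rule in which \<open>y\<close> acts by left multiplication with its coaction, and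
  \<open>h\<close> acts through its coproduct by left multiplication and action. On generators the
  required relations are supplied by \<open>smash\<close>.\<close>

lemma yd_X:
 assumes h: "h \<in> carrier H" and y: "y \<in> carrier X"
 shows "sweedler TX' (\<lambda>h' h''. sweedler TX' (\<lambda>a x0. tens H X (a \<otimes>\<^bsub>H\<^esub> h'') x0) (coact X (act X h' y))) (comult H h) =
   sweedler TX' (\<lambda>h' h''. sweedler TX' (\<lambda>a x0. tens H X (h' \<otimes>\<^bsub>H\<^esub> a) (act X h'' x0)) (coact X y)) (comult H h)"
proof -
 let ?C = "End TX'"
 interpret P: tprod "H" X TX' "tens H X" "\<lambda>x. x" by (rule tprod_tensor[OF H.cvec_axioms X.cvec_axioms])
 note TC = P.ET.cx_algebra_axioms
 define u where "u = (\<lambda>a. P.opL (lmul H (ug a)))"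
 define v where "v = (\<lambda>a. P.opR (rho (ug a)))"
 define w where "w = (\<lambda>i. P.opR (lmul X (x i)))"
 note LH = hom_comp[OF lmul_hom[OF cx_algebra_Uq] P.opL_hom] and RH = hom_comp[OF rho_hom P.opR_hom] and LX = lmul_hom[OF T.cx_algebra_tensor]
 have e: "lmul H a \<in> carrier (End H)" "rho a \<in> carrier (End X)" if "a \<in> carrier H" for a
  using hom_closed[OF lmul_hom[OF cx_algebra_Uq] that] hom_closed[OF rho_hom that] .
 have ex: "lmul X b \<in> carrier (End X)" if "b \<in> carrier X" for b
  using hom_closed[OF lmul_hom[OF X] that] .
 have uc: "ucond ?C u" unfolding u_def by (rule hom_ucond[OF LH cx_algebra_Uq TC ucond_Uq])
 have sc: "scond ?C I w v" unfolding v_def w_def by (rule hom_scond[OF P.opR_hom EX TC sm])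
 have comm: "v a \<otimes>\<^bsub>?C\<^esub> u b = u b \<otimes>\<^bsub>?C\<^esub> v a" for a b
  unfolding u_def v_def by (rule P.opLR_comm[symmetric]) (simp_all add: e)
 interpret S: upair p q s g ?C u v
  by unfold_locales (use sc comm in \<open>auto simp: uc scond_def\<close>)
 have sm': "scond ?C I (coact_gen ?C u w) (comult_gen ?C u v)"
  by (rule S.smash[OF sc]) (unfold u_def w_def, rule P.opLR_comm[symmetric], simp_all add: e ex)
 define l where "l y = lmul TX' (coact X y)" for y
 have l: "l \<in> alg_homs X ?C" unfolding l_def[abs_def] by (rule hom_comp[OF coact_hom LX])
 note TH = UU.tensor_hom[OF LH RH TC P.opLR_comm[OF e]]
 define Th where "Th = sweedler ?C (\<lambda>a b. P.opL (lmul H a) \<otimes>\<^bsub>?C\<^esub> P.opR (rho b))"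
 note Th = TH(1)[folded Th_def]
 have Th2: "Th (tens H H a b) = P.opL (lmul H a) \<otimes>\<^bsub>?C\<^esub> P.opR (rho b)"
  if "a \<in> carrier H" "b \<in> carrier H" for a b unfolding Th_def by (rule TH(2)[OF _ _ that]) (use that in auto)
 define r where "r h = Th (comult H h)" for h
 have r: "r \<in> alg_homs H ?C" unfolding r_def[abs_def] by (rule hom_comp[OF comult_hom' Th])
 have lt: "lmul TX' (tens H X a b) = P.opL (lmul H a) \<otimes>\<^bsub>?C\<^esub> P.opR (lmul X b)"
  if ab: "a \<in> carrier H" "b \<in> carrier X" for a b
  by (rule P.end_tp_ext)
   (use ab hom_closed[OF LX T.tens_closed[OF ab]] in \<open>simp_all add: P.opL_closed P.opR_closed e ex end_simps T.tens_closed P.opR_\<tau> P.opL_\<tau> lmul_apply T.tens_mult\<close>)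
 have one: "P.opR (lmul X \<one>\<^bsub>X\<^esub>) = \<one>\<^bsub>?C\<^esub>" "P.opL (lmul H \<one>\<^bsub>H\<^esub>) = \<one>\<^bsub>?C\<^esub>" "P.opR (rho \<one>\<^bsub>H\<^esub>) = \<one>\<^bsub>?C\<^esub>"
  using hom_one[OF hom_comp[OF lmul_hom[OF X] P.opR_hom]] hom_one[OF LH] hom_one[OF RH] by simp_all
 have uJ: "kinv ?C (u gK) = P.opL (lmul H UJ)"
  unfolding u_def by (rule kinv_hom[OF LH cx_algebra_Uq TC ug_closed, symmetric])
 have lx: "l (x i) = coact_gen ?C u w i" if i: "i \<in> I" for i
 proof -
  note JT = tensor_left_ucond(2)[OF X]
  show ?thesis using i
   by (cases "odd i") (simp_all add: l_def coact_x coact_gen_def twist_def JT T.tens_mult T.tens_closed hom_add[OF LX] hom_sm[OF LX] lt one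
     P.opL_closed P.opR_closed e ex uJ[unfolded u_def] u_def w_def hom_mult[OF LH])
 qed
 have rx: "r (ug a) = comult_gen ?C u v a" for a
  by (cases a) (simp_all add: r_def comult_ug comult_gen_values hom_add[OF Th] UU.tens_closed Th2 one P.opL_closed P.opR_closed e uJ[unfolded u_def] u_def v_def
    del: comult_gen.simps, simp_all add: u_def v_def uJ[unfolded u_def])
 have main: "r h \<otimes>\<^bsub>?C\<^esub> l y = sweedler ?C (\<lambda>h' h''. l (act X h' y) \<otimes>\<^bsub>?C\<^esub> r h'') (comult H h)"
  by (rule smash_rep[OF TC l r _ h y]) (use sm' in \<open>simp add: lx rx scond_def cong: if_cong\<close>)
 let ?one = "tens H X \<one>\<^bsub>H\<^esub> \<one>\<^bsub>X\<^esub>"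
 have o: "?one \<in> carrier TX'" by (simp add: T.tens_closed)
 have cc: "!!h. h \<in> carrier H ==> comult H h \<in> carrier UT" by (rule hom_closed[OF comult_hom'])
 have cy: "!!y. y \<in> carrier X ==> coact X y \<in> carrier TX'" by (rule hom_closed[OF coact_hom])
 have Thl: "(\<lambda>t. (Th t) z) \<in> lin_maps UT TX'" if "z \<in> carrier TX'" for z
  by (rule lin_comp[OF hom_lin[OF Th] end_eval_lin[OF that]])
 have act2: "bilin H X TX' (\<lambda>a x0. tens H X (h' \<otimes>\<^bsub>H\<^esub> a) (act X h'' x0))"
  if "h' \<in> carrier H" "h'' \<in> carrier H" for h' h''
  using that by (intro bilinI lin_mapsI)
   (simp_all add: T.tens_closed H.r_distr T.tens_add_left T.tens_add_right T.tens_sm_left T.tens_sm_right lin_add[OF act_lin] lin_sm[OF act_lin])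
 have rhs: "(Th t) z = sweedler TX' (\<lambda>h' h''. sweedler TX' (\<lambda>a x0. tens H X (h' \<otimes>\<^bsub>H\<^esub> a) (act X h'' x0)) z) t"
  if t: "t \<in> carrier UT" and z: "z \<in> carrier TX'" for t z
 proof (rule UU.sweedler_eq[OF Thl[OF z] T.T.cvec_Q _ t, symmetric])
  fix h' h'' assume hh: "h' \<in> carrier H" "h'' \<in> carrier H"
  have "P.opL (lmul H h') \<otimes>\<^bsub>?C\<^esub> P.opR (rho h'') \<in> carrier ?C" using hh by (simp add: P.opL_closed P.opR_closed e)
  from T.sweedler_eq[OF end_lin[OF this] T.T.cvec_Q _ z, of "\<lambda>a x0. tens H X (h' \<otimes>\<^bsub>H\<^esub> a) (act X h'' x0)"]
  show "(Th (tens H H h' h'')) z = sweedler TX' (\<lambda>a x0. tens H X (h' \<otimes>\<^bsub>H\<^esub> a) (act X h'' x0)) z"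
   using hh by (simp add: Th2 end_simps T.tens_closed P.opL_closed P.opR_closed e P.opL_\<tau> P.opR_\<tau> lmul_apply)
 qed
 \<comment> \<open>The second leg acts on the unit of \<open>X\<close> by its counit, so the counit
   axiom returns \<open>h\<close>.\<close>
 have r1: "r h ?one = tens H X h \<one>\<^bsub>X\<^esub>" if h: "h \<in> carrier H" for h
 proof -
  have lin: "(\<lambda>a. tens H X a \<one>\<^bsub>X\<^esub>) \<in> lin_maps H TX'" by (rule hom_lin[OF T.tens_left_hom])
  have b: "bilin H H H (\<lambda>a b. counit H b \<odot>\<^bsub>H\<^esub> a)"
   by (intro bilinI lin_mapsI) (simp_all add: H.sm_add H.sm_distr H.sm_sm mult.commute hom_add[OF counit_hom'] hom_sm[OF counit_hom'])
  have "tens H X h \<one>\<^bsub>X\<^esub> = tens H X (sweedler H (\<lambda>a b. counit H b \<odot>\<^bsub>H\<^esub> a) (comult H h)) \<one>\<^bsub>X\<^esub>"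
   by (simp add: counit_right_Uq h)
  also have "... = sweedler TX' (\<lambda>a b. tens H X (counit H b \<odot>\<^bsub>H\<^esub> a) \<one>\<^bsub>X\<^esub>) (comult H h)"
   by (rule UU.lin_sweedler[OF lin H.cvec_axioms T.T.cvec_Q b cc[OF h]])
  also have "... = Th (comult H h) ?one"
   by (rule UU.sweedler_eq[OF Thl[OF o] T.T.cvec_Q _ cc[OF h]])
    (simp add: Th2 end_simps o T.tens_closed P.opL_closed P.opR_closed e P.opL_\<tau> P.opR_\<tau> lmul_apply act_one T.tens_sm_left T.tens_sm_right lin_sm[OF end_lin[OF P.opL_closed[OF e(1)]]])
  finally show ?thesis by (simp add: r_def)
 qed
 have lc: "l z \<in> carrier ?C" if "z \<in> carrier X" for z by (rule hom_closed[OF l that])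
 have rc: "r z \<in> carrier ?C" if "z \<in> carrier H" for z by (rule hom_closed[OF r that])
 have b: "bilin H H ?C (\<lambda>h' h''. l (act X h' y) \<otimes>\<^bsub>?C\<^esub> r h'')"
  using y lc rc by (intro bilinI lin_mapsI)
   (simp_all add: lin_add[OF act_lin'] lin_sm[OF act_lin'] hom_add[OF l] hom_sm[OF l] hom_add[OF r] hom_sm[OF r] P.ET.l_distr P.ET.r_distr)
 have l1: "l z ?one = coact X z" if "z \<in> carrier X" for z
  using that cy by (simp add: l_def lmul_apply o flip: T.one_tens)
 have "(r h \<otimes>\<^bsub>?C\<^esub> l y) ?one = sweedler TX' (\<lambda>h' h''. (l (act X h' y) \<otimes>\<^bsub>?C\<^esub> r h'') ?one) (comult H h)"
  unfolding main by (rule UU.lin_sweedler[OF end_eval_lin[OF o] P.ET.cvec_axioms T.T.cvec_Q b cc[OF h]])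
 moreover have "(r h \<otimes>\<^bsub>?C\<^esub> l y) ?one = sweedler TX' (\<lambda>h' h''. sweedler TX' (\<lambda>a x0. tens H X (h' \<otimes>\<^bsub>H\<^esub> a) (act X h'' x0)) (coact X y)) (comult H h)"
  using rhs[OF cc[OF h] cy[OF y]] by (simp add: end_simps o l1 y r_def)
 moreover have "sweedler TX' (\<lambda>h' h''. (l (act X h' y) \<otimes>\<^bsub>?C\<^esub> r h'') ?one) (comult H h)
   = sweedler TX' (\<lambda>h' h''. sweedler TX' (\<lambda>a x0. tens H X (a \<otimes>\<^bsub>H\<^esub> h'') x0) (coact X (act X h' y))) (comult H h)"
 proof (rule UU.sweedler_cong[OF T.T.cvec_Q _ _ cc[OF h]])
  show "bilin H H TX' (\<lambda>h' h''. (l (act X h' y) \<otimes>\<^bsub>?C\<^esub> r h'') ?one)"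
   using bilinD(1,2)[OF b] lin_comp[OF _ end_eval_lin[OF o]] by (intro bilinI) blast+
  fix h' h'' assume hh: "h' \<in> carrier H" "h'' \<in> carrier H"
  \<comment> \<open>The operator of h'' sends 1 \<otimes> 1 to h'' \<otimes> 1, so the left
    multiplication by a coaction becomes that coaction multiplied on the right by this
    element.\<close>
  have "(\<lambda>t. t \<otimes>\<^bsub>TX'\<^esub> tens H X h'' \<one>\<^bsub>X\<^esub>) \<in> lin_maps TX' TX'"
   using hh by (intro lin_mapsI) (simp_all add: T.tens_closed T.TA.l_distr)
  from T.sweedler_eq[OF this T.T.cvec_Q _ cy[of "act X h' y"], of "\<lambda>a x0. tens H X (a \<otimes>\<^bsub>H\<^esub> h'') x0"]
  show "(l (act X h' y) \<otimes>\<^bsub>?C\<^esub> r h'') ?one = sweedler TX' (\<lambda>a x0. tens H X (a \<otimes>\<^bsub>H\<^esub> h'') x0) (coact X (act X h' y))"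
   using hh y by (simp add: end_simps o r1 l_def lmul_apply T.tens_closed T.tens_mult)
 qed
 ultimately show ?thesis by simp
qed

theorem yd_algebra_X: "yd_algebra H X"
 by (intro yd_algebra.intro yd_algebra_axioms.intro hopf_Uq X act_lin act_lin' act_1 act_m module_alg act_one coact_hom
   coassoc_X[unfolded assl_def] counit_X yd_X)

end


section \<open>Truncated polynomial algebras\<close>

context uq
begin

abbreviation "V \<equiv> trunc_poly p"
abbreviation "X \<equiv> xpow p"

declare One_nat_def [simp del]

lemma V_simps [simp]: "f \<in> carrier V \<longleftrightarrow> degree f < p" "\<one>\<^bsub>V\<^esub> = 1" "\<zero>\<^bsub>V\<^esub> = 0" "f \<oplus>\<^bsub>V\<^esub> h = f + h"
 "c \<odot>\<^bsub>V\<^esub> f = Polynomial.smult c f" "f \<otimes>\<^bsub>V\<^esub> h = (f * h) mod monom 1 p"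
 by (simp_all add: trunc_poly_def)

lemma degree_mod: "degree (f mod monom (1::complex) p) < p"
 using p2 degree_mod_less[of "monom (1::complex) p" f] by (auto simp: degree_monom_eq)

lemma mod_small: "degree f < p ==> f mod monom (1::complex) p = f"
 by (simp add: mod_poly_less degree_monom_eq)

lemma cvec_V: "cvec V"
 using p2 by (intro cvecI) (auto simp: algebra_simps smult_add_left smult_add_right degree_add_less le_less_trans[OF degree_smult_le])

sublocale V: cx_algebra V
proof (rule cx_algebraI[OF cvec_V])
 show "f \<otimes>\<^bsub>V\<^esub> f' \<otimes>\<^bsub>V\<^esub> h = f \<otimes>\<^bsub>V\<^esub> (f' \<otimes>\<^bsub>V\<^esub> h)" for f f' h
  by (simp add: mod_mult_left_eq mod_mult_right_eq mult.assoc)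
qed (use p2 in \<open>auto simp: degree_mod mod_small algebra_simps poly_mod_add_left mod_smult_left\<close>)

lemma V_alg: "cx_algebra V" ..

lemma X_small: "n < p ==> X n = monom 1 n"
 by (simp add: xpow_def mod_small degree_monom_eq)

text \<open>The powers past the truncation are available as zeros, so that formulas for
  \<open>X n\<close> can be stated for all \<open>n\<close>.\<close>

lemma X_big: "n \<ge> p ==> X n = 0"
proof -
 assume "n \<ge> p"
 then have "monom (1::complex) n = monom 1 p * monom 1 (n - p)" by (simp add: mult_monom)
 then show ?thesis by (simp add: xpow_def)
qed

lemma X_closed [simp]: "X n \<in> carrier V" "degree (X n) < p"
 by (simp_all add: xpow_def degree_mod)

lemma X_mult: "X n \<otimes>\<^bsub>V\<^esub> X m = X (n + m)"
 by (simp add: xpow_def mod_mult_left_eq mod_mult_right_eq mult_monom)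

lemma X_0: "X 0 = 1"
 using p2 by (simp add: X_small)

lemma X_pow: "X 1 [^]\<^bsub>V\<^esub> (n::nat) = X n"
 by (induction n) (simp_all add: X_0 X_mult del: V_simps(6) flip: Suc_eq_plus1)

lemma finsum_V: "finite A ==> (!!n. n \<in> A ==> f n \<in> carrier V) ==> finsum V f A = sum f A"
 by (induction A rule: finite_induct) (auto simp: V.finsum_insert Pi_def)

lemma V_expand: "f \<in> carrier V ==> f = (\<Oplus>\<^bsub>V\<^esub>n\<in>{..<p}. coeff f n \<odot>\<^bsub>V\<^esub> X n)"
proof -
 assume f: "f \<in> carrier V"
 have e: "{..<p} = {..p - 1}" using p2 by auto
 have "(\<Oplus>\<^bsub>V\<^esub>n\<in>{..<p}. coeff f n \<odot>\<^bsub>V\<^esub> X n) = (\<Sum>n<p. coeff f n \<odot>\<^bsub>V\<^esub> X n)"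
  by (rule finsum_V) (auto intro!: le_less_trans[OF degree_smult_le])
 also have "... = (\<Sum>n<p. monom (coeff f n) n)"
  by (rule sum.cong) (auto simp: X_small smult_monom)
 also have "... = f" unfolding e using f p2 by (intro poly_as_sum_of_monoms') simp
 finally show ?thesis by simp
qed

text \<open>Only n < p matter for a basis, but equations between powers are established uniformly in
  \<open>n\<close>, so the test is stated for all of them.\<close>

lemma V_lin_ext:
 assumes "F \<in> lin_maps V M" "G \<in> lin_maps V M" "cvec M" "!!n. F (X n) = G (X n)" "f \<in> carrier V"
 shows "F f = G f"
proof -
 interpret M: cvec M by fact
 have *: "H f = (\<Oplus>\<^bsub>M\<^esub>n\<in>{..<p}. coeff f n \<odot>\<^bsub>M\<^esub> H (X n))" if "H \<in> lin_maps V M" for H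
 proof -
  have "H f = H (\<Oplus>\<^bsub>V\<^esub>n\<in>{..<p}. coeff f n \<odot>\<^bsub>V\<^esub> X n)" using V_expand[OF assms(5)] by simp
  also have "... = (\<Oplus>\<^bsub>M\<^esub>n\<in>{..<p}. H (coeff f n \<odot>\<^bsub>V\<^esub> X n))"
   by (rule lin_finsum[OF that V.cvec_axioms assms(3)]) (auto intro!: le_less_trans[OF degree_smult_le])
  also have "... = (\<Oplus>\<^bsub>M\<^esub>n\<in>{..<p}. coeff f n \<odot>\<^bsub>M\<^esub> H (X n))"
   by (rule M.finsum_cong') (simp_all del: V_simps(5) add: lin_sm[OF that] lin_closed[OF that] Pi_def)
  finally show ?thesis .
 qed
 show ?thesis using *[OF assms(1)] *[OF assms(2)] assms(4) by simp
qed

lemma generated_V: "generated_by V {i :: nat} (\<lambda>_. X 1)"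
proof -
 have x: "(\<lambda>_. X 1) ` {i} \<subseteq> carrier V" by simp
 have "f \<in> free_eval V (\<lambda>_. X 1) ` {f. keys f \<subseteq> lists {i}}" if f: "f \<in> carrier V" for f
 proof -
  let ?r = "\<Sum>n<p. scal (coeff f n) (gen i ^ n)"
  have k: "keys (gen i :: nat list \<Rightarrow>\<^sub>0 complex) \<subseteq> lists {i}" by auto
  have *: "keys (\<Sum>n\<in>A. scal (coeff f n) (gen i ^ n)) \<subseteq> lists {i} \<and>
    free_eval V (\<lambda>_. X 1) (\<Sum>n\<in>A. scal (coeff f n) (gen i ^ n)) = (\<Oplus>\<^bsub>V\<^esub>n\<in>A. coeff f n \<odot>\<^bsub>V\<^esub> X n)" if "finite A" for A
   using that
  proof (induction A rule: finite_induct)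
   case empty
   show ?case unfolding sum.empty keys_zero V.finsum_empty V.free_eval_0[OF x] by blast
  next
   case (insert a A)
   note P = V.free_eval_pow[OF x k, of a]
   have ks: "keys (scal (coeff f a) (gen i ^ a)) \<subseteq> lists {i}"
    by (rule subset_trans[OF keys_scal P[THEN conjunct1]])
   have "free_eval V (\<lambda>_. X 1) (scal (coeff f a) (gen i ^ a)) = coeff f a \<odot>\<^bsub>V\<^esub> X a"
    using P V.free_eval_scal[OF x, of "gen i ^ a"] V.free_eval_gen[OF x, of i] by (simp only: X_pow insertI1)
   moreover have "(\<Oplus>\<^bsub>V\<^esub>n\<in>insert a A. coeff f n \<odot>\<^bsub>V\<^esub> X n) = coeff f a \<odot>\<^bsub>V\<^esub> X a \<oplus>\<^bsub>V\<^esub> (\<Oplus>\<^bsub>V\<^esub>n\<in>A. coeff f n \<odot>\<^bsub>V\<^esub> X n)"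
    using insert(1,2) by (rule V.finsum_insert) (simp_all del: V_simps add: Pi_def)
   ultimately show ?case using insert ks keys_add[of "scal (coeff f a) (gen i ^ a)" "\<Sum>n\<in>A. scal (coeff f n) (gen i ^ n)"]
    by (simp only: sum.insert V.free_eval_add[OF x] conj_assoc simp_thms) blast
  qed
  show ?thesis using *[of "{..<p}"] V_expand[OF f] by (intro image_eqI[of _ _ ?r]) simp_all
 qed
 moreover have "free_eval V (\<lambda>_. X 1) f \<in> carrier V" if "keys f \<subseteq> lists {i}" for f
  using V.free_eval_closed[OF x that] .
 ultimately show ?thesis using x unfolding generated_by_def by blast
qed


text \<open>Evaluation of a truncated polynomial at an element. It is a morphism when the p-th power
  of the element vanishes; the coaction of \<open>trunc_yd\<close> is the evaluation at its value on
  the variable.\<close>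

definition ev :: "(complex, 'b, 'm) module_scheme => 'b => complex poly => 'b" where
 "ev B d f = (\<Oplus>\<^bsub>B\<^esub>n\<in>{..<p}. coeff f n \<odot>\<^bsub>B\<^esub> d [^]\<^bsub>B\<^esub> n)"

lemma ev_hom:
 assumes B: "cx_algebra B" and d: "d \<in> carrier B" "d [^]\<^bsub>B\<^esub> p = \<zero>\<^bsub>B\<^esub>"
 shows "ev B d \<in> alg_homs V B" "ev B d (X n) = d [^]\<^bsub>B\<^esub> n"
proof -
 interpret B: cx_algebra B by fact
 have l: "ev B d \<in> lin_maps V B"
 proof (rule lin_mapsI)
  show "ev B d f \<in> carrier B" for f unfolding ev_def using d by (intro B.finsum_closed) auto
  show "ev B d (f \<oplus>\<^bsub>V\<^esub> h) = ev B d f \<oplus>\<^bsub>B\<^esub> ev B d h" for f h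
   unfolding ev_def using d by (subst B.finsum_addf[symmetric]) (auto simp: B.sm_add)
  show "ev B d (c \<odot>\<^bsub>V\<^esub> f) = c \<odot>\<^bsub>B\<^esub> ev B d f" for c f
   unfolding ev_def using d by (subst B.finsum_sm) (auto simp: B.sm_sm)
 qed
 show X: "ev B d (X n) = d [^]\<^bsub>B\<^esub> n" for n
 proof (cases "n < p")
  case True
  then have "ev B d (X n) = coeff (X n) n \<odot>\<^bsub>B\<^esub> d [^]\<^bsub>B\<^esub> n"
   unfolding ev_def using d by (intro B.finsum_single_nonzero) (auto simp: X_small)
  then show ?thesis using True d by (simp add: X_small)
 next
  case False
  then have "d [^]\<^bsub>B\<^esub> n = d [^]\<^bsub>B\<^esub> p \<otimes>\<^bsub>B\<^esub> d [^]\<^bsub>B\<^esub> (n - p)" using d(1) by (simp add: B.nat_pow_mult)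
  then have "d [^]\<^bsub>B\<^esub> n = \<zero>\<^bsub>B\<^esub>" using d by (simp only: d(2) B.l_null B.nat_pow_closed)
  then show ?thesis using False d lin_zero[OF l V.cvec_axioms B.cvec_axioms] by (simp add: X_big)
 qed
 show "ev B d \<in> alg_homs V B"
 proof (rule alg_homsI[OF l])
  fix f h assume f: "f \<in> carrier V" and h: "h \<in> carrier V"
  have 1: "ev B d (X n \<otimes>\<^bsub>V\<^esub> h) = d [^]\<^bsub>B\<^esub> n \<otimes>\<^bsub>B\<^esub> ev B d h" for n
  proof (rule V_lin_ext[OF _ _ B.cvec_axioms _ h])
   show "(\<lambda>h. ev B d (X n \<otimes>\<^bsub>V\<^esub> h)) \<in> lin_maps V B"
    by (rule lin_mapsI) (simp_all only: V.m_closed X_closed V.r_distr V.smult_mult_right lin_closed[OF l] lin_add[OF l] lin_sm[OF l])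
   show "(\<lambda>h. d [^]\<^bsub>B\<^esub> n \<otimes>\<^bsub>B\<^esub> ev B d h) \<in> lin_maps V B"
    using d by (intro lin_mapsI) (simp_all del: V_simps add: lin_closed[OF l] lin_add[OF l] lin_sm[OF l] B.r_distr)
   show "ev B d (X n \<otimes>\<^bsub>V\<^esub> X m) = d [^]\<^bsub>B\<^esub> n \<otimes>\<^bsub>B\<^esub> ev B d (X m)" for m
    unfolding X_mult X using d by (simp add: B.nat_pow_mult)
  qed
  show "ev B d (f \<otimes>\<^bsub>V\<^esub> h) = ev B d f \<otimes>\<^bsub>B\<^esub> ev B d h"
  proof (rule V_lin_ext[OF _ _ B.cvec_axioms _ f])
   show "(\<lambda>f. ev B d (f \<otimes>\<^bsub>V\<^esub> h)) \<in> lin_maps V B"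
    using h by (intro lin_mapsI) (simp_all only: V.m_closed V.l_distr V.smult_mult_left lin_closed[OF l] lin_add[OF l] lin_sm[OF l])
   show "(\<lambda>f. ev B d f \<otimes>\<^bsub>B\<^esub> ev B d h) \<in> lin_maps V B"
    using lin_closed[OF l h] by (intro lin_mapsI) (simp_all del: V_simps add: lin_closed[OF l] lin_add[OF l] lin_sm[OF l] B.l_distr)
   show "ev B d (X n \<otimes>\<^bsub>V\<^esub> h) = ev B d (X n) \<otimes>\<^bsub>B\<^esub> ev B d h" for n using 1 by (simp only: X)
  qed
 qed (use X[of 0] in \<open>simp add: X_0\<close>)
qed

definition wop :: "(ugen => nat => complex poly) => ugen => complex poly => complex poly" where
 "wop a b f = (\<Sum>n<p. Polynomial.smult (coeff f n) (a b n))"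

lemma fv_smult_sum: "Polynomial.smult c (\<Sum>n\<in>A. f n) = (\<Sum>n\<in>A. Polynomial.smult (c :: complex) (f n))"
 by (induction A rule: infinite_finite_induct) (simp_all add: smult_add_right)

lemma wop_lin:
 assumes "!!n. n < p ==> a b n \<in> carrier V"
 shows "wop a b \<in> lin_maps V V"
proof -
 have "wop a b f \<in> carrier V" for f
 proof -
  have "(\<Oplus>\<^bsub>V\<^esub>n\<in>{..<p}. coeff f n \<odot>\<^bsub>V\<^esub> a b n) \<in> carrier V"
   using assms by (intro V.finsum_closed) (auto intro: le_less_trans[OF degree_smult_le])
  moreover have "(\<Oplus>\<^bsub>V\<^esub>n\<in>{..<p}. coeff f n \<odot>\<^bsub>V\<^esub> a b n) = (\<Sum>n<p. coeff f n \<odot>\<^bsub>V\<^esub> a b n)"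
   using assms by (intro finsum_V) (auto intro: le_less_trans[OF degree_smult_le])
  ultimately show ?thesis by (simp add: wop_def)
 qed
 then show ?thesis
  by (intro lin_mapsI) (simp_all add: wop_def smult_add_left sum.distrib fv_smult_sum)
qed

lemma wop_X: "n < p ==> wop a b (X n) = a b n"
 by (simp add: wop_def X_small if_distrib[where f = "\<lambda>c. Polynomial.smult c _"] cong: if_cong)

lemma trunc_same: "same_alg (trunc_yd p a d) V"
 by (simp add: same_alg_def same_mod_def trunc_yd_def mk_yd_def)

lemma trunc_coact: "coact (trunc_yd p a d) = ev (tensor H V) d"
 by (simp add: trunc_yd_def mk_yd_def ev_def[abs_def])

text \<open>The action is defined on a representative in the free algebra; once the operators
  satisfy the relations of the quantum group, it is the representation that they induce.\<close>

lemma trunc_act: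
 assumes uc: "ucond (End V) (\<lambda>b. restrict (wop a b) (carrier V))"
  and h: "h \<in> carrier H" and f: "f \<in> carrier V"
 shows "act (trunc_yd p a d) h f = uhom (End V) (\<lambda>b. restrict (wop a b) (carrier V)) h f"
proof -
 interpret E: cx_algebra "End V" by (rule cx_algebra_end[OF V.cvec_axioms])
 let ?y = "\<lambda>b. restrict (wop a b) (carrier V)"
 have y: "?y ` UNIV \<subseteq> carrier (End V)" using uc by (simp add: ucond_def)
 have yc: "?y b \<in> carrier (End V)" for b using y by auto
 have w: "word_eval (End V) ?y w \<in> carrier (End V)" for w
  by (rule E.word_eval_closed[OF y]) simp
 have e: "word_eval (End V) ?y w f = foldr (\<lambda>b. wop a b) w f" for w
 proof (induction w)
  case Nil then show ?case using f by (simp add: word_eval_def end_simps)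
 next
  case (Cons b w)
  have "word_eval (End V) ?y (b # w) f = ?y b (word_eval (End V) ?y w f)"
   using f by (simp add: word_eval_def end_simps del: V_simps)
  also have "... = wop a b (word_eval (End V) ?y w f)"
   by (rule restrict_apply') (rule lin_closed[OF end_lin[OF w] f])
  finally show ?case using Cons by (simp only: foldr.simps o_apply)
 qed
 have "uhom (End V) ?y h f = lin_ext V (\<lambda>w. word_eval (End V) ?y w f) (rep h)"
  unfolding uhom_def free_eval_def
  by (rule lin_lin_ext[OF end_eval_lin[OF f] E.cvec_axioms V.cvec_axioms]) (rule w)
 moreover have "(\<lambda>b f'. \<Sum>n<p. Polynomial.smult (coeff f' n) (a b n)) = wop a"
  by (simp add: fun_eq_iff wop_def)
 ultimately show ?thesis by (simp add: e trunc_yd_def mk_yd_def)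
qed

lemma ucond_trivial:
 assumes "cx_algebra C" shows "ucond C (\<lambda>a. u_counit_gen a \<odot>\<^bsub>C\<^esub> \<one>\<^bsub>C\<^esub>)"
proof -
 interpret C: cx_algebra C by fact
 have "(\<lambda>c. c \<odot>\<^bsub>C\<^esub> \<one>\<^bsub>C\<^esub>) \<in> alg_homs cx C"
  by (intro alg_homsI lin_mapsI) (simp_all add: C.sm_add C.sm_sm mult.commute)
 from hom_ucond[OF this cx_algebra_cx assms ucond_counit] show ?thesis .
qed

text \<open>The pair asks for a second copy of the quantum group commuting with the first; the
  counit, read as multiples of the unit, provides one.\<close>

lemma hcond_tensor:
 assumes B: "cx_algebra B" and y: "hcond B I y"
 shows "hcond (tensor H B) I (coact_gen (tensor H B) (\<lambda>a. tens H B (ug a) \<one>\<^bsub>B\<^esub>) (\<lambda>i. tens H B \<one>\<^bsub>H\<^esub> (y i)))"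
proof -
 interpret T: tensor_algs "H" B by (rule tensor_algsI[OF cx_algebra_Uq B])
 interpret P: upair p q s g "tensor H B" "\<lambda>a. tens H B (ug a) \<one>\<^bsub>B\<^esub>" "\<lambda>a. u_counit_gen a \<odot>\<^bsub>tensor H B\<^esub> \<one>\<^bsub>tensor H B\<^esub>"
  by unfold_locales (simp_all add: ucond_trivial[OF T.cx_algebra_tensor] tensor_left_ucond[OF B] T.tens_closed)
 show ?thesis
  by (rule P.hcond_coact[OF hom_hcond[OF T.tens_right_hom B T.cx_algebra_tensor y]])
   (use y in \<open>auto simp: T.tens_mult hcond_def\<close>)
qed

text \<open>With a single index the quadratic relations read x^2 = w x^2 + (1 - w) x^2, an
  identity.\<close>

lemma hcond_V: "hcond V {i} (\<lambda>_. X 1)"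
proof -
 have "X 1 [^]\<^bsub>V\<^esub> p = \<zero>\<^bsub>V\<^esub>" by (simp only: X_pow) (simp add: X_big)
 moreover have "f = s ^ 2 \<odot>\<^bsub>V\<^esub> f \<oplus>\<^bsub>V\<^esub> (1 - s ^ 2) \<odot>\<^bsub>V\<^esub> f" "f = q ^ 2 \<odot>\<^bsub>V\<^esub> f \<oplus>\<^bsub>V\<^esub> (1 - q ^ 2) \<odot>\<^bsub>V\<^esub> f" for f
  by (simp_all flip: smult_add_left)
 ultimately show ?thesis unfolding hcond_def zrel_def drel_def by (auto simp del: V_simps simp add: X_closed)
qed

lemma trunc_yd_data:
 assumes a: "!!b n. n < p ==> a b n \<in> carrier V"
  and sc: "scond (End V) {i} (\<lambda>_. lmul V (X 1)) (\<lambda>b. restrict (wop a b) (carrier V))"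
  and a0: "!!b. a b 0 = Polynomial.smult (u_counit_gen b) 1"
  and d: "d = coact_gen (tensor H V) (\<lambda>a. tens H V (ug a) \<one>\<^bsub>V\<^esub>) (\<lambda>i. tens H V \<one>\<^bsub>H\<^esub> (X 1)) i"
 shows "yd_data p q s g (trunc_yd p a d) {i} (\<lambda>_. X 1)"
proof -
 let ?Y = "trunc_yd p a d"
 let ?r = "uhom (End V) (\<lambda>b. restrict (wop a b) (carrier V))"
 interpret E: cx_algebra "End V" by (rule cx_algebra_end[OF V.cvec_axioms])
 interpret T: tensor_algs "H" V by unfold_locales
 have uc: "ucond (End V) (\<lambda>b. restrict (wop a b) (carrier V))" using sc by (simp add: scond_def)
 note r = uhom[OF E.cx_algebra_axioms uc] and ta = trunc_act[OF uc, of _ _ d]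
 have same: "same_alg ?Y V" by (rule trunc_same)
 have eqs: "carrier ?Y = carrier V" "one ?Y = one V" "mult ?Y = mult V" "add ?Y = add V" "smult ?Y = smult V" "zero ?Y = zero V"
  using same by (auto simp: same_alg_def same_mod_def)
 have tsame: "tensor H ?Y = tensor H V" "tens H ?Y = tens H V"
  using tensor_cong[of "H" "H" ?Y V] tens_cong[of "H" "H" ?Y V] same by (simp_all add: same_alg_def same_mod_def)
 have rl: "?r h \<in> lin_maps V V" if "h \<in> carrier H" for h using end_lin[OF hom_closed[OF r(1) that]] .
 have Elin: "End ?Y = End V"
  by (simp add: End_def eqs lin_maps_def del: V_simps)
 have "lmul ?Y = lmul V" by (simp add: lmul_def fun_eq_iff eqs del: V_simps)
 have ac: "act ?Y h \<in> lin_maps V V" if "h \<in> carrier H" for h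
  by (rule lin_cong[OF rl[OF that] V.cvec_axioms ta[OF that, symmetric]])
 have aw: "act ?Y (ug b) f = wop a b f" if "f \<in> carrier V" for b f
  using ta[OF ug_closed that] r(2) that by (simp del: V_simps)
 have hh: "hcond V {i} (\<lambda>_. X 1)" by (rule hcond_V)
 have dh: "d \<in> carrier (tensor H V)" "d [^]\<^bsub>tensor H V\<^esub> p = \<zero>\<^bsub>tensor H V\<^esub>"
  using hcond_tensor[OF V_alg hh] unfolding d by (simp_all add: hcond_def)
 note D = ev_hom[OF T.cx_algebra_tensor dh]
 have d1: "d [^]\<^bsub>tensor H V\<^esub> (1::nat) = d" using dh(1) by (simp add: One_nat_def)
 show ?thesis
 proof (rule yd_data.intro[OF uq_axioms cx_algebra_cong[OF same V_alg] yd_data_axioms.intro])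
  show "generated_by ?Y {i} (\<lambda>_. X 1)" using generated_V generated_cong[OF same] by blast
  show "act ?Y h \<in> lin_maps ?Y ?Y" if "h \<in> carrier H" for h
   using ac[OF that] by (simp add: lin_maps_def eqs del: V_simps)
  show "(\<lambda>h. act ?Y h y) \<in> lin_maps H ?Y" if "y \<in> carrier ?Y" for y
  proof -
   have y: "y \<in> carrier V" using that by (simp only: eqs)
   have "(\<lambda>h. act ?Y h y) \<in> lin_maps H V"
    by (rule lin_cong[OF lin_comp[OF hom_lin[OF r(1)] end_eval_lin[OF y]] H.cvec_axioms ta[OF _ y, symmetric]])
   then show ?thesis by (simp add: lin_maps_def eqs del: V_simps)
  qed
  show "act ?Y \<one>\<^bsub>H\<^esub> y = y" if "y \<in> carrier ?Y" for y
   using that ta[of "\<one>\<^bsub>H\<^esub>" y] hom_one[OF r(1)] by (simp add: eqs end_simps del: V_simps)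
  show "act ?Y (h \<otimes>\<^bsub>H\<^esub> h') y = act ?Y h (act ?Y h' y)" if "h \<in> carrier H" "h' \<in> carrier H" "y \<in> carrier ?Y" for h h' y
  proof -
   have y: "y \<in> carrier V" using that by (simp only: eqs)
   show ?thesis using that y lin_closed[OF rl[OF that(2)] y] by (simp add: ta hom_mult[OF r(1)] end_simps del: V_simps)
  qed
  have "(\<lambda>b. restrict (act ?Y (ug b)) (carrier V)) = (\<lambda>b. restrict (wop a b) (carrier V))"
   by (rule ext, rule restrict_ext) (rule aw)
  then show "scond (End ?Y) {i} (\<lambda>_. lmul ?Y (X 1)) (\<lambda>b. restrict (act ?Y (ug b)) (carrier ?Y))"
   using sc by (simp only: Elin \<open>lmul ?Y = lmul V\<close> eqs)
  show "act ?Y (ug b) \<one>\<^bsub>?Y\<^esub> = counit H (ug b) \<odot>\<^bsub>?Y\<^esub> \<one>\<^bsub>?Y\<^esub>" for b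
   using aw[of 1 b] wop_X[of 0 a b] a0 p2 by (simp add: eqs counit_ug X_0)
  show "coact ?Y \<in> alg_homs ?Y (tensor H ?Y)"
   unfolding trunc_coact tsame using D(1) by (simp add: alg_homs_def ring_hom_def lin_maps_def eqs del: V_simps)
  show "coact ?Y (X 1) = coact_gen (tensor H ?Y) (\<lambda>a. tens H ?Y (ug a) \<one>\<^bsub>?Y\<^esub>) (\<lambda>i. tens H ?Y \<one>\<^bsub>H\<^esub> (X 1)) j"
   if "j \<in> {i}" for j
   using that D(2)[of 1] d1 unfolding trunc_coact tsame eqs by (simp add: d[symmetric] del: V_simps)
 qed
qed

subsection \<open>The algebras generated by one variable\<close>

text \<open>The coefficients -q^n [n] for raising and q^(1-n) [n] for lowering an exponent,
  rewritten in powers of q^2 and s^2 so that exponents stay natural numbers.\<close>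

definition up :: "nat => complex" where "up n = - ((q ^ 2) ^ n - 1) * g"
definition dn :: "nat => complex" where "dn n = q * (1 - (s ^ 2) ^ n) * g"

lemma qint_eq: "qint p n = (q ^ n - s ^ n) * g"
 by (simp add: qint_def g_def s_def q_def)

lemma up_eq: "- (qq p ^ n * qint p n) = up n"
proof -
 have "q ^ n * s ^ n = 1" using qs by (metis power_mult_distrib power_one)
 then have "q ^ n * (q ^ n - s ^ n) = (q ^ 2) ^ n - 1"
  by (simp add: algebra_simps power2_eq_square power_mult_distrib)
 then have "q ^ n * qint p n = ((q ^ 2) ^ n - 1) * g" unfolding qint_eq by (metis mult.assoc)
 then show ?thesis by (simp add: up_def algebra_simps flip: q_def)
qed

lemma dn_eq: "qint p n * qq p powi (1 - int n) = dn n"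
proof -
 have qn: "q ^ n * s ^ n = 1" using qs by (metis power_mult_distrib power_one)
 have "q powi (1 - int n) = q * s ^ n"
  using q_nz by (simp add: power_int_diff s_pow divide_inverse)
 then have "qint p n * q powi (1 - int n) = q * ((q ^ n * s ^ n) - s ^ n * s ^ n) * g"
  by (simp add: qint_eq algebra_simps)
 then show ?thesis using qn by (simp add: dn_def power2_eq_square power_mult_distrib flip: q_def)
qed

text \<open>The zero of \<open>dn\<close> at \<open>p\<close> comes from s^(2p) = 1; it makes
  lowering consistent with x^p = 0.\<close>

lemma up_0 [simp]: "up 0 = 0" and dn_0 [simp]: "dn 0 = 0" and dn_p: "dn p = 0"
 using roots by (simp_all add: up_def dn_def)

lemma qpow_eqs: "(q\<^sup>2) ^ n * (s\<^sup>2) ^ n = 1" "q ^ 2 * s ^ 2 = 1" "(q ^ 2 - 1) * g = q" "q * (1 - s ^ 2) * g = 1"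
proof -
 show 1: "q ^ 2 * s ^ 2 = 1" using qs by (metis power_mult_distrib power_one)
 then show "(q\<^sup>2) ^ n * (s\<^sup>2) ^ n = 1" by (metis power_mult_distrib power_one)
 have "q * (1 - s ^ 2) = q - s" using qs by (simp add: algebra_simps power2_eq_square)
 then show "q * (1 - s ^ 2) * g = 1" using gc by (simp add: mult.commute)
 have "(q ^ 2 - 1) * g = q * ((q - s) * g)" using qs by (simp add: algebra_simps power2_eq_square)
 then show "(q ^ 2 - 1) * g = q" using gc by (simp add: mult.commute)
qed

lemma up_Suc: "up (Suc n) = up n - q * (q ^ 2) ^ n"
proof -
 have "(q ^ 2) ^ n * ((q ^ 2 - 1) * g) = q * (q ^ 2) ^ n" unfolding qpow_eqs(3) by (rule mult.commute)
 then show ?thesis by (simp add: up_def algebra_simps)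
qed

lemma up_Suc': "up (Suc n) = q ^ 2 * up n - q"
proof -
 have "(q ^ 2 - 1) * g = q" by (rule qpow_eqs)
 then show ?thesis by (simp add: up_def algebra_simps)
qed

lemma dn_Suc: "dn (Suc n) = 1 + s ^ 2 * dn n"
proof -
 have "1 + s ^ 2 * dn n = q * (1 - s ^ 2) * g + s ^ 2 * dn n" by (simp only: qpow_eqs(4))
 then show ?thesis by (simp add: dn_def algebra_simps)
qed

lemma dn_Suc': "dn (Suc n) = (s ^ 2) ^ n + dn n"
proof -
 have "(s ^ 2) ^ n * (q * (1 - s ^ 2) * g) = (s ^ 2) ^ n" by (simp only: qpow_eqs mult_1_right)
 then show ?thesis by (simp add: dn_def algebra_simps)
qed

text \<open>The relation for [E, F] on x^n: the commutator of lowering and raising has the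
  eigenvalue -g (q^(2n) - s^(2n)), where K has the eigenvalue q^(2n).\<close>

lemma updn: "dn (Suc n) * up n - (if n = 0 then 0 else up (n - 1) * dn n) = g * (s ^ 2) ^ n - g * (q ^ 2) ^ n"
proof (cases n)
 case 0
 have "dn (Suc 0) = 1" by (simp add: dn_Suc)
 with 0 show ?thesis by simp
next
 case (Suc m)
 have "dn (Suc n) * up n - up m * dn n = (1 + s ^ 2 * dn n) * up n - up m * dn n" by (simp add: dn_Suc)
 also have "up n = q ^ 2 * up m - q" using Suc by (simp add: up_Suc')
 also have "(1 + s ^ 2 * dn n) * (q ^ 2 * up m - q) - up m * dn n = (q ^ 2 * up m - q) + (q ^ 2 * s ^ 2 - 1) * (dn n * up m) - q * s ^ 2 * dn n"
  by (simp add: algebra_simps)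
 also have "q * s ^ 2 = s" using qs by (simp add: power2_eq_square flip: mult.assoc)
 also have "(q ^ 2 * up m - q) + (q ^ 2 * s ^ 2 - 1) * (dn n * up m) - s * dn n = up n - s * dn n"
  using Suc by (simp add: qpow_eqs(2) up_Suc')
 also have "... = g * (s ^ 2) ^ n - g * (q ^ 2) ^ n"
  using qs by (simp add: up_def dn_def algebra_simps)
 finally show ?thesis using Suc by (simp add: up_Suc')
qed

text \<open>The common shape of the two actions: one of \<open>E\<close>, \<open>F\<close> raises the exponent and the other lowers it.\<close>

context
 fixes U D K L J :: "complex poly => complex poly"
 assumes cl: "U \<in> carrier (End V)" "D \<in> carrier (End V)" "K \<in> carrier (End V)" "J \<in> carrier (End V)"
  and UX: "!!n. U (X n) = up n \<odot>\<^bsub>V\<^esub> X (Suc n)"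
  and DX: "!!n. D (X n) = dn n \<odot>\<^bsub>V\<^esub> X (n - 1)"
  and KX: "!!n. K (X n) = (q ^ 2) ^ n \<odot>\<^bsub>V\<^esub> X n"
  and JX: "!!n. J (X n) = (s ^ 2) ^ n \<odot>\<^bsub>V\<^esub> X n"
begin

interpretation E: cx_algebra "End V" by (rule cx_algebra_end[OF V.cvec_axioms])

lemma L_closed: "lmul V (X 1) \<in> carrier (End V)" and LX: "lmul V (X 1) (X n) = X (Suc n)"
 using hom_closed[OF lmul_hom[OF V_alg]] by (simp_all add: lmul_apply X_mult del: V_simps flip: Suc_eq_plus1_left)

lemma end_V_ext:
 assumes "f \<in> carrier (End V)" "h \<in> carrier (End V)" "!!n. f (X n) = h (X n)"
 shows "f = h"
 by (rule end_ext[OF assms(1,2)], rule V_lin_ext[OF end_lin[OF assms(1)] end_lin[OF assms(2)] V.cvec_axioms assms(3)])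

lemmas clL = cl L_closed
lemmas lin_rules = lin_sm[OF end_lin[OF cl(1)]] lin_sm[OF end_lin[OF cl(2)]] lin_sm[OF end_lin[OF cl(3)]] lin_sm[OF end_lin[OF cl(4)]] lin_sm[OF end_lin[OF L_closed]]
lemmas appl = end_simps lin_closed[OF end_lin] lin_rules UX DX KX JX LX V.sm_sm

lemma pow_UX: "\<exists>c. (U [^]\<^bsub>End V\<^esub> m) (X n) = c \<odot>\<^bsub>V\<^esub> X (n + m)"
proof (induction m arbitrary: n)
 case 0
 show ?case by (rule exI[of _ 1]) (simp add: end_simps del: V_simps)
next
 case (Suc m)
 obtain c where c: "(U [^]\<^bsub>End V\<^esub> m) (X (Suc n)) = c \<odot>\<^bsub>V\<^esub> X (Suc n + m)" using Suc by blast
 have "(U [^]\<^bsub>End V\<^esub> Suc m) (X n) = (up n * c) \<odot>\<^bsub>V\<^esub> X (n + Suc m)"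
  using c lin_sm[OF end_lin[OF E.nat_pow_closed[OF cl(1)]]] by (simp add: appl del: V_simps)
 then show ?case by blast
qed

text \<open>The exponent n - m is truncated at 0, so the vanishing of the coefficient for n < m has
  to be carried through the induction.\<close>

lemma pow_DX: "\<exists>c. (D [^]\<^bsub>End V\<^esub> m) (X n) = c \<odot>\<^bsub>V\<^esub> X (n - m) \<and> (n < m --> c = 0)"
proof (induction m arbitrary: n)
 case 0
 show ?case by (rule exI[of _ 1]) (simp add: end_simps del: V_simps)
next
 case (Suc m)
 obtain c where c: "(D [^]\<^bsub>End V\<^esub> m) (X (n - 1)) = c \<odot>\<^bsub>V\<^esub> X (n - 1 - m)" "n - 1 < m --> c = 0" using Suc by blast
 have "(D [^]\<^bsub>End V\<^esub> Suc m) (X n) = (dn n * c) \<odot>\<^bsub>V\<^esub> X (n - Suc m)"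
  using c lin_sm[OF end_lin[OF E.nat_pow_closed[OF cl(2)]]] by (simp add: appl del: V_simps flip: Suc_eq_plus1_left)
 moreover have "n < Suc m --> dn n * c = 0" using c(2) by (cases n) auto
 ultimately show ?case by blast
qed

lemma pow_zero: "U [^]\<^bsub>End V\<^esub> p = \<zero>\<^bsub>End V\<^esub>" "D [^]\<^bsub>End V\<^esub> p = \<zero>\<^bsub>End V\<^esub>"
proof -
 show "U [^]\<^bsub>End V\<^esub> p = \<zero>\<^bsub>End V\<^esub>"
 proof (rule end_V_ext)
  fix n
  obtain c where "(U [^]\<^bsub>End V\<^esub> p) (X n) = c \<odot>\<^bsub>V\<^esub> X (n + p)" using pow_UX by blast
  then show "(U [^]\<^bsub>End V\<^esub> p) (X n) = \<zero>\<^bsub>End V\<^esub> (X n)" by (simp add: end_simps X_big)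
 qed (simp_all add: cl)
 show "D [^]\<^bsub>End V\<^esub> p = \<zero>\<^bsub>End V\<^esub>"
 proof (rule end_V_ext)
  fix n
  obtain c where c: "(D [^]\<^bsub>End V\<^esub> p) (X n) = c \<odot>\<^bsub>V\<^esub> X (n - p)" "n < p --> c = 0" using pow_DX by blast
  show "(D [^]\<^bsub>End V\<^esub> p) (X n) = \<zero>\<^bsub>End V\<^esub> (X n)"
  proof (cases "n < p")
   case False
   then have "X n = 0" by (simp add: X_big)
   then show ?thesis using lin_zero[OF end_lin[OF E.nat_pow_closed[OF cl(2)]] V.cvec_axioms V.cvec_axioms, of p]
     lin_zero[OF end_lin[OF E.zero_closed] V.cvec_axioms V.cvec_axioms]
    by simp
  qed (use c in \<open>simp add: end_simps\<close>)
 qed (simp_all add: cl)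
qed

lemma diag_pow: "(K [^]\<^bsub>End V\<^esub> m) (X n) = (q ^ 2) ^ (n * m) \<odot>\<^bsub>V\<^esub> X n" "(J [^]\<^bsub>End V\<^esub> m) (X n) = (s ^ 2) ^ (n * m) \<odot>\<^bsub>V\<^esub> X n"
proof -
 show "(K [^]\<^bsub>End V\<^esub> m) (X n) = (q ^ 2) ^ (n * m) \<odot>\<^bsub>V\<^esub> X n"
 proof (induction m)
  case (Suc m)
  then show ?case using lin_sm[OF end_lin[OF E.nat_pow_closed[OF cl(3)]]]
   by (simp add: appl power_add mult.commute del: V_simps)
 qed (simp add: end_simps del: V_simps)
 show "(J [^]\<^bsub>End V\<^esub> m) (X n) = (s ^ 2) ^ (n * m) \<odot>\<^bsub>V\<^esub> X n"
 proof (induction m)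
  case (Suc m)
  then show ?case using lin_sm[OF end_lin[OF E.nat_pow_closed[OF cl(4)]]]
   by (simp add: appl power_add mult.commute del: V_simps)
 qed (simp add: end_simps del: V_simps)
qed

text \<open>All operators here are diagonal, and the eigenvalues of K and J are mutually inverse
  p-th roots of unity; hence the power 2p - 1 inverts each of them.\<close>

lemma kinv_KJ: "kinv (End V) K = J" "kinv (End V) J = K"
 "K [^]\<^bsub>End V\<^esub> (2 * p) = \<one>\<^bsub>End V\<^esub>" "J [^]\<^bsub>End V\<^esub> (2 * p) = \<one>\<^bsub>End V\<^esub>"
proof -
 have *: "a ^ (n * (2 * p - 1)) = b ^ n" if "a ^ p = 1" "a * b = 1" for a b :: complex and n
 proof -
  have e: "2 * p = Suc (2 * p - 1)" using p2 by simp
  have "a ^ (2 * p - 1) * a = a ^ (2 * p)" by (subst (2) e) (simp only: power_Suc2)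
  also have "... = (a ^ p) ^ 2" by (simp only: mult.commute[of 2] power_mult)
  finally have "a ^ (2 * p - 1) * a = (a ^ p) ^ 2" .
  then have "a ^ (2 * p - 1) * a = 1" using that by simp
  then have "a ^ (2 * p - 1) = b" using that by (metis mult.assoc mult.commute mult_1_right)
  then show ?thesis by (metis mult.commute power_mult)
 qed
 have sq: "s ^ 2 * q ^ 2 = 1" using qpow_eqs(2) by (simp add: mult.commute)
 have e: "(a ^ (n * (2 * p))) = 1" if "a ^ p = 1" for a :: complex and n
  using that by (metis mult.assoc mult.commute power_mult power_one)
 show "kinv (End V) K = J" "kinv (End V) J = K"
  unfolding kinv_def by (rule end_V_ext; simp add: cl diag_pow KX JX *[OF roots(1) qpow_eqs(2)] *[OF roots(2) sq] del: V_simps)+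
 show "K [^]\<^bsub>End V\<^esub> (2 * p) = \<one>\<^bsub>End V\<^esub>" "J [^]\<^bsub>End V\<^esub> (2 * p) = \<one>\<^bsub>End V\<^esub>"
  by (rule end_V_ext; simp add: cl diag_pow e[OF roots(1)] e[OF roots(2)] end_simps del: V_simps)+
qed

lemma KU: "K \<otimes>\<^bsub>End V\<^esub> U = q ^ 2 \<odot>\<^bsub>End V\<^esub> (U \<otimes>\<^bsub>End V\<^esub> K)"
 and KD: "K \<otimes>\<^bsub>End V\<^esub> D = s ^ 2 \<odot>\<^bsub>End V\<^esub> (D \<otimes>\<^bsub>End V\<^esub> K)"
 and JU: "J \<otimes>\<^bsub>End V\<^esub> U = s ^ 2 \<odot>\<^bsub>End V\<^esub> (U \<otimes>\<^bsub>End V\<^esub> J)"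
 and JD: "J \<otimes>\<^bsub>End V\<^esub> D = q ^ 2 \<odot>\<^bsub>End V\<^esub> (D \<otimes>\<^bsub>End V\<^esub> J)"
 and KL: "K \<otimes>\<^bsub>End V\<^esub> lmul V (X 1) = q ^ 2 \<odot>\<^bsub>End V\<^esub> (lmul V (X 1) \<otimes>\<^bsub>End V\<^esub> K)"
 and JL: "J \<otimes>\<^bsub>End V\<^esub> lmul V (X 1) = s ^ 2 \<odot>\<^bsub>End V\<^esub> (lmul V (X 1) \<otimes>\<^bsub>End V\<^esub> J)"
proof -
 \<comment> \<open>At n = 0 the exponent n - 1 is truncated, but there \<open>dn\<close>
   vanishes.\<close>
 have w: "(q ^ 2) ^ (n - 1) * dn n = s ^ 2 * ((q ^ 2) ^ n * dn n)" "(s ^ 2) ^ (n - 1) * dn n = q ^ 2 * ((s ^ 2) ^ n * dn n)" for n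
 proof -
  have *: "x ^ (n - 1) * dn n = y * (x ^ n * dn n)" if "x * y = 1" for x y :: complex
  proof (cases n)
   case (Suc m)
   have "y * (x ^ Suc m * dn n) = (x * y) * (x ^ m * dn n)" by (simp only: power_Suc ac_simps)
   then show ?thesis using Suc that by simp
  qed simp
  have "s ^ 2 * q ^ 2 = 1" using qpow_eqs(2) by (simp only: mult.commute)
  then show "(q ^ 2) ^ (n - 1) * dn n = s ^ 2 * ((q ^ 2) ^ n * dn n)" "(s ^ 2) ^ (n - 1) * dn n = q ^ 2 * ((s ^ 2) ^ n * dn n)"
   using qpow_eqs(2) by (simp_all only: *)
 qed
 show "K \<otimes>\<^bsub>End V\<^esub> U = q ^ 2 \<odot>\<^bsub>End V\<^esub> (U \<otimes>\<^bsub>End V\<^esub> K)"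
  "J \<otimes>\<^bsub>End V\<^esub> U = s ^ 2 \<odot>\<^bsub>End V\<^esub> (U \<otimes>\<^bsub>End V\<^esub> J)"
  "K \<otimes>\<^bsub>End V\<^esub> lmul V (X 1) = q ^ 2 \<odot>\<^bsub>End V\<^esub> (lmul V (X 1) \<otimes>\<^bsub>End V\<^esub> K)"
  "J \<otimes>\<^bsub>End V\<^esub> lmul V (X 1) = s ^ 2 \<odot>\<^bsub>End V\<^esub> (lmul V (X 1) \<otimes>\<^bsub>End V\<^esub> J)"
  by (rule end_V_ext; simp add: clL appl ac_simps del: V_simps)+
 show "K \<otimes>\<^bsub>End V\<^esub> D = s ^ 2 \<odot>\<^bsub>End V\<^esub> (D \<otimes>\<^bsub>End V\<^esub> K)"
  by (rule end_V_ext; simp add: clL appl del: V_simps) (simp only: w(1) mult.commute[of "dn _"])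
 show "J \<otimes>\<^bsub>End V\<^esub> D = q ^ 2 \<odot>\<^bsub>End V\<^esub> (D \<otimes>\<^bsub>End V\<^esub> J)"
  by (rule end_V_ext; simp add: clL appl del: V_simps) (simp only: w(2) mult.commute[of "dn _"])
qed

lemma UD: "U \<otimes>\<^bsub>End V\<^esub> D = D \<otimes>\<^bsub>End V\<^esub> U \<oplus>\<^bsub>End V\<^esub> (g \<odot>\<^bsub>End V\<^esub> K \<oplus>\<^bsub>End V\<^esub> (- g) \<odot>\<^bsub>End V\<^esub> J)"
proof (rule end_V_ext)
 fix n
 have 1: "(U \<otimes>\<^bsub>End V\<^esub> D) (X n) = (if n = 0 then 0 else up (n - 1) * dn n) \<odot>\<^bsub>V\<^esub> X n"
  by (cases n) (simp_all add: clL appl mult.commute lin_zero[OF end_lin[OF cl(1)] V.cvec_axioms V.cvec_axioms] del: V_simps)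
 have 2: "(D \<otimes>\<^bsub>End V\<^esub> U \<oplus>\<^bsub>End V\<^esub> (g \<odot>\<^bsub>End V\<^esub> K \<oplus>\<^bsub>End V\<^esub> (- g) \<odot>\<^bsub>End V\<^esub> J)) (X n)
   = (dn (Suc n) * up n + (g * (q ^ 2) ^ n + (- g) * (s ^ 2) ^ n)) \<odot>\<^bsub>V\<^esub> X n"
 proof -
  have "(D \<otimes>\<^bsub>End V\<^esub> U \<oplus>\<^bsub>End V\<^esub> (g \<odot>\<^bsub>End V\<^esub> K \<oplus>\<^bsub>End V\<^esub> (- g) \<odot>\<^bsub>End V\<^esub> J)) (X n)
   = (dn (Suc n) * up n) \<odot>\<^bsub>V\<^esub> X n \<oplus>\<^bsub>V\<^esub> ((g * (q ^ 2) ^ n) \<odot>\<^bsub>V\<^esub> X n \<oplus>\<^bsub>V\<^esub> ((- g) * (s ^ 2) ^ n) \<odot>\<^bsub>V\<^esub> X n)"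
   by (simp add: clL appl mult.commute del: V_simps)
  then show ?thesis by (simp only: V.sm_add X_closed)
 qed
 have "(if n = 0 then 0 else up (n - 1) * dn n) = dn (Suc n) * up n + (g * (q ^ 2) ^ n + (- g) * (s ^ 2) ^ n)"
  using updn[of n] by (simp add: algebra_simps)
 then show "(U \<otimes>\<^bsub>End V\<^esub> D) (X n) = (D \<otimes>\<^bsub>End V\<^esub> U \<oplus>\<^bsub>End V\<^esub> (g \<odot>\<^bsub>End V\<^esub> K \<oplus>\<^bsub>End V\<^esub> (- g) \<odot>\<^bsub>End V\<^esub> J)) (X n)"
  unfolding 1 2 by simp
qed (simp_all add: cl)

text \<open>The commutator as it is needed for \<partial>, where E lowers, F raises and K acts by
  the operator \<open>J\<close>.\<close>

lemma DU: "D \<otimes>\<^bsub>End V\<^esub> U = U \<otimes>\<^bsub>End V\<^esub> D \<oplus>\<^bsub>End V\<^esub> (g \<odot>\<^bsub>End V\<^esub> J \<oplus>\<^bsub>End V\<^esub> (- g) \<odot>\<^bsub>End V\<^esub> K)"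
 unfolding UD
 by (rule E.scale_one_eqI; simp add: cl E.nf del: E.r_one E.sm_one;
    (simp only: E.Lfold E.m_closed E.one_closed cl, rule E.Lc_eqI, simp only: Llook, simp add: scalar_rules algebra_simps)?)

text \<open>One product, two expansions, resting on the two recursions for \<open>up\<close>. For z,
  where E raises, q^(2n) appears as the operator \<open>K\<close>; for \<partial>, where F raises,
  the passage past the variable costs the factor q^2 instead.\<close>

lemma UL: "U \<otimes>\<^bsub>End V\<^esub> lmul V (X 1) = (- q) \<odot>\<^bsub>End V\<^esub> (lmul V (X 1) \<otimes>\<^bsub>End V\<^esub> lmul V (X 1) \<otimes>\<^bsub>End V\<^esub> K) \<oplus>\<^bsub>End V\<^esub> lmul V (X 1) \<otimes>\<^bsub>End V\<^esub> U"
 and UL': "U \<otimes>\<^bsub>End V\<^esub> lmul V (X 1) = (- q) \<odot>\<^bsub>End V\<^esub> (lmul V (X 1) \<otimes>\<^bsub>End V\<^esub> lmul V (X 1)) \<oplus>\<^bsub>End V\<^esub> q ^ 2 \<odot>\<^bsub>End V\<^esub> (lmul V (X 1) \<otimes>\<^bsub>End V\<^esub> U)"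
 by (rule end_V_ext; simp add: clL appl up_Suc algebra_simps del: V_simps flip: V.sm_add)
   (rule end_V_ext; simp add: clL appl up_Suc' algebra_simps del: V_simps flip: V.sm_add)

lemma DL: "D \<otimes>\<^bsub>End V\<^esub> lmul V (X 1) = \<one>\<^bsub>End V\<^esub> \<oplus>\<^bsub>End V\<^esub> s ^ 2 \<odot>\<^bsub>End V\<^esub> (lmul V (X 1) \<otimes>\<^bsub>End V\<^esub> D)"
 and DL': "D \<otimes>\<^bsub>End V\<^esub> lmul V (X 1) = J \<oplus>\<^bsub>End V\<^esub> lmul V (X 1) \<otimes>\<^bsub>End V\<^esub> D"
proof -
 have *: "dn n \<odot>\<^bsub>V\<^esub> X (Suc (n - 1)) = dn n \<odot>\<^bsub>V\<^esub> X n" for n by (cases n) simp_all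
 show "D \<otimes>\<^bsub>End V\<^esub> lmul V (X 1) = \<one>\<^bsub>End V\<^esub> \<oplus>\<^bsub>End V\<^esub> s ^ 2 \<odot>\<^bsub>End V\<^esub> (lmul V (X 1) \<otimes>\<^bsub>End V\<^esub> D)"
 proof (rule end_V_ext)
  fix n
  have "(\<one>\<^bsub>End V\<^esub> \<oplus>\<^bsub>End V\<^esub> s ^ 2 \<odot>\<^bsub>End V\<^esub> (lmul V (X 1) \<otimes>\<^bsub>End V\<^esub> D)) (X n) = 1 \<odot>\<^bsub>V\<^esub> X n \<oplus>\<^bsub>V\<^esub> s ^ 2 \<odot>\<^bsub>V\<^esub> (dn n \<odot>\<^bsub>V\<^esub> X n)"
   by (simp add: clL appl del: V_simps) (simp add: * del: V_simps flip: V.sm_sm)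
  then show "(D \<otimes>\<^bsub>End V\<^esub> lmul V (X 1)) (X n) = (\<one>\<^bsub>End V\<^esub> \<oplus>\<^bsub>End V\<^esub> s ^ 2 \<odot>\<^bsub>End V\<^esub> (lmul V (X 1) \<otimes>\<^bsub>End V\<^esub> D)) (X n)"
   by (simp add: clL appl dn_Suc V.sm_add del: V_simps)
 qed (simp_all add: clL)
 show "D \<otimes>\<^bsub>End V\<^esub> lmul V (X 1) = J \<oplus>\<^bsub>End V\<^esub> lmul V (X 1) \<otimes>\<^bsub>End V\<^esub> D"
  by (rule end_V_ext; simp add: clL appl dn_Suc' V.sm_add * del: V_simps)
qed

lemma hcond_lmul: "hcond (End V) {i} (\<lambda>_. lmul V (X 1))"
 by (rule hom_hcond[OF lmul_hom[OF V_alg] V_alg E.cx_algebra_axioms hcond_V])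

lemma scond_z:
 assumes "y gE = U" "y gK = K" "y gF = D" "even i"
 shows "scond (End V) {i} (\<lambda>_. lmul V (X 1)) y"
proof -
 have "range y \<subseteq> carrier (End V)" by (rule image_subsetI, rename_tac a, case_tac a) (simp_all add: assms cl)
 then have "ucond (End V) y"
  unfolding ucond_def assms kinv_KJ by (intro conjI KU KD UD pow_zero kinv_KJ refl)
 moreover have "zcross (End V) y (lmul V (X 1))"
  unfolding zcross_def assms by (intro conjI KL UL DL)
 ultimately show ?thesis unfolding scond_def using hcond_lmul[of i] assms(4) by simp
qed

text \<open>For \<partial> the roles of E and F are exchanged and K acts by the inverse diagonal
  operator.\<close>

lemma scond_d:
 assumes "y gE = D" "y gK = J" "y gF = U" "odd i"
 shows "scond (End V) {i} (\<lambda>_. lmul V (X 1)) y"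
proof -
 have "range y \<subseteq> carrier (End V)" by (rule image_subsetI, rename_tac a, case_tac a) (simp_all add: assms cl)
 then have "ucond (End V) y"
  unfolding ucond_def assms kinv_KJ by (intro conjI JD JU DU pow_zero kinv_KJ refl)
 moreover have "dcross (End V) y (lmul V (X 1))"
  unfolding dcross_def assms by (intro conjI JL UL' DL')
 ultimately show ?thesis unfolding scond_def using hcond_lmul[of i] assms(4) by simp
qed

end

lemma wop_X_all:
 assumes "!!n. n \<ge> p ==> a b n = 0" "!!n. n < p ==> a b n \<in> carrier V"
 shows "wop a b (X n) = a b n"
proof (cases "n < p")
 case False
 then have "wop a b (X n) = 0" using lin_zero[OF wop_lin[of a b, OF assms(2)] V.cvec_axioms V.cvec_axioms] by (simp add: X_big)
 then show ?thesis using False assms(1) by simp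
qed (rule wop_X)

lemma act_values:
 "z_act p gE n = up n \<odot>\<^bsub>V\<^esub> X (Suc n)" "z_act p gK n = (q ^ 2) ^ n \<odot>\<^bsub>V\<^esub> X n" "z_act p gF n = dn n \<odot>\<^bsub>V\<^esub> X (n - 1)"
 "d_act p gF n = up n \<odot>\<^bsub>V\<^esub> X (Suc n)" "d_act p gK n = (s ^ 2) ^ n \<odot>\<^bsub>V\<^esub> X n" "d_act p gE n = dn n \<odot>\<^bsub>V\<^esub> X (n - 1)"
 using up_eq[of n] dn_eq[of n]
 by (simp_all add: mult.commute[of _ "qint p n"]) (simp_all add: power_mult q_def s_def flip: Suc_eq_plus1)

lemma dn_big: "n \<ge> p ==> dn n \<odot>\<^bsub>V\<^esub> X (n - 1) = 0"
 by (cases "n = p") (simp_all add: dn_p X_big)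

lemma act_carrier: "z_act p b n \<in> carrier V" "d_act p b n \<in> carrier V"
 by (cases b; simp only: act_values V.sm_closed X_closed)+

lemma act_big: "n \<ge> p ==> z_act p b n = 0" "n \<ge> p ==> d_act p b n = 0"
 by (cases b; simp only: act_values; simp add: dn_big[simplified] X_big)+

lemma V_restrict: "restrict (wop a b) (carrier V) (X n) = wop a b (X n)"
 by (rule restrict_apply') (rule X_closed)

text \<open>Supplies the inverse of the action of K, which the common treatment of z and \<partial>
  takes as a separate diagonal operator.\<close>

lemma diag_ops: "\<exists>K\<in>carrier (End V). \<forall>n. K (X n) = c ^ n \<odot>\<^bsub>V\<^esub> X n"
proof -
 let ?a = "\<lambda>(b :: ugen) n. c ^ n \<odot>\<^bsub>V\<^esub> X n"
 have "restrict (wop ?a gE) (carrier V) \<in> carrier (End V)"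
  by (rule restrict_end[OF V.cvec_axioms wop_lin]) (simp only: V.sm_closed X_closed)
 moreover have "restrict (wop ?a gE) (carrier V) (X n) = c ^ n \<odot>\<^bsub>V\<^esub> X n" for n
  unfolding V_restrict by (rule wop_X_all) (simp add: X_big, simp only: V.sm_closed X_closed)
 ultimately show ?thesis by blast
qed

lemma kinv_tensor_values:
 "even i ==> coact_gen (tensor H V) (\<lambda>a. tens H V (ug a) \<one>\<^bsub>V\<^esub>) (\<lambda>i. tens H V \<one>\<^bsub>H\<^esub> (X 1)) i
  = tens H V (u_cls p (Kinv p)) (X 1) \<oplus>\<^bsub>tensor H V\<^esub>
   (- (qq p - inverse (qq p))) \<odot>\<^bsub>tensor H V\<^esub> tens H V (u_cls p (gen gE * Kinv p)) 1"
 "odd i ==> coact_gen (tensor H V) (\<lambda>a. tens H V (ug a) \<one>\<^bsub>V\<^esub>) (\<lambda>i. tens H V \<one>\<^bsub>H\<^esub> (X 1)) i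
  = tens H V (u_cls p (Kinv p)) (X 1) \<oplus>\<^bsub>tensor H V\<^esub>
   (qq p - inverse (qq p)) \<odot>\<^bsub>tensor H V\<^esub> tens H V (u_cls p (gen gF)) 1"
proof -
 interpret T: tensor_algs "H" V by unfold_locales
 have sq: "- (qq p - inverse (qq p)) = s - q" "qq p - inverse (qq p) = q - s" by (simp_all add: q_def s_def)
 have one: "(1 :: complex poly) = \<one>\<^bsub>V\<^esub>" by simp
 show "even i ==> coact_gen (tensor H V) (\<lambda>a. tens H V (ug a) \<one>\<^bsub>V\<^esub>) (\<lambda>i. tens H V \<one>\<^bsub>H\<^esub> (X 1)) i
  = tens H V (u_cls p (Kinv p)) (X 1) \<oplus>\<^bsub>tensor H V\<^esub>
   (- (qq p - inverse (qq p))) \<odot>\<^bsub>tensor H V\<^esub> tens H V (u_cls p (gen gE * Kinv p)) 1"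
  "odd i ==> coact_gen (tensor H V) (\<lambda>a. tens H V (ug a) \<one>\<^bsub>V\<^esub>) (\<lambda>i. tens H V \<one>\<^bsub>H\<^esub> (X 1)) i
  = tens H V (u_cls p (Kinv p)) (X 1) \<oplus>\<^bsub>tensor H V\<^esub>
   (qq p - inverse (qq p)) \<odot>\<^bsub>tensor H V\<^esub> tens H V (u_cls p (gen gF)) 1"
  unfolding sq u_cls_mult u_cls_Kinv coact_gen_def twist_def one
  by (simp_all add: tensor_left_ucond(2)[OF V_alg] T.tens_mult del: V_simps)
qed

lemma restrict_end_ops:
 "restrict (wop (z_act p) b) (carrier V) \<in> carrier (End V)" "restrict (wop (d_act p) b) (carrier V) \<in> carrier (End V)"
 by (rule restrict_end[OF V.cvec_axioms wop_lin], rule act_carrier)+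

lemma ops_X:
 "restrict (wop (z_act p) b) (carrier V) (X n) = z_act p b n" "restrict (wop (d_act p) b) (carrier V) (X n) = d_act p b n"
 unfolding V_restrict by (rule wop_X_all, erule act_big, rule act_carrier)+

lemma yd_data_Cz:
 assumes i: "even i" shows "yd_data p q s g (Cz p) {i} (\<lambda>_. X 1)"
proof -
 obtain J where J: "J \<in> carrier (End V)" "!!n. J (X n) = (s ^ 2) ^ n \<odot>\<^bsub>V\<^esub> X n" using diag_ops by blast
 have "scond (End V) {i} (\<lambda>_. lmul V (X 1)) (\<lambda>b. restrict (wop (z_act p) b) (carrier V))"
  by (rule scond_z[OF restrict_end_ops(1) restrict_end_ops(1) restrict_end_ops(1) J(1) _ _ _ J(2) refl refl refl i])
   (simp_all only: ops_X act_values)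
 moreover have "z_act p b 0 = Polynomial.smult (u_counit_gen b) 1" for b
  by (cases b; simp only: act_values; simp add: X_0)
 ultimately show ?thesis
  unfolding Cz_def by (intro trunc_yd_data act_carrier kinv_tensor_values(1)[symmetric] i)
qed

lemma yd_data_Cd:
 assumes i: "odd i" shows "yd_data p q s g (Cd p) {i} (\<lambda>_. X 1)"
proof -
 obtain K where K: "K \<in> carrier (End V)" "!!n. K (X n) = (q ^ 2) ^ n \<odot>\<^bsub>V\<^esub> X n" using diag_ops by blast
 have "scond (End V) {i} (\<lambda>_. lmul V (X 1)) (\<lambda>b. restrict (wop (d_act p) b) (carrier V))"
  by (rule scond_d[OF restrict_end_ops(2) restrict_end_ops(2) K(1) restrict_end_ops(2) _ _ K(2) _ refl refl refl i])
   (simp_all only: ops_X act_values)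
 moreover have "d_act p b 0 = Polynomial.smult (u_counit_gen b) 1" for b
  by (cases b; simp only: act_values; simp add: X_0)
 ultimately show ?thesis
  unfolding Cd_def by (intro trunc_yd_data act_carrier kinv_tensor_values(2)[symmetric] i)
qed

theorem yd_Cd_Cz: "yd_algebra H (Cd p)" "yd_algebra H (Cz p)"
 using yd_data.yd_algebra_X[OF yd_data_Cd[of 1]] yd_data.yd_algebra_X[OF yd_data_Cz[of 0]] by simp_all

end


section \<open>Iterated tensor products\<close>

context cvec
begin

lemma lin_ext_rel_add:
 assumes "f a \<in> carrier V" "f b \<in> carrier V" "f c \<in> carrier V" "f a = f b \<oplus> f c"
 shows "lin_ext V f (single a 1 - single b 1 - single c 1) = \<zero>"
proof -
 have k: "!!k. k \<in> {a, b, c} ==> f k \<in> carrier V" using assms(1-3) by auto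
 have d: "keys (single a (1::complex) - single b 1) \<subseteq> {a, b, c}"
  by (intro subset_trans[OF keys_diff_subset]) auto
 have "lin_ext V f (single a 1 - single b 1 - single c 1) = f a \<ominus> f b \<ominus> f c"
  using assms(1-3) d
  by (subst lin_ext_diff[where S = "{a, b, c}"], auto)
   (subst lin_ext_diff[where S = "{a, b, c}"], auto simp: lin_ext_single)
 also have "f a \<ominus> f b = f c"
  using assms(2,3) by (simp add: assms(4) a_comm[of "f b"] a_minus_def a_assoc r_neg)
 finally show ?thesis using assms by (simp add: diff_zero_iff)
qed

lemma lin_ext_rel_sm:
 assumes "f a \<in> carrier V" "f b \<in> carrier V" "f a = c \<odot> f b"
 shows "lin_ext V f (single a 1 - single b c) = \<zero>"
proof -
 have k: "!!k. k \<in> {a, b} ==> f k \<in> carrier V" using assms(1,2) by auto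
 have "lin_ext V f (single a 1 - single b c) = f a \<ominus> c \<odot> f b"
  using assms(1,2) by (subst lin_ext_diff[where S = "{a, b}"]) (auto simp: lin_ext_single)
 then show ?thesis using assms by (simp add: diff_zero_iff)
qed

end

lemma pure_Cons: "pure_lists (X # Xs) = {x # xs | x xs. x \<in> carrier X \<and> xs \<in> pure_lists Xs}"
 by (auto simp: set_Cons_def)

lemma pure_length: "xs \<in> pure_lists Xs ==> length xs = length Xs"
 by (induction Xs arbitrary: xs) (auto simp: set_Cons_def)

lemma pure_nth: "xs \<in> pure_lists Xs ==> i < length Xs ==> xs ! i \<in> carrier (Xs ! i)"
 by (induction Xs arbitrary: xs i) (auto simp: set_Cons_def nth_Cons split: nat.split)

lemma pure_update: "xs \<in> pure_lists Xs ==> i < length Xs ==> a \<in> carrier (Xs ! i) ==> xs[i := a] \<in> pure_lists Xs"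
 by (induction Xs arbitrary: xs i) (auto simp: set_Cons_def nth_Cons split: nat.splits)

lemma pure_append: "xs \<in> pure_lists Xs ==> ys \<in> pure_lists Ys ==> xs @ ys \<in> pure_lists (Xs @ Ys)"
 by (induction Xs arbitrary: xs) (auto simp: set_Cons_def)

locale mspace =
 fixes Xs :: "(complex, 'x, 'm) module_scheme list"
 assumes cv: "!!X. X \<in> set Xs ==> cvec X"
begin

lemma nth_closed:
 assumes "i < length Xs" "a \<in> carrier (Xs ! i)" "b \<in> carrier (Xs ! i)"
 shows "a \<oplus>\<^bsub>Xs ! i\<^esub> b \<in> carrier (Xs ! i)" "c \<odot>\<^bsub>Xs ! i\<^esub> a \<in> carrier (Xs ! i)"
proof -
 interpret X: cvec "Xs ! i" using assms by (intro cv) auto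
 show "a \<oplus>\<^bsub>Xs ! i\<^esub> b \<in> carrier (Xs ! i)" "c \<odot>\<^bsub>Xs ! i\<^esub> a \<in> carrier (Xs ! i)" using assms by auto
qed

lemma multilin_keys: "r \<in> multilin_rels Xs ==> keys r \<subseteq> pure_lists Xs"
 unfolding multilin_rels_def
 by (elim UnE) (auto dest!: subsetD[OF keys_diff_subset] split: if_splits simp: pure_update nth_closed)

sublocale M: fquot "pure_lists Xs" "multilin_rels Xs" undefined "single (map one Xs) 1" "mtensor Xs"
 by unfold_locales (simp_all add: multilin_keys mtensor_def)

lemma mtens_eq: "mtens Xs xs = M.kl (single xs 1)"
 by (simp add: mtens_def)

lemma mtens_closed [simp]: "xs \<in> pure_lists Xs ==> mtens Xs xs \<in> carrier (mtensor Xs)"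
 unfolding mtens_eq by (rule M.kl_closed) auto

lemma one_mtensor: "\<one>\<^bsub>mtensor Xs\<^esub> = mtens Xs (map one Xs)"
 unfolding mtens_eq by (rule M.one_Q)

lemma mtens_add:
 assumes "xs \<in> pure_lists Xs" "i < length Xs" "a \<in> carrier (Xs ! i)" "b \<in> carrier (Xs ! i)"
 shows "mtens Xs (xs[i := a \<oplus>\<^bsub>Xs ! i\<^esub> b]) = mtens Xs (xs[i := a]) \<oplus>\<^bsub>mtensor Xs\<^esub> mtens Xs (xs[i := b])"
proof -
 have "single (xs[i := a \<oplus>\<^bsub>Xs ! i\<^esub> b]) 1 - single (xs[i := a]) 1 - single (xs[i := b]) 1 \<in> cspan (multilin_rels Xs)"
  using assms by (intro fv.span_base) (unfold multilin_rels_def, blast)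
 then show ?thesis unfolding mtens_eq using assms
  by (subst M.add_Q) (simp_all add: pure_update nth_closed cls_eq_iff diff_diff_eq)
qed

lemma mtens_sm:
 assumes "xs \<in> pure_lists Xs" "i < length Xs" "a \<in> carrier (Xs ! i)"
 shows "mtens Xs (xs[i := c \<odot>\<^bsub>Xs ! i\<^esub> a]) = c \<odot>\<^bsub>mtensor Xs\<^esub> mtens Xs (xs[i := a])"
proof -
 have "single (xs[i := c \<odot>\<^bsub>Xs ! i\<^esub> a]) 1 - single (xs[i := a]) c \<in> cspan (multilin_rels Xs)"
  using assms by (intro fv.span_base) (unfold multilin_rels_def, blast)
 then show ?thesis unfolding mtens_eq using assms
  by (subst M.smult_Q) (simp_all add: pure_update nth_closed cls_eq_iff)
qed

lemma mlin:
 assumes M: "cvec M" and f: "!!xs. xs \<in> pure_lists Xs ==> f xs \<in> carrier M"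
  and a: "!!xs i a b. xs \<in> pure_lists Xs ==> i < length Xs ==> a \<in> carrier (Xs ! i) ==> b \<in> carrier (Xs ! i) ==>
    f (xs[i := a \<oplus>\<^bsub>Xs ! i\<^esub> b]) = f (xs[i := a]) \<oplus>\<^bsub>M\<^esub> f (xs[i := b])"
  and s: "!!xs i a c. xs \<in> pure_lists Xs ==> i < length Xs ==> a \<in> carrier (Xs ! i) ==>
    f (xs[i := c \<odot>\<^bsub>Xs ! i\<^esub> a]) = c \<odot>\<^bsub>M\<^esub> f (xs[i := a])"
 shows "(\<lambda>t. lin_ext M f (rep t)) \<in> lin_maps (mtensor Xs) M"
  and "xs \<in> pure_lists Xs ==> lin_ext M f (rep (mtens Xs xs)) = f xs"
proof -
 interpret M: cvec M by fact
 have z: "lin_ext M f r = \<zero>\<^bsub>M\<^esub>" if "r \<in> multilin_rels Xs" for r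
  using that unfolding multilin_rels_def
 proof (elim UnE CollectE exE conjE)
  fix xs i a' b assume "r = single (xs[i := a' \<oplus>\<^bsub>Xs ! i\<^esub> b]) 1 - single (xs[i := a']) 1 - single (xs[i := b]) 1"
   "xs \<in> pure_lists Xs" "i < length Xs" "a' \<in> carrier (Xs ! i)" "b \<in> carrier (Xs ! i)"
  then show ?thesis by (simp only:) (rule M.lin_ext_rel_add; simp add: f a pure_update nth_closed)
 next
  fix xs i a c assume "r = single (xs[i := c \<odot>\<^bsub>Xs ! i\<^esub> a]) 1 - single (xs[i := a]) c"
   "xs \<in> pure_lists Xs" "i < length Xs" "a \<in> carrier (Xs ! i)"
  then show ?thesis by (simp only:) (rule M.lin_ext_rel_sm; simp add: f s pure_update nth_closed)
 qed
 note L = M.lin_from_Q[of M f, OF assms(1) f z]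
 show "(\<lambda>t. lin_ext M f (rep t)) \<in> lin_maps (mtensor Xs) M" by (rule L(1))
 show "xs \<in> pure_lists Xs ==> lin_ext M f (rep (mtens Xs xs)) = f xs"
  unfolding mtens_eq using f[of xs] by (subst L(2)) (simp_all add: M.lin_ext_single)
qed

lemma mlin_eq:
 assumes "F \<in> lin_maps (mtensor Xs) M" "cvec M" "!!xs. xs \<in> pure_lists Xs ==> F (mtens Xs xs) = f xs" "t \<in> carrier (mtensor Xs)"
 shows "lin_ext M f (rep t) = F t"
 by (rule M.lin_ext_Q_eq[OF assms(1,2) _ assms(4)]) (use assms(3) in \<open>simp add: mtens_eq\<close>)

lemma mtens_ext:
 assumes "F \<in> lin_maps (mtensor Xs) M" "G \<in> lin_maps (mtensor Xs) M" "cvec M"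
  "!!xs. xs \<in> pure_lists Xs ==> F (mtens Xs xs) = G (mtens Xs xs)" "t \<in> carrier (mtensor Xs)"
 shows "F t = G t"
 by (rule M.lin_Q_ext[OF assms(1-3) _ assms(5)]) (use assms(4) in \<open>simp add: mtens_eq\<close>)

lemma mtens_induct [consumes 1, case_names mtens add smult]:
 assumes "t \<in> carrier (mtensor Xs)" "!!xs. xs \<in> pure_lists Xs ==> P (mtens Xs xs)"
  "!!s t. s \<in> carrier (mtensor Xs) ==> t \<in> carrier (mtensor Xs) ==> P s ==> P t ==> P (s \<oplus>\<^bsub>mtensor Xs\<^esub> t)"
  "!!c t. t \<in> carrier (mtensor Xs) ==> P t ==> P (c \<odot>\<^bsub>mtensor Xs\<^esub> t)"
  "P \<zero>\<^bsub>mtensor Xs\<^esub>"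
 shows "P t"
proof -
 obtain r where r: "keys r \<subseteq> pure_lists Xs" "t = M.kl r" using assms(1) by (rule M.carrierE)
 from r(1) have "M.kl r \<in> carrier (mtensor Xs) \<and> P (M.kl r)"
 proof (induction r rule: pm_induct)
  case zero
  then show ?case using assms(5) M.Q.zero_closed by (simp add: M.zero_Q)
 next
  case (add k c r)
  have "M.kl (single k c + r) = c \<odot>\<^bsub>mtensor Xs\<^esub> mtens Xs k \<oplus>\<^bsub>mtensor Xs\<^esub> M.kl r"
   using add unfolding mtens_eq by (subst M.smult_Q, simp, subst M.add_Q) simp_all
  then show ?case using add assms(2-4) by simp
 qed
 then show ?thesis using r(2) by simp
qed

end

lemma mspaceI: "(!!X. X \<in> set Xs ==> cvec X) ==> mspace Xs" by (simp add: mspace_def)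

text \<open>The inverse of \<open>mcons\<close>: a list is read as its head tensored with its tail.
  It exhibits an iterated tensor product as a tensor product of two spaces.\<close>

definition msplit :: "(complex, 'x, 'm) module_scheme => (complex, 'x, 'm) module_scheme list =>
  ('x list \<Rightarrow>\<^sub>0 complex) set => ('x \<times> ('x list \<Rightarrow>\<^sub>0 complex) set \<Rightarrow>\<^sub>0 complex) set" where
 "msplit X Xs s = lin_ext (tensor X (mtensor Xs)) (\<lambda>l. tens X (mtensor Xs) (hd l) (mtens Xs (tl l))) (rep s)"

locale mcons_space = X: cvec X + Y: mspace Xs for X :: "(complex, 'x, 'm) module_scheme" and Xs :: "(complex, 'x, 'm) module_scheme list"
begin

sublocale Z: mspace "X # Xs"
 by (rule mspaceI) (auto simp: X.cvec_axioms Y.cv)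

sublocale T: tensor_spaces X "mtensor Xs" by unfold_locales

lemma mtens_Cons_lin:
 assumes "xs \<in> pure_lists Xs"
 shows "(\<lambda>x. mtens (X # Xs) (x # xs)) \<in> lin_maps X (mtensor (X # Xs))"
proof (rule lin_mapsI)
 have p: "x \<in> carrier X ==> x # xs \<in> pure_lists (X # Xs)" for x using assms by (auto simp: set_Cons_def)
 show "x \<in> carrier X ==> mtens (X # Xs) (x # xs) \<in> carrier (mtensor (X # Xs))" for x by (rule Z.mtens_closed) (rule p)
 show "mtens (X # Xs) ((x \<oplus>\<^bsub>X\<^esub> y) # xs) = mtens (X # Xs) (x # xs) \<oplus>\<^bsub>mtensor (X # Xs)\<^esub> mtens (X # Xs) (y # xs)"
  if "x \<in> carrier X" "y \<in> carrier X" for x y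
  using Z.mtens_add[OF p[OF that(1)], of 0 x y] that by simp
 show "mtens (X # Xs) ((c \<odot>\<^bsub>X\<^esub> x) # xs) = c \<odot>\<^bsub>mtensor (X # Xs)\<^esub> mtens (X # Xs) (x # xs)" if "x \<in> carrier X" for x c
  using Z.mtens_sm[OF p[OF that], of 0 x c] that by simp
qed

lemma mcons_lin:
 assumes x: "x \<in> carrier X"
 shows "mcons X Xs x \<in> lin_maps (mtensor Xs) (mtensor (X # Xs))"
  and "xs \<in> pure_lists Xs ==> mcons X Xs x (mtens Xs xs) = mtens (X # Xs) (x # xs)"
proof -
 have p: "xs \<in> pure_lists Xs ==> x # xs \<in> pure_lists (X # Xs)" for xs using x by (auto simp: set_Cons_def)
 note L = Y.mlin[OF Z.M.cvec_Q, of "\<lambda>xs. mtens (X # Xs) (x # xs)"]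
 have 1: "mtens (X # Xs) (x # xs[i := a \<oplus>\<^bsub>Xs ! i\<^esub> b]) = mtens (X # Xs) (x # xs[i := a]) \<oplus>\<^bsub>mtensor (X # Xs)\<^esub> mtens (X # Xs) (x # xs[i := b])"
  if "xs \<in> pure_lists Xs" "i < length Xs" "a \<in> carrier (Xs ! i)" "b \<in> carrier (Xs ! i)" for xs i a b
  using Z.mtens_add[OF p[OF that(1)], of "Suc i" a b] that by simp
 have 2: "mtens (X # Xs) (x # xs[i := c \<odot>\<^bsub>Xs ! i\<^esub> a]) = c \<odot>\<^bsub>mtensor (X # Xs)\<^esub> mtens (X # Xs) (x # xs[i := a])"
  if "xs \<in> pure_lists Xs" "i < length Xs" "a \<in> carrier (Xs ! i)" for xs i a c
  using Z.mtens_sm[OF p[OF that(1)], of "Suc i" a c] that by simp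
 show "mcons X Xs x \<in> lin_maps (mtensor Xs) (mtensor (X # Xs))"
  unfolding mcons_def[abs_def] by (rule L(1)[OF Z.mtens_closed[OF p] 1 2])
 show "xs \<in> pure_lists Xs ==> mcons X Xs x (mtens Xs xs) = mtens (X # Xs) (x # xs)"
  unfolding mcons_def by (rule L(2)[OF Z.mtens_closed[OF p] 1 2])
qed

lemma mcons_bilin: "bilin X (mtensor Xs) (mtensor (X # Xs)) (mcons X Xs)"
proof (rule bilinI)
 fix t assume t: "t \<in> carrier (mtensor Xs)"
 note c = lin_closed[OF mcons_lin(1)] and v = mcons_lin(2)
 show "(\<lambda>x. mcons X Xs x t) \<in> lin_maps X (mtensor (X # Xs))"
 proof (rule lin_mapsI)
  fix x y assume x: "x \<in> carrier X" "y \<in> carrier X"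
  show "mcons X Xs (x \<oplus>\<^bsub>X\<^esub> y) t = mcons X Xs x t \<oplus>\<^bsub>mtensor (X # Xs)\<^esub> mcons X Xs y t"
  proof (rule Y.mtens_ext[OF _ _ Z.M.cvec_Q _ t])
   show "mcons X Xs (x \<oplus>\<^bsub>X\<^esub> y) \<in> lin_maps (mtensor Xs) (mtensor (X # Xs))" using x by (intro mcons_lin) simp
   show "(\<lambda>t. mcons X Xs x t \<oplus>\<^bsub>mtensor (X # Xs)\<^esub> mcons X Xs y t) \<in> lin_maps (mtensor Xs) (mtensor (X # Xs))"
    using x c by (intro lin_mapsI) (simp_all add: lin_add[OF mcons_lin(1)] lin_sm[OF mcons_lin(1)] Z.M.Q.a_ac Z.M.Q.sm_distr)
  qed (use x in \<open>simp add: v lin_add[OF mtens_Cons_lin]\<close>)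
 next
  fix x k assume x: "x \<in> carrier X"
  show "mcons X Xs (k \<odot>\<^bsub>X\<^esub> x) t = k \<odot>\<^bsub>mtensor (X # Xs)\<^esub> mcons X Xs x t"
  proof (rule Y.mtens_ext[OF _ _ Z.M.cvec_Q _ t])
   show "mcons X Xs (k \<odot>\<^bsub>X\<^esub> x) \<in> lin_maps (mtensor Xs) (mtensor (X # Xs))" using x by (intro mcons_lin) simp
   show "(\<lambda>t. k \<odot>\<^bsub>mtensor (X # Xs)\<^esub> mcons X Xs x t) \<in> lin_maps (mtensor Xs) (mtensor (X # Xs))"
    using x c by (intro lin_mapsI) (simp_all add: lin_add[OF mcons_lin(1)] lin_sm[OF mcons_lin(1)] Z.M.Q.sm_sm Z.M.Q.sm_distr mult.commute)
  qed (use x in \<open>simp add: v lin_sm[OF mtens_Cons_lin]\<close>)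
 qed (use c t in blast)
qed (rule mcons_lin)

lemma msplit_lin:
 "msplit X Xs \<in> lin_maps (mtensor (X # Xs)) (tensor X (mtensor Xs))"
 "x \<in> carrier X ==> xs \<in> pure_lists Xs ==> msplit X Xs (mtens (X # Xs) (x # xs)) = tens X (mtensor Xs) x (mtens Xs xs)"
proof -
 let ?f = "\<lambda>l. tens X (mtensor Xs) (hd l) (mtens Xs (tl l))"
 note L = Z.mlin[OF T.T.cvec_Q, of ?f]
 have 0: "?f l \<in> carrier (tensor X (mtensor Xs))" if "l \<in> pure_lists (X # Xs)" for l
  using that unfolding pure_Cons by (auto simp: T.tens_closed)
 have 1: "?f (l[i := a \<oplus>\<^bsub>(X # Xs) ! i\<^esub> b]) = ?f (l[i := a]) \<oplus>\<^bsub>tensor X (mtensor Xs)\<^esub> ?f (l[i := b])"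
  if "l \<in> pure_lists (X # Xs)" "i < length (X # Xs)" "a \<in> carrier ((X # Xs) ! i)" "b \<in> carrier ((X # Xs) ! i)" for l i a b
  using that unfolding pure_Cons
  by (cases i) (auto simp: T.tens_add_left T.tens_add_right Y.mtens_add pure_update)
 have 2: "?f (l[i := c \<odot>\<^bsub>(X # Xs) ! i\<^esub> a]) = c \<odot>\<^bsub>tensor X (mtensor Xs)\<^esub> ?f (l[i := a])"
  if "l \<in> pure_lists (X # Xs)" "i < length (X # Xs)" "a \<in> carrier ((X # Xs) ! i)" for l i a c
  using that unfolding pure_Cons
  by (cases i) (auto simp: T.tens_sm_left T.tens_sm_right Y.mtens_sm pure_update)
 show "msplit X Xs \<in> lin_maps (mtensor (X # Xs)) (tensor X (mtensor Xs))"
  unfolding msplit_def[abs_def] by (rule L(1)[OF 0 1 2])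
 show "x \<in> carrier X ==> xs \<in> pure_lists Xs ==> msplit X Xs (mtens (X # Xs) (x # xs)) = tens X (mtensor Xs) x (mtens Xs xs)"
  unfolding msplit_def using L(2)[OF 0 1 2, of "x # xs"] unfolding pure_Cons by auto
qed

lemma mtensor_tprod: "tprod X (mtensor Xs) (mtensor (X # Xs)) (mcons X Xs) (msplit X Xs)"
proof unfold_locales
 show "bilin X (mtensor Xs) (mtensor (X # Xs)) (mcons X Xs)" by (rule mcons_bilin)
 show "msplit X Xs \<in> lin_maps (mtensor (X # Xs)) (tensor X (mtensor Xs))" by (rule msplit_lin)
 show "msplit X Xs (mcons X Xs v w) = tens X (mtensor Xs) v w" if "v \<in> carrier X" "w \<in> carrier (mtensor Xs)" for v w
  by (rule Y.mtens_ext[OF lin_comp[OF mcons_lin(1)[OF that(1)] msplit_lin(1)] bilinD(2)[OF T.bilin_tens that(1)] T.T.cvec_Q _ that(2)])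
   (simp add: mcons_lin msplit_lin that)
 note S = T.sweedler_lin[OF Z.M.cvec_Q mcons_bilin]
 show "sweedler (mtensor (X # Xs)) (mcons X Xs) (msplit X Xs x) = x" if x: "x \<in> carrier (mtensor (X # Xs))" for x
 proof (rule Z.mtens_ext[OF lin_comp[OF msplit_lin(1) S(1)] lin_id Z.M.cvec_Q _ x])
  fix l assume "l \<in> pure_lists (X # Xs)"
  then obtain x xs where l: "l = x # xs" "x \<in> carrier X" "xs \<in> pure_lists Xs" unfolding pure_Cons by blast
  show "sweedler (mtensor (X # Xs)) (mcons X Xs) (msplit X Xs (mtens (X # Xs) l)) = mtens (X # Xs) l"
   unfolding l(1) msplit_lin(2)[OF l(2,3)] S(2)[OF l(2) Y.mtens_closed[OF l(3)]] by (rule mcons_lin(2)[OF l(2,3)])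
 qed
qed

sublocale tprod X "mtensor Xs" "mtensor (X # Xs)" "mcons X Xs" "msplit X Xs" by (rule mtensor_tprod)

end

lemma mtensor_Nil: "mspace []" by (rule mspaceI) simp

section \<open>The diagonal action as a representation\<close>

context uq
begin

definition actrep :: "((ugen list \<Rightarrow>\<^sub>0 complex) set, 'x, 'n) yd_scheme => (ugen list \<Rightarrow>\<^sub>0 complex) set => 'x => 'x" where
 "actrep Y h = restrict (act Y h) (carrier Y)"

definition diag :: "((ugen list \<Rightarrow>\<^sub>0 complex) set, 'x, 'n) yd_scheme list => (ugen list \<Rightarrow>\<^sub>0 complex) set => _ => _" where
 "diag Ys h = restrict (diag_act H Ys h) (carrier (mtensor Ys))"

text \<open>The empty tensor product is the trivial module given by the counit, the start of the
  induction on the number of factors.\<close>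

lemma diag_Nil:
 "diag ([] :: ((ugen list \<Rightarrow>\<^sub>0 complex) set, 'x, 'n) yd_scheme list) \<in> alg_homs H (End (mtensor ([] :: ((ugen list \<Rightarrow>\<^sub>0 complex) set, 'x, 'n) yd_scheme list)))"
 "h \<in> carrier H ==> t \<in> carrier (mtensor ([] :: ((ugen list \<Rightarrow>\<^sub>0 complex) set, 'x, 'n) yd_scheme list)) ==>
   diag_act H ([] :: ((ugen list \<Rightarrow>\<^sub>0 complex) set, 'x, 'n) yd_scheme list) h t
   = counit H h \<odot>\<^bsub>mtensor ([] :: ((ugen list \<Rightarrow>\<^sub>0 complex) set, 'x, 'n) yd_scheme list)\<^esub> t"
proof -
 let ?N = "[] :: ((ugen list \<Rightarrow>\<^sub>0 complex) set, 'x, 'n) yd_scheme list"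
 interpret N: mspace ?N by (rule mtensor_Nil)
 have e: "diag_act H ?N h t = counit H h \<odot>\<^bsub>mtensor ?N\<^esub> t" if "t \<in> carrier (mtensor ?N)" for h t
  unfolding diag_act_def
  by (rule N.mlin_eq[OF _ N.M.cvec_Q _ that]) (auto intro!: lin_mapsI simp: N.M.Q.sm_distr N.M.Q.sm_sm mult.commute)
 then show "h \<in> carrier H ==> t \<in> carrier (mtensor ?N) ==> diag_act H ?N h t = counit H h \<odot>\<^bsub>mtensor ?N\<^esub> t" by simp
 have "(\<lambda>h. restrict (\<lambda>t. counit H h \<odot>\<^bsub>mtensor ?N\<^esub> t) (carrier (mtensor ?N))) \<in> alg_homs H (End (mtensor ?N))"
  by (rule end_hom[OF N.M.cvec_Q cx_algebra_Uq])
   (auto intro!: lin_mapsI simp: N.M.Q.sm_distr N.M.Q.sm_sm N.M.Q.sm_add mult.commute hom_add[OF counit_hom'] hom_sm[OF counit_hom'] hom_mult[OF counit_hom'] hom_one[OF counit_hom'])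
 moreover have "diag ?N = (\<lambda>h. restrict (\<lambda>t. counit H h \<odot>\<^bsub>mtensor ?N\<^esub> t) (carrier (mtensor ?N)))"
  unfolding diag_def by (rule ext, rule restrict_ext) (rule e)
 ultimately show "diag ?N \<in> alg_homs H (End (mtensor ?N))" by simp
qed

context
 fixes Y :: "((ugen list \<Rightarrow>\<^sub>0 complex) set, 'x, 'n) yd_scheme" and Ys
 assumes sp: "mcons_space Y Ys"
  and aX: "actrep Y \<in> alg_homs H (End Y)"
  and aXs: "diag Ys \<in> alg_homs H (End (mtensor Ys))"
  and pureXs: "!!h xs. h \<in> carrier H ==> xs \<in> pure_lists Ys ==> diag_act H Ys h (mtens Ys xs) = diag_act_pure H Ys h xs"
begin

interpretation S: mcons_space Y Ys by (rule sp)

abbreviation "CC \<equiv> End (mtensor (Y # Ys))"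
abbreviation "ru \<equiv> \<lambda>h. S.opL (actrep Y h)"
abbreviation "rv \<equiv> \<lambda>h. S.opR (diag Ys h)"

lemma ru_hom: "ru \<in> alg_homs H CC" by (rule hom_comp[OF aX S.opL_hom])
lemma rv_hom: "rv \<in> alg_homs H CC" by (rule hom_comp[OF aXs S.opR_hom])

lemma ruv: "a \<in> carrier H ==> b \<in> carrier H ==> ru a \<otimes>\<^bsub>CC\<^esub> rv b = rv b \<otimes>\<^bsub>CC\<^esub> ru a"
 by (rule S.opLR_comm[OF hom_closed[OF aX] hom_closed[OF aXs]])

lemma upair_ruv: "upair p q s g CC (\<lambda>a. ru (ug a)) (\<lambda>a. rv (ug a))"
 by unfold_locales
  (auto simp: ruv intro: hom_ucond[OF ru_hom cx_algebra_Uq S.ET.cx_algebra_axioms ucond_Uq] hom_ucond[OF rv_hom cx_algebra_Uq S.ET.cx_algebra_axioms ucond_Uq])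

text \<open>The recursion on pure tensors is the coproduct followed by the product of two commuting
  representations. This operator exists on the whole space, so the definition by representatives is
  independent of their choice, and the generators act by \<open>comult_gen\<close>.\<close>

lemma diag_Cons:
 "diag (Y # Ys) \<in> alg_homs H CC"
 "h \<in> carrier H ==> zs \<in> pure_lists (Y # Ys) ==> diag_act H (Y # Ys) h (mtens (Y # Ys) zs) = diag_act_pure H (Y # Ys) h zs"
 "diag (Y # Ys) (ug a) = comult_gen CC (\<lambda>a. ru (ug a)) (\<lambda>a. rv (ug a)) a"
proof -
 note T = UU.tensor_hom[OF ru_hom rv_hom S.ET.cx_algebra_axioms ruv]
 define Th where "Th = sweedler CC (\<lambda>a b. ru a \<otimes>\<^bsub>CC\<^esub> rv b)"
 have Th: "Th \<in> alg_homs UT CC" unfolding Th_def by (rule T(1))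
 have Th2: "Th (tens H H a b) = ru a \<otimes>\<^bsub>CC\<^esub> rv b" if "a \<in> carrier H" "b \<in> carrier H" for a b
  unfolding Th_def by (rule T(2)[OF _ _ that]) auto
 have cc: "!!h. h \<in> carrier H ==> comult H h \<in> carrier UT" by (rule hom_closed[OF comult_hom'])
 have Thl: "(\<lambda>t. (Th t) z) \<in> lin_maps UT (mtensor (Y # Ys))" if "z \<in> carrier (mtensor (Y # Ys))" for z
  by (rule lin_comp[OF hom_lin[OF Th] end_eval_lin[OF that]])
 have pure: "Th (comult H h) (mtens (Y # Ys) zs) = diag_act_pure H (Y # Ys) h zs"
  if h: "h \<in> carrier H" and zs: "zs \<in> pure_lists (Y # Ys)" for h zs
 proof -
  from zs obtain x xs where y: "zs = x # xs" "x \<in> carrier Y" "xs \<in> pure_lists Ys" unfolding pure_Cons by blast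
  have "mtens (Y # Ys) zs = mcons Y Ys x (mtens Ys xs)" using y by (simp add: S.mcons_lin)
  moreover have "sweedler (mtensor (Y # Ys)) (\<lambda>h' h''. mcons Y Ys (act Y h' x) (diag_act_pure H Ys h'' xs)) (comult H h)
    = Th (comult H h) (mcons Y Ys x (mtens Ys xs))"
  proof (rule UU.sweedler_eq[OF Thl S.Z.M.cvec_Q _ cc[OF h]])
   show "mcons Y Ys x (mtens Ys xs) \<in> carrier (mtensor (Y # Ys))" using y S.\<tau>_simps(1) by simp
   fix h' h'' assume hh: "h' \<in> carrier H" "h'' \<in> carrier H"
   have "diag_act_pure H Ys h'' xs = diag Ys h'' (mtens Ys xs)" using pureXs[OF hh(2) y(3)] y by (simp add: diag_def)
   then show "Th (tens H H h' h'') (mcons Y Ys x (mtens Ys xs)) = mcons Y Ys (act Y h' x) (diag_act_pure H Ys h'' xs)"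
    using hh y hom_closed[OF aX hh(1)] hom_closed[OF aXs hh(2)] S.\<tau>_simps(1)
    by (simp add: Th2 end_simps S.opR_\<tau> S.opL_\<tau> lin_closed[OF end_lin]) (simp add: actrep_def)
  qed
  ultimately show ?thesis using y by simp
 qed
 have eq: "diag_act H (Y # Ys) h t = Th (comult H h) t" if "h \<in> carrier H" "t \<in> carrier (mtensor (Y # Ys))" for h t
  unfolding diag_act_def
  by (rule S.Z.mlin_eq[OF end_lin[OF hom_closed[OF Th cc[OF that(1)]]] S.Z.M.cvec_Q pure[OF that(1)] that(2)])
 show "h \<in> carrier H ==> zs \<in> pure_lists (Y # Ys) ==> diag_act H (Y # Ys) h (mtens (Y # Ys) zs) = diag_act_pure H (Y # Ys) h zs"
  by (simp add: eq pure)
 have dT: "diag (Y # Ys) h = Th (comult H h)" if "h \<in> carrier H" for h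
  using hom_closed[OF Th cc[OF that]] unfolding diag_def
  by (intro extensionalityI[of _ "carrier (mtensor (Y # Ys))"]) (auto simp: end_carrier eq[OF that])
 show "diag (Y # Ys) \<in> alg_homs H CC"
  by (rule hom_cong[OF hom_comp[OF comult_hom' Th] cx_algebra_Uq dT[symmetric]])
 have one: "ru \<one>\<^bsub>H\<^esub> = \<one>\<^bsub>CC\<^esub>" "rv \<one>\<^bsub>H\<^esub> = \<one>\<^bsub>CC\<^esub>" by (rule hom_one[OF ru_hom] hom_one[OF rv_hom])+
 have J: "ru UJ = kinv CC (ru (ug gK))" by (rule kinv_hom[OF ru_hom cx_algebra_Uq S.ET.cx_algebra_axioms ug_closed])
 note c = hom_closed[OF ru_hom] hom_closed[OF rv_hom]
 show "diag (Y # Ys) (ug a) = comult_gen CC (\<lambda>a. ru (ug a)) (\<lambda>a. rv (ug a)) a"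
  unfolding dT[OF ug_closed] comult_ug
  apply (cases a)
   apply (simp_all only: comult_gen_values)
   apply (simp_all only: comult_gen.simps J[symmetric])
   apply (simp_all add: hom_add[OF Th] UU.tens_closed Th2 one c)
  done
qed

end

end


section \<open>The alternating factors\<close>

type_synonym uel = "(ugen list \<Rightarrow>\<^sub>0 complex) set"
type_synonym xyd = "(uel, complex poly) yd"

context uq
begin

declare V_simps [simp del]

lemma V_one: "\<one>\<^bsub>V\<^esub> = X 0" by (simp add: V_simps X_0)

definition Xf :: "nat => xyd" where "Xf i = (if odd i then Cd p else Cz p)"

lemma Xf_data: "yd_data p q s g (Xf i) {i} (\<lambda>_. X 1)"
 using yd_data_Cd[of i] yd_data_Cz[of i] by (simp add: Xf_def)

lemma Xf_same: "same_alg (Xf i) V"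
 by (simp add: Xf_def Cd_def Cz_def trunc_same)

lemma Xf_simps [simp]:
 "carrier (Xf i) = carrier V" "one (Xf i) = one V" "mult (Xf i) = mult V" "zero (Xf i) = zero V"
 "add (Xf i) = add V" "smult (Xf i) = smult V" "lin_maps (Xf i) B = lin_maps V B" "alg_homs (Xf i) B = alg_homs V B"
 using Xf_same[of i] by (simp_all add: same_alg_def same_mod_def lin_maps_def alg_homs_def ring_hom_def)

lemma Xf_cvec: "cvec (Xf i)" by (rule cvec_cong[OF Xf_same[THEN same_alg_mod] V.cvec_axioms])

lemma Xf_act_closed [simp]: "h \<in> carrier H ==> f \<in> carrier V ==> act (Xf k) h f \<in> carrier V"
 using yd_data.act_closed[OF Xf_data[of k]] by simp

lemma Xf_act_lin: "h \<in> carrier H ==> act (Xf k) h \<in> lin_maps V V"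
 using lin_closed yd_data.act_lin[OF Xf_data[of k], of h] by (simp add: lin_maps_def)

text \<open>For k < i the braiding reads x_i x_k = cJ x_k x_i + c2 x_k^2 + c3. Here
  \<open>cJ\<close> is the eigenvalue of K^(-1) on x_k, and c2 x_k^2 + c3 is T_i applied to x_k. The
  factor q^2 in \<open>c3\<close> is this eigenvalue for x_k = \<partial>, since T_i contains K^(-1)
  when i is even.\<close>

definition cJ :: "nat => complex" where "cJ k = (if odd k then q ^ 2 else s ^ 2)"
definition c2 :: "nat => nat => complex" where "c2 k i = (if odd k = odd i then 1 - cJ k else 0)"
definition c3 :: "nat => nat => complex" where
 "c3 k i = (if odd k = odd i then 0 else if odd i then q - s else (s - q) * q ^ 2)"

text \<open>In \<open>\<delta>(x\<^sub>i) = K\<^sup>-\<^sup>1 \<otimes> x\<^sub>i + T\<^sub>i \<otimes> 1\<close>, the action of \<open>T\<^sub>i\<close> on the \<open>k\<close>-th factor.\<close>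

definition tw :: "nat => nat => complex poly => complex poly" where
 "tw k i f = (if odd i then (q - s) \<odot>\<^bsub>V\<^esub> act (Xf k) (ug gF) f
   else (s - q) \<odot>\<^bsub>V\<^esub> act (Xf k) (ug gE) (act (Xf k) UJ f))"

lemma tw_lin: "tw k i \<in> lin_maps V V"
 using lin_comp[OF Xf_act_lin[OF UJ_closed] Xf_act_lin[OF ug_closed]]
 by (intro lin_mapsI) (simp_all add: tw_def lin_closed[OF Xf_act_lin] lin_add[OF Xf_act_lin] lin_sm[OF Xf_act_lin]
   V.sm_distr V.sm_sm mult.commute)

lemma act_KJ: "f \<in> carrier V ==> act (Xf k) (ug gK) (act (Xf k) UJ f) = f"
 using yd_data.act_m[OF Xf_data[of k], of "ug gK" UJ f] yd_data.act_1[OF Xf_data[of k], of f]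
  ucondD(3)[OF cx_algebra_Uq ucond_Uq] by simp

text \<open>A twisted Leibniz rule for T_i. In E K^(-1) the K from the coproduct of E cancels
  against K^(-1), so the correction terms contain \<open>f\<close> itself and no operator of the
  quantum group applied to it.\<close>

lemma Xf_rules:
 assumes f: "f \<in> carrier V"
 shows "act (Xf k) UJ (X 1 \<otimes>\<^bsub>V\<^esub> f) = cJ k \<odot>\<^bsub>V\<^esub> (X 1 \<otimes>\<^bsub>V\<^esub> act (Xf k) UJ f)"
  and "tw k i (X 1 \<otimes>\<^bsub>V\<^esub> f) = cJ k \<odot>\<^bsub>V\<^esub> (X 1 \<otimes>\<^bsub>V\<^esub> tw k i f) \<oplus>\<^bsub>V\<^esub>
   (c2 k i \<odot>\<^bsub>V\<^esub> (X 1 \<otimes>\<^bsub>V\<^esub> (X 1 \<otimes>\<^bsub>V\<^esub> f)) \<oplus>\<^bsub>V\<^esub> c3 k i \<odot>\<^bsub>V\<^esub> f)"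
proof -
 note R = yd_data.act_rules[OF Xf_data[of k], of k, simplified]
 have sq: "- (q * ((s - q) * s ^ 2)) = 1 - s ^ 2" "- (q * (q - s)) = 1 - q ^ 2"
  using qs by (simp_all add: algebra_simps power2_eq_square)
 show "act (Xf k) UJ (X 1 \<otimes>\<^bsub>V\<^esub> f) = cJ k \<odot>\<^bsub>V\<^esub> (X 1 \<otimes>\<^bsub>V\<^esub> act (Xf k) UJ f)"
  using R(2)[OF f] by (simp add: cJ_def)
 show "tw k i (X 1 \<otimes>\<^bsub>V\<^esub> f) = cJ k \<odot>\<^bsub>V\<^esub> (X 1 \<otimes>\<^bsub>V\<^esub> tw k i f) \<oplus>\<^bsub>V\<^esub>
   (c2 k i \<odot>\<^bsub>V\<^esub> (X 1 \<otimes>\<^bsub>V\<^esub> (X 1 \<otimes>\<^bsub>V\<^esub> f)) \<oplus>\<^bsub>V\<^esub> c3 k i \<odot>\<^bsub>V\<^esub> f)"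
  using f
  by (simp add: tw_def cJ_def c2_def c3_def R act_KJ lin_sm[OF Xf_act_lin] V.sm_distr V.sm_sm V.smult_mult_right sq mult.commute V.a_ac)
qed

lemma Xf_one: "act (Xf k) UJ (X 0) = X 0" "tw k i (X 0) = \<zero>\<^bsub>V\<^esub>"
 using yd_data.unit_rules[OF Xf_data[of k]] by (simp_all add: V_one tw_def)

text \<open>All relations solved for the product with the larger index on the left. This is a
  rearrangement when \<open>i\<close> is even and \<open>k\<close> is odd; there the mixed relation
  is multiplied by q^2.\<close>

lemma hcond_braid:
 assumes B: "cx_algebra B" and h: "hcond B I b" and I: "i \<in> I" "k \<in> I" "k < i"
 shows "b i \<otimes>\<^bsub>B\<^esub> b k = cJ k \<odot>\<^bsub>B\<^esub> (b k \<otimes>\<^bsub>B\<^esub> b i) \<oplus>\<^bsub>B\<^esub> (c2 k i \<odot>\<^bsub>B\<^esub> (b k \<otimes>\<^bsub>B\<^esub> b k) \<oplus>\<^bsub>B\<^esub> c3 k i \<odot>\<^bsub>B\<^esub> \<one>\<^bsub>B\<^esub>)"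
proof -
 interpret B: cx_algebra B by fact
 have c: "b i \<in> carrier B" "b k \<in> carrier B" using h I by (auto simp: hcond_def)
 consider "odd i = odd k" | "odd i" "even k" | "even i" "odd k" by blast
 then show ?thesis
 proof cases
  case 1 then have "if odd i then drel B (b i) (b k) else zrel B (b i) (b k)" using h I by (simp add: hcond_def)
  then show ?thesis using 1 c by (cases "odd i") (simp_all add: zrel_def drel_def cJ_def c2_def c3_def)
 next
  case 2 then have "dzrel B (b i) (b k)" using h I by (auto simp: hcond_def)
  then show ?thesis using c 2 by (simp add: dzrel_def cJ_def c2_def c3_def B.a_comm)
 next
  case 3 then have "dzrel B (b k) (b i)" using h I by (auto simp: hcond_def)
  then have e: "b k \<otimes>\<^bsub>B\<^esub> b i = (q - s) \<odot>\<^bsub>B\<^esub> \<one>\<^bsub>B\<^esub> \<oplus>\<^bsub>B\<^esub> s ^ 2 \<odot>\<^bsub>B\<^esub> (b i \<otimes>\<^bsub>B\<^esub> b k)" by (simp add: dzrel_def)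
  have "q ^ 2 \<odot>\<^bsub>B\<^esub> (b k \<otimes>\<^bsub>B\<^esub> b i) \<oplus>\<^bsub>B\<^esub> ((s - q) * q ^ 2) \<odot>\<^bsub>B\<^esub> \<one>\<^bsub>B\<^esub>
    = ((q - s) * q ^ 2 + (s - q) * q ^ 2) \<odot>\<^bsub>B\<^esub> \<one>\<^bsub>B\<^esub> \<oplus>\<^bsub>B\<^esub> (q ^ 2 * s ^ 2) \<odot>\<^bsub>B\<^esub> (b i \<otimes>\<^bsub>B\<^esub> b k)"
   unfolding e using c by (simp add: B.sm_add B.sm_distr B.sm_sm B.a_ac mult.commute)
  also have "(q - s) * q ^ 2 + (s - q) * q ^ 2 = 0" by (simp add: algebra_simps)
  also have "q ^ 2 * s ^ 2 = 1" using qs by (simp flip: power_mult_distrib)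
  finally show ?thesis using c 3 by (simp add: cJ_def c2_def c3_def)
 qed
qed

text \<open>Moves a generator past a polynomial in an earlier one. When the degree grows by one, the
  left side changes by \<open>hcond_braid\<close> and the right side by \<open>Xf_rules\<close>,
  with the same constants.\<close>

lemma ev_braid:
 assumes B: "cx_algebra B" and h: "hcond B I b" and I: "i \<in> I" "k \<in> I" "k < i" and f: "f \<in> carrier V"
 shows "b i \<otimes>\<^bsub>B\<^esub> ev B (b k) f = ev B (b k) (act (Xf k) UJ f) \<otimes>\<^bsub>B\<^esub> b i \<oplus>\<^bsub>B\<^esub> ev B (b k) (tw k i f)"
proof -
 interpret B: cx_algebra B by fact
 have c: "b i \<in> carrier B" "b k \<in> carrier B" "b k [^]\<^bsub>B\<^esub> p = \<zero>\<^bsub>B\<^esub>" using h I by (auto simp: hcond_def)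
 note e = ev_hom(1)[OF B c(2,3)]
 have b: "b k = ev B (b k) (X 1)" using ev_hom(2)[OF B c(2,3), of 1] c(2) by (simp add: One_nat_def)
 note J = Xf_act_lin[OF UJ_closed, of k]
 note cl = hom_closed[OF e] lin_closed[OF J] lin_closed[OF tw_lin]
 show ?thesis
 proof (rule V_lin_ext[OF _ _ B.cvec_axioms _ f])
  show "(\<lambda>f. b i \<otimes>\<^bsub>B\<^esub> ev B (b k) f) \<in> lin_maps V B"
   by (rule lin_mapsI) (simp_all add: cl c hom_add[OF e] hom_sm[OF e] B.r_distr)
  show "(\<lambda>f. ev B (b k) (act (Xf k) UJ f) \<otimes>\<^bsub>B\<^esub> b i \<oplus>\<^bsub>B\<^esub> ev B (b k) (tw k i f)) \<in> lin_maps V B"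
   by (rule lin_mapsI) (simp_all add: cl c hom_add[OF e] hom_sm[OF e] lin_add[OF J] lin_sm[OF J] lin_add[OF tw_lin] lin_sm[OF tw_lin] B.l_distr B.sm_distr B.a_ac)
  show "b i \<otimes>\<^bsub>B\<^esub> ev B (b k) (X n) = ev B (b k) (act (Xf k) UJ (X n)) \<otimes>\<^bsub>B\<^esub> b i \<oplus>\<^bsub>B\<^esub> ev B (b k) (tw k i (X n))" for n
  proof (induction n)
   case 0
   then show ?case using c hom_one[OF e] lin_zero[OF hom_lin[OF e] V.cvec_axioms B.cvec_axioms] by (simp add: Xf_one V_one)
  next
   case (Suc n)
   have "b i \<otimes>\<^bsub>B\<^esub> ev B (b k) (X (Suc n)) = (b i \<otimes>\<^bsub>B\<^esub> b k) \<otimes>\<^bsub>B\<^esub> ev B (b k) (X n)"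
    using c cl b hom_mult[OF e, of "X 1" "X n"] by (simp add: B.m_assoc X_mult plus_1_eq_Suc)
   also have "... = cJ k \<odot>\<^bsub>B\<^esub> (b k \<otimes>\<^bsub>B\<^esub> (b i \<otimes>\<^bsub>B\<^esub> ev B (b k) (X n))) \<oplus>\<^bsub>B\<^esub>
     (c2 k i \<odot>\<^bsub>B\<^esub> (b k \<otimes>\<^bsub>B\<^esub> (b k \<otimes>\<^bsub>B\<^esub> ev B (b k) (X n))) \<oplus>\<^bsub>B\<^esub> c3 k i \<odot>\<^bsub>B\<^esub> ev B (b k) (X n))"
    unfolding hcond_braid[OF B h I] using c cl by (simp add: B.l_distr B.m_assoc)
   also have "... = ev B (b k) (act (Xf k) UJ (X 1 \<otimes>\<^bsub>V\<^esub> X n)) \<otimes>\<^bsub>B\<^esub> b i \<oplus>\<^bsub>B\<^esub> ev B (b k) (tw k i (X 1 \<otimes>\<^bsub>V\<^esub> X n))"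
    unfolding Suc.IH using c cl b
    by (simp add: Xf_rules hom_add[OF e] hom_sm[OF e] hom_mult[OF e] B.r_distr B.sm_distr B.m_assoc B.a_ac)
   finally show ?case by (simp add: X_mult plus_1_eq_Suc)
  qed
 qed
qed


text \<open>The offset \<open>M\<close> counts the factors removed on the left, so that the tail of
  an alternating list keeps the indices and parities of its factors.\<close>

fun alt :: "nat => xyd list => bool" where
 "alt M [] = True"
| "alt M (Y # Ys) = (Y = Xf (Suc M) \<and> alt (Suc M) Ys)"

abbreviation ix :: "nat => xyd list => nat set" where "ix M Ys \<equiv> {M<..M + length Ys}"

lemma ix_Cons: "ix M (Y # Ys) = insert (Suc M) (ix (Suc M) Ys)" by auto

text \<open>Left multiplication by the generators, before the multiplication is available.\<close>

fun opy :: "nat => xyd list => nat => (complex poly list \<Rightarrow>\<^sub>0 complex) set => (complex poly list \<Rightarrow>\<^sub>0 complex) set" where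
 "opy M [] i = undefined"
| "opy M (Y # Ys) i =
  (if i = Suc M then tprod.opL (mtensor (Y # Ys)) (mcons Y Ys) (msplit Y Ys) (lmul Y (X 1))
   else coact_gen (End (mtensor (Y # Ys)))
    (\<lambda>a. tprod.opL (mtensor (Y # Ys)) (mcons Y Ys) (msplit Y Ys) (actrep Y (ug a)))
    (\<lambda>i. tprod.opR (mtensor (Y # Ys)) (mcons Y Ys) (msplit Y Ys) (opy (Suc M) Ys i)) i)"

abbreviation ones :: "xyd list => (complex poly list \<Rightarrow>\<^sub>0 complex) set" where "ones Ys \<equiv> mtens Ys (map one Ys)"

lemma actrep_hom: "actrep (Xf i) \<in> alg_homs H (End (Xf i))"
 using yd_data.rho_hom[OF Xf_data[of i]] by (simp add: actrep_def[abs_def])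

lemma actrep_eq: "f \<in> carrier V ==> actrep (Xf i) h f = act (Xf i) h f"
 by (simp add: actrep_def)

lemma alt_mspace: "alt M Ys ==> mspace Ys"
 by (induction M Ys rule: alt.induct) (auto simp: mspace_def Xf_cvec)

lemma alt_ones: "alt M Ys ==> map one Ys \<in> pure_lists Ys"
 by (induction M Ys rule: alt.induct) (auto simp: set_Cons_def V_one)

text \<open>The facts are proved together: the step forms a pair of commuting copies from the
  actions on head and tail, which presupposes the representation on the tail, and then
  \<open>smash_head\<close> transports the operator relations of the tail and adds those of the
  head.\<close>

lemma alt_ops:
 "alt M Ys ==> diag Ys \<in> alg_homs H (End (mtensor Ys)) \<and>
  (\<forall>h\<in>carrier H. \<forall>xs\<in>pure_lists Ys. diag_act H Ys h (mtens Ys xs) = diag_act_pure H Ys h xs) \<and>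
  scond (End (mtensor Ys)) (ix M Ys) (opy M Ys) (\<lambda>a. diag Ys (ug a)) \<and>
  (\<forall>a. diag Ys (ug a) (ones Ys) = counit H (ug a) \<odot>\<^bsub>mtensor Ys\<^esub> ones Ys)"
proof (induction M Ys rule: alt.induct)
 case (1 M)
 interpret N: mspace "[] :: xyd list" by (rule mtensor_Nil)
 have "ucond (End (mtensor ([] :: xyd list))) (\<lambda>a. diag ([] :: xyd list) (ug a))"
  by (rule hom_ucond[OF diag_Nil(1) cx_algebra_Uq cx_algebra_end[OF N.M.cvec_Q] ucond_Uq])
 then show ?case by (simp add: diag_Nil scond_def hcond_def) (simp add: diag_def diag_Nil(2))
next
 case (2 M Y Ys)
 then have Y: "Y = Xf (Suc M)" and a: "alt (Suc M) Ys" and aM: "alt M (Y # Ys)" by simp_all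
 note IH = "2.IH"[OF a]
 interpret Z: yd_data p q s g Y "{Suc M}" "\<lambda>_. X 1" unfolding Y by (rule Xf_data)
 interpret L: mspace Ys by (rule alt_mspace[OF a])
 have sp: "mcons_space Y Ys" by unfold_locales
 interpret S: mcons_space Y Ys by (rule sp)
 have aY: "actrep Y \<in> alg_homs H (End Y)" unfolding Y by (rule actrep_hom)
 have aYs: "diag Ys \<in> alg_homs H (End (mtensor Ys))" using IH by simp
 have pu: "!!h xs. h \<in> carrier H ==> xs \<in> pure_lists Ys ==> diag_act H Ys h (mtens Ys xs) = diag_act_pure H Ys h xs"
  using IH by simp
 note D = diag_Cons[OF sp aY aYs pu]
 interpret U: upair p q s g "End (mtensor (Y # Ys))" "\<lambda>a. S.opL (actrep Y (ug a))" "\<lambda>a. S.opR (diag Ys (ug a))"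
  by (rule upair_ruv[OF sp aY aYs pu])
 have yc: "opy (Suc M) Ys i \<in> carrier (End (mtensor Ys))" if "i \<in> ix (Suc M) Ys" for i
  using IH that by (simp add: scond_def hcond_def)
 have xc: "lmul Y (X 1) \<in> carrier (End Y)" using hom_closed[OF lmul_hom[OF Z.X], of "X 1"] by (simp add: Y)
 have "scond (End (mtensor (Y # Ys))) (insert (Suc M) (ix (Suc M) Ys))
  (\<lambda>i. if i = Suc M then S.opL (lmul Y (X 1)) else coact_gen (End (mtensor (Y # Ys))) (\<lambda>a. S.opL (actrep Y (ug a))) (\<lambda>i. S.opR (opy (Suc M) Ys i)) i)
  (comult_gen (End (mtensor (Y # Ys))) (\<lambda>a. S.opL (actrep Y (ug a))) (\<lambda>a. S.opR (diag Ys (ug a))))"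
 proof (rule U.smash_head)
  show "scond (End (mtensor (Y # Ys))) (ix (Suc M) Ys) (\<lambda>i. S.opR (opy (Suc M) Ys i)) (\<lambda>a. S.opR (diag Ys (ug a)))"
   using IH by (intro hom_scond[OF S.opR_hom S.EW.cx_algebra_axioms S.ET.cx_algebra_axioms]) simp
  show "scond (End (mtensor (Y # Ys))) {Suc M} (\<lambda>_. S.opL (lmul Y (X 1))) (\<lambda>a. S.opL (actrep Y (ug a)))"
   using Z.sm by (intro hom_scond[OF S.opL_hom S.EV.cx_algebra_axioms S.ET.cx_algebra_axioms]) (simp add: actrep_def)
 qed (use xc yc hom_closed[OF aY] hom_closed[OF aYs] in \<open>simp_all add: S.opLR_comm\<close>)
 moreover have dg: "(\<lambda>a. diag (Y # Ys) (ug a)) = comult_gen (End (mtensor (Y # Ys))) (\<lambda>a. S.opL (actrep Y (ug a))) (\<lambda>a. S.opR (diag Ys (ug a)))"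
  by (rule ext) (rule D(3))
 ultimately have sc: "scond (End (mtensor (Y # Ys))) (ix M (Y # Ys)) (opy M (Y # Ys)) (\<lambda>a. diag (Y # Ys) (ug a))"
  unfolding ix_Cons by (simp only: opy.simps[abs_def] dg)
 have J: "kinv (End (mtensor (Y # Ys))) (S.opL (actrep Y (ug gK))) = S.opL (actrep Y UJ)"
  using kinv_hom[OF hom_comp[OF aY S.opL_hom] cx_algebra_Uq S.ET.cx_algebra_axioms ug_closed] by simp
 have o: "ones (Y # Ys) = mcons Y Ys \<one>\<^bsub>Y\<^esub> (ones Ys)" "ones Ys \<in> carrier (mtensor Ys)" "\<one>\<^bsub>Y\<^esub> \<in> carrier Y"
  using alt_ones[OF a] by (simp_all add: S.mcons_lin)
 have au: "actrep Y (ug gK) \<one>\<^bsub>Y\<^esub> = \<one>\<^bsub>Y\<^esub>" "actrep Y UJ \<one>\<^bsub>Y\<^esub> = \<one>\<^bsub>Y\<^esub>"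
  "actrep Y (ug gE) \<one>\<^bsub>Y\<^esub> = \<zero>\<^bsub>Y\<^esub>" "actrep Y (ug gF) \<one>\<^bsub>Y\<^esub> = \<zero>\<^bsub>Y\<^esub>"
  using Z.unit_rules o(3) by (simp_all add: actrep_def)
 have mz: "mcons Y Ys \<zero>\<^bsub>Y\<^esub> (ones Ys) = \<zero>\<^bsub>mtensor (Y # Ys)\<^esub>" "mcons Y Ys \<one>\<^bsub>Y\<^esub> \<zero>\<^bsub>mtensor Ys\<^esub> = \<zero>\<^bsub>mtensor (Y # Ys)\<^esub>"
  using lin_zero[OF bilinD(1)[OF S.mcons_bilin o(2)] Z.X.cvec_axioms S.Z.M.cvec_Q]
   lin_zero[OF S.mcons_lin(1)[OF o(3)] L.M.cvec_Q S.Z.M.cvec_Q] by simp_all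
 note mz = mz lin_zero[OF end_lin[OF hom_closed[OF hom_comp[OF aY S.opL_hom] UJ_closed]] S.Z.M.cvec_Q S.Z.M.cvec_Q]
 have "diag (Y # Ys) (ug a) (ones (Y # Ys)) = counit H (ug a) \<odot>\<^bsub>mtensor (Y # Ys)\<^esub> ones (Y # Ys)" for a
  unfolding fun_cong[OF dg, of a] o(1) using o(2,3) IH hom_closed[OF aY] hom_closed[OF aYs] S.\<tau>_simps(1)
  by (cases a) (simp_all add: J end_simps S.opL_\<tau> S.opR_\<tau> counit_ug S.\<tau>_simps(2-) au mz)
 then show ?case using D(1,2) sc by blast
qed


lemma alt_scond: "alt M Ys ==> scond (End (mtensor Ys)) (ix M Ys) (opy M Ys) (\<lambda>a. diag Ys (ug a))"
 using alt_ops by blast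

lemma opy_end: "alt M Ys ==> i \<in> ix M Ys ==> opy M Ys i \<in> carrier (End (mtensor Ys))"
 using alt_scond by (auto simp: scond_def hcond_def)

text \<open>The operators on f \<otimes> t made explicit: the first one multiplies the head, a later
  one is its coaction with K^(-1) and T_i acting on the head.\<close>

lemma opy_mcons:
 assumes a: "alt M (Y # Ys)" and f: "f \<in> carrier V" and t: "t \<in> carrier (mtensor Ys)"
 shows "opy M (Y # Ys) (Suc M) (mcons Y Ys f t) = mcons Y Ys (X 1 \<otimes>\<^bsub>V\<^esub> f) t"
  and "i \<in> ix (Suc M) Ys ==> opy M (Y # Ys) i (mcons Y Ys f t) =
   mcons Y Ys (act (Xf (Suc M)) UJ f) (opy (Suc M) Ys i t) \<oplus>\<^bsub>mtensor (Y # Ys)\<^esub> mcons Y Ys (tw (Suc M) i f) t"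
proof -
 have Y: "Y = Xf (Suc M)" and a': "alt (Suc M) Ys" using a by simp_all
 interpret Y: cvec Y unfolding Y by (rule Xf_cvec)
 interpret L: mspace Ys by (rule alt_mspace[OF a'])
 interpret S: mcons_space Y Ys by unfold_locales
 have aY: "actrep Y \<in> alg_homs H (End Y)" unfolding Y by (rule actrep_hom)
 have Yalg: "cx_algebra Y" unfolding Y by (rule cx_algebra_cong[OF Xf_same V_alg])
 have xc: "lmul Y (X 1) \<in> carrier (End Y)" using hom_closed[OF lmul_hom[OF Yalg], of "X 1"] by (simp add: Y)
 have fY: "f \<in> carrier Y" using f by (simp add: Y)
 show "opy M (Y # Ys) (Suc M) (mcons Y Ys f t) = mcons Y Ys (X 1 \<otimes>\<^bsub>V\<^esub> f) t"
  using fY t xc S.opL_\<tau>[OF xc fY t] by (simp del: S.opL_\<tau>) (simp add: Y lmul_apply f)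
 have J: "kinv (End (mtensor (Y # Ys))) (S.opL (actrep Y (ug gK))) = S.opL (actrep Y UJ)"
  using kinv_hom[OF hom_comp[OF aY S.opL_hom] cx_algebra_Uq S.ET.cx_algebra_axioms ug_closed] by simp
 show "opy M (Y # Ys) i (mcons Y Ys f t) =
   mcons Y Ys (act (Xf (Suc M)) UJ f) (opy (Suc M) Ys i t) \<oplus>\<^bsub>mtensor (Y # Ys)\<^esub> mcons Y Ys (tw (Suc M) i f) t"
  if i: "i \<in> ix (Suc M) Ys"
 proof -
  have c: "act Y h f \<in> carrier Y" if "h \<in> carrier H" "f \<in> carrier Y" for h f using that by (simp add: Y)
  have ae: "actrep Y h f = act Y h f" if "f \<in> carrier Y" for h f using that by (simp add: actrep_def)
  have tc: "opy (Suc M) Ys i t \<in> carrier (mtensor Ys)" by (rule lin_closed[OF end_lin[OF opy_end[OF a' i]] t])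
  have tw: "tw (Suc M) i f = (if odd i then (q - s) \<odot>\<^bsub>Y\<^esub> act Y (ug gF) f else (s - q) \<odot>\<^bsub>Y\<^esub> act Y (ug gE) (act Y UJ f))"
   by (simp add: tw_def Y)
  show ?thesis
   using i fY t tc hom_closed[OF aY] opy_end[OF a' i] S.\<tau>_simps(1) c
   by (simp add: tw coact_gen_def twist_def J end_simps S.opL_\<tau> S.opR_\<tau> S.\<tau>_simps(4) Y[symmetric] ae)
 qed
qed

text \<open>The space is cyclic under the operators. On a unit head T_i vanishes and K^(-1) is the
  identity, so later operators move the tail alone and reach every 1 \<otimes> t; the first operator
  then builds up the head.\<close>

lemma mt_induct [consumes 2, case_names one opy add smult]:
 assumes "alt M Ys" "t \<in> carrier (mtensor Ys)"
  "P (ones Ys)" "!!i t. i \<in> ix M Ys ==> t \<in> carrier (mtensor Ys) ==> P t ==> P (opy M Ys i t)"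
  "!!s t. s \<in> carrier (mtensor Ys) ==> t \<in> carrier (mtensor Ys) ==> P s ==> P t ==> P (s \<oplus>\<^bsub>mtensor Ys\<^esub> t)"
  "!!c t. t \<in> carrier (mtensor Ys) ==> P t ==> P (c \<odot>\<^bsub>mtensor Ys\<^esub> t)"
 shows "P t"
 using assms
proof (induction M Ys arbitrary: P t rule: alt.induct)
 case (1 M)
 interpret N: mspace "[] :: xyd list" by (rule mtensor_Nil)
 have "0 \<odot>\<^bsub>mtensor ([] :: xyd list)\<^esub> ones [] = \<zero>\<^bsub>mtensor ([] :: xyd list)\<^esub>" by (simp add: N.M.Q.sm_0)
 then have "P \<zero>\<^bsub>mtensor ([] :: xyd list)\<^esub>" using 1(6)[of "ones []" 0] 1(3) by simp
 with 1(2) show ?case by (induction rule: N.mtens_induct) (use 1 in simp_all)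
next
 case (2 M Y Ys)
 have a: "alt (Suc M) Ys" and Y: "Y = Xf (Suc M)" using 2(2) by simp_all
 interpret Y: cvec Y unfolding Y by (rule Xf_cvec)
 interpret L: mspace Ys by (rule alt_mspace[OF a])
 interpret S: mcons_space Y Ys by unfold_locales
 note om = opy_mcons[OF 2(2)]
 have "\<forall>t\<in>carrier (mtensor Ys). P (mcons Y Ys f t)" if "f \<in> carrier V" for f
  using generated_V[of 0] V_alg that
 proof (induction rule: generated_induct)
  case one
  show ?case
  proof
   fix t assume "t \<in> carrier (mtensor Ys)"
   then show "P (mcons Y Ys \<one>\<^bsub>V\<^esub> t)"
   proof (rule 2(1)[OF a, of _ "\<lambda>t. P (mcons Y Ys \<one>\<^bsub>V\<^esub> t)"])
    show "P (mcons Y Ys \<one>\<^bsub>V\<^esub> (ones Ys))" using 2(4) alt_ones[OF a] S.mcons_lin(2)[of "\<one>\<^bsub>V\<^esub>" "map one Ys"] by (simp add: Y)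
    show "P (mcons Y Ys \<one>\<^bsub>V\<^esub> (opy (Suc M) Ys i t))" if i: "i \<in> ix (Suc M) Ys" and t: "t \<in> carrier (mtensor Ys)" and P: "P (mcons Y Ys \<one>\<^bsub>V\<^esub> t)" for i t
    proof -
     have "mcons Y Ys \<zero>\<^bsub>V\<^esub> t = \<zero>\<^bsub>mtensor (Y # Ys)\<^esub>"
      using lin_zero[OF bilinD(1)[OF S.mcons_bilin t] Y.cvec_axioms S.Z.M.cvec_Q] by (simp add: Y)
     then have "mcons Y Ys \<one>\<^bsub>V\<^esub> (opy (Suc M) Ys i t) = opy M (Y # Ys) i (mcons Y Ys \<one>\<^bsub>V\<^esub> t)"
      using t lin_closed[OF end_lin[OF opy_end[OF a i]] t] S.\<tau>_simps(1) S.Z.M.Q.r_zero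
      by (subst om(2)[OF _ t i]) (simp_all add: Xf_one V_one Y)
     then show ?thesis using 2(5)[of i "mcons Y Ys \<one>\<^bsub>V\<^esub> t"] i P t S.\<tau>_simps(1)[of "\<one>\<^bsub>V\<^esub>" t] by (simp add: Y)
    qed
   qed (use 2(6,7) S.\<tau>_simps in \<open>simp_all add: Y\<close>)
  qed
 next
  case (mult i f)
  show ?case
  proof
   fix t assume t: "t \<in> carrier (mtensor Ys)"
   have "P (opy M (Y # Ys) (Suc M) (mcons Y Ys f t))"
    using 2(5)[of "Suc M" "mcons Y Ys f t"] mult t S.\<tau>_simps(1)[of f t] by (simp add: Y)
   then show "P (mcons Y Ys (X 1 \<otimes>\<^bsub>V\<^esub> f) t)" by (simp only: om(1)[OF mult(2) t])
  qed
 qed (use 2(6,7) S.\<tau>_simps in \<open>simp_all add: Y\<close>)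
 then have "P (mcons Y Ys f t)" if "f \<in> carrier Y" "t \<in> carrier (mtensor Ys)" for f t using that by (simp add: Y)
 with 2(3) show ?case by (induction rule: S.tp_induct) (use 2(6) in auto)
qed

end


section \<open>Braided products of the alternating factors\<close>

context uq
begin

fun pprod :: "(complex, 'b, 'm) module_scheme => (nat => 'b) => nat => complex poly list => 'b" where
 "pprod B b M [] = \<one>\<^bsub>B\<^esub>"
| "pprod B b M (f # fs) = ev B (b (Suc M)) f \<otimes>\<^bsub>B\<^esub> pprod B b (Suc M) fs"

definition phi :: "(complex, 'b, 'm) module_scheme => (nat => 'b) => nat => xyd list => (complex poly list \<Rightarrow>\<^sub>0 complex) set => 'b" where
 "phi B b M Ys t = lin_ext B (pprod B b M) (rep t)"

lemma hcondD:
 "hcond B I b ==> i \<in> I ==> b i \<in> carrier B" "hcond B I b ==> i \<in> I ==> b i [^]\<^bsub>B\<^esub> p = \<zero>\<^bsub>B\<^esub>"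
 by (simp_all add: hcond_def)

lemma hcond_mono: "hcond B I b ==> I' \<subseteq> I ==> hcond B I' b"
 unfolding hcond_def by (meson subsetD)

text \<open>Intertwining goes by induction on the factors. The first operator multiplies the first
  polynomial; for a later one \<open>ev_braid\<close> moves b_i past that polynomial and produces
  exactly the K^(-1) and T_i of the recursion in \<open>opy_mcons\<close>.\<close>

lemma phi_exists:
 assumes "alt M Ys" "cx_algebra B" "hcond B (ix M Ys) b"
 shows "\<exists>F\<in>lin_maps (mtensor Ys) B. (\<forall>xs\<in>pure_lists Ys. F (mtens Ys xs) = pprod B b M xs) \<and>
  (\<forall>i\<in>ix M Ys. \<forall>t\<in>carrier (mtensor Ys). F (opy M Ys i t) = b i \<otimes>\<^bsub>B\<^esub> F t)"
 using assms
proof (induction M Ys rule: alt.induct)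
 case (1 M)
 interpret B: cx_algebra B by fact
 interpret N: mspace "[] :: xyd list" by (rule mtensor_Nil)
 note L = N.mlin[OF B.cvec_axioms, of "\<lambda>_. \<one>\<^bsub>B\<^esub>"]
 show ?case
  by (rule bexI[where x = "\<lambda>t. lin_ext B (\<lambda>_. \<one>\<^bsub>B\<^esub>) (rep t)"]) (use L in simp_all)
next
 case (2 M Y Ys)
 interpret B: cx_algebra B by fact
 have a: "alt (Suc M) Ys" and Y: "Y = Xf (Suc M)" using 2(2) by simp_all
 interpret Y: cvec Y unfolding Y by (rule Xf_cvec)
 have Yc: "carrier Y = carrier V" by (simp add: Y)
 interpret L: mspace Ys by (rule alt_mspace[OF a])
 interpret S: mcons_space Y Ys by unfold_locales
 have hc: "hcond B (ix M (Y # Ys)) b" by fact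
 then have bc: "b i \<in> carrier B" "b i [^]\<^bsub>B\<^esub> p = \<zero>\<^bsub>B\<^esub>" if "i \<in> ix M (Y # Ys)" for i
  using that by (auto simp: hcond_def)
 have M: "Suc M \<in> ix M (Y # Ys)" by simp
 note e = ev_hom[OF B.cx_algebra_axioms bc[OF M]]
 have eX: "ev B (b (Suc M)) (X 1) = b (Suc M)" using e(2)[of 1] bc[OF M] by (simp add: One_nat_def)
 obtain F where F: "F \<in> lin_maps (mtensor Ys) B" "!!xs. xs \<in> pure_lists Ys ==> F (mtens Ys xs) = pprod B b (Suc M) xs"
  "!!i t. i \<in> ix (Suc M) Ys ==> t \<in> carrier (mtensor Ys) ==> F (opy (Suc M) Ys i t) = b i \<otimes>\<^bsub>B\<^esub> F t"
  using 2(1)[OF a 2(3) hcond_mono[OF hc]] by (metis ix_Cons subset_insertI)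
 note cl = hom_closed[OF e(1)] lin_closed[OF F(1)]
 have bil: "bilin Y (mtensor Ys) B (\<lambda>f t. ev B (b (Suc M)) f \<otimes>\<^bsub>B\<^esub> F t)"
  by (intro bilinI lin_mapsI)
   (simp_all add: Y cl hom_add[OF e(1)] hom_sm[OF e(1)] lin_add[OF F(1)] lin_sm[OF F(1)] B.l_distr B.r_distr)
 define G where "G = (\<lambda>t. sweedler B (\<lambda>f t. ev B (b (Suc M)) f \<otimes>\<^bsub>B\<^esub> F t) (msplit Y Ys t))"
 have G: "G \<in> lin_maps (mtensor (Y # Ys)) B"
  and Gv: "!!f t. f \<in> carrier V ==> t \<in> carrier (mtensor Ys) ==> G (mcons Y Ys f t) = ev B (b (Suc M)) f \<otimes>\<^bsub>B\<^esub> F t"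
  unfolding G_def using S.tp_lin[OF B.cvec_axioms bil] by (simp_all add: Y)
 have "G (mtens (Y # Ys) xs) = pprod B b M xs" if xs: "xs \<in> pure_lists (Y # Ys)" for xs
 proof -
  obtain x zs where x: "xs = x # zs" "x \<in> carrier Y" "zs \<in> pure_lists Ys" using xs unfolding pure_Cons by blast
  then have "G (mtens (Y # Ys) xs) = G (mcons Y Ys x (mtens Ys zs))" by (simp add: S.mcons_lin)
  also have "... = ev B (b (Suc M)) x \<otimes>\<^bsub>B\<^esub> F (mtens Ys zs)" using x by (intro Gv) (simp_all add: Y)
  finally show ?thesis by (simp add: F(2) x)
 qed
 moreover have "G (opy M (Y # Ys) i t) = b i \<otimes>\<^bsub>B\<^esub> G t" if i: "i \<in> ix M (Y # Ys)" and t: "t \<in> carrier (mtensor (Y # Ys))" for i t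
 proof (rule S.tp_ext[OF lin_comp[OF end_lin[OF opy_end[OF 2(2) i]] G] _ B.cvec_axioms _ t])
  show "(\<lambda>t. b i \<otimes>\<^bsub>B\<^esub> G t) \<in> lin_maps (mtensor (Y # Ys)) B"
   by (rule lin_mapsI) (simp_all add: lin_closed[OF G] lin_add[OF G] lin_sm[OF G] bc[OF i] B.r_distr)
  fix f t assume fY: "f \<in> carrier Y" and t: "t \<in> carrier (mtensor Ys)"
  then have f: "f \<in> carrier V" by (simp add: Y)
  show "G (opy M (Y # Ys) i (mcons Y Ys f t)) = b i \<otimes>\<^bsub>B\<^esub> G (mcons Y Ys f t)"
  proof (cases "i = Suc M")
   case True
   have "G (opy M (Y # Ys) (Suc M) (mcons Y Ys f t)) = (b (Suc M) \<otimes>\<^bsub>B\<^esub> ev B (b (Suc M)) f) \<otimes>\<^bsub>B\<^esub> F t"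
    using f t unfolding opy_mcons(1)[OF 2(2) f t] by (simp add: Gv hom_mult[OF e(1)] eX)
   then show ?thesis using f t True bc[OF M] by (simp add: Gv cl B.m_assoc)
  next
   case False
   then have iI: "i \<in> ix (Suc M) Ys" and Mi: "Suc M < i" using i by auto
   have oc: "opy (Suc M) Ys i t \<in> carrier (mtensor Ys)" by (rule lin_closed[OF end_lin[OF opy_end[OF a iI]] t])
   have "G (opy M (Y # Ys) i (mcons Y Ys f t)) = ev B (b (Suc M)) (act (Xf (Suc M)) UJ f) \<otimes>\<^bsub>B\<^esub> (b i \<otimes>\<^bsub>B\<^esub> F t)
     \<oplus>\<^bsub>B\<^esub> ev B (b (Suc M)) (tw (Suc M) i f) \<otimes>\<^bsub>B\<^esub> F t"
    using f t oc S.\<tau>_simps(1) unfolding opy_mcons(2)[OF 2(2) f t iI]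
    by (simp add: lin_add[OF G] Gv lin_closed[OF tw_lin] F(3)[OF iI] Yc)
   also have "... = (b i \<otimes>\<^bsub>B\<^esub> ev B (b (Suc M)) f) \<otimes>\<^bsub>B\<^esub> F t"
    using f t bc[OF i] unfolding ev_braid[OF B.cx_algebra_axioms hc i M Mi f]
    by (simp add: cl lin_closed[OF tw_lin] B.l_distr B.m_assoc)
   finally show ?thesis using f t bc[OF i] by (simp add: Gv cl B.m_assoc)
  qed
 qed
 ultimately show ?case using G by blast
qed

lemma phi:
 assumes a: "alt M Ys" and B: "cx_algebra B" and h: "hcond B (ix M Ys) b"
 shows "phi B b M Ys \<in> lin_maps (mtensor Ys) B"
  and "xs \<in> pure_lists Ys ==> phi B b M Ys (mtens Ys xs) = pprod B b M xs"
  and "i \<in> ix M Ys ==> t \<in> carrier (mtensor Ys) ==> phi B b M Ys (opy M Ys i t) = b i \<otimes>\<^bsub>B\<^esub> phi B b M Ys t"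
proof -
 interpret B: cx_algebra B by fact
 interpret L: mspace Ys by (rule alt_mspace[OF a])
 obtain F where F: "F \<in> lin_maps (mtensor Ys) B" "!!xs. xs \<in> pure_lists Ys ==> F (mtens Ys xs) = pprod B b M xs"
  "!!i t. i \<in> ix M Ys ==> t \<in> carrier (mtensor Ys) ==> F (opy M Ys i t) = b i \<otimes>\<^bsub>B\<^esub> F t"
  using phi_exists[OF assms] by blast
 have e: "phi B b M Ys t = F t" if "t \<in> carrier (mtensor Ys)" for t
  unfolding phi_def by (rule L.mlin_eq[OF F(1) B.cvec_axioms F(2) that])
 show "phi B b M Ys \<in> lin_maps (mtensor Ys) B" by (rule lin_cong[OF F(1) L.M.cvec_Q]) (simp add: e)
 show "xs \<in> pure_lists Ys ==> phi B b M Ys (mtens Ys xs) = pprod B b M xs" by (simp add: e F(2))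
 show "i \<in> ix M Ys ==> t \<in> carrier (mtensor Ys) ==> phi B b M Ys (opy M Ys i t) = b i \<otimes>\<^bsub>B\<^esub> phi B b M Ys t"
  using lin_closed[OF end_lin[OF opy_end[OF a]]] by (simp add: e F(3))
qed

lemma pprod_at:
 assumes a: "alt M Ys" and B: "cx_algebra B" and h: "hcond B (ix M Ys) b" and f: "f \<in> carrier V"
 shows "pprod B b M (map one Ys) = \<one>\<^bsub>B\<^esub>"
  and "j < length Ys ==> pprod B b M ((map one Ys)[j := f]) = ev B (b (Suc (M + j))) f"
proof -
 interpret B: cx_algebra B by fact
 have "pprod B b M (map one Ys) = \<one>\<^bsub>B\<^esub> \<and> (\<forall>j<length Ys. pprod B b M ((map one Ys)[j := f]) = ev B (b (Suc (M + j))) f)"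
  using a h
 proof (induction M Ys rule: alt.induct)
  case (2 M Y Ys)
  have bc: "b i \<in> carrier B" "b i [^]\<^bsub>B\<^esub> p = \<zero>\<^bsub>B\<^esub>" if "i \<in> ix M (Y # Ys)" for i using 2(3) that by (auto simp: hcond_def)
  have e: "ev B (b i) \<in> alg_homs V B" if "i \<in> ix M (Y # Ys)" for i by (rule ev_hom[OF B bc[OF that]])
  have IH: "pprod B b (Suc M) (map one Ys) = \<one>\<^bsub>B\<^esub> \<and> (\<forall>j<length Ys. pprod B b (Suc M) ((map one Ys)[j := f]) = ev B (b (Suc (Suc M + j))) f)"
   using 2(2) by (intro 2(1) hcond_mono[OF 2(3)]) auto
  have "ev B (b (Suc M)) \<one>\<^bsub>V\<^esub> = \<one>\<^bsub>B\<^esub>" by (rule hom_one[OF e]) simp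
  moreover have "ev B (b (Suc M)) f \<in> carrier B" by (intro hom_closed[OF e f]) simp
  moreover have "ev B (b (Suc (Suc (M + j)))) f \<in> carrier B" if "j < length Ys" for j
   using that by (intro hom_closed[OF e f]) auto
  ultimately show ?case using 2(2) IH by (auto simp: nth_Cons less_Suc_eq_0_disj)
 qed simp
 then show "pprod B b M (map one Ys) = \<one>\<^bsub>B\<^esub>" "j < length Ys ==> pprod B b M ((map one Ys)[j := f]) = ev B (b (Suc (M + j))) f"
  by simp_all
qed

lemma pprod_foldr:
 "pprod B b M xs = foldr (\<lambda>i t. ev B (b (Suc (M + i))) (xs ! i) \<otimes>\<^bsub>B\<^esub> t) [0..<length xs] \<one>\<^bsub>B\<^esub>"
proof (induction xs arbitrary: M)
 case (Cons x xs)
 have "[0..<length (x # xs)] = 0 # map Suc [0..<length xs]" by (simp add: upt_conv_Cons map_Suc_upt del: upt_Suc)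
 then show ?case by (simp add: Cons foldr_map comp_def)
qed simp

lemma ev_unique:
 assumes h: "h \<in> alg_homs V B" and B: "cx_algebra B" and f: "f \<in> carrier V"
 shows "h f = ev B (h (X 1)) f"
proof -
 interpret B: cx_algebra B by fact
 have c: "h (X 1) \<in> carrier B" by (rule hom_closed[OF h X_closed(1)])
 have z: "h (X 1) [^]\<^bsub>B\<^esub> p = \<zero>\<^bsub>B\<^esub>"
  using hcond_V[of 0] hom_pow[OF h V_alg B X_closed(1), of 1 p] lin_zero[OF hom_lin[OF h] V.cvec_axioms B.cvec_axioms]
  by (simp add: hcond_def)
 note e = ev_hom[OF B c z]
 have hX: "h (X n) = h (X 1) [^]\<^bsub>B\<^esub> n" for n using hom_pow[OF h V_alg B X_closed(1), of 1 n] by (simp only: X_pow)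
 show ?thesis
  by (rule V_lin_ext[OF hom_lin[OF h] hom_lin[OF e(1)] B.cvec_axioms _ f]) (rule trans[OF hX e(2)[symmetric]])
qed

text \<open>\<open>phi\<close> with values in operators turns \<open>t\<close> into an operator,
  which is then applied to \<open>u\<close>. Off the carrier the value is the one prescribed by
  \<open>is_braided_mult\<close>.\<close>

definition bm :: "nat => xyd list => (complex poly list \<Rightarrow>\<^sub>0 complex) set => (complex poly list \<Rightarrow>\<^sub>0 complex) set => (complex poly list \<Rightarrow>\<^sub>0 complex) set" where
 "bm M Ys t u = (if t \<in> carrier (mtensor Ys) \<and> u \<in> carrier (mtensor Ys)
   then phi (End (mtensor Ys)) (opy M Ys) M Ys t u else undefined)"

abbreviation BA where "BA M Ys \<equiv> (mtensor Ys)\<lparr>mult := bm M Ys\<rparr>"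
abbreviation xg where "xg M Ys i \<equiv> at_pos Ys (i - Suc M) (X 1)"

text \<open>T_i kills the unit and K^(-1) fixes it, so the factors before position i remain equal to
  1.\<close>

lemma opy_ones: "alt M Ys ==> i \<in> ix M Ys ==> opy M Ys i (ones Ys) = xg M Ys i"
proof (induction M Ys rule: alt.induct)
 case (2 M Y Ys)
 have a: "alt (Suc M) Ys" and Y: "Y = Xf (Suc M)" using 2(2) by simp_all
 interpret Y: cvec Y unfolding Y by (rule Xf_cvec)
 interpret L: mspace Ys by (rule alt_mspace[OF a])
 interpret S: mcons_space Y Ys by unfold_locales
 have o: "ones (Y # Ys) = mcons Y Ys (X 0) (ones Ys)" "ones Ys \<in> carrier (mtensor Ys)"
  using alt_ones[OF a] S.mcons_lin(2)[of "X 0"] by (simp_all add: Y V_one)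
 note om = opy_mcons[OF 2(2) X_closed(1) o(2)]
 show ?case
 proof (cases "i = Suc M")
  case True
  then show ?thesis using alt_ones[OF a] S.mcons_lin(2)[of "X 1"] unfolding o(1)
   by (simp only: True om(1) X_mult) (simp add: at_pos_def Y)
 next
  case False
  then have i: "i \<in> ix (Suc M) Ys" using 2(3) by auto
  then have oc: "opy (Suc M) Ys i (ones Ys) \<in> carrier (mtensor Ys)" by (intro lin_closed[OF end_lin[OF opy_end[OF a]]]) (use o in simp_all)
  have "mcons Y Ys \<zero>\<^bsub>V\<^esub> (ones Ys) = \<zero>\<^bsub>mtensor (Y # Ys)\<^esub>"
   using lin_zero[OF bilinD(1)[OF S.mcons_bilin o(2)] Y.cvec_axioms S.Z.M.cvec_Q] by (simp add: Y)
  then have "opy M (Y # Ys) i (ones (Y # Ys)) = mcons Y Ys (X 0) (xg (Suc M) Ys i)"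
   using oc S.\<tau>_simps(1) S.Z.M.Q.r_zero unfolding o(1) om(2)[OF i] Xf_one 2(1)[OF a i] by (simp add: Y)
  also have "... = xg M (Y # Ys) i"
  proof -
   have e: "i - Suc M = Suc (i - Suc (Suc M))" using i by auto
   have "(map one Ys)[i - Suc (Suc M) := X 1] \<in> pure_lists Ys"
   proof (rule pure_update[OF alt_ones[OF a]])
    show "i - Suc (Suc M) < length Ys" using i by auto
    have "alt M Zs ==> k < length Zs ==> carrier (Zs ! k) = carrier V" for M Zs k
     by (induction M Zs arbitrary: k rule: alt.induct) (auto simp: nth_Cons split: nat.split)
    then show "X 1 \<in> carrier (Ys ! (i - Suc (Suc M)))" using a i by (auto simp: less_diff_conv2)
   qed
   then show ?thesis using S.mcons_lin(2)[of "X 0"] unfolding at_pos_def e by (simp add: Y V_one)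
  qed
  finally show ?thesis .
 qed
qed simp


section \<open>The algebra structure obtained from the operators\<close>

context
 fixes M :: nat and Ys :: "xyd list"
 assumes alt: "alt M Ys"
begin

interpretation L: mspace Ys by (rule alt_mspace[OF alt])

abbreviation (input) "W \<equiv> mtensor Ys"
abbreviation (input) "Lm \<equiv> phi (End (mtensor Ys)) (opy M Ys) M Ys"

lemma BA_simps [simp]:
 "lin_maps (BA M Ys) B = lin_maps W B" "lin_maps C (BA M Ys) = lin_maps C W"
 by (simp_all add: lin_maps_def)

lemma D_alg: "cx_algebra (End W)" by (rule cx_algebra_end[OF L.M.cvec_Q])

lemma D_hcond: "hcond (End W) (ix M Ys) (opy M Ys)" using alt_scond[OF alt] by (simp add: scond_def)

lemma ones_closed [simp]: "ones Ys \<in> carrier W" using alt_ones[OF alt] by simp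

lemma opy_closed: "i \<in> ix M Ys ==> t \<in> carrier W ==> opy M Ys i t \<in> carrier W"
 by (rule lin_closed[OF end_lin[OF opy_end[OF alt]]])

lemma phi_ones: "cx_algebra B ==> hcond B (ix M Ys) b ==> phi B b M Ys (ones Ys) = \<one>\<^bsub>B\<^esub>"
 using phi(2)[OF alt _ _ alt_ones[OF alt]] pprod_at(1)[OF alt _ _ X_closed(1)] by metis

text \<open>The form in which cyclicity is used: a linear map is determined by its value at the unit
  and its behaviour under the operators.\<close>

lemma lin_eq:
 assumes F: "F \<in> lin_maps W B" and G: "G \<in> lin_maps W B" and t: "t \<in> carrier W" and "F (ones Ys) = G (ones Ys)"
  and "!!i t. i \<in> ix M Ys ==> t \<in> carrier W ==> F t = G t ==> F (opy M Ys i t) = G (opy M Ys i t)"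
 shows "F t = G t"
 using alt t by (induction rule: mt_induct) (simp_all add: assms lin_add[OF F] lin_add[OF G] lin_sm[OF F] lin_sm[OF G])

lemma Lm_end: "t \<in> carrier W ==> Lm t \<in> carrier (End W)"
 by (rule lin_closed[OF phi(1)[OF alt D_alg D_hcond]])

lemma Lm_closed [simp]: "t \<in> carrier W ==> u \<in> carrier W ==> Lm t u \<in> carrier W"
 by (rule lin_closed[OF end_lin[OF Lm_end]])

lemma Lm_ones: "u \<in> carrier W ==> Lm (ones Ys) u = u"
 by (simp add: phi_ones[OF D_alg D_hcond] end_simps)

lemma Lm_opy: "i \<in> ix M Ys ==> t \<in> carrier W ==> u \<in> carrier W ==> Lm (opy M Ys i t) u = opy M Ys i (Lm t u)"
 by (simp only: phi(3)[OF alt D_alg D_hcond] end_simps)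

lemma Lm_lin: "t \<in> carrier W ==> Lm t \<in> lin_maps W W" "u \<in> carrier W ==> (\<lambda>t. Lm t u) \<in> lin_maps W W"
 by (rule end_lin[OF Lm_end], assumption) (rule lin_comp[OF phi(1)[OF alt D_alg D_hcond] end_eval_lin])

lemma Lm_right_ones: "t \<in> carrier W ==> Lm t (ones Ys) = t"
 by (rule lin_eq[OF Lm_lin(2) lin_id]) (simp_all add: Lm_ones Lm_opy)

text \<open>As functions of \<open>t\<close> both sides have the same value at the unit and obey the
  same recursion, because prefixing a generator to \<open>t\<close> composes with its
  operator.\<close>

lemma Lm_assoc:
 assumes "t \<in> carrier W" "u \<in> carrier W" "v \<in> carrier W"
 shows "Lm (Lm t u) v = Lm t (Lm u v)"
 by (rule lin_eq[OF lin_comp[OF Lm_lin(2)[OF assms(2)] Lm_lin(2)[OF assms(3)]] Lm_lin(2) assms(1)])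
  (use assms in \<open>simp_all add: Lm_ones Lm_opy\<close>)

lemma BA_mult: "t \<in> carrier W ==> u \<in> carrier W ==> t \<otimes>\<^bsub>BA M Ys\<^esub> u = Lm t u"
 by (simp add: bm_def)

lemma BA_one: "\<one>\<^bsub>BA M Ys\<^esub> = ones Ys" by (simp add: L.one_mtensor)

lemma BA_cvec: "cvec (BA M Ys)" by (rule cvec_cong[OF _ L.M.cvec_Q]) (simp add: same_mod_def)

lemma BA_alg: "cx_algebra (BA M Ys)"
 by (rule cx_algebraI[OF BA_cvec])
  (simp_all add: bm_def L.one_mtensor Lm_ones Lm_right_ones Lm_assoc lin_add[OF Lm_lin(1)] lin_add[OF Lm_lin(2)]
   lin_sm[OF Lm_lin(1)] lin_sm[OF Lm_lin(2)])

lemma xg_closed: "i \<in> ix M Ys ==> xg M Ys i \<in> carrier W"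
 using opy_closed[OF _ ones_closed] opy_ones[OF alt] by metis

lemma xg_mult: "i \<in> ix M Ys ==> t \<in> carrier W ==> xg M Ys i \<otimes>\<^bsub>BA M Ys\<^esub> t = opy M Ys i t"
 using Lm_opy[of i "ones Ys" t] opy_ones[OF alt, of i] by (simp only: BA_mult xg_closed Lm_ones ones_closed)

text \<open>Multiplicativity is again an induction on the left factor: intertwining the generators
  is its step, preserving the unit its start.\<close>

lemma hom_from_lin:
 assumes F: "F \<in> lin_maps W B" and B: "cx_algebra B" and b: "!!i. i \<in> ix M Ys ==> b i \<in> carrier B"
  and F1: "F (ones Ys) = \<one>\<^bsub>B\<^esub>" and Fy: "!!i t. i \<in> ix M Ys ==> t \<in> carrier W ==> F (opy M Ys i t) = b i \<otimes>\<^bsub>B\<^esub> F t"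
 shows "F \<in> alg_homs (BA M Ys) B" "!!i. i \<in> ix M Ys ==> F (xg M Ys i) = b i"
proof -
 interpret B: cx_algebra B by fact
 note c = lin_closed[OF F]
 show "F \<in> alg_homs (BA M Ys) B"
 proof (rule alg_homsI)
  fix t u assume t: "t \<in> carrier (BA M Ys)" and u: "u \<in> carrier (BA M Ys)"
  have "F (Lm t u) = F t \<otimes>\<^bsub>B\<^esub> F u"
  proof (rule lin_eq[OF lin_comp[OF Lm_lin(2) F]])
   show "(\<lambda>t. F t \<otimes>\<^bsub>B\<^esub> F u) \<in> lin_maps W B"
    using u by (intro lin_mapsI) (simp_all add: c lin_add[OF F] lin_sm[OF F] B.l_distr)
  qed (use t u b in \<open>simp_all add: Lm_ones Lm_opy F1 Fy c opy_closed B.m_assoc\<close>)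
  then show "F (t \<otimes>\<^bsub>BA M Ys\<^esub> u) = F t \<otimes>\<^bsub>B\<^esub> F u" using t u by (simp add: bm_def)
 qed (use F F1 in \<open>simp_all add: L.one_mtensor\<close>)
 show "F (xg M Ys i) = b i" if "i \<in> ix M Ys" for i
  using that opy_ones[OF alt that] Fy[OF that ones_closed] b by (simp add: F1)
qed

lemma phi_hom:
 assumes "cx_algebra B" "hcond B (ix M Ys) b"
 shows "phi B b M Ys \<in> alg_homs (BA M Ys) B" "!!i. i \<in> ix M Ys ==> phi B b M Ys (xg M Ys i) = b i"
 using hom_from_lin[OF phi(1)[OF alt assms] assms(1) _ phi_ones[OF assms] phi(3)[OF alt assms]] assms(2)
 by (simp_all add: hcond_def)

text \<open>The relations are known for the operators; evaluated at the unit they become relations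
  for the elements.\<close>

lemma BA_hcond: "hcond (BA M Ys) (ix M Ys) (xg M Ys)"
proof -
 note h = D_hcond[unfolded hcond_def]
 note h1 = h[THEN conjunct1, rule_format, THEN conjunct2] and h2 = h[THEN conjunct2, THEN conjunct1, rule_format]
  and h3 = h[THEN conjunct2, THEN conjunct2, THEN conjunct1, rule_format] and h4 = h[THEN conjunct2, THEN conjunct2, THEN conjunct2, rule_format]
 let ?I = "ix M Ys"
 have m: "xg M Ys i \<otimes>\<^bsub>BA M Ys\<^esub> xg M Ys j = (opy M Ys i \<otimes>\<^bsub>End W\<^esub> opy M Ys j) (ones Ys)" if "i \<in> ?I" "j \<in> ?I" for i j
  using that by (simp only: xg_mult xg_closed end_simps ones_closed opy_ones[OF alt])
 have pw: "(xg M Ys i) [^]\<^bsub>BA M Ys\<^esub> n = (opy M Ys i [^]\<^bsub>End W\<^esub> n) (ones Ys)" if i: "i \<in> ?I" for i and n :: nat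
 proof -
  interpret B: cx_algebra "BA M Ys" by (rule BA_alg)
  interpret D: cx_algebra "End W" by (rule D_alg)
  have x: "xg M Ys i \<in> carrier (BA M Ys)" using xg_closed[OF i] by simp
  show ?thesis
  proof (induction n)
   case 0 show ?case by (simp add: L.one_mtensor end_simps nat_pow_def)
  next
   case (Suc n)
   have "(xg M Ys i) [^]\<^bsub>BA M Ys\<^esub> Suc n = xg M Ys i \<otimes>\<^bsub>BA M Ys\<^esub> (xg M Ys i) [^]\<^bsub>BA M Ys\<^esub> n" by (rule B.nat_pow_Suc2[OF x])
   also have "... = opy M Ys i ((opy M Ys i [^]\<^bsub>End W\<^esub> n) (ones Ys))"
    using xg_mult[OF i, of "(xg M Ys i) [^]\<^bsub>BA M Ys\<^esub> n"] B.nat_pow_closed[OF x, of n] by (simp add: Suc)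
   also have "... = (opy M Ys i \<otimes>\<^bsub>End W\<^esub> opy M Ys i [^]\<^bsub>End W\<^esub> n) (ones Ys)" by (simp only: end_simps ones_closed)
   finally show ?case by (simp only: D.nat_pow_Suc2[OF opy_end[OF alt i]])
  qed
 qed
 have sms: "c \<odot>\<^bsub>BA M Ys\<^esub> t = c \<odot>\<^bsub>W\<^esub> t" "t \<oplus>\<^bsub>BA M Ys\<^esub> u = t \<oplus>\<^bsub>W\<^esub> u" "\<zero>\<^bsub>BA M Ys\<^esub> = \<zero>\<^bsub>W\<^esub>" "carrier (BA M Ys) = carrier W" for c t u by simp_all
 have z: "zrel (BA M Ys) (xg M Ys i) (xg M Ys j)" if "zrel (End W) (opy M Ys i) (opy M Ys j)" "i \<in> ?I" "j \<in> ?I" for i j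
  using fun_cong[OF that(1)[unfolded zrel_def], of "ones Ys"] unfolding zrel_def m[OF that(2,3)] m[OF that(3,2)] m[OF that(3,3)] sms
  by (simp only: end_simps(4,5) ones_closed)
 have d: "drel (BA M Ys) (xg M Ys i) (xg M Ys j)" if "drel (End W) (opy M Ys i) (opy M Ys j)" "i \<in> ?I" "j \<in> ?I" for i j
  using fun_cong[OF that(1)[unfolded drel_def], of "ones Ys"] unfolding drel_def m[OF that(2,3)] m[OF that(3,2)] m[OF that(3,3)] sms
  by (simp only: end_simps(4,5) ones_closed)
 have dz: "dzrel (BA M Ys) (xg M Ys i) (xg M Ys j)" if "dzrel (End W) (opy M Ys i) (opy M Ys j)" "i \<in> ?I" "j \<in> ?I" for i j
  using fun_cong[OF that(1)[unfolded dzrel_def], of "ones Ys"] unfolding dzrel_def m[OF that(2,3)] m[OF that(3,2)] BA_one sms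
  by (simp only: end_simps(2,4,5) ones_closed)
 have n: "xg M Ys i \<in> carrier W \<and> xg M Ys i [^]\<^bsub>BA M Ys\<^esub> p = \<zero>\<^bsub>W\<^esub>" if "i \<in> ?I" for i
 proof -
  have "xg M Ys i [^]\<^bsub>BA M Ys\<^esub> p = \<zero>\<^bsub>W\<^esub>" unfolding pw[OF that] h1[OF that] by (rule end_simps(3)[OF ones_closed])
  then show ?thesis using xg_closed[OF that] by (rule conjI[rotated])
 qed
 show ?thesis unfolding hcond_def sms
 proof (intro conjI ballI impI)
  show "dzrel (BA M Ys) (xg M Ys i) (xg M Ys j)" if "i \<in> ?I" "j \<in> ?I" "odd i" "even j" for i j
   using h2[OF that] that(1,2) by (rule dz)
  show "zrel (BA M Ys) (xg M Ys i) (xg M Ys j)" if "i \<in> ?I" "j \<in> ?I" "even i" "even j" "j \<le> i" for i j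
   using h3[OF that] that(1,2) by (rule z)
  show "drel (BA M Ys) (xg M Ys i) (xg M Ys j)" if "i \<in> ?I" "j \<in> ?I" "odd i" "odd j" "j \<le> i" for i j
   using h4[OF that] that(1,2) by (rule d)
 qed (rule n[THEN conjunct1] n[THEN conjunct2], assumption)+
qed

text \<open>Together with the values of \<open>phi\<close> on pure tensors this says that a pure
  tensor is the ordered product of its entries.\<close>

lemma phi_id: "t \<in> carrier W ==> phi (BA M Ys) (xg M Ys) M Ys t = t"
proof (rule lin_eq[OF _ lin_id])
 show "phi (BA M Ys) (xg M Ys) M Ys \<in> lin_maps W W" using phi(1)[OF alt BA_alg BA_hcond] by simp
qed (simp_all only: phi_ones[OF BA_alg BA_hcond] BA_one phi(3)[OF alt BA_alg BA_hcond] xg_mult)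

lemma at_pos_ev: "j < length Ys ==> f \<in> carrier V ==> at_pos Ys j f = ev (BA M Ys) (xg M Ys (Suc (M + j))) f"
proof -
 assume j: "j < length Ys" and f: "f \<in> carrier V"
 have "alt M Zs ==> k < length Zs ==> carrier (Zs ! k) = carrier V" for M Zs k
  by (induction M Zs arbitrary: k rule: alt.induct) (auto simp: nth_Cons split: nat.split)
 then have p: "(map one Ys)[j := f] \<in> pure_lists Ys" using alt j f by (intro pure_update[OF alt_ones[OF alt]]) auto
 have "at_pos Ys j f = mtens Ys ((map one Ys)[j := f])" by (rule at_pos_def)
 also have "... = ev (BA M Ys) (xg M Ys (Suc (M + j))) f"
  using phi_id[OF L.mtens_closed[OF p]] unfolding phi(2)[OF alt BA_alg BA_hcond p] pprod_at(2)[OF alt BA_alg BA_hcond f j] by (rule sym)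
 finally show ?thesis .
qed

lemma at_pos_hom: "j < length Ys ==> at_pos Ys j \<in> alg_homs V (BA M Ys)"
proof -
 assume j: "j < length Ys"
 then have "Suc (M + j) \<in> ix M Ys" by simp
 note ev_hom(1)[OF BA_alg hcondD[OF BA_hcond this]]
 from this V_alg show ?thesis by (rule hom_cong) (rule at_pos_ev[OF j, symmetric])
qed

lemma generated_BA: "generated_by (BA M Ys) (ix M Ys) (xg M Ys)"
proof -
 interpret B: cx_algebra "BA M Ys" by (rule BA_alg)
 have x: "xg M Ys ` ix M Ys \<subseteq> carrier (BA M Ys)" using xg_closed by auto
 note fe = B.free_eval_simps[OF x]
 have "t \<in> free_eval (BA M Ys) (xg M Ys) ` {f. keys f \<subseteq> lists (ix M Ys)}" if "t \<in> carrier W" for t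
  using alt that
 proof (induction rule: mt_induct)
  case one
  show ?case using fe(7) by (intro image_eqI[of _ _ 1]) (simp_all add: BA_one zero_list_def)
 next
  case (opy i t)
  then obtain f where f: "t = free_eval (BA M Ys) (xg M Ys) f" "keys f \<subseteq> lists (ix M Ys)" by auto
  show ?case
   by (rule image_eqI[of _ _ "gen i * f"])
    (use f opy in \<open>simp_all add: fe keys_mult_lists xg_mult[symmetric] del: partial_object.simps monoid.simps\<close>)
 next
  case (add t u)
  then obtain f h where f: "t = free_eval (BA M Ys) (xg M Ys) f" "keys f \<subseteq> lists (ix M Ys)"
   "u = free_eval (BA M Ys) (xg M Ys) h" "keys h \<subseteq> lists (ix M Ys)" by auto
  show ?case by (rule image_eqI[of _ _ "f + h"]) (use f keys_add[of f h] in \<open>auto simp: fe(1)\<close>)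
 next
  case (smult c t)
  then obtain f where f: "t = free_eval (BA M Ys) (xg M Ys) f" "keys f \<subseteq> lists (ix M Ys)" by auto
  show ?case by (rule image_eqI[of _ _ "scal c f"]) (use f keys_scal[of c f] in \<open>auto simp: fe(3)\<close>)
 qed
 moreover have "free_eval (BA M Ys) (xg M Ys) f \<in> carrier W" if "keys f \<subseteq> lists (ix M Ys)" for f
  using B.free_eval_closed[OF x that] by simp
 ultimately show ?thesis using x unfolding generated_by_def by auto
qed

end

end


section \<open>Presentation, braiding rule and uniqueness of the multiplication\<close>

context uq
begin

lemma HH_relators_keys: "r \<in> HH_relators p I ==> keys r \<subseteq> lists I"
proof -
 have d: "keys a \<subseteq> lists I ==> keys b \<subseteq> lists I ==> keys (a - b) \<subseteq> lists I" for a b :: "nat list \<Rightarrow>\<^sub>0 complex"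
  using keys_diff_subset[of a b] by blast
 have ad: "keys a \<subseteq> lists I ==> keys b \<subseteq> lists I ==> keys (a + b) \<subseteq> lists I" for a b :: "nat list \<Rightarrow>\<^sub>0 complex"
  using keys_add[of a b] by blast
 have pw: "keys a \<subseteq> lists I ==> keys (a ^ n) \<subseteq> lists I" for a :: "nat list \<Rightarrow>\<^sub>0 complex" and n
  by (induction n) (simp_all add: keys_mult_lists)
 have g: "i \<in> I ==> keys (gen i) \<subseteq> lists I" for i by simp
 have c: "keys (const c :: nat list \<Rightarrow>\<^sub>0 complex) \<subseteq> lists I" for c by simp
 show "r \<in> HH_relators p I ==> keys r \<subseteq> lists I"
  unfolding HH_relators_def by (elim UnE CollectE exE conjE; hypsubst; intro d ad pw keys_mult_lists g c; assumption)
qed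

lemma hcond_free_eval:
 assumes B: "cx_algebra B" and x: "x ` I \<subseteq> carrier B"
 shows "hcond B I x \<longleftrightarrow> (\<forall>r\<in>HH_relators p I. free_eval B x r = \<zero>\<^bsub>B\<^esub>)"
proof -
 interpret B: cx_algebra B by fact
 have c: "x i \<in> carrier B" if "i \<in> I" for i using x that by auto
 note fe = B.free_eval_simps[OF x]
 have q': "qq p = q" "inverse q = s" by (simp_all add: q_def s_def)
 have ad: "keys a \<subseteq> lists I ==> keys b \<subseteq> lists I ==> keys (a + b) \<subseteq> lists I" for a b :: "nat list \<Rightarrow>\<^sub>0 complex"
  using keys_add[of a b] by blast
 have sq: "x j \<otimes>\<^bsub>B\<^esub> x j = x j [^]\<^bsub>B\<^esub> (2::nat)" if "j \<in> I" for j using c[OF that] by (simp add: numeral_2_eq_2)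
 have p: "free_eval B x (gen i ^ p) = x i [^]\<^bsub>B\<^esub> p" if "i \<in> I" for i using that by (simp add: fe)
 have dz: "free_eval B x (gen i * gen j - (const (q - s) + const (s ^ 2) * gen j * gen i)) =
   x i \<otimes>\<^bsub>B\<^esub> x j \<ominus>\<^bsub>B\<^esub> ((q - s) \<odot>\<^bsub>B\<^esub> \<one>\<^bsub>B\<^esub> \<oplus>\<^bsub>B\<^esub> s ^ 2 \<odot>\<^bsub>B\<^esub> (x j \<otimes>\<^bsub>B\<^esub> x i))" if "i \<in> I" "j \<in> I" for i j
  using that by (simp add: fe c ad B.m_assoc)
 have zd: "free_eval B x (gen i * gen j - (const (w ^ 2) * gen j * gen i + const (1 - w ^ 2) * gen j ^ 2)) =
   x i \<otimes>\<^bsub>B\<^esub> x j \<ominus>\<^bsub>B\<^esub> (w ^ 2 \<odot>\<^bsub>B\<^esub> (x j \<otimes>\<^bsub>B\<^esub> x i) \<oplus>\<^bsub>B\<^esub> (1 - w ^ 2) \<odot>\<^bsub>B\<^esub> (x j \<otimes>\<^bsub>B\<^esub> x j))" if "i \<in> I" "j \<in> I" for i j w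
  using that by (simp add: fe c sq ad B.m_assoc)
 have s1: "(\<forall>r\<in>{f i | i. i \<in> I}. Q r) \<longleftrightarrow> (\<forall>i\<in>I. Q (f i))" for f :: "nat => nat list \<Rightarrow>\<^sub>0 complex" and Q by blast
 have s2: "(\<forall>r\<in>{f i j | i j. i \<in> I \<and> j \<in> I \<and> P i \<and> P' j}. Q r) \<longleftrightarrow> (\<forall>i\<in>I. \<forall>j\<in>I. P i --> P' j --> Q (f i j))"
  for f :: "nat => nat => nat list \<Rightarrow>\<^sub>0 complex" and P P' Q by blast
 have s3: "(\<forall>r\<in>{f i j | i j. i \<in> I \<and> j \<in> I \<and> P i \<and> P' j \<and> j \<le> i}. Q r) \<longleftrightarrow> (\<forall>i\<in>I. \<forall>j\<in>I. P i --> P' j --> j \<le> i --> Q (f i j))"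
  for f :: "nat => nat => nat list \<Rightarrow>\<^sub>0 complex" and P P' Q by blast
 have R: "(\<forall>r\<in>HH_relators p I. Q r) \<longleftrightarrow> (\<forall>i\<in>I. Q (gen i ^ p)) \<and>
  (\<forall>i\<in>I. \<forall>j\<in>I. odd i --> even j --> Q (gen i * gen j - (const (q - s) + const (s ^ 2) * gen j * gen i))) \<and>
  (\<forall>i\<in>I. \<forall>j\<in>I. even i --> even j --> j \<le> i --> Q (gen i * gen j - (const (s ^ 2) * gen j * gen i + const (1 - s ^ 2) * gen j ^ 2))) \<and>
  (\<forall>i\<in>I. \<forall>j\<in>I. odd i --> odd j --> j \<le> i --> Q (gen i * gen j - (const (q ^ 2) * gen j * gen i + const (1 - q ^ 2) * gen j ^ 2)))" for Q
  unfolding HH_relators_def q' ball_Un s1 s2 s3 conj_assoc ..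
 have d: "a \<ominus>\<^bsub>B\<^esub> b = \<zero>\<^bsub>B\<^esub> \<longleftrightarrow> a = b" if "a \<in> carrier B" "b \<in> carrier B" for a b using that by (simp add: B.diff_zero_iff)
 show ?thesis
  unfolding R hcond_def zrel_def drel_def dzrel_def
  by (simp only: p dz zd d c B.m_closed B.a_closed B.smult_closed B.one_closed UNIV_I cx_simps simp_thms cong: ball_cong)
qed

lemma coact_X1: "coact (Xf i) (X 1) = tens H V UJ (X 1) \<oplus>\<^bsub>tensor H V\<^esub>
  (if odd i then (q - s) \<odot>\<^bsub>tensor H V\<^esub> tens H V (ug gF) (X 0)
   else (s - q) \<odot>\<^bsub>tensor H V\<^esub> tens H V (ug gE \<otimes>\<^bsub>H\<^esub> UJ) (X 0))"
 and Xf_tensor: "tensor H (Xf i) = tensor H V" "tens H (Xf i) = tens H V"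
proof -
 interpret T: tensor_algs "H" V by (rule tensor_algsI[OF cx_algebra_Uq V_alg])
 show t: "tensor H (Xf i) = tensor H V" "tens H (Xf i) = tens H V"
  using tensor_cong[of "H" "H" "Xf i" V] tens_cong[of "H" "H" "Xf i" V] Xf_same[of i] by (simp_all add: same_alg_def same_mod_def)
 note yd_data.coact_x[OF Xf_data[of i], of i, unfolded t]
 then show "coact (Xf i) (X 1) = tens H V UJ (X 1) \<oplus>\<^bsub>tensor H V\<^esub>
  (if odd i then (q - s) \<odot>\<^bsub>tensor H V\<^esub> tens H V (ug gF) (X 0)
   else (s - q) \<odot>\<^bsub>tensor H V\<^esub> tens H V (ug gE \<otimes>\<^bsub>H\<^esub> UJ) (X 0))"
  by (simp add: coact_gen_def twist_def tensor_left_ucond(2)[OF V_alg] T.tens_mult V_one[symmetric])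
qed

lemma coact_Xf_hom: "coact (Xf i) \<in> alg_homs V (tensor H V)"
 using yd_data.coact_hom[OF Xf_data[of i]] by (simp add: Xf_tensor)

lemma end_Xf: "End (Xf k) = End V" by (simp add: End_def lin_maps_def)

text \<open>The braiding of two factors in \<open>B\<close> comes from a representation on \<open>X\<^sub>k \<otimes> B\<close>, on which
 the coacting factor \<open>X\<^sub>i\<close> acts through \<open>\<delta>\<close>; hence it is determined by the generators.\<close>

lemma braid_rel:
 assumes B: "cx_algebra B" and h: "hcond B I b" and I: "i \<in> I" "k \<in> I" "k < i"
  and al: "\<alpha> \<in> alg_homs V B" "\<alpha> (X 1) = b i" and be: "\<beta> \<in> alg_homs V B" "\<beta> (X 1) = b k"
  and x: "x \<in> carrier V" and y: "y \<in> carrier V"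
 shows "\<alpha> x \<otimes>\<^bsub>B\<^esub> \<beta> y = sweedler B (\<lambda>u x0. \<beta> (act (Xf k) u y) \<otimes>\<^bsub>B\<^esub> \<alpha> x0) (coact (Xf i) x)"
proof -
 interpret B: cx_algebra B by fact
 interpret T: tensor_algs "H" V by (rule tensor_algsI[OF cx_algebra_Uq V_alg])
 interpret P: tprod V B "tensor V B" "tens V B" "\<lambda>x. x" by (rule tprod_tensor[OF V.cvec_axioms B.cvec_axioms])
 let ?C = "End (tensor V B)"
 have bi: "b i \<in> carrier B" by (rule hcondD(1)[OF h I(1)])
 have br: "b i \<otimes>\<^bsub>B\<^esub> \<beta> f = \<beta> (act (Xf k) UJ f) \<otimes>\<^bsub>B\<^esub> b i \<oplus>\<^bsub>B\<^esub> \<beta> (tw k i f)" if f: "f \<in> carrier V" for f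
  using ev_braid[OF B h I f] ev_unique[OF be(1) B] f lin_closed[OF tw_lin f] by (simp add: be(2))
 define r where "r = (\<lambda>u. P.opL (actrep (Xf k) u))"
 define l where "l = (\<lambda>f. P.opR (lmul B (\<alpha> f)))"
 have aa: "actrep (Xf k) u \<in> carrier (End V)" if "u \<in> carrier H" for u
  using hom_closed[OF actrep_hom[of k] that] by (simp add: end_Xf)
 have ll: "lmul B (\<alpha> f) \<in> carrier (End B)" if "f \<in> carrier V" for f
  by (rule hom_closed[OF lmul_hom[OF B] hom_closed[OF al(1) that]])
 have r: "r \<in> alg_homs H ?C" unfolding r_def using hom_comp[OF actrep_hom[of k, unfolded end_Xf] P.opL_hom] .
 have l: "l \<in> alg_homs V ?C" unfolding l_def using hom_comp[OF hom_comp[OF al(1) lmul_hom[OF B]] P.opR_hom] .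
 note Th = T.tensor_hom[OF r l P.ET.cx_algebra_axioms]
 define \<Theta> where "\<Theta> = sweedler ?C (\<lambda>u f. r u \<otimes>\<^bsub>?C\<^esub> l f)"
 have cm: "r u \<otimes>\<^bsub>?C\<^esub> l f = l f \<otimes>\<^bsub>?C\<^esub> r u" if "u \<in> carrier H" "f \<in> carrier V" for u f
  unfolding r_def l_def by (rule P.opLR_comm[OF aa[OF that(1)] ll[OF that(2)]])
 have \<Theta>: "\<Theta> \<in> alg_homs (tensor H V) ?C" and \<Theta>v: "!!u f. u \<in> carrier H ==> f \<in> carrier V ==> \<Theta> (tens H V u f) = r u \<otimes>\<^bsub>?C\<^esub> l f"
  unfolding \<Theta>_def by (rule Th(1)[OF cm], assumption+) (rule Th(2)[OF cm], assumption+)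
 have app: "r u (l f (tens V B v t)) = tens V B (act (Xf k) u v) (\<alpha> f \<otimes>\<^bsub>B\<^esub> t)"
  if "u \<in> carrier H" "f \<in> carrier V" "v \<in> carrier V" "t \<in> carrier B" for u f v t
  using that aa ll hom_closed[OF al(1)] by (simp add: end_simps P.tens_closed r_def l_def P.opL_\<tau> P.opR_\<tau> lmul_apply actrep_eq)
 have bil: "bilin V B B (\<lambda>v t. \<beta> v \<otimes>\<^bsub>B\<^esub> t)"
  by (intro bilinI lin_mapsI) (simp_all add: hom_closed[OF be(1)] hom_add[OF be(1)] hom_sm[OF be(1)] B.l_distr B.r_distr)
 define G where "G = sweedler B (\<lambda>v t. \<beta> v \<otimes>\<^bsub>B\<^esub> t)"
 have G: "G \<in> lin_maps (tensor V B) B" and Gv: "!!v t. v \<in> carrier V ==> t \<in> carrier B ==> G (tens V B v t) = \<beta> v \<otimes>\<^bsub>B\<^esub> t"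
  unfolding G_def by (rule P.sweedler_lin[OF B.cvec_axioms bil])+
 note co = coact_Xf_hom[of i]
 have \<Theta>c: "\<Theta> (coact (Xf i) f) \<in> carrier ?C" if "f \<in> carrier V" for f by (rule hom_closed[OF \<Theta> hom_closed[OF co that]])
 \<comment> \<open>The case x = X 1, tested on all of V \<otimes> B through the product map
   \<open>G\<close>; it amounts to the braiding of b_i with a polynomial in b_k.\<close>
 have S1: "b i \<otimes>\<^bsub>B\<^esub> G \<tau> = G (\<Theta> (coact (Xf i) (X 1)) \<tau>)" if t: "\<tau> \<in> carrier (tensor V B)" for \<tau>
 proof (rule P.tensor_ext[OF _ lin_comp[OF end_lin[OF \<Theta>c[OF X_closed(1)]] G] B.cvec_axioms _ t])
  show "(\<lambda>\<tau>. b i \<otimes>\<^bsub>B\<^esub> G \<tau>) \<in> lin_maps (tensor V B) B"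
   using bi by (intro lin_mapsI) (simp_all add: lin_closed[OF G] lin_add[OF G] lin_sm[OF G] B.r_distr)
  fix v t assume v: "v \<in> carrier V" and t: "t \<in> carrier B"
  have 0: "\<alpha> (X 0) = \<one>\<^bsub>B\<^esub>" using hom_one[OF al(1)] by (simp add: V_one)
  have m: "act (Xf k) (ug gE \<otimes>\<^bsub>H\<^esub> UJ) v = act (Xf k) (ug gE) (act (Xf k) UJ v)"
   using yd_data.act_m[OF Xf_data[of k], of "ug gE" UJ v] v by simp
  have "\<Theta> (coact (Xf i) (X 1)) (tens V B v t) = tens V B (act (Xf k) UJ v) (b i \<otimes>\<^bsub>B\<^esub> t) \<oplus>\<^bsub>tensor V B\<^esub> tens V B (tw k i v) t"
   using v t unfolding coact_X1
   by (simp add: hom_add[OF \<Theta>] hom_sm[OF \<Theta>] T.tens_closed \<Theta>v end_simps P.tens_closed app al(2) 0 tw_def P.tens_sm_left m del: V_one)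
  then show "b i \<otimes>\<^bsub>B\<^esub> G (tens V B v t) = G (\<Theta> (coact (Xf i) (X 1)) (tens V B v t))"
   using v t bi hom_closed[OF be(1)] lin_closed[OF tw_lin v] br[OF v]
   by (simp add: lin_add[OF G] P.tens_closed Gv B.l_distr B.m_assoc[symmetric])
 qed
 \<comment> \<open>Stated for every tensor, so that multiplying \<open>x\<close> by the generator
   composes the two operators and the induction goes through.\<close>
 have S: "\<forall>\<tau>\<in>carrier (tensor V B). \<alpha> x \<otimes>\<^bsub>B\<^esub> G \<tau> = G (\<Theta> (coact (Xf i) x) \<tau>)"
  using generated_V[of 0] V_alg x
 proof (induction rule: generated_induct)
  case one
  then show ?case using lin_closed[OF G] by (simp add: hom_one[OF al(1)] hom_one[OF co] hom_one[OF \<Theta>] end_simps)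
 next
  case (mult j f)
  then show ?case
   using \<Theta>c S1 bi hom_closed[OF al(1)] lin_closed[OF G] lin_closed[OF end_lin[OF \<Theta>c]]
   by (simp add: hom_mult[OF al(1)] hom_mult[OF co] hom_mult[OF \<Theta>] hom_closed[OF co] end_simps al(2) B.m_assoc)
 next
  case (add f f')
  then show ?case using lin_closed[OF G] lin_closed[OF end_lin[OF \<Theta>c]] hom_closed[OF al(1)]
   by (simp add: hom_add[OF al(1)] hom_add[OF co] hom_add[OF \<Theta>] hom_closed[OF co] end_simps lin_add[OF G] B.l_distr)
 next
  case (smult c f)
  then show ?case using lin_closed[OF G] lin_closed[OF end_lin[OF \<Theta>c]] hom_closed[OF al(1)]
   by (simp add: hom_sm[OF al(1)] hom_sm[OF co] hom_sm[OF \<Theta>] hom_closed[OF co] end_simps lin_sm[OF G])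
 qed
 have yt: "tens V B y \<one>\<^bsub>B\<^esub> \<in> carrier (tensor V B)" using y by (simp add: P.tens_closed)
 have "\<alpha> x \<otimes>\<^bsub>B\<^esub> \<beta> y = G (\<Theta> (coact (Xf i) x) (tens V B y \<one>\<^bsub>B\<^esub>))"
  using S yt y hom_closed[OF be(1)] by (simp add: Gv flip: bspec[OF S])
 also have "... = sweedler B (\<lambda>u x0. \<beta> (act (Xf k) u y) \<otimes>\<^bsub>B\<^esub> \<alpha> x0) (coact (Xf i) x)"
  by (rule T.sweedler_eq[symmetric, OF lin_comp[OF lin_comp[OF hom_lin[OF \<Theta>] end_eval_lin[OF yt]] G] B.cvec_axioms _ hom_closed[OF co x]])
   (use y hom_closed[OF al(1)] in \<open>simp add: \<Theta>v app Gv end_simps P.tens_closed\<close>)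
 finally show ?thesis .
qed

text \<open>Converse of \<open>hcond_braid\<close>. Equal indices give identities, and the mixed
  relation with \<partial> in the earlier factor is recovered from the braiding by multiplying with
  s^2.\<close>

lemma hcond_from_braid:
 assumes B: "cx_algebra B" and b: "!!i. i \<in> I ==> b i \<in> carrier B" "!!i. i \<in> I ==> b i [^]\<^bsub>B\<^esub> p = \<zero>\<^bsub>B\<^esub>"
  and br: "!!i k. i \<in> I ==> k \<in> I ==> k < i ==>
   b i \<otimes>\<^bsub>B\<^esub> b k = cJ k \<odot>\<^bsub>B\<^esub> (b k \<otimes>\<^bsub>B\<^esub> b i) \<oplus>\<^bsub>B\<^esub> (c2 k i \<odot>\<^bsub>B\<^esub> (b k \<otimes>\<^bsub>B\<^esub> b k) \<oplus>\<^bsub>B\<^esub> c3 k i \<odot>\<^bsub>B\<^esub> \<one>\<^bsub>B\<^esub>)"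
 shows "hcond B I b"
proof -
 interpret B: cx_algebra B by fact
 have sm1: "w \<odot>\<^bsub>B\<^esub> a \<oplus>\<^bsub>B\<^esub> (1 - w) \<odot>\<^bsub>B\<^esub> a = a" if "a \<in> carrier B" for a w
  using that by (simp flip: B.sm_add)
 have z: "zrel B (b i) (b k)" if "i \<in> I" "k \<in> I" "even i" "even k" "k \<le> i" for i k
  using br[of i k] that b(1) sm1 by (cases "k = i") (simp_all add: zrel_def cJ_def c2_def c3_def)
 have d: "drel B (b i) (b k)" if "i \<in> I" "k \<in> I" "odd i" "odd k" "k \<le> i" for i k
  using br[of i k] that b(1) sm1 by (cases "k = i") (simp_all add: drel_def cJ_def c2_def c3_def)
 have dz: "dzrel B (b i) (b k)" if "i \<in> I" "k \<in> I" "odd i" "even k" for i k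
 proof (cases "k < i")
  case True
  then show ?thesis using br[of i k] that b(1) by (simp add: dzrel_def cJ_def c2_def c3_def B.a_comm)
 next
  case False
  then have "i < k" using that by (metis linorder_neqE_nat)
  then have e: "b k \<otimes>\<^bsub>B\<^esub> b i = q ^ 2 \<odot>\<^bsub>B\<^esub> (b i \<otimes>\<^bsub>B\<^esub> b k) \<oplus>\<^bsub>B\<^esub> ((s - q) * q ^ 2) \<odot>\<^bsub>B\<^esub> \<one>\<^bsub>B\<^esub>"
   using br[of k i] that b(1) by (simp add: cJ_def c2_def c3_def)
  have sq: "s ^ 2 * q ^ 2 = 1" using qs by (simp add: mult.commute flip: power_mult_distrib)
  then have s0: "(q - s) + s ^ 2 * ((s - q) * q ^ 2) = 0" by (simp add: algebra_simps)
  have "(q - s) \<odot>\<^bsub>B\<^esub> \<one>\<^bsub>B\<^esub> \<oplus>\<^bsub>B\<^esub> s ^ 2 \<odot>\<^bsub>B\<^esub> (b k \<otimes>\<^bsub>B\<^esub> b i)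
    = ((q - s) + s ^ 2 * ((s - q) * q ^ 2)) \<odot>\<^bsub>B\<^esub> \<one>\<^bsub>B\<^esub> \<oplus>\<^bsub>B\<^esub> (s ^ 2 * q ^ 2) \<odot>\<^bsub>B\<^esub> (b i \<otimes>\<^bsub>B\<^esub> b k)"
   unfolding e using b(1) that by (simp add: B.sm_add B.sm_distr B.sm_sm B.a_ac)
  also have "... = b i \<otimes>\<^bsub>B\<^esub> b k" using b(1) that by (simp add: s0 sq)
  finally show ?thesis by (simp add: dzrel_def)
 qed
 show ?thesis unfolding hcond_def using b z d dz by (intro conjI ballI impI) simp_all
qed


lemma presented_hcond:
 assumes A: "cx_algebra A" and P: "presented_by A I x (HH_relators p I)"
 shows "hcond A I x"
proof (rule iffD2[OF hcond_free_eval[OF A]])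
 show "x ` I \<subseteq> carrier A" using P by (simp add: presented_by_def)
 show "\<forall>r\<in>HH_relators p I. free_eval A x r = \<zero>\<^bsub>A\<^esub>"
 proof
  fix r assume r: "r \<in> HH_relators p I"
  have "single [] 1 = (1 :: nat list \<Rightarrow>\<^sub>0 complex)" by (metis single_one zero_list_def)
  then have "r = single [] 1 * r * single [] 1" by simp
  then have "r \<in> two_sided I (HH_relators p I)" unfolding two_sided_def using r by blast
  then have "r \<in> cspan (two_sided I (HH_relators p I))" by (rule fv.span_base)
  then show "free_eval A x r = \<zero>\<^bsub>A\<^esub>" using P HH_relators_keys[OF r] by (simp add: presented_by_def)
 qed
qed

lemma alt_nth: "alt M Ys ==> j < length Ys ==> Ys ! j = Xf (Suc (M + j))"
 by (induction M Ys arbitrary: j rule: alt.induct) (auto simp: nth_Cons split: nat.split)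

context
 fixes M :: nat and Ys :: "xyd list"
 assumes alt: "alt M Ys"
begin

interpretation L: mspace Ys by (rule alt_mspace[OF alt])

text \<open>If a combination of words evaluates to zero, then \<open>phi\<close> with values in the
  presented algebra sends this zero to the class of the combination, which is therefore
  trivial.\<close>

lemma presented_BA: "presented_by (BA M Ys) (ix M Ys) (xg M Ys) (HH_relators p (ix M Ys))"
proof -
 let ?I = "ix M Ys"
 interpret P: pres ?I "HH_relators p ?I" by unfold_locales (rule HH_relators_keys)
 interpret B: cx_algebra "BA M Ys" by (rule BA_alg[OF alt])
 note g = generated_BA[OF alt, unfolded generated_by_def]
 let ?b = "\<lambda>i. P.fq.kl (gen i)"
 have hB: "free_eval (BA M Ys) (xg M Ys) r = \<zero>\<^bsub>BA M Ys\<^esub>" if "r \<in> HH_relators p ?I" for r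
  using iffD1[OF hcond_free_eval[OF BA_alg[OF alt] g[THEN conjunct1]] BA_hcond[OF alt]] that by simp
 have "hcond (pres_alg ?I (HH_relators p ?I)) ?I ?b"
  by (rule presented_hcond[OF P.cx_algebra_pres P.presented_pres])
 note F = phi_hom[OF alt P.cx_algebra_pres this]
 let ?F = "phi (pres_alg ?I (HH_relators p ?I)) ?b M Ys"
 have "free_eval (BA M Ys) (xg M Ys) f = \<zero>\<^bsub>BA M Ys\<^esub> \<longleftrightarrow> f \<in> cspan (two_sided ?I (HH_relators p ?I))"
  if k: "keys f \<subseteq> lists ?I" for f
 proof
  assume "free_eval (BA M Ys) (xg M Ys) f = \<zero>\<^bsub>BA M Ys\<^esub>"
  then have "?F (free_eval (BA M Ys) (xg M Ys) f) = \<zero>\<^bsub>pres_alg ?I (HH_relators p ?I)\<^esub>"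
   using lin_zero[OF hom_lin[OF F(1)] B.cvec_axioms P.fq.cvec_Q] by simp
  then have "free_eval (pres_alg ?I (HH_relators p ?I)) (\<lambda>i. ?F (xg M Ys i)) f = \<zero>\<^bsub>pres_alg ?I (HH_relators p ?I)\<^esub>"
   using hom_free_eval[OF F(1) BA_alg[OF alt] P.cx_algebra_pres g[THEN conjunct1] k] by simp
  moreover have "free_eval (pres_alg ?I (HH_relators p ?I)) (\<lambda>i. ?F (xg M Ys i)) f = free_eval (pres_alg ?I (HH_relators p ?I)) ?b f"
   by (rule free_eval_fun_cong[OF P.cx_algebra_pres _ k]) (simp_all add: F(2) P.gen_closed image_subset_iff)
  ultimately show "f \<in> cspan (two_sided ?I (HH_relators p ?I))"
   by (simp add: P.free_eval_pres[OF k] P.fq.kl_zero_iff[OF k])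
 next
  assume f: "f \<in> cspan (two_sided ?I (HH_relators p ?I))"
  show "free_eval (BA M Ys) (xg M Ys) f = \<zero>\<^bsub>BA M Ys\<^esub>"
   by (rule P.free_eval_ideal_zero[OF BA_alg[OF alt] g[THEN conjunct1] _ f]) (rule hB)
 qed
 then show ?thesis using g unfolding presented_by_def by (intro conjI allI impI) simp_all
qed

lemma foldr_at_pos:
 assumes B: "cx_algebra B" and h: "hcond B (ix M Ys) (xg M Ys)" and hom: "!!j. j < length Ys ==> at_pos Ys j \<in> alg_homs V B"
  and xs: "xs \<in> pure_lists Ys"
 shows "foldr (\<lambda>i t. at_pos Ys i (xs ! i) \<otimes>\<^bsub>B\<^esub> t) [0..<length Ys] \<one>\<^bsub>B\<^esub> = pprod B (xg M Ys) M xs"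
 unfolding pprod_foldr pure_length[OF xs]
proof (rule foldr_cong)
 fix j t assume "j \<in> set [0..<length Ys]"
 then have j: "j < length Ys" by simp
 then have "xs ! j \<in> carrier V" using pure_nth[OF xs j] by (simp add: alt_nth[OF alt])
 then have "at_pos Ys j (xs ! j) = ev B (at_pos Ys j (X 1)) (xs ! j)" by (rule ev_unique[OF hom[OF j] B])
 then show "at_pos Ys j (xs ! j) \<otimes>\<^bsub>B\<^esub> t = ev B (xg M Ys (Suc (M + j))) (xs ! j) \<otimes>\<^bsub>B\<^esub> t" by simp
qed simp_all

lemma BA_braided: "is_braided_mult H Ys (bm M Ys)"
proof -
 note hom = at_pos_hom[OF alt]
 have cl: "at_pos Ys i f \<in> carrier (mtensor Ys)" if "i < length Ys" "f \<in> carrier V" for i f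
  using hom_closed[OF hom[OF that(1)] that(2)] by simp
 show ?thesis
  unfolding is_braided_mult_def Let_def
 proof (intro conjI allI impI ballI)
  show "cx_algebra (BA M Ys)" by (rule BA_alg[OF alt])
  show "at_pos Ys i \<in> alg_homs (Ys ! i) (BA M Ys)" if "i < length Ys" for i
   using hom[OF that] by (simp add: alt_nth[OF alt that])
  show "foldr (\<lambda>i t. at_pos Ys i (xs ! i) \<otimes>\<^bsub>BA M Ys\<^esub> t) [0..<length Ys] \<one>\<^bsub>BA M Ys\<^esub> = mtens Ys xs" if xs: "xs \<in> pure_lists Ys" for xs
   by (rule trans[OF foldr_at_pos[OF BA_alg[OF alt] BA_hcond[OF alt] hom xs]
      trans[OF phi(2)[OF alt BA_alg[OF alt] BA_hcond[OF alt] xs, symmetric] phi_id[OF alt L.mtens_closed[OF xs]]]])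
  show "at_pos Ys i x \<otimes>\<^bsub>BA M Ys\<^esub> at_pos Ys j y =
     sweedler (BA M Ys) (\<lambda>h x0. at_pos Ys j (act (Ys ! j) h y) \<otimes>\<^bsub>BA M Ys\<^esub> at_pos Ys i x0) (coact (Ys ! i) x)"
   if "i < length Ys" "j < i" "x \<in> carrier (Ys ! i)" "y \<in> carrier (Ys ! j)" for i j x y
  proof -
   have j: "j < length Ys" using that by simp
   show ?thesis unfolding alt_nth[OF alt j] alt_nth[OF alt that(1)]
    by (rule braid_rel[OF BA_alg[OF alt] BA_hcond[OF alt], where i = "Suc (M + i)" and k = "Suc (M + j)"])
     (use that j hom in \<open>simp_all add: alt_nth[OF alt]\<close>)
  qed
 qed (auto simp: bm_def)
qed

text \<open>In any candidate the braiding of the generators yields all the relations, so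
  \<open>phi\<close> is a morphism into it. It is the identity on the underlying space, because in
  both algebras a pure tensor is the ordered product of its entries.\<close>

lemma braided_unique:
 assumes m: "is_braided_mult H Ys m"
 shows "m = bm M Ys"
proof -
 define A where "A = (mtensor Ys)\<lparr>mult := m\<rparr>"
 have A: "cx_algebra A" and hom: "!!i. i < length Ys ==> at_pos Ys i \<in> alg_homs V A"
  and fo: "!!xs. xs \<in> pure_lists Ys ==> foldr (\<lambda>i t. at_pos Ys i (xs ! i) \<otimes>\<^bsub>A\<^esub> t) [0..<length Ys] \<one>\<^bsub>A\<^esub> = mtens Ys xs"
  and br: "!!i j x y. i < length Ys ==> j < i ==> x \<in> carrier V ==> y \<in> carrier V ==>
   at_pos Ys i x \<otimes>\<^bsub>A\<^esub> at_pos Ys j y =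
   sweedler A (\<lambda>h x0. at_pos Ys j (act (Xf (Suc (M + j))) h y) \<otimes>\<^bsub>A\<^esub> at_pos Ys i x0) (coact (Xf (Suc (M + i))) x)"
  and un: "!!t u. t \<notin> carrier (mtensor Ys) \<or> u \<notin> carrier (mtensor Ys) ==> m t u = undefined"
  using m unfolding is_braided_mult_def Let_def A_def[symmetric]
  by (simp_all add: alt_nth[OF alt]) (simp add: A_def)
 interpret A: cx_algebra A by (rule A)
 interpret T: tensor_algs "H" V by (rule tensor_algsI[OF cx_algebra_Uq V_alg])
 have ixE: "\<exists>j<length Ys. i = Suc (M + j)" if "i \<in> ix M Ys" for i
  using that by (intro exI[of _ "i - Suc M"]) auto
 have xc: "at_pos Ys j f \<in> carrier A" if "j < length Ys" "f \<in> carrier V" for j f using hom_closed[OF hom[OF that(1)] that(2)] .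
 have h: "hcond A (ix M Ys) (xg M Ys)"
 proof (rule hcond_from_braid[OF A])
  fix i assume "i \<in> ix M Ys"
  then obtain j where j: "j < length Ys" "i = Suc (M + j)" using ixE by blast
  show "xg M Ys i \<in> carrier A" using j xc by simp
  have "at_pos Ys j (X 1) [^]\<^bsub>A\<^esub> p = at_pos Ys j (X 1 [^]\<^bsub>V\<^esub> p)"
   by (rule hom_pow[OF hom[OF j(1)] V_alg A X_closed(1), symmetric])
  also have "X 1 [^]\<^bsub>V\<^esub> p = \<zero>\<^bsub>V\<^esub>" by (rule hcondD(2)[OF hcond_V[of 0] singletonI])
  finally show "xg M Ys i [^]\<^bsub>A\<^esub> p = \<zero>\<^bsub>A\<^esub>"
   using lin_zero[OF hom_lin[OF hom[OF j(1)]] V.cvec_axioms A.cvec_axioms] j by simp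
 next
  fix i' k' assume "i' \<in> ix M Ys" "k' \<in> ix M Ys" and lt: "k' < i'"
  then obtain i k where i: "i < length Ys" "i' = Suc (M + i)" and k: "k < length Ys" "k' = Suc (M + k)" using ixE by blast
  have ki: "k < i" using lt i k by simp
  note hk = hom[OF k(1)] and hi = hom[OF i(1)]
  let ?f = "\<lambda>h x0. at_pos Ys k (act (Xf k') h (X 1)) \<otimes>\<^bsub>A\<^esub> at_pos Ys i x0"
  have al: "(\<lambda>h. act (Xf k') h (X 1)) \<in> lin_maps H V"
   using yd_data.act_lin'[OF Xf_data[of k'], of "X 1"] by (simp add: lin_maps_def)
  have bil: "bilin H V A ?f"
   by (intro bilinI lin_mapsI)
    (simp_all add: xc k(1) i(1) lin_add[OF al] lin_sm[OF al] hom_add[OF hk] hom_sm[OF hk] hom_add[OF hi] hom_sm[OF hi] A.l_distr A.r_distr)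
  note S = T.sweedler_lin[OF A.cvec_axioms bil]
  have one: "at_pos Ys i (X 0) = \<one>\<^bsub>A\<^esub>" "at_pos Ys k (X 0) = \<one>\<^bsub>A\<^esub>" using hom_one[OF hi] hom_one[OF hk] by (simp_all add: V_one)
  have X1: "X 1 \<otimes>\<^bsub>V\<^esub> X 0 = X 1" by (simp only: X_mult add_0_right)
  have m: "act (Xf k') (ug gE \<otimes>\<^bsub>H\<^esub> UJ) (X 1) = act (Xf k') (ug gE) (act (Xf k') UJ (X 1))"
   using yd_data.act_m[OF Xf_data[of k'], of "ug gE" UJ "X 1"] by simp
  have "at_pos Ys i (X 1) \<otimes>\<^bsub>A\<^esub> at_pos Ys k (X 1) = sweedler A ?f (coact (Xf i') (X 1))"
   unfolding i(2) k(2) by (rule br[OF i(1) ki]) simp_all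
  also have "... = at_pos Ys k (act (Xf k') UJ (X 1)) \<otimes>\<^bsub>A\<^esub> at_pos Ys i (X 1) \<oplus>\<^bsub>A\<^esub> at_pos Ys k (tw k' i' (X 1))"
   unfolding coact_X1
   by (simp add: lin_add[OF S(1)] lin_sm[OF S(1)] S(2) T.tens_closed tw_def m hom_sm[OF hk] one xc k(1) del: V_one)
  also have "act (Xf k') UJ (X 1) = cJ k' \<odot>\<^bsub>V\<^esub> X 1"
   using Xf_rules(1)[of "X 0" k'] by (simp only: X1 X_closed(1) Xf_one)
  also have "tw k' i' (X 1) = c2 k' i' \<odot>\<^bsub>V\<^esub> (X 1 \<otimes>\<^bsub>V\<^esub> X 1) \<oplus>\<^bsub>V\<^esub> c3 k' i' \<odot>\<^bsub>V\<^esub> X 0"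
   using Xf_rules(2)[of "X 0" k' i'] by (simp add: X1 Xf_one del: X_mult)
  finally show "xg M Ys i' \<otimes>\<^bsub>A\<^esub> xg M Ys k' = cJ k' \<odot>\<^bsub>A\<^esub> (xg M Ys k' \<otimes>\<^bsub>A\<^esub> xg M Ys i') \<oplus>\<^bsub>A\<^esub>
    (c2 k' i' \<odot>\<^bsub>A\<^esub> (xg M Ys k' \<otimes>\<^bsub>A\<^esub> xg M Ys k') \<oplus>\<^bsub>A\<^esub> c3 k' i' \<odot>\<^bsub>A\<^esub> \<one>\<^bsub>A\<^esub>)"
   using i k by (simp add: hom_add[OF hk] hom_sm[OF hk] hom_mult[OF hk] one xc)
 qed
 note F = phi_hom(1)[OF alt A h]
 let ?F = "phi A (xg M Ys) M Ys"
 have id: "?F t = t" if "t \<in> carrier (mtensor Ys)" for t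
 proof (rule L.mtens_ext[OF phi(1)[OF alt A h] _ A.cvec_axioms _ that])
  show "(\<lambda>t. t) \<in> lin_maps (mtensor Ys) A" by (rule lin_mapsI) (simp_all add: A_def)
  show "?F (mtens Ys xs) = mtens Ys xs" if "xs \<in> pure_lists Ys" for xs
   using phi(2)[OF alt A h that] foldr_at_pos[OF A h hom that] fo[OF that] by simp
 qed
 have "m t u = bm M Ys t u" for t u
 proof (cases "t \<in> carrier (mtensor Ys) \<and> u \<in> carrier (mtensor Ys)")
  case True
  then have c: "bm M Ys t u \<in> carrier (mtensor Ys)" using cx_algebra_def[of "BA M Ys"] BA_alg[OF alt] Lm_closed[OF alt] by (simp add: bm_def)
  have "?F (bm M Ys t u) = ?F t \<otimes>\<^bsub>A\<^esub> ?F u" using hom_mult[OF F, of t u] True by simp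
  then show ?thesis using True c by (simp add: id) (simp add: A_def)
 next
  case False
  then show ?thesis using un by (auto simp: bm_def)
 qed
 then show ?thesis by blast
qed

lemma braided_mult_eq: "braided_mult H Ys = bm M Ys"
 unfolding braided_mult_def using BA_braided braided_unique by blast

end

end


section \<open>The codiagonal coaction as an algebra morphism\<close>

context uq
begin

lemma hom_coact_gen:
 assumes h: "h \<in> alg_homs B C" and B: "cx_algebra B" and C: "cx_algebra C" and u: "ucond B u" and y: "y i \<in> carrier B"
 shows "h (coact_gen B u y i) = coact_gen C (\<lambda>a. h (u a)) (\<lambda>i. h (y i)) i"
proof -
 interpret B: cx_algebra B by fact
 note U = ucondD(1,2)[OF B u]
 show ?thesis using y U
  by (simp add: coact_gen_def twist_def hom_add[OF h] hom_mult[OF h] hom_sm[OF h] kinv_hom[OF h B C U(1)])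
qed

text \<open>The map id \<otimes> h, along which coactions are compared.\<close>

definition idt :: "(complex, 'b, 'm) module_scheme => ('a => 'b) => (uel \<times> 'a \<Rightarrow>\<^sub>0 complex) set => (uel \<times> 'b \<Rightarrow>\<^sub>0 complex) set" where
 "idt B h = sweedler (tensor H B) (\<lambda>u a. tens H B u (h a))"

lemma idt:
 assumes A: "cx_algebra A" and B: "cx_algebra B" and h: "h \<in> alg_homs A B"
 shows "idt B h \<in> alg_homs (tensor H A) (tensor H B)"
  and "u \<in> carrier H ==> a \<in> carrier A ==> idt B h (tens H A u a) = tens H B u (h a)"
  and "y i \<in> carrier A ==> idt B h (coact_gen (tensor H A) (\<lambda>a. tens H A (ug a) \<one>\<^bsub>A\<^esub>) (\<lambda>i. tens H A \<one>\<^bsub>H\<^esub> (y i)) i) =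
   coact_gen (tensor H B) (\<lambda>a. tens H B (ug a) \<one>\<^bsub>B\<^esub>) (\<lambda>i. tens H B \<one>\<^bsub>H\<^esub> (h (y i))) i"
proof -
 interpret A: tensor_algs "H" A by (rule tensor_algsI[OF cx_algebra_Uq A])
 interpret B: tensor_algs "H" B by (rule tensor_algsI[OF cx_algebra_Uq B])
 have bil: "bilin H A (tensor H B) (\<lambda>u a. tens H B u (h a))"
  by (intro bilinI lin_mapsI)
   (simp_all add: hom_closed[OF h] B.tens_closed B.tens_add_left B.tens_add_right B.tens_sm_left B.tens_sm_right hom_add[OF h] hom_sm[OF h])
 note S = A.sweedler_lin[OF B.T.cvec_Q bil, folded idt_def]
 show v: "idt B h (tens H A u a) = tens H B u (h a)" if "u \<in> carrier H" "a \<in> carrier A" for u a by (rule S(2)[OF that])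
 show hm: "idt B h \<in> alg_homs (tensor H A) (tensor H B)"
  by (rule A.tensor_homI[OF S(1) B.cx_algebra_tensor])
   (simp_all add: v hom_one[OF h] hom_mult[OF h] hom_closed[OF h] B.tens_mult B.one_tens)
 show "idt B h (coact_gen (tensor H A) (\<lambda>a. tens H A (ug a) \<one>\<^bsub>A\<^esub>) (\<lambda>i. tens H A \<one>\<^bsub>H\<^esub> (y i)) i) =
   coact_gen (tensor H B) (\<lambda>a. tens H B (ug a) \<one>\<^bsub>B\<^esub>) (\<lambda>i. tens H B \<one>\<^bsub>H\<^esub> (h (y i))) i"
  if "y i \<in> carrier A"
  using that hom_coact_gen[OF hm A.cx_algebra_tensor B.cx_algebra_tensor tensor_left_ucond(1)[OF A], of "\<lambda>i. tens H A \<one>\<^bsub>H\<^esub> (y i)" i]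
  by (simp add: A.tens_closed v hom_one[OF h] coact_gen_def)
qed

abbreviation cgen where
 "cgen A x \<equiv> coact_gen (tensor H A) (\<lambda>a. tens H A (ug a) \<one>\<^bsub>A\<^esub>) (\<lambda>i. tens H A \<one>\<^bsub>H\<^esub> (x i))"

text \<open>The coaction introduced as the morphism with prescribed values on generators;
  \<open>codiag_del\<close> identifies it with the codiagonal one.\<close>

definition del where "del M Ys = phi (tensor H (BA M Ys)) (cgen (BA M Ys) (xg M Ys)) M Ys"

lemma del:
 assumes a: "alt M Ys"
 shows "del M Ys \<in> alg_homs (BA M Ys) (tensor H (BA M Ys))"
  and "i \<in> ix M Ys ==> del M Ys (xg M Ys i) = cgen (BA M Ys) (xg M Ys) i"
proof -
 interpret T: tensor_algs "H" "BA M Ys" by (rule tensor_algsI[OF cx_algebra_Uq BA_alg[OF a]])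
 note F = phi_hom[OF a T.cx_algebra_tensor hcond_tensor[OF BA_alg[OF a] BA_hcond[OF a]], folded del_def]
 show "del M Ys \<in> alg_homs (BA M Ys) (tensor H (BA M Ys))" by (rule F(1))
 show "i \<in> ix M Ys ==> del M Ys (xg M Ys i) = cgen (BA M Ys) (xg M Ys) i" by (rule F(2))
qed

lemma opy_mcons_one:
 assumes a: "alt M (Y # Ys)" and i: "i \<in> ix (Suc M) Ys" and t: "t \<in> carrier (mtensor Ys)"
 shows "opy M (Y # Ys) i (mcons Y Ys (X 0) t) = mcons Y Ys (X 0) (opy (Suc M) Ys i t)"
proof -
 have Y: "Y = Xf (Suc M)" and a': "alt (Suc M) Ys" using a by simp_all
 interpret Y: cvec Y unfolding Y by (rule Xf_cvec)
 interpret L: mspace Ys by (rule alt_mspace[OF a'])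
 interpret S: mcons_space Y Ys by unfold_locales
 have "mcons Y Ys \<zero>\<^bsub>V\<^esub> t = \<zero>\<^bsub>mtensor (Y # Ys)\<^esub>"
  using lin_zero[OF bilinD(1)[OF S.mcons_bilin t] Y.cvec_axioms S.Z.M.cvec_Q] by (simp add: Y)
 moreover have "mcons Y Ys (X 0) (opy (Suc M) Ys i t) \<in> carrier (mtensor (Y # Ys))"
  using S.\<tau>_simps(1)[of "X 0"] opy_closed[OF a' i t] by (simp add: Y)
 ultimately show ?thesis using S.Z.M.Q.r_zero by (simp only: opy_mcons(2)[OF a X_closed(1) t i] Xf_one)
qed

lemma BA_mod: "same_mod (BA M Ys) (mtensor Ys)" by (simp add: same_mod_def)

lemma BA_tensor_cong:
 "sweedler (tensor H (mtensor Ys)) = sweedler (tensor H (BA M Ys))"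
 "tens H (mtensor Ys) = tens H (BA M Ys)"
 by (rule sweedler_cong_mod, rule tensor_cong_mod; simp add: same_mod_def) (rule tens_cong; simp add: same_mod_def)

text \<open>\<open>x \<otimes> t\<close> is the product of \<open>x \<otimes> 1\<close> and \<open>1 \<otimes> t\<close>; both embeddings commute with the coactions, since
 they do so on generators.\<close>

lemma codiag_pure:
 "alt M Ys ==> xs \<in> pure_lists Ys ==> codiag_coact_pure H Ys xs = del M Ys (mtens Ys xs)"
proof (induction M Ys arbitrary: xs rule: alt.induct)
 case (1 M)
 interpret T: tensor_algs "H" "BA M []" by (rule tensor_algsI[OF cx_algebra_Uq BA_alg[OF 1(1)]])
 have d: "del M [] (ones []) = tens H (BA M []) \<one>\<^bsub>H\<^esub> (ones [])"
  using hom_one[OF del(1)[OF 1(1)]] unfolding T.one_tens BA_one[OF 1(1)] .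
 have "tens H (BA M []) = tens H (mtensor ([] :: xyd list))" by (rule tens_cong[OF _ BA_mod]) (simp add: same_mod_def)
 then show ?case using 1(2) d by simp
next
 case (2 M Y Ys)
 note a = 2(2)
 have a': "alt (Suc M) Ys" and Y: "Y = Xf (Suc M)" using a by simp_all
 interpret Y: cvec Y unfolding Y by (rule Xf_cvec)
 interpret L: mspace Ys by (rule alt_mspace[OF a'])
 interpret S: mcons_space Y Ys by unfold_locales
 let ?A = "BA M (Y # Ys)" and ?A' = "BA (Suc M) Ys"
 interpret A: cx_algebra ?A by (rule BA_alg[OF a])
 interpret A': cx_algebra ?A' by (rule BA_alg[OF a'])
 interpret T: tensor_algs "H" ?A by unfold_locales
 interpret T': tensor_algs "H" ?A' by unfold_locales
 interpret TV: tensor_algs "H" V by unfold_locales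
 let ?j = "mcons Y Ys (X 0)"
 have X0: "X 0 \<in> carrier Y" by (simp add: Y)
 have at: "at_pos (Y # Ys) 0 f = mcons Y Ys f (ones Ys)" if "f \<in> carrier V" for f
  using S.mcons_lin(2)[of f "map one Ys"] alt_ones[OF a'] that by (simp add: at_pos_def Y)
 have ath: "at_pos (Y # Ys) 0 \<in> alg_homs V ?A" by (rule at_pos_hom[OF a]) simp
 have mc: "mcons Y Ys f t \<in> carrier (mtensor (Y # Ys))" if "f \<in> carrier V" "t \<in> carrier (mtensor Ys)" for f t
  using S.\<tau>_simps(1)[of f t] that by (simp add: Y)
 have jl: "?j \<in> lin_maps (mtensor Ys) ?A" using S.mcons_lin(1)[OF X0] by (simp add: lin_maps_def)
 have j1: "?j (ones Ys) = \<one>\<^bsub>?A\<^esub>" using at[OF X_closed(1), of 0] hom_one[OF ath] by (simp only: V_one)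
 have iX: "i \<in> ix M (Y # Ys)" if "i \<in> ix (Suc M) Ys" for i using that by simp
 have jy: "?j (opy (Suc M) Ys i t) = xg M (Y # Ys) i \<otimes>\<^bsub>?A\<^esub> ?j t" if "i \<in> ix (Suc M) Ys" "t \<in> carrier (mtensor Ys)" for i t
  by (simp only: xg_mult[OF a iX[OF that(1)] mc[OF X_closed(1) that(2)]] opy_mcons_one[OF a that])
 note J = hom_from_lin[OF a' jl A.cx_algebra_axioms _ j1 jy]
 have xc: "xg M (Y # Ys) i \<in> carrier ?A" if "i \<in> ix M (Y # Ys)" for i using xg_closed[OF a that] by simp
 have jh: "?j \<in> alg_homs ?A' ?A" by (rule J(1)) (rule xc[OF iX])
 have jx: "?j (xg (Suc M) Ys i) = xg M (Y # Ys) i" if "i \<in> ix (Suc M) Ys" for i by (rule J(2)[OF _ _ _ that]) (rule xc[OF iX])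
 \<comment> \<open>Both sides are linear in \<open>f\<close> and obey the same recursion when the
   generator of the first factor is multiplied on the left.\<close>
 have prod: "mcons Y Ys f t = at_pos (Y # Ys) 0 f \<otimes>\<^bsub>?A\<^esub> ?j t" if f: "f \<in> carrier V" and t: "t \<in> carrier (mtensor Ys)" for f t
 proof (rule V_lin_ext[OF _ _ A.cvec_axioms _ f])
  show "(\<lambda>f. mcons Y Ys f t) \<in> lin_maps V ?A" using bilinD(1)[OF S.mcons_bilin t] unfolding Y by (simp add: lin_maps_def)
  show "(\<lambda>f. at_pos (Y # Ys) 0 f \<otimes>\<^bsub>?A\<^esub> ?j t) \<in> lin_maps V ?A"
   by (rule lin_comp[OF hom_lin[OF ath]], rule lin_mapsI) (use mc[OF X_closed(1) t] A.m_closed A.l_distr A.smult_mult_left in simp_all)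
  show "mcons Y Ys (X n) t = at_pos (Y # Ys) 0 (X n) \<otimes>\<^bsub>?A\<^esub> ?j t" for n
  proof (induction n)
   case 0
   have "at_pos (Y # Ys) 0 (X 0) = \<one>\<^bsub>?A\<^esub>" using hom_one[OF ath] by (simp only: V_one)
   then show ?case using A.l_one mc[OF X_closed(1) t] by simp
  next
   case (Suc n)
   have M: "Suc M \<in> ix M (Y # Ys)" by simp
   have c: "at_pos (Y # Ys) 0 (X n) \<in> carrier ?A" for n by (rule hom_closed[OF ath X_closed(1)])
   have S: "X (Suc n) = X 1 \<otimes>\<^bsub>V\<^esub> X n" by (simp add: X_mult plus_1_eq_Suc)
   have "mcons Y Ys (X (Suc n)) t = xg M (Y # Ys) (Suc M) \<otimes>\<^bsub>?A\<^esub> mcons Y Ys (X n) t"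
    unfolding xg_mult[OF a M mc[OF X_closed(1) t]] opy_mcons(1)[OF a X_closed(1) t] S ..
   also have "... = at_pos (Y # Ys) 0 (X 1) \<otimes>\<^bsub>?A\<^esub> (at_pos (Y # Ys) 0 (X n) \<otimes>\<^bsub>?A\<^esub> ?j t)" by (simp only: Suc diff_self_eq_0)
   also have "... = at_pos (Y # Ys) 0 (X (Suc n)) \<otimes>\<^bsub>?A\<^esub> ?j t"
    using A.m_assoc[OF c c, of "?j t" 1 n] mc[OF X_closed(1) t] unfolding S hom_mult[OF ath X_closed(1) X_closed(1)] by simp
   finally show ?case .
  qed
 qed
 note D = del[OF a] and D' = del[OF a']
 note ia = idt[OF V_alg A.cx_algebra_axioms ath] and ij = idt[OF A'.cx_algebra_axioms A.cx_algebra_axioms jh]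
 have TA: "cx_algebra (tensor H ?A)" by (rule T.cx_algebra_tensor)
 have co: "coact (Xf (Suc M)) (X 1) = cgen V (\<lambda>_. X 1) (Suc M)"
  using yd_data.coact_x[OF Xf_data[of "Suc M"], of "Suc M"] by (simp add: Xf_tensor)
 have M: "Suc M \<in> ix M (Y # Ys)" by simp
 have d1: "del M (Y # Ys) (at_pos (Y # Ys) 0 f) = idt ?A (at_pos (Y # Ys) 0) (coact (Xf (Suc M)) f)" if f: "f \<in> carrier V" for f
 proof -
  note h1 = hom_comp[OF ath D(1)] and h2 = hom_comp[OF coact_Xf_hom[of "Suc M"] ia(1)]
  have "del M (Y # Ys) (at_pos (Y # Ys) 0 (X 1)) = idt ?A (at_pos (Y # Ys) 0) (coact (Xf (Suc M)) (X 1))"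
   using D(2)[OF M] ia(3)[of "\<lambda>_. X 1" "Suc M", OF X_closed(1)] unfolding co by (simp add: coact_gen_def)
  then show ?thesis using ev_unique[OF h1 TA f] ev_unique[OF h2 TA f] by simp
 qed
 have d2: "del M (Y # Ys) (?j t) = idt ?A ?j (del (Suc M) Ys t)" if t: "t \<in> carrier (mtensor Ys)" for t
 proof (rule generated_hom_ext[OF generated_BA[OF a'] A'.cx_algebra_axioms TA hom_comp[OF jh D(1)] hom_comp[OF D'(1) ij(1)]])
  fix i assume i: "i \<in> ix (Suc M) Ys"
  have "xg (Suc M) Ys i \<in> carrier ?A'" using xg_closed[OF a' i] by simp
  then have "idt ?A ?j (del (Suc M) Ys (xg (Suc M) Ys i)) = cgen ?A (\<lambda>i. ?j (xg (Suc M) Ys i)) i"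
   unfolding D'(2)[OF i] by (rule ij(3))
  also have "... = cgen ?A (xg M (Y # Ys)) i" unfolding coact_gen_def jx[OF i] ..
  also have "... = del M (Y # Ys) (?j (xg (Suc M) Ys i))" unfolding jx[OF i] D(2)[OF iX[OF i]] ..
  finally show "del M (Y # Ys) (?j (xg (Suc M) Ys i)) = idt ?A ?j (del (Suc M) Ys (xg (Suc M) Ys i))" ..
 qed (use t in simp)
 obtain f zs where x: "xs = f # zs" "f \<in> carrier V" "zs \<in> pure_lists Ys" using 2(3) unfolding pure_Cons by (auto simp: Y)
 define c where "c = coact Y f"
 define d where "d = del (Suc M) Ys (mtens Ys zs)"
 have c': "c = coact (Xf (Suc M)) f" unfolding c_def Y ..
 have c: "c \<in> carrier (tensor H V)" unfolding c_def Y by (rule hom_closed[OF coact_Xf_hom x(2)])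
 have d: "d \<in> carrier (tensor H ?A')" unfolding d_def using x(3) by (intro hom_closed[OF D'(1)]) simp
 note cong = BA_tensor_cong[of "Y # Ys" M]
 \<comment> \<open>The inner Sweedler sum is left multiplication by u \<otimes> x0 in the tensor
   product with \<open>?A\<close>. Summing over the coaction of the head then gives the product of
   the two embedded coactions.\<close>
 have s1: "sweedler (tensor H ?A) (\<lambda>b t. tens H ?A (u \<otimes>\<^bsub>H\<^esub> b) (mcons Y Ys x0 t)) d
   = tens H ?A u (at_pos (Y # Ys) 0 x0) \<otimes>\<^bsub>tensor H ?A\<^esub> idt ?A ?j d"
  if u: "u \<in> carrier H" and x0: "x0 \<in> carrier V" for u x0
 proof (rule T'.sweedler_eq[OF lin_comp[OF hom_lin[OF ij(1)]] T.T.cvec_Q _ d])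
  have tc: "tens H ?A u (at_pos (Y # Ys) 0 x0) \<in> carrier (tensor H ?A)"
   by (rule T.tens_closed[OF u hom_closed[OF ath x0]])
  show "(\<lambda>t. tens H ?A u (at_pos (Y # Ys) 0 x0) \<otimes>\<^bsub>tensor H ?A\<^esub> t) \<in> lin_maps (tensor H ?A) (tensor H ?A)"
   by (rule lin_mapsI) (simp_all only: T.TA.m_closed T.TA.r_distr T.TA.smult_mult_right tc)
  fix b t assume b: "b \<in> carrier H" and t: "t \<in> carrier ?A'"
  then have t': "t \<in> carrier (mtensor Ys)" by simp
  show "tens H ?A u (at_pos (Y # Ys) 0 x0) \<otimes>\<^bsub>tensor H ?A\<^esub> idt ?A ?j (tens H ?A' b t) = tens H ?A (u \<otimes>\<^bsub>H\<^esub> b) (mcons Y Ys x0 t)"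
   unfolding ij(2)[OF b t] prod[OF x0 t'] by (rule T.tens_mult[OF u hom_closed[OF ath x0] b hom_closed[OF jh t]])
 qed
 have dc: "idt ?A ?j d \<in> carrier (tensor H ?A)" by (rule hom_closed[OF ij(1) d])
 have "sweedler (tensor H ?A) (\<lambda>u x0. sweedler (tensor H ?A) (\<lambda>b t. tens H ?A (u \<otimes>\<^bsub>H\<^esub> b) (mcons Y Ys x0 t)) d) c
   = idt ?A (at_pos (Y # Ys) 0) c \<otimes>\<^bsub>tensor H ?A\<^esub> idt ?A ?j d"
 proof (rule TV.sweedler_eq[OF lin_comp[OF hom_lin[OF ia(1)]] T.T.cvec_Q _ c])
  show "(\<lambda>t. t \<otimes>\<^bsub>tensor H ?A\<^esub> idt ?A ?j d) \<in> lin_maps (tensor H ?A) (tensor H ?A)"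
   by (rule lin_mapsI) (simp_all only: T.TA.m_closed T.TA.l_distr T.TA.smult_mult_left dc)
 qed (simp only: s1 ia(2))
 also have "... = del M (Y # Ys) (at_pos (Y # Ys) 0 f) \<otimes>\<^bsub>tensor H ?A\<^esub> del M (Y # Ys) (?j (mtens Ys zs))"
  unfolding d1[OF x(2)] d2[OF L.mtens_closed[OF x(3)]] c' d_def ..
 also have "... = del M (Y # Ys) (mcons Y Ys f (mtens Ys zs))"
  unfolding prod[OF x(2) L.mtens_closed[OF x(3)]]
  by (rule hom_mult[OF D(1) hom_closed[OF ath x(2)] hom_closed[OF jh], symmetric]) (simp add: x(3))
 also have "mcons Y Ys f (mtens Ys zs) = mtens (Y # Ys) xs" unfolding x(1) by (rule S.mcons_lin(2)) (use x in \<open>simp_all add: Y\<close>)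
 finally show ?case unfolding x(1) codiag_coact_pure.simps cong 2(1)[OF a' x(3)] c_def d_def .
qed

lemma codiag_del:
 assumes a: "alt M Ys" and t: "t \<in> carrier (mtensor Ys)"
 shows "codiag_coact H Ys t = del M Ys t"
proof -
 interpret L: mspace Ys by (rule alt_mspace[OF a])
 interpret T: tensor_algs "H" "BA M Ys" by (rule tensor_algsI[OF cx_algebra_Uq BA_alg[OF a]])
 have "lin_ext (tensor H (mtensor Ys)) (codiag_coact_pure H Ys) (rep t) = lin_ext (tensor H (BA M Ys)) (codiag_coact_pure H Ys) (rep t)"
  by (subst lin_ext_cong_mod[OF tensor_cong_mod[of "H" "H" "mtensor Ys" "BA M Ys"]]) (simp_all add: same_mod_def)
 moreover have "lin_ext (tensor H (BA M Ys)) (codiag_coact_pure H Ys) (rep t) = del M Ys t"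
  by (rule L.mlin_eq[OF _ T.T.cvec_Q _ t]) (use hom_lin[OF del(1)[OF a]] codiag_pure[OF a] in \<open>simp_all add: BA_simps[OF a]\<close>)
 ultimately show ?thesis by (simp add: codiag_coact_def)
qed


section \<open>The products as Yetter-Drinfeld module algebras and the embeddings between
  them\<close>

lemma scond_cong: "(!!i. i \<in> I ==> y i = y' i) ==> scond B I y u ==> scond B I y' u"
 unfolding scond_def hcond_def by (simp cong: ball_cong if_cong)

text \<open>The relations of \<open>alt_ops\<close> become the criterion as soon as the operators
  are recognised as left multiplications by the generators, and the codiagonal coaction as the
  morphism \<open>del\<close>.\<close>

lemma product_yd_data:
 assumes a: "alt M Ys"
 shows "yd_data p q s g (braided_product H Ys) (ix M Ys) (xg M Ys)"
  and "presented_by (braided_product H Ys) (ix M Ys) (xg M Ys) (HH_relators p (ix M Ys))"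
  and "same_alg (braided_product H Ys) (BA M Ys)"
proof -
 let ?Z = "braided_product H Ys" and ?W = "mtensor Ys"
 interpret L: mspace Ys by (rule alt_mspace[OF a])
 have Z: "?Z = mk_yd (BA M Ys) (diag_act H Ys) (codiag_coact H Ys)"
  by (simp add: braided_product_def braided_mult_eq[OF a])
 show same: "same_alg ?Z (BA M Ys)" by (simp add: Z mk_yd_def same_alg_def same_mod_def)
 show "presented_by ?Z (ix M Ys) (xg M Ys) (HH_relators p (ix M Ys))"
  by (rule iffD2[OF presented_cong[OF same] presented_BA[OF a]])
 have zs: "carrier ?Z = carrier ?W" "add ?Z = add ?W" "smult ?Z = smult ?W" "zero ?Z = zero ?W" "mult ?Z = bm M Ys" "one ?Z = one ?W"
  using same by (simp_all add: same_alg_def same_mod_def)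
 have ac: "act ?Z = diag_act H Ys" "coact ?Z = codiag_coact H Ys" by (simp_all add: Z mk_yd_def)
 have lm: "lin_maps ?Z ?Z = lin_maps ?W ?W" "lin_maps H ?Z = lin_maps H ?W" by (simp_all add: lin_maps_def zs)
 have ez: "End ?Z = End ?W" by (simp add: End_def lm zs)
 have tz: "tensor H ?Z = tensor H (BA M Ys)" "tens H ?Z = tens H (BA M Ys)"
  using tensor_cong[OF _ same, of "H" "H"] tens_cong[OF _ same_alg_mod[OF same], of "H" "H"] by (simp_all add: same_alg_def same_mod_def)
 note dh = alt_ops[OF a, THEN conjunct1]
 have de: "diag_act H Ys h t = diag Ys h t" if "t \<in> carrier ?W" for h t using that by (simp add: diag_def)
 note dl = end_lin[OF hom_closed[OF dh]]
 show "yd_data p q s g ?Z (ix M Ys) (xg M Ys)"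
 proof (rule yd_data.intro[OF uq_axioms cx_algebra_cong[OF same BA_alg[OF a]] yd_data_axioms.intro])
  show "generated_by ?Z (ix M Ys) (xg M Ys)" by (rule iffD2[OF generated_cong[OF same] generated_BA[OF a]])
  show "act ?Z h \<in> lin_maps ?Z ?Z" if "h \<in> carrier H" for h
   unfolding ac lm by (rule lin_cong[OF dl[OF that] L.M.cvec_Q]) (simp add: de)
  show "(\<lambda>h. act ?Z h y) \<in> lin_maps H ?Z" if "y \<in> carrier ?Z" for y
   using lin_comp[OF hom_lin[OF dh] end_eval_lin, of y] that unfolding ac lm by (simp add: zs de)
  show "act ?Z \<one>\<^bsub>H\<^esub> y = y" if "y \<in> carrier ?Z" for y
   using that hom_one[OF dh] by (simp add: zs ac de end_simps)
  show "act ?Z (h \<otimes>\<^bsub>H\<^esub> h') y = act ?Z h (act ?Z h' y)" if "h \<in> carrier H" "h' \<in> carrier H" "y \<in> carrier ?Z" for h h' y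
   using that lin_closed[OF dl, of h' y] by (simp add: zs ac de hom_mult[OF dh] end_simps)
  show "scond (End ?Z) (ix M Ys) (\<lambda>i. lmul ?Z (xg M Ys i)) (\<lambda>b. restrict (act ?Z (ug b)) (carrier ?Z))"
  proof (rule scond_cong)
   show "scond (End ?Z) (ix M Ys) (opy M Ys) (\<lambda>b. restrict (act ?Z (ug b)) (carrier ?Z))"
    using alt_scond[OF a] unfolding ez ac zs diag_def .
   fix i assume i: "i \<in> ix M Ys"
   have "opy M Ys i \<in> extensional (carrier ?W)" using opy_end[OF a i] by (simp add: end_carrier)
   then show "opy M Ys i = lmul ?Z (xg M Ys i)"
    by (rule extensionalityI) (use xg_mult[OF a i] in \<open>simp_all add: lmul_def zs\<close>)
  qed
  show "act ?Z (ug b) \<one>\<^bsub>?Z\<^esub> = counit H (ug b) \<odot>\<^bsub>?Z\<^esub> \<one>\<^bsub>?Z\<^esub>" for b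
   using alt_ops[OF a] ones_closed[OF a] by (simp add: zs ac de L.one_mtensor)
  have "codiag_coact H Ys \<in> alg_homs (BA M Ys) (tensor H (BA M Ys))"
   by (rule hom_cong[OF del(1)[OF a] BA_alg[OF a]]) (simp add: codiag_del[OF a])
  then show "coact ?Z \<in> alg_homs ?Z (tensor H ?Z)"
   unfolding ac tz by (subst alg_homs_cong[OF same]) (simp_all add: same_alg_def same_mod_def)
  show "coact ?Z (xg M Ys i) = coact_gen (tensor H ?Z) (\<lambda>b. tens H ?Z (ug b) \<one>\<^bsub>?Z\<^esub>) (\<lambda>i. tens H ?Z \<one>\<^bsub>H\<^esub> (xg M Ys i)) i"
   if "i \<in> ix M Ys" for i
   using del(2)[OF a that] codiag_del[OF a xg_closed[OF a that]] by (simp add: ac tz zs)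
 qed
qed

lemma alt_factors: "alt M (factors p M N)"
proof (induction "N - M" arbitrary: M)
 case (Suc k)
 then have "M < N" by simp
 then have "factors p M N = Xf (Suc M) # factors p (Suc M) N" by (simp add: factors_def upt_conv_Cons Xf_def del: upt_Suc)
 then show ?case using Suc by simp
qed (simp add: factors_def)

lemma alt_append: "alt M (Xs @ Ys) ==> alt M Xs"
 by (induction M Xs rule: alt.induct) simp_all

lemma pprod_append_ones:
 assumes "alt (M + length xs) Ys" "cx_algebra B" "hcond B (ix M (Xs @ Ys)) b" "length xs = length Xs"
 shows "pprod B b M (xs @ map one Ys) = pprod B b M xs"
 using assms
proof (induction xs arbitrary: M Xs)
 case Nil
 then show ?case using pprod_at(1)[OF _ _ _ X_closed(1), of M Ys B b] by simp
next
 case (Cons x xs)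
 then obtain Z Zs where Z: "Xs = Z # Zs" by (cases Xs) auto
 have "pprod B b (Suc M) (xs @ map one Ys) = pprod B b (Suc M) xs"
  using Cons(2-5) Z by (intro Cons(1)[of _ Zs] hcond_mono[OF Cons(4)]) auto
 then show ?case by simp
qed

text \<open>The embedding is \<open>phi\<close> for the first generators of the larger product,
  since appended units do not change an ordered product.\<close>

lemma unit_emb_hom:
 assumes a: "alt M (Xs @ Ys)" and b: "alt (M + length Xs) Ys"
 shows "unit_emb Xs Ys \<in> alg_homs (BA M Xs) (BA M (Xs @ Ys))"
  and "i \<in> ix M Xs ==> unit_emb Xs Ys (xg M Xs i) = xg M (Xs @ Ys) i"
proof -
 note aX = alt_append[OF a]
 interpret L: mspace Xs by (rule alt_mspace[OF aX])
 interpret L2: mspace "Xs @ Ys" by (rule alt_mspace[OF a])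
 let ?B = "BA M (Xs @ Ys)" and ?x = "xg M (Xs @ Ys)"
 have h: "hcond ?B (ix M Xs) ?x" by (rule hcond_mono[OF BA_hcond[OF a]]) auto
 note F = phi_hom[OF aX BA_alg[OF a] h] and P = phi[OF aX BA_alg[OF a] h]
 have e: "unit_emb Xs Ys t = phi ?B ?x M Xs t" if t: "t \<in> carrier (mtensor Xs)" for t
 proof -
  have "lin_ext (mtensor (Xs @ Ys)) (\<lambda>xs. mtens (Xs @ Ys) (xs @ map one Ys)) (rep t) = phi ?B ?x M Xs t"
  proof (rule L.mlin_eq[OF _ L2.M.cvec_Q _ t])
   show "phi ?B ?x M Xs \<in> lin_maps (mtensor Xs) (mtensor (Xs @ Ys))" using P(1) by (simp add: lin_maps_def)
   fix xs assume xs: "xs \<in> pure_lists Xs"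
   have c: "xs @ map one Ys \<in> pure_lists (Xs @ Ys)" by (rule pure_append[OF xs alt_ones[OF b]])
   have "phi ?B ?x M Xs (mtens Xs xs) = pprod ?B ?x M xs" by (rule P(2)[OF xs])
   also have "... = pprod ?B ?x M (xs @ map one Ys)"
    by (rule pprod_append_ones[OF _ BA_alg[OF a] BA_hcond[OF a], symmetric]) (simp_all add: pure_length[OF xs] b)
   also have "... = phi ?B ?x M (Xs @ Ys) (mtens (Xs @ Ys) (xs @ map one Ys))"
    by (rule phi(2)[OF a BA_alg[OF a] BA_hcond[OF a] c, symmetric])
   also have "... = mtens (Xs @ Ys) (xs @ map one Ys)" by (rule phi_id[OF a L2.mtens_closed[OF c]])
   finally show "phi ?B ?x M Xs (mtens Xs xs) = mtens (Xs @ Ys) (xs @ map one Ys)" .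
  qed
  then show ?thesis by (simp add: unit_emb_def)
 qed
 show "unit_emb Xs Ys \<in> alg_homs (BA M Xs) ?B" by (rule hom_cong[OF F(1) BA_alg[OF aX]]) (simp add: e)
 show "unit_emb Xs Ys (xg M Xs i) = ?x i" if "i \<in> ix M Xs" using e[OF xg_closed[OF aX that]] F(2)[OF that] by simp
qed

lemma factors_append:
 assumes "M \<le> K" "K \<le> N" shows "factors p M N = factors p M K @ factors p K N"
proof -
 have "[Suc M..<Suc N] = [Suc M..<Suc K] @ [Suc K..<Suc N]"
  using upt_add_eq_append[of "Suc M" "Suc K" "N - K"] assms by (simp del: upt_Suc)
 then show ?thesis by (simp add: factors_def del: upt_Suc)
qed

lemma factors_ix: "ix 0 (factors p 0 N) = {1..N}" by (auto simp: factors_def)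

lemma HH_gen_xg: "HH_gen p N = xg 0 (factors p 0 N)" by (simp add: HH_gen_def[abs_def] One_nat_def)

lemma HH_yd_data: "yd_data p q s g (HH p N) {1..N} (HH_gen p N)"
 and HH_presented: "presented_by (HH p N) {1..N} (HH_gen p N) (HH_relators p {1..N})"
 and HH_BA: "same_alg (HH p N) (BA 0 (factors p 0 N))"
 using product_yd_data[OF alt_factors[of 0 N]] unfolding factors_ix HH_def[symmetric] HH_gen_xg[symmetric] by simp_all

lemma HH_emb_hom:
 assumes "M \<le> N"
 shows "HH_emb p M N \<in> alg_homs (HH p M) (HH p N)" "i \<in> {1..M} ==> HH_emb p M N (HH_gen p M i) = HH_gen p N i"
proof -
 have f: "factors p 0 N = factors p 0 M @ factors p M N" by (rule factors_append) (use assms in simp_all)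
 have "length (factors p 0 M) = M" by (simp add: factors_def)
 then have "alt (0 + length (factors p 0 M)) (factors p M N)" by (simp only: add_0 alt_factors)
 note E = unit_emb_hom[OF alt_factors[of 0 N, unfolded f] this, folded f]
 show "HH_emb p M N \<in> alg_homs (HH p M) (HH p N)"
  using E(1) unfolding alg_homs_cong[OF HH_BA HH_BA] by (simp add: HH_emb_def)
 show "i \<in> {1..M} ==> HH_emb p M N (HH_gen p M i) = HH_gen p N i"
  unfolding HH_emb_def HH_gen_xg factors_ix[symmetric] by (rule E(2))
qed

end


section \<open>Inductive limits\<close>

text \<open>Indices run over a cofinal set, because the products with an even and those with an odd
  number of factors form two systems.\<close>

locale direct_system =
 fixes J :: "nat set" and A :: "nat => (complex, 'x, 'm) module_scheme" and \<phi> :: "nat => nat => 'x => 'x"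
 assumes cofinal: "\<exists>N\<in>J. n \<le> N"
  and alg: "N \<in> J ==> cx_algebra (A N)"
  and hom: "M \<in> J ==> N \<in> J ==> M \<le> N ==> \<phi> M N \<in> alg_homs (A M) (A N)"
  and ident: "N \<in> J ==> a \<in> carrier (A N) ==> \<phi> N N a = a"
  and trans: "M \<in> J ==> N \<in> J ==> K \<in> J ==> M \<le> N ==> N \<le> K ==> a \<in> carrier (A M) ==> \<phi> N K (\<phi> M N a) = \<phi> M K a"
begin

abbreviation "\<iota> \<equiv> lim_class J A \<phi>"
abbreviation "L \<equiv> lim_alg J A \<phi>"

lemma \<phi>_closed: "M \<in> J ==> N \<in> J ==> M \<le> N ==> a \<in> carrier (A M) ==> \<phi> M N a \<in> carrier (A N)"
 by (rule hom_closed[OF hom])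

lemma max_in: "M \<in> J ==> N \<in> J ==> max M N \<in> J" by (simp add: max_def)

lemma \<iota>_mem: "(N, b) \<in> \<iota> M a \<longleftrightarrow> N \<in> J \<and> b \<in> carrier (A N) \<and> (\<exists>K\<in>J. M \<le> K \<and> N \<le> K \<and> \<phi> M K a = \<phi> N K b)"
 by (simp add: lim_class_def)

lemma eq_up:
 assumes "M \<in> J" "N \<in> J" "a \<in> carrier (A M)" "b \<in> carrier (A N)" "K \<in> J" "M \<le> K" "N \<le> K" "\<phi> M K a = \<phi> N K b" "K' \<in> J" "K \<le> K'"
 shows "\<phi> M K' a = \<phi> N K' b"
 using trans[of M K K' a] trans[of N K K' b] assms by simp

text \<open>An index at which two images agree may be replaced by any later index in
  \<open>J\<close>, so two such indices are compared at their maximum.\<close>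

lemma \<iota>_eq_iff:
 assumes M: "M \<in> J" "a \<in> carrier (A M)" and N: "N \<in> J" "b \<in> carrier (A N)"
 shows "\<iota> M a = \<iota> N b \<longleftrightarrow> (\<exists>K\<in>J. M \<le> K \<and> N \<le> K \<and> \<phi> M K a = \<phi> N K b)"
proof
 assume "\<iota> M a = \<iota> N b"
 moreover have "(N, b) \<in> \<iota> N b" using N by (auto simp: \<iota>_mem)
 ultimately show "\<exists>K\<in>J. M \<le> K \<and> N \<le> K \<and> \<phi> M K a = \<phi> N K b" by (metis \<iota>_mem)
next
 assume "\<exists>K\<in>J. M \<le> K \<and> N \<le> K \<and> \<phi> M K a = \<phi> N K b"
 then obtain K where K: "K \<in> J" "M \<le> K" "N \<le> K" "\<phi> M K a = \<phi> N K b" by blast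
 have *: "(\<exists>Q\<in>J. M \<le> Q \<and> R \<le> Q \<and> \<phi> M Q a = \<phi> R Q c) \<longleftrightarrow> (\<exists>Q\<in>J. N \<le> Q \<and> R \<le> Q \<and> \<phi> N Q b = \<phi> R Q c)"
  if R: "R \<in> J" "c \<in> carrier (A R)" for R c
 proof (intro iffI; elim bexE conjE)
  fix Q assume "Q \<in> J" "M \<le> Q" "R \<le> Q" "\<phi> M Q a = \<phi> R Q c"
  then show "\<exists>Q\<in>J. N \<le> Q \<and> R \<le> Q \<and> \<phi> N Q b = \<phi> R Q c"
   using max_in[of Q K] K eq_up[of M N a b K "max Q K"] eq_up[of M R a c Q "max Q K"] M N R
   by (intro bexI[of _ "max Q K"]) auto
 next
  fix Q assume "Q \<in> J" "N \<le> Q" "R \<le> Q" "\<phi> N Q b = \<phi> R Q c"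
  then show "\<exists>Q\<in>J. M \<le> Q \<and> R \<le> Q \<and> \<phi> M Q a = \<phi> R Q c"
   using max_in[of Q K] K eq_up[of M N a b K "max Q K"] eq_up[of N R b c Q "max Q K"] M N R
   by (intro bexI[of _ "max Q K"]) auto
 qed
 have "(R, c) \<in> \<iota> M a \<longleftrightarrow> (R, c) \<in> \<iota> N b" for R c using *[of R c] unfolding \<iota>_mem by blast
 then show "\<iota> M a = \<iota> N b" by auto
qed

lemma \<iota>_\<phi>: "M \<in> J ==> N \<in> J ==> M \<le> N ==> a \<in> carrier (A M) ==> \<iota> N (\<phi> M N a) = \<iota> M a"
 by (subst \<iota>_eq_iff) (auto simp: \<phi>_closed trans intro!: bexI[of _ N])

lemma rep_\<iota>:
 assumes "M \<in> J" "a \<in> carrier (A M)"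
 obtains N b where "rep (\<iota> M a) = (N, b)" "N \<in> J" "b \<in> carrier (A N)" "\<iota> N b = \<iota> M a"
proof -
 obtain N b where r: "rep (\<iota> M a) = (N, b)" by (cases "rep (\<iota> M a)") auto
 have "(M, a) \<in> \<iota> M a" using assms by (auto simp: \<iota>_mem)
 then have "rep (\<iota> M a) \<in> \<iota> M a" unfolding rep_def by (rule someI[where P = "\<lambda>r. r \<in> \<iota> M a"])
 then have "(N, b) \<in> \<iota> M a" by (simp add: r)
 then have n: "N \<in> J" "b \<in> carrier (A N)" and "\<exists>K\<in>J. M \<le> K \<and> N \<le> K \<and> \<phi> M K a = \<phi> N K b" unfolding \<iota>_mem by blast+
 then have "\<iota> N b = \<iota> M a" using \<iota>_eq_iff[OF assms n] by simp
 with r n show ?thesis by (rule that)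
qed

lemma carrier_L: "T \<in> carrier L \<longleftrightarrow> (\<exists>N\<in>J. \<exists>a\<in>carrier (A N). T = \<iota> N a)"
 by (auto simp: lim_alg_def)

lemma \<iota>_closed: "N \<in> J ==> a \<in> carrier (A N) ==> \<iota> N a \<in> carrier L"
 unfolding carrier_L by blast

text \<open>The lower bound \<open>n\<close> allows several classes to be represented at one common
  level, which reduces each law in the limit to the same law in one algebra.\<close>

lemma level:
 assumes "T \<in> carrier L"
 obtains N a where "N \<in> J" "n \<le> N" "a \<in> carrier (A N)" "T = \<iota> N a"
proof -
 obtain M b where M: "M \<in> J" "b \<in> carrier (A M)" "T = \<iota> M b" using assms unfolding carrier_L by blast
 obtain N where N: "N \<in> J" "max n M \<le> N" using cofinal by blast
 then show ?thesis using M \<phi>_closed[of M N b] \<iota>_\<phi>[of M N b] by (intro that[of N "\<phi> M N b"]) auto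
qed

lemma level2:
 assumes "T \<in> carrier L" "U \<in> carrier L"
 obtains N a b where "N \<in> J" "n \<le> N" "a \<in> carrier (A N)" "T = \<iota> N a" "b \<in> carrier (A N)" "U = \<iota> N b"
proof -
 obtain M b where M: "M \<in> J" "n \<le> M" "b \<in> carrier (A M)" "U = \<iota> M b" by (rule level[OF assms(2)])
 obtain N a where N: "N \<in> J" "M \<le> N" "a \<in> carrier (A N)" "T = \<iota> N a" by (rule level[OF assms(1)])
 show ?thesis using M N \<phi>_closed[of M N b] \<iota>_\<phi>[of M N b] by (intro that[of N a "\<phi> M N b"]) auto
qed

lemma level3:
 assumes "T \<in> carrier L" "U \<in> carrier L" "R \<in> carrier L"
 obtains N a b c where "N \<in> J" "a \<in> carrier (A N)" "T = \<iota> N a" "b \<in> carrier (A N)" "U = \<iota> N b" "c \<in> carrier (A N)" "R = \<iota> N c"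
proof -
 obtain M b c where M: "M \<in> J" "b \<in> carrier (A M)" "U = \<iota> M b" "c \<in> carrier (A M)" "R = \<iota> M c" by (rule level2[OF assms(2,3)])
 obtain N a where N: "N \<in> J" "M \<le> N" "a \<in> carrier (A N)" "T = \<iota> N a" by (rule level[OF assms(1)])
 show ?thesis using M N \<phi>_closed[of M N b] \<iota>_\<phi>[of M N b] \<phi>_closed[of M N c] \<iota>_\<phi>[of M N c]
  by (intro that[of N a "\<phi> M N b" "\<phi> M N c"]) auto
qed

lemma op1:
 assumes f: "!!N a. N \<in> J ==> a \<in> carrier (A N) ==> f N a \<in> carrier (A N)"
  and c: "!!M N a. M \<in> J ==> N \<in> J ==> M \<le> N ==> a \<in> carrier (A M) ==> \<phi> M N (f M a) = f N (\<phi> M N a)"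
  and N: "N \<in> J" "a \<in> carrier (A N)"
 shows "lim_op1 J A \<phi> f (\<iota> N a) = \<iota> N (f N a)"
proof -
 obtain M b where r: "rep (\<iota> N a) = (M, b)" "M \<in> J" "b \<in> carrier (A M)" "\<iota> M b = \<iota> N a" by (rule rep_\<iota>[OF N])
 obtain K where K: "K \<in> J" "M \<le> K" "N \<le> K" "\<phi> M K b = \<phi> N K a" using r(4) \<iota>_eq_iff[OF r(2,3) N] by blast
 have "\<iota> M (f M b) = \<iota> N (f N a)" using K r N f by (subst \<iota>_eq_iff) (auto simp: c intro!: bexI[of _ K])
 then show ?thesis by (simp add: lim_op1_def r(1))
qed

lemma op2:
 assumes f: "!!N a b. N \<in> J ==> a \<in> carrier (A N) ==> b \<in> carrier (A N) ==> f N a b \<in> carrier (A N)"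
  and c: "!!M N a b. M \<in> J ==> N \<in> J ==> M \<le> N ==> a \<in> carrier (A M) ==> b \<in> carrier (A M) ==> \<phi> M N (f M a b) = f N (\<phi> M N a) (\<phi> M N b)"
  and N: "N \<in> J" "a \<in> carrier (A N)" "b \<in> carrier (A N)"
 shows "lim_op2 J A \<phi> f (\<iota> N a) (\<iota> N b) = \<iota> N (f N a b)"
proof -
 obtain M a' where r: "rep (\<iota> N a) = (M, a')" "M \<in> J" "a' \<in> carrier (A M)" "\<iota> M a' = \<iota> N a" by (rule rep_\<iota>[OF N(1,2)])
 obtain M' b' where r': "rep (\<iota> N b) = (M', b')" "M' \<in> J" "b' \<in> carrier (A M')" "\<iota> M' b' = \<iota> N b" by (rule rep_\<iota>[OF N(1,3)])
 define K where "K = max M M'"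
 have K: "K \<in> J" "M \<le> K" "M' \<le> K" using max_in r r' by (auto simp: K_def)
 have "\<iota> K (\<phi> M K a') = \<iota> N a" "\<iota> K (\<phi> M' K b') = \<iota> N b" using \<iota>_\<phi> r r' K by simp_all
 moreover have cl: "\<phi> M K a' \<in> carrier (A K)" "\<phi> M' K b' \<in> carrier (A K)" using \<phi>_closed r r' K by simp_all
 ultimately obtain Q Q' where Q: "Q \<in> J" "K \<le> Q" "N \<le> Q" "\<phi> K Q (\<phi> M K a') = \<phi> N Q a"
  "Q' \<in> J" "K \<le> Q'" "N \<le> Q'" "\<phi> K Q' (\<phi> M' K b') = \<phi> N Q' b"
  using \<iota>_eq_iff[OF K(1) _ N(1)] N(2,3) by metis
 define R where "R = max Q Q'"
 have R: "R \<in> J" "K \<le> R" "N \<le> R" using max_in Q by (auto simp: R_def)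
 have "\<phi> K R (\<phi> M K a') = \<phi> N R a" "\<phi> K R (\<phi> M' K b') = \<phi> N R b"
  using eq_up[OF K(1) N(1) cl(1) N(2) Q(1-4), of R] eq_up[OF K(1) N(1) cl(2) N(3) Q(5-8), of R] R by (simp_all add: R_def)
 then have "\<iota> K (f K (\<phi> M K a') (\<phi> M' K b')) = \<iota> N (f N a b)"
  using K R N cl f by (subst \<iota>_eq_iff) (auto simp: c intro!: bexI[of _ R])
 then show ?thesis by (simp add: lim_op2_def r(1) r'(1) Let_def K_def)
qed

lemma L_add: "N \<in> J ==> a \<in> carrier (A N) ==> b \<in> carrier (A N) ==> \<iota> N a \<oplus>\<^bsub>L\<^esub> \<iota> N b = \<iota> N (a \<oplus>\<^bsub>A N\<^esub> b)"
 and L_mult: "N \<in> J ==> a \<in> carrier (A N) ==> b \<in> carrier (A N) ==> \<iota> N a \<otimes>\<^bsub>L\<^esub> \<iota> N b = \<iota> N (a \<otimes>\<^bsub>A N\<^esub> b)"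
 and L_smult: "N \<in> J ==> a \<in> carrier (A N) ==> c \<odot>\<^bsub>L\<^esub> \<iota> N a = \<iota> N (c \<odot>\<^bsub>A N\<^esub> a)"
proof -
 have cl: "a \<oplus>\<^bsub>A N\<^esub> b \<in> carrier (A N)" "a \<otimes>\<^bsub>A N\<^esub> b \<in> carrier (A N)" "c \<odot>\<^bsub>A N\<^esub> a \<in> carrier (A N)"
  if "N \<in> J" "a \<in> carrier (A N)" "b \<in> carrier (A N)" for N a b c
 proof -
  interpret A: cx_algebra "A N" by (rule alg[OF that(1)])
  show "a \<oplus>\<^bsub>A N\<^esub> b \<in> carrier (A N)" "a \<otimes>\<^bsub>A N\<^esub> b \<in> carrier (A N)" "c \<odot>\<^bsub>A N\<^esub> a \<in> carrier (A N)" using that by simp_all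
 qed
 assume N: "N \<in> J" "a \<in> carrier (A N)"
 show "c \<odot>\<^bsub>L\<^esub> \<iota> N a = \<iota> N (c \<odot>\<^bsub>A N\<^esub> a)"
  using op1[of "\<lambda>N. smult (A N) c" N a] N cl hom_sm[OF hom] by (simp add: lim_alg_def)
 assume b: "b \<in> carrier (A N)"
 show "\<iota> N a \<oplus>\<^bsub>L\<^esub> \<iota> N b = \<iota> N (a \<oplus>\<^bsub>A N\<^esub> b)"
  using op2[of "\<lambda>N. add (A N)" N a b] N b cl hom_add[OF hom] by (simp add: lim_alg_def)
 show "\<iota> N a \<otimes>\<^bsub>L\<^esub> \<iota> N b = \<iota> N (a \<otimes>\<^bsub>A N\<^esub> b)"
  using op2[of "\<lambda>N. mult (A N)" N a b] N b cl hom_mult[OF hom] by (simp add: lim_alg_def)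
qed

lemma Inf_J: "Inf J \<in> J" using cofinal[of 0] by (intro Inf_nat_def1) auto

text \<open>Unit and zero of the limit are defined at the least level; the transition morphisms
  carry them to every other one.\<close>

lemma L_one: "N \<in> J ==> \<one>\<^bsub>L\<^esub> = \<iota> N \<one>\<^bsub>A N\<^esub>" and L_zero: "N \<in> J ==> \<zero>\<^bsub>L\<^esub> = \<iota> N \<zero>\<^bsub>A N\<^esub>"
proof -
 assume N: "N \<in> J"
 have le: "Inf J \<le> N" by (rule cInf_lower[OF N]) simp
 interpret I: cx_algebra "A (Inf J)" by (rule alg[OF Inf_J])
 interpret A: cx_algebra "A N" by (rule alg[OF N])
 note h = hom[OF Inf_J N le]
 show "\<one>\<^bsub>L\<^esub> = \<iota> N \<one>\<^bsub>A N\<^esub>" using \<iota>_\<phi>[OF Inf_J N le I.one_closed] hom_one[OF h] by (simp add: lim_alg_def)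
 show "\<zero>\<^bsub>L\<^esub> = \<iota> N \<zero>\<^bsub>A N\<^esub>" using \<iota>_\<phi>[OF Inf_J N le I.zero_closed] lin_zero[OF hom_lin[OF h] I.cvec_axioms A.cvec_axioms] by (simp add: lim_alg_def)
qed

lemma cx_algebra_L: "cx_algebra L"
proof -
 note ops = L_add L_mult L_smult
 have A: "module cx (A N)" "ring (A N)" "cx_algebra (A N)" "cvec (A N)" if "N \<in> J" for N
  using alg[OF that] by (auto simp: cx_algebra_def cvec_def)
 show ?thesis
 proof (rule cx_algebraI[OF cvecI])
  fix T U R assume TUR: "T \<in> carrier L" "U \<in> carrier L" "R \<in> carrier L"
  obtain N a b c where N: "N \<in> J" "a \<in> carrier (A N)" "T = \<iota> N a" "b \<in> carrier (A N)" "U = \<iota> N b" "c \<in> carrier (A N)" "R = \<iota> N c"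
   by (rule level3[OF TUR])
  interpret A: cx_algebra "A N" by (rule alg[OF N(1)])
  note [simp] = N L_add[OF N(1)] L_mult[OF N(1)]
  show "T \<oplus>\<^bsub>L\<^esub> U \<oplus>\<^bsub>L\<^esub> R = T \<oplus>\<^bsub>L\<^esub> (U \<oplus>\<^bsub>L\<^esub> R)" by (simp add: A.a_assoc)
  show "T \<otimes>\<^bsub>L\<^esub> U \<otimes>\<^bsub>L\<^esub> R = T \<otimes>\<^bsub>L\<^esub> (U \<otimes>\<^bsub>L\<^esub> R)" by (simp add: A.m_assoc)
  show "(T \<oplus>\<^bsub>L\<^esub> U) \<otimes>\<^bsub>L\<^esub> R = T \<otimes>\<^bsub>L\<^esub> R \<oplus>\<^bsub>L\<^esub> U \<otimes>\<^bsub>L\<^esub> R" by (simp add: A.l_distr)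
  show "R \<otimes>\<^bsub>L\<^esub> (T \<oplus>\<^bsub>L\<^esub> U) = R \<otimes>\<^bsub>L\<^esub> T \<oplus>\<^bsub>L\<^esub> R \<otimes>\<^bsub>L\<^esub> U" by (simp add: A.r_distr)
 next
  fix T U c assume TU: "T \<in> carrier L" "U \<in> carrier L"
  obtain N a b where N: "N \<in> J" "a \<in> carrier (A N)" "T = \<iota> N a" "b \<in> carrier (A N)" "U = \<iota> N b" by (rule level2[OF TU])
  interpret A: cx_algebra "A N" by (rule alg[OF N(1)])
  note [simp] = N L_add[OF N(1)] L_mult[OF N(1)] L_smult[OF N(1)] \<iota>_closed[OF N(1)]
  show "T \<oplus>\<^bsub>L\<^esub> U \<in> carrier L" "T \<otimes>\<^bsub>L\<^esub> U \<in> carrier L" by simp_all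
  show "T \<oplus>\<^bsub>L\<^esub> U = U \<oplus>\<^bsub>L\<^esub> T" by (simp add: A.a_comm)
  show "c \<odot>\<^bsub>L\<^esub> (T \<oplus>\<^bsub>L\<^esub> U) = c \<odot>\<^bsub>L\<^esub> T \<oplus>\<^bsub>L\<^esub> c \<odot>\<^bsub>L\<^esub> U" by (simp add: A.sm_distr)
  show "(c \<odot>\<^bsub>L\<^esub> T) \<otimes>\<^bsub>L\<^esub> U = c \<odot>\<^bsub>L\<^esub> (T \<otimes>\<^bsub>L\<^esub> U)" by (simp add: A.smult_mult_left)
  show "T \<otimes>\<^bsub>L\<^esub> (c \<odot>\<^bsub>L\<^esub> U) = c \<odot>\<^bsub>L\<^esub> (T \<otimes>\<^bsub>L\<^esub> U)" by (simp add: A.smult_mult_right)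
 next
  fix T and c d :: complex assume T: "T \<in> carrier L"
  obtain N a where N: "N \<in> J" "0 \<le> N" "a \<in> carrier (A N)" "T = \<iota> N a" by (rule level[OF T])
  interpret A: cx_algebra "A N" by (rule alg[OF N(1)])
  note [simp] = N L_add[OF N(1)] L_mult[OF N(1)] L_smult[OF N(1)] \<iota>_closed[OF N(1)] L_one[OF N(1)] L_zero[OF N(1)]
  show "c \<odot>\<^bsub>L\<^esub> T \<in> carrier L" "\<zero>\<^bsub>L\<^esub> \<oplus>\<^bsub>L\<^esub> T = T" "\<one>\<^bsub>L\<^esub> \<otimes>\<^bsub>L\<^esub> T = T" "T \<otimes>\<^bsub>L\<^esub> \<one>\<^bsub>L\<^esub> = T"
   "1 \<odot>\<^bsub>L\<^esub> T = T" "0 \<odot>\<^bsub>L\<^esub> T = \<zero>\<^bsub>L\<^esub>" by (simp_all add: A.sm_0)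
  show "(c + d) \<odot>\<^bsub>L\<^esub> T = c \<odot>\<^bsub>L\<^esub> T \<oplus>\<^bsub>L\<^esub> d \<odot>\<^bsub>L\<^esub> T" "(c * d) \<odot>\<^bsub>L\<^esub> T = c \<odot>\<^bsub>L\<^esub> (d \<odot>\<^bsub>L\<^esub> T)" by (simp_all add: A.sm_add A.sm_sm)
 next
  interpret I: cx_algebra "A (Inf J)" by (rule alg[OF Inf_J])
  show "\<zero>\<^bsub>L\<^esub> \<in> carrier L" "\<one>\<^bsub>L\<^esub> \<in> carrier L" by (simp_all add: L_zero[OF Inf_J] L_one[OF Inf_J] \<iota>_closed[OF Inf_J])
 qed
qed

lemma \<iota>_hom: "N \<in> J ==> \<iota> N \<in> alg_homs (A N) L"
 by (intro alg_homsI lin_mapsI) (simp_all add: \<iota>_closed L_add L_mult L_smult L_one)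

end

section \<open>Relations, actions and coactions in the limit\<close>

context uq
begin

lemma hcond_cong: "(!!i. i \<in> I ==> y i = y' i) ==> hcond B I y ==> hcond B I y'"
 unfolding hcond_def by (simp cong: ball_cong)

text \<open>Each relation involves at most two indices and so belongs to a finite stage.\<close>

lemma hcond_directed:
 assumes N: "!!n. \<exists>N\<ge>n. hcond B {1..N} b"
 shows "hcond B {1..} b"
proof -
 have ex: "\<exists>N. i \<in> {1..N} \<and> j \<in> {1..N} \<and> hcond B {1..N} b" if "i \<in> {1..}" "j \<in> {1..}" for i j :: nat
  using N[of "max i j"] that by auto
 show ?thesis
  unfolding hcond_def
 proof (intro conjI ballI impI)
  fix i assume "i \<in> {1::nat..}"
  then show "b i \<in> carrier B" "b i [^]\<^bsub>B\<^esub> p = \<zero>\<^bsub>B\<^esub>" using ex[of i i] hcondD[of B _ b i] by blast+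
 next
  fix i j :: nat assume "i \<in> {1..}" "j \<in> {1..}" and p: "odd i" "even j"
  then obtain N where "i \<in> {1..N}" "j \<in> {1..N}" "hcond B {1..N} b" using ex by blast
  then show "dzrel B (b i) (b j)" using p unfolding hcond_def by blast
 next
  fix i j :: nat assume "i \<in> {1..}" "j \<in> {1..}" and p: "even i" "even j" "j \<le> i"
  then obtain N where "i \<in> {1..N}" "j \<in> {1..N}" "hcond B {1..N} b" using ex by blast
  then show "zrel B (b i) (b j)" using p unfolding hcond_def by blast
 next
  fix i j :: nat assume "i \<in> {1..}" "j \<in> {1..}" and p: "odd i" "odd j" "j \<le> i"
  then obtain N where "i \<in> {1..N}" "j \<in> {1..N}" "hcond B {1..N} b" using ex by blast
  then show "drel B (b i) (b j)" using p unfolding hcond_def by blast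
 qed
qed

lemma idt_comp:
 assumes A: "cx_algebra A" and B: "cx_algebra B" and C: "cx_algebra C"
  and h: "h \<in> alg_homs A B" and k: "k \<in> alg_homs B C" and l: "l \<in> alg_homs A C"
  and e: "!!a. a \<in> carrier A ==> l a = k (h a)" and t: "t \<in> carrier (tensor H A)"
 shows "idt C l t = idt C k (idt B h t)"
proof -
 interpret A: tensor_algs "H" A by (rule tensor_algsI[OF cx_algebra_Uq A])
 interpret C: tensor_algs "H" C by (rule tensor_algsI[OF cx_algebra_Uq C])
 note ih = idt[OF A B h] and ik = idt[OF B C k] and il = idt[OF A C l]
 show ?thesis
  by (rule A.tensor_ext[OF hom_lin[OF il(1)] lin_comp[OF hom_lin[OF ih(1)] hom_lin[OF ik(1)]] C.T.cvec_Q _ t])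
   (simp add: ih(2) ik(2) il(2) e hom_closed[OF h])
qed

text \<open>The action is determined by its rules for multiplication by a generator, and the
  coaction by its values on generators; an algebra morphism that matches the generators therefore
  respects both. This makes the unit embeddings compatible with the whole structure.\<close>

lemma yd_data_map:
 assumes D: "yd_data p q s g Y I y" and D': "yd_data p q s g Y' I' y'" and h: "h \<in> alg_homs Y Y'"
  and I: "I \<subseteq> I'" and hy: "!!i. i \<in> I ==> h (y i) = y' i"
 shows "u \<in> carrier H ==> t \<in> carrier Y ==> h (act Y u t) = act Y' u (h t)"
  and "t \<in> carrier Y ==> coact Y' (h t) = idt Y' h (coact Y t)"
proof -
 interpret D: yd_data p q s g Y I y by (rule D)
 interpret D': yd_data p q s g Y' I' y' by (rule D')
 note hc = hom_closed[OF h] and hl = hom_add[OF h] hom_sm[OF h] hom_mult[OF h] hom_one[OF h]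
 have h0: "h \<zero>\<^bsub>Y\<^esub> = \<zero>\<^bsub>Y'\<^esub>" by (rule lin_zero[OF hom_lin[OF h] D.X.cvec_axioms D'.X.cvec_axioms])
 note lin = lin_add[OF D.act_lin] lin_sm[OF D.act_lin] lin_add[OF D'.act_lin] lin_sm[OF D'.act_lin]
 have K: "h (act Y (ug gK) t) = act Y' (ug gK) (h t)" if "t \<in> carrier Y" for t
  using D.gen D.X that
  by (induction rule: generated_induct)
   (simp_all add: D.unit_rules D'.unit_rules D.act_rules(1) hl hc hy D'.act_rules(1) subsetD[OF I] lin)
 have E: "h (act Y (ug gE) t) = act Y' (ug gE) (h t)" if "t \<in> carrier Y" for t
  using D.gen D.X that
  by (induction rule: generated_induct)
   (simp_all add: D.unit_rules D'.unit_rules D.act_rules(3) hl hc hy D'.act_rules(3) subsetD[OF I] lin h0 K)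
 have F: "h (act Y (ug gF) t) = act Y' (ug gF) (h t)" if "t \<in> carrier Y" for t
  using D.gen D.X that
  by (induction rule: generated_induct)
   (simp_all add: D.unit_rules D'.unit_rules D.act_rules(4) hl hc hy D'.act_rules(4) subsetD[OF I] lin h0)
 have G: "h (act Y (ug b) t) = act Y' (ug b) (h t)" if "t \<in> carrier Y" for b t
  using that by (cases b) (simp_all add: K E F)
 have "\<forall>t\<in>carrier Y. h (act Y u t) = act Y' u (h t)" if "u \<in> carrier H" for u
  using generated_Uq cx_algebra_Uq that
  by (induction rule: generated_induct)
   (simp_all add: D.act_1 D'.act_1 hc D.act_m D'.act_m G lin_add[OF D.act_lin'] lin_sm[OF D.act_lin'] lin_add[OF D'.act_lin'] lin_sm[OF D'.act_lin'] hl)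
 then show "u \<in> carrier H ==> t \<in> carrier Y ==> h (act Y u t) = act Y' u (h t)" by blast
 note i = idt[OF D.X D'.X h]
 show "coact Y' (h t) = idt Y' h (coact Y t)" if "t \<in> carrier Y"
 proof (rule generated_hom_ext[OF D.gen D.X D'.T.cx_algebra_tensor hom_comp[OF h D'.coact_hom] hom_comp[OF D.coact_hom i(1)] _ that])
  fix j assume j: "j \<in> I"
  then show "coact Y' (h (y j)) = idt Y' h (coact Y (y j))"
   using D'.coact_x[of j] subsetD[OF I j] hy[OF j] unfolding D.coact_x[OF j] i(3)[of y j, OF D.x_closed[OF j]]
   by (simp add: coact_gen_def)
 qed
qed

end

locale yd_system = uq p q s g for p q s g +
 fixes J :: "nat set" and A :: "nat => (uel, 'x) yd" and \<phi> :: "nat => nat => 'x => 'x" and x :: "nat => nat => 'x"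
 assumes cofinal: "\<exists>N\<in>J. n \<le> N"
  and data: "N \<in> J ==> yd_data p q s g (A N) {1..N} (x N)"
  and pres: "N \<in> J ==> presented_by (A N) {1..N} (x N) (HH_relators p {1..N})"
  and hom: "M \<in> J ==> N \<in> J ==> M \<le> N ==> \<phi> M N \<in> alg_homs (A M) (A N)"
  and gens: "M \<in> J ==> N \<in> J ==> M \<le> N ==> i \<in> {1..M} ==> \<phi> M N (x M i) = x N i"
begin

lemma alg: "N \<in> J ==> cx_algebra (A N)" by (rule yd_data.X[OF data])

sublocale direct_system J A \<phi>
proof (rule direct_system.intro)
 fix M N K :: nat and a
 show "\<phi> N N a = a" if N: "N \<in> J" "a \<in> carrier (A N)"
 proof (rule generated_hom_ext[OF presented_generated[OF pres[OF N(1)]] alg[OF N(1)] alg[OF N(1)] hom[OF N(1) N(1) order_refl] _ _ N(2)])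
  show "(\<lambda>a. a) \<in> alg_homs (A N) (A N)" by (rule alg_homsI[OF lin_id]) simp_all
 qed (rule gens[OF N(1) N(1) order_refl])
 show "\<phi> N K (\<phi> M N a) = \<phi> M K a" if J: "M \<in> J" "N \<in> J" "K \<in> J" "M \<le> N" "N \<le> K" "a \<in> carrier (A M)"
 proof (rule generated_hom_ext[OF presented_generated[OF pres[OF J(1)]] alg[OF J(1)] alg[OF J(3)] _ _ _ J(6)])
  show "(\<lambda>a. \<phi> N K (\<phi> M N a)) \<in> alg_homs (A M) (A K)" "\<phi> M K \<in> alg_homs (A M) (A K)"
   using J by (auto intro: hom_comp[OF hom hom] hom)
  show "\<phi> N K (\<phi> M N (x M i)) = \<phi> M K (x M i)" if "i \<in> {1..M}" for i
   using gens[of M N i] gens[of N K i] gens[of M K i] J that by simp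
 qed
qed (rule cofinal alg hom; assumption?)+

abbreviation "Z \<equiv> ind_lim H J A \<phi>"

definition xl :: "nat => (nat \<times> 'x) set" where "xl i = (let N = (LEAST N. N \<in> J \<and> i \<le> N) in \<iota> N (x N i))"

lemma x_closed: "N \<in> J ==> i \<in> {1..N} ==> x N i \<in> carrier (A N)"
 using yd_data.x_closed[OF data] .

lemma xl: "N \<in> J ==> i \<in> {1..N} ==> xl i = \<iota> N (x N i)"
proof -
 assume N: "N \<in> J" "i \<in> {1..N}"
 let ?M = "LEAST N. N \<in> J \<and> i \<le> N"
 have M: "?M \<in> J" "i \<in> {1..?M}" "?M \<le> N" using LeastI[of "\<lambda>N. N \<in> J \<and> i \<le> N" N] Least_le[of "\<lambda>N. N \<in> J \<and> i \<le> N" N] N by auto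
 have "\<iota> N (x N i) = \<iota> ?M (x ?M i)" using \<iota>_\<phi>[OF M(1) N(1) M(3) x_closed[OF M(1,2)]] gens[OF M(1) N(1) M(3,2)] by simp
 then show ?thesis by (simp add: xl_def Let_def)
qed

lemma act_closed: "N \<in> J ==> u \<in> carrier H ==> a \<in> carrier (A N) ==> act (A N) u a \<in> carrier (A N)"
 by (rule yd_data.act_closed[OF data])

lemma map_data: "M \<in> J ==> N \<in> J ==> M \<le> N ==> u \<in> carrier H ==> a \<in> carrier (A M) ==> \<phi> M N (act (A M) u a) = act (A N) u (\<phi> M N a)"
 "M \<in> J ==> N \<in> J ==> M \<le> N ==> a \<in> carrier (A M) ==> coact (A N) (\<phi> M N a) = idt (A N) (\<phi> M N) (coact (A M) a)"
 using yd_data_map[OF data[of M] data[of N] hom[of M N] _ gens[of M N]] by auto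

lemma act_Z: "N \<in> J ==> u \<in> carrier H ==> a \<in> carrier (A N) ==> act Z u (\<iota> N a) = \<iota> N (act (A N) u a)"
 unfolding ind_lim_def mk_yd_def using op1[of "\<lambda>N. act (A N) u" N a] act_closed map_data(1) by simp

text \<open>The definition evaluates at an arbitrarily chosen representative; passing to a later
  level leaves the value unchanged, because the transition maps respect the coactions.\<close>

lemma coact_Z:
 assumes N: "N \<in> J" "a \<in> carrier (A N)"
 shows "coact Z (\<iota> N a) = idt L (\<iota> N) (coact (A N) a)"
proof -
 have cc: "coact (A M) b \<in> carrier (tensor H (A M))" if "M \<in> J" "b \<in> carrier (A M)" for M b
  by (rule hom_closed[OF yd_data.coact_hom[OF data[OF that(1)]] that(2)])
 have up: "idt L (\<iota> M) (coact (A M) b) = idt L (\<iota> K) (coact (A K) (\<phi> M K b))" if "M \<in> J" "K \<in> J" "M \<le> K" "b \<in> carrier (A M)" for M K b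
  unfolding map_data(2)[OF that]
  by (rule idt_comp[OF alg alg cx_algebra_L hom \<iota>_hom \<iota>_hom _ cc]) (use that in \<open>simp_all add: \<iota>_\<phi>\<close>)
 obtain M b where r: "rep (\<iota> N a) = (M, b)" "M \<in> J" "b \<in> carrier (A M)" "\<iota> M b = \<iota> N a" by (rule rep_\<iota>[OF N])
 obtain K where K: "K \<in> J" "M \<le> K" "N \<le> K" "\<phi> M K b = \<phi> N K a" using r(4) \<iota>_eq_iff[OF r(2,3) N] by blast
 have "coact Z (\<iota> N a) = idt L (\<iota> M) (coact (A M) b)" by (simp add: ind_lim_def mk_yd_def r(1) idt_def)
 also have "... = idt L (\<iota> N) (coact (A N) a)" using up[OF r(2) K(1,2) r(3)] up[OF N(1) K(1,3) N(2)] K(4) by simp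
 finally show ?thesis .
qed

lemma L_hcond: "hcond L {1..} xl"
proof (rule hcond_directed)
 fix n
 obtain N where N: "N \<in> J" "n \<le> N" using cofinal by blast
 have "hcond L {1..N} (\<lambda>i. \<iota> N (x N i))"
  by (rule hom_hcond[OF \<iota>_hom[OF N(1)] alg[OF N(1)] cx_algebra_L presented_hcond[OF alg[OF N(1)] pres[OF N(1)]]])
 then have "hcond L {1..N} xl" by (rule hcond_cong[rotated]) (simp add: xl[OF N(1)])
 then show "\<exists>N\<ge>n. hcond L {1..N} xl" using N(2) by blast
qed

lemma xl_closed: "xl ` {1..} \<subseteq> carrier L" using hcondD(1)[OF L_hcond] by blast

lemma free_eval_L:
 assumes N: "N \<in> J" and f: "keys f \<subseteq> lists {1..N}"
 shows "free_eval L xl f = \<iota> N (free_eval (A N) (x N) f)"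
proof -
 have x: "x N ` {1..N} \<subseteq> carrier (A N)" using x_closed[OF N] by blast
 have "\<iota> N (free_eval (A N) (x N) f) = free_eval L (\<lambda>i. \<iota> N (x N i)) f" by (rule hom_free_eval[OF \<iota>_hom[OF N] alg[OF N] cx_algebra_L x f])
 also have "... = free_eval L xl f"
  by (rule free_eval_fun_cong[OF cx_algebra_L _ f]) (use xl[OF N] x \<iota>_closed[OF N] in auto)
 finally show ?thesis ..
qed

text \<open>A combination of words contains finitely many letters, so some level in \<open>J\<close>
  has them all.\<close>

lemma keys_level:
 assumes "keys f \<subseteq> lists {1..}"
 obtains N where "N \<in> J" "keys f \<subseteq> lists {1..N}"
proof -
 have "finite (\<Union>w\<in>keys f. set w)" by simp
 then obtain n where n: "\<forall>i\<in>(\<Union>w\<in>keys f. set w). i \<le> n" using finite_nat_set_iff_bounded_le by blast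
 obtain N where N: "N \<in> J" "n \<le> N" using cofinal by blast
 have "keys f \<subseteq> lists {1..N}" using assms n N(2) by (fastforce simp: lists_eq_set)
 with N(1) show ?thesis by (rule that)
qed

lemma presented_L: "presented_by L {1..} xl (HH_relators p {1..})"
proof -
 interpret P: pres "{1..}" "HH_relators p {1..}" by unfold_locales (rule HH_relators_keys)
 have mono: "two_sided {1..N} (HH_relators p {1..N}) \<subseteq> two_sided {1..} (HH_relators p {1..})" for N
 proof -
  have "HH_relators p {1..N} \<subseteq> HH_relators p {1..}" unfolding HH_relators_def by (intro Un_mono subsetI) force+
  moreover have "lists {1..N} \<subseteq> lists {1..}" by (intro lists_mono) auto
  ultimately show ?thesis unfolding two_sided_def by blast
 qed
 have kl: "free_eval L xl f = \<zero>\<^bsub>L\<^esub> \<longleftrightarrow> f \<in> cspan (two_sided {1..} (HH_relators p {1..}))" if f: "keys f \<subseteq> lists {1..}" for f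
 proof
  assume z: "free_eval L xl f = \<zero>\<^bsub>L\<^esub>"
  obtain N where N: "N \<in> J" "keys f \<subseteq> lists {1..N}" by (rule keys_level[OF f])
  interpret AN: cx_algebra "A N" by (rule alg[OF N(1)])
  have x: "x N ` {1..N} \<subseteq> carrier (A N)" using x_closed[OF N(1)] by blast
  have c: "free_eval (A N) (x N) f \<in> carrier (A N)" by (rule AN.free_eval_closed[OF x N(2)])
  \<comment> \<open>To vanish in the limit means to vanish at some later level, where the
    presentation of that product puts \<open>f\<close> into the ideal.\<close>
  obtain K where K: "K \<in> J" "N \<le> K" "\<phi> N K (free_eval (A N) (x N) f) = \<phi> N K \<zero>\<^bsub>A N\<^esub>"
   using z \<iota>_eq_iff[OF N(1) c N(1) AN.zero_closed] unfolding free_eval_L[OF N] L_zero[OF N(1)] by blast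
  interpret AK: cx_algebra "A K" by (rule alg[OF K(1)])
  note h = hom[OF N(1) K(1,2)]
  have "{1..N} \<subseteq> {1..K}" using K(2) by auto
  then have fK: "keys f \<subseteq> lists {1..K}" using N(2) lists_mono[of "{1..N}" "{1..K}"] by blast
  have "free_eval (A K) (x K) f = free_eval (A K) (\<lambda>i. \<phi> N K (x N i)) f"
   by (rule free_eval_fun_cong[OF alg[OF K(1)] _ N(2), symmetric]) (use gens[OF N(1) K(1,2)] x_closed[OF K(1)] K(2) in auto)
  also have "... = \<phi> N K (free_eval (A N) (x N) f)" by (rule hom_free_eval[OF h alg[OF N(1)] alg[OF K(1)] x N(2), symmetric])
  also have "... = \<zero>\<^bsub>A K\<^esub>" using K(3) lin_zero[OF hom_lin[OF h] AN.cvec_axioms AK.cvec_axioms] by simp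
  finally have "f \<in> cspan (two_sided {1..K} (HH_relators p {1..K}))" using pres[OF K(1)] fK by (simp add: presented_by_def)
  then show "f \<in> cspan (two_sided {1..} (HH_relators p {1..}))" using fv.span_mono[OF mono[of K]] by blast
 next
  assume "f \<in> cspan (two_sided {1..} (HH_relators p {1..}))"
  then show "free_eval L xl f = \<zero>\<^bsub>L\<^esub>"
   by (rule P.free_eval_ideal_zero[OF cx_algebra_L xl_closed, rotated]) (use iffD1[OF hcond_free_eval[OF cx_algebra_L xl_closed] L_hcond] in simp)
 qed
 have "T \<in> free_eval L xl ` {f. keys f \<subseteq> lists {1..}}" if T: "T \<in> carrier L" for T
 proof -
  obtain N a where N: "N \<in> J" "0 \<le> N" "a \<in> carrier (A N)" "T = \<iota> N a" by (rule level[OF T])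
  obtain f where f: "keys f \<subseteq> lists {1..N}" "a = free_eval (A N) (x N) f"
   using pres[OF N(1)] N(3) unfolding presented_by_def by blast
  have "lists {1..N} \<subseteq> lists {1..}" by (intro lists_mono) auto
  then show ?thesis using f N(4) free_eval_L[OF N(1) f(1)] by (intro image_eqI[of _ _ f]) auto
 qed
 moreover have "free_eval L xl f \<in> carrier L" if "keys f \<subseteq> lists {1..}" for f
  using cx_algebra.free_eval_closed[OF cx_algebra_L xl_closed that] .
 ultimately have sur: "free_eval L xl ` {f. keys f \<subseteq> lists {1..}} = carrier L" by blast
 show ?thesis unfolding presented_by_def using xl_closed sur kl by (intro conjI allI impI) simp_all
qed


text \<open>Read off at a level that contains both the index \<open>i\<close> and a representative
  of \<open>T\<close>.\<close>

lemma Z_rules: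
 assumes i: "1 \<le> i" and T: "T \<in> carrier L"
 shows "act Z (ug gK) (xl i \<otimes>\<^bsub>L\<^esub> T) = (if odd i then s ^ 2 else q ^ 2) \<odot>\<^bsub>L\<^esub> (xl i \<otimes>\<^bsub>L\<^esub> act Z (ug gK) T)"
  "act Z (ug gE) (xl i \<otimes>\<^bsub>L\<^esub> T) = (if odd i then act Z (ug gK) T
    else (- q) \<odot>\<^bsub>L\<^esub> (xl i \<otimes>\<^bsub>L\<^esub> (xl i \<otimes>\<^bsub>L\<^esub> act Z (ug gK) T))) \<oplus>\<^bsub>L\<^esub> xl i \<otimes>\<^bsub>L\<^esub> act Z (ug gE) T"
  "act Z (ug gF) (xl i \<otimes>\<^bsub>L\<^esub> T) = (if odd i then (- q) \<odot>\<^bsub>L\<^esub> (xl i \<otimes>\<^bsub>L\<^esub> (xl i \<otimes>\<^bsub>L\<^esub> T)) else T) \<oplus>\<^bsub>L\<^esub>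
    (if odd i then q ^ 2 else s ^ 2) \<odot>\<^bsub>L\<^esub> (xl i \<otimes>\<^bsub>L\<^esub> act Z (ug gF) T)"
proof -
 obtain N a where N: "N \<in> J" "i \<le> N" "a \<in> carrier (A N)" "T = \<iota> N a" by (rule level[OF T])
 interpret D: yd_data p q s g "A N" "{1..N}" "x N" by (rule data[OF N(1)])
 have iN: "i \<in> {1..N}" using i N by simp
 note [simp] = N(3,4) xl[OF N(1) iN] x_closed[OF N(1) iN] L_add[OF N(1)] L_mult[OF N(1)] L_smult[OF N(1)] act_Z[OF N(1)]
  D.act_rules[OF iN]
 show "act Z (ug gK) (xl i \<otimes>\<^bsub>L\<^esub> T) = (if odd i then s ^ 2 else q ^ 2) \<odot>\<^bsub>L\<^esub> (xl i \<otimes>\<^bsub>L\<^esub> act Z (ug gK) T)" by simp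
 show "act Z (ug gE) (xl i \<otimes>\<^bsub>L\<^esub> T) = (if odd i then act Z (ug gK) T
    else (- q) \<odot>\<^bsub>L\<^esub> (xl i \<otimes>\<^bsub>L\<^esub> (xl i \<otimes>\<^bsub>L\<^esub> act Z (ug gK) T))) \<oplus>\<^bsub>L\<^esub> xl i \<otimes>\<^bsub>L\<^esub> act Z (ug gE) T" by simp
 show "act Z (ug gF) (xl i \<otimes>\<^bsub>L\<^esub> T) = (if odd i then (- q) \<odot>\<^bsub>L\<^esub> (xl i \<otimes>\<^bsub>L\<^esub> (xl i \<otimes>\<^bsub>L\<^esub> T)) else T) \<oplus>\<^bsub>L\<^esub>
    (if odd i then q ^ 2 else s ^ 2) \<odot>\<^bsub>L\<^esub> (xl i \<otimes>\<^bsub>L\<^esub> act Z (ug gF) T)" by simp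
qed

lemma Z_same: "same_alg Z L" by (simp add: ind_lim_def mk_yd_def same_alg_def same_mod_def)

lemma Z_yd_data: "yd_data p q s g Z {1..} xl"
proof -
 interpret LA: cx_algebra L by (rule cx_algebra_L)
 have zs: "carrier Z = carrier L" "add Z = add L" "smult Z = smult L" "zero Z = zero L" "mult Z = mult L" "one Z = one L"
  using Z_same by (simp_all add: same_alg_def same_mod_def)
 have lm: "lin_maps Z Z = lin_maps L L" "lin_maps H Z = lin_maps H L" by (simp_all add: lin_maps_def zs)
 have ez: "End Z = End L" by (simp add: End_def lm zs)
 have lz: "lmul Z = lmul L" by (simp add: lmul_def[abs_def] zs)
 have tz: "tensor H Z = tensor H L" "tens H Z = tens H L"
  using tensor_cong[OF _ Z_same, of "H" "H"] tens_cong[OF _ same_alg_mod[OF Z_same], of "H" "H"] by (simp_all add: same_alg_def same_mod_def)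
 have ac: "act Z u T \<in> carrier L" if "u \<in> carrier H" "T \<in> carrier L" for u T
  by (rule level[OF that(2), of 0]) (simp add: act_Z act_closed \<iota>_closed that(1))
 have al: "act Z u \<in> lin_maps L L" if u: "u \<in> carrier H" for u
 proof (rule lin_mapsI)
  fix T U c assume T: "T \<in> carrier L"
  show "act Z u T \<in> carrier L" by (rule ac[OF u T])
  show "act Z u (c \<odot>\<^bsub>L\<^esub> T) = c \<odot>\<^bsub>L\<^esub> act Z u T"
  proof (rule level[OF T, of 0])
   fix N a assume N: "N \<in> J" "a \<in> carrier (A N)" "T = \<iota> N a"
   interpret D: yd_data p q s g "A N" "{1..N}" "x N" by (rule data[OF N(1)])
   show ?thesis using N u by (simp add: act_Z L_smult act_closed lin_sm[OF D.act_lin])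
  qed
  assume "U \<in> carrier L"
  then obtain N a b where N: "N \<in> J" "a \<in> carrier (A N)" "T = \<iota> N a" "b \<in> carrier (A N)" "U = \<iota> N b" by (rule level2[OF T])
  interpret D: yd_data p q s g "A N" "{1..N}" "x N" by (rule data[OF N(1)])
  show "act Z u (T \<oplus>\<^bsub>L\<^esub> U) = act Z u T \<oplus>\<^bsub>L\<^esub> act Z u U"
   using N u by (simp add: act_Z L_add act_closed lin_add[OF D.act_lin])
 qed
 have al': "(\<lambda>u. act Z u T) \<in> lin_maps H L" if T: "T \<in> carrier L" for T
 proof (rule level[OF T, of 0])
  fix N a assume N: "N \<in> J" "a \<in> carrier (A N)" "T = \<iota> N a"
  interpret D: yd_data p q s g "A N" "{1..N}" "x N" by (rule data[OF N(1)])
  show ?thesis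
   using N by (intro lin_mapsI) (simp_all add: act_Z L_add L_smult act_closed \<iota>_closed lin_add[OF D.act_lin'] lin_sm[OF D.act_lin'])
 qed
 have am: "act Z (u \<otimes>\<^bsub>H\<^esub> v) T = act Z u (act Z v T)" and a1: "act Z \<one>\<^bsub>H\<^esub> T = T"
  if "u \<in> carrier H" "v \<in> carrier H" and T: "T \<in> carrier L" for u v T
 proof -
  obtain N a where N: "N \<in> J" "0 \<le> N" "a \<in> carrier (A N)" "T = \<iota> N a" by (rule level[OF T])
  interpret D: yd_data p q s g "A N" "{1..N}" "x N" by (rule data[OF N(1)])
  show "act Z (u \<otimes>\<^bsub>H\<^esub> v) T = act Z u (act Z v T)" "act Z \<one>\<^bsub>H\<^esub> T = T"
   using that N by (simp_all add: act_Z act_closed D.act_m D.act_1)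
 qed
 let ?r = "\<lambda>u. restrict (act Z u) (carrier L)"
 have r: "?r \<in> alg_homs H (End L)"
  by (rule end_hom[OF LA.cvec_axioms cx_algebra_Uq al al' am a1[OF H.one_closed H.one_closed]])
 have E: "cx_algebra (End L)" by (rule cx_algebra_end[OF LA.cvec_axioms])
 interpret E: cx_algebra "End L" by (rule E)
 have xc: "xl i \<in> carrier L" if "1 \<le> i" for i using xl_closed that by auto
 have sc: "scond (End L) {1..} (\<lambda>i. lmul L (xl i)) (\<lambda>b. ?r (ug b))"
  unfolding scond_def
 proof (intro conjI ballI)
  show "ucond (End L) (\<lambda>b. ?r (ug b))" by (rule hom_ucond[OF r cx_algebra_Uq E ucond_Uq])
  show "hcond (End L) {1..} (\<lambda>i. lmul L (xl i))" by (rule hom_hcond[OF lmul_hom[OF cx_algebra_L] cx_algebra_L E L_hcond])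
  fix i assume "i \<in> {1::nat..}"
  then have i: "1 \<le> i" by simp
  note [simp] = hom_closed[OF r ug_closed] hom_closed[OF lmul_hom[OF cx_algebra_L] xc[OF i]] xc[OF i] ac end_simps lmul_apply
  show "if odd i then dcross (End L) (\<lambda>b. ?r (ug b)) (lmul L (xl i)) else zcross (End L) (\<lambda>b. ?r (ug b)) (lmul L (xl i))"
  proof (cases "odd i")
   case True
   show ?thesis unfolding if_P[OF True] dcross_def
    by (intro conjI end_ext[where V = L]) (simp_all add: True Z_rules[OF i] LA.m_assoc)
  next
   case False
   show ?thesis unfolding if_not_P[OF False] zcross_def
    by (intro conjI end_ext[where V = L]) (simp_all add: False Z_rules[OF i] LA.m_assoc)
  qed
 qed
 show ?thesis
 proof (rule yd_data.intro[OF uq_axioms cx_algebra_cong[OF Z_same cx_algebra_L] yd_data_axioms.intro])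
  show "generated_by Z {1..} xl" by (rule iffD2[OF generated_cong[OF Z_same] presented_generated[OF presented_L]])
  show "scond (End Z) {1..} (\<lambda>i. lmul Z (xl i)) (\<lambda>b. restrict (act Z (ug b)) (carrier Z))"
   unfolding ez lz zs by (rule sc)
  show "act Z (ug b) \<one>\<^bsub>Z\<^esub> = counit H (ug b) \<odot>\<^bsub>Z\<^esub> \<one>\<^bsub>Z\<^esub>" for b
  proof -
   interpret D: yd_data p q s g "A (Inf J)" "{1..Inf J}" "x (Inf J)" by (rule data[OF Inf_J])
   show ?thesis using Inf_J unfolding zs by (simp add: L_one[OF Inf_J] act_Z L_smult D.act_unit del: counit_ug)
  qed
  have ch: "coact Z \<in> alg_homs L (tensor H L)"
  proof (rule alg_homsI[OF lin_mapsI])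
   fix T U c assume T: "T \<in> carrier L"
   obtain N a where N: "N \<in> J" "0 \<le> N" "a \<in> carrier (A N)" "T = \<iota> N a" by (rule level[OF T])
   interpret D: yd_data p q s g "A N" "{1..N}" "x N" by (rule data[OF N(1)])
   note h = hom_comp[OF D.coact_hom idt(1)[OF alg[OF N(1)] cx_algebra_L \<iota>_hom[OF N(1)]]]
   show "coact Z T \<in> carrier (tensor H L)" using hom_closed[OF h N(3)] by (simp add: N coact_Z)
   show "coact Z (c \<odot>\<^bsub>L\<^esub> T) = c \<odot>\<^bsub>tensor H L\<^esub> coact Z T" using hom_sm[OF h N(3)] N by (simp add: L_smult coact_Z)
  next
   fix T U assume "T \<in> carrier L" "U \<in> carrier L"
   then obtain N a b where N: "N \<in> J" "a \<in> carrier (A N)" "T = \<iota> N a" "b \<in> carrier (A N)" "U = \<iota> N b" by (rule level2)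
   interpret D: yd_data p q s g "A N" "{1..N}" "x N" by (rule data[OF N(1)])
   note h = hom_comp[OF D.coact_hom idt(1)[OF alg[OF N(1)] cx_algebra_L \<iota>_hom[OF N(1)]]]
   show "coact Z (T \<oplus>\<^bsub>L\<^esub> U) = coact Z T \<oplus>\<^bsub>tensor H L\<^esub> coact Z U" using hom_add[OF h N(2,4)] N by (simp add: L_add coact_Z)
   show "coact Z (T \<otimes>\<^bsub>L\<^esub> U) = coact Z T \<otimes>\<^bsub>tensor H L\<^esub> coact Z U" using hom_mult[OF h N(2,4)] N by (simp add: L_mult coact_Z)
  next
   interpret D: yd_data p q s g "A (Inf J)" "{1..Inf J}" "x (Inf J)" by (rule data[OF Inf_J])
   note h = hom_comp[OF D.coact_hom idt(1)[OF alg[OF Inf_J] cx_algebra_L \<iota>_hom[OF Inf_J]]]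
   show "coact Z \<one>\<^bsub>L\<^esub> = \<one>\<^bsub>tensor H L\<^esub>" using hom_one[OF h] Inf_J by (simp add: L_one[OF Inf_J] coact_Z)
  qed
  then show "coact Z \<in> alg_homs Z (tensor H Z)"
   unfolding tz by (subst alg_homs_cong[OF Z_same]) (simp_all add: same_alg_def same_mod_def)
  show "coact Z (xl i) = coact_gen (tensor H Z) (\<lambda>b. tens H Z (ug b) \<one>\<^bsub>Z\<^esub>) (\<lambda>i. tens H Z \<one>\<^bsub>H\<^esub> (xl i)) i"
   if i: "i \<in> {1..}" for i
  proof -
   obtain N where N: "N \<in> J" "i \<le> N" using cofinal by blast
   then have iN: "i \<in> {1..N}" using i by simp
   interpret D: yd_data p q s g "A N" "{1..N}" "x N" by (rule data[OF N(1)])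
   have "coact Z (xl i) = cgen L (\<lambda>i. \<iota> N (x N i)) i"
    using idt(3)[OF alg[OF N(1)] cx_algebra_L \<iota>_hom[OF N(1)], of "x N" i] x_closed[OF N(1) iN]
    by (simp add: xl[OF N(1) iN] coact_Z N D.coact_x[OF iN])
   then show ?thesis unfolding tz zs by (simp add: coact_gen_def xl[OF N(1) iN])
  qed
 qed (use al al' am a1[OF H.one_closed H.one_closed] in \<open>simp_all add: zs lm\<close>)
qed

end

section \<open>The infinite alternating products and the theorem\<close>

lemma HH_inf:
 assumes p: "p \<ge> 2" and J: "!!n. \<exists>N\<in>J. n \<le> N"
 shows "yd_algebra (Uq p) (HH_inf p J) \<and> presented_by (HH_inf p J) {1..} (HH_inf_gen p J) (HH_relators p {1..})"
proof -
 interpret U: uq p "qq p" "inverse (qq p)" "1 / (qq p - inverse (qq p))" using p by unfold_locales simp_all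
 interpret S: yd_system p "qq p" "inverse (qq p)" "1 / (qq p - inverse (qq p))" J "HH p" "HH_emb p" "HH_gen p"
  by (rule yd_system.intro[OF U.uq_axioms yd_system_axioms.intro])
   (rule J U.HH_yd_data U.HH_presented U.HH_emb_hom; assumption)+
 have "HH_inf_gen p J = S.xl" by (simp add: HH_inf_gen_def[abs_def] S.xl_def[abs_def])
 with yd_data.yd_algebra_X[OF S.Z_yd_data] iffD2[OF presented_cong[OF S.Z_same] S.presented_L]
 show ?thesis unfolding HH_inf_def by (intro conjI) simp_all
qed

theorem mainTheorem6:
  fixes p :: nat
  assumes "p \<ge> 2"
  shows
    "yd_algebra (Uq p) (Cd p) \<and> yd_algebra (Uq p) (Cz p) \<and>
     (\<forall>n\<ge>1. \<forall>N\<in>{2 * n, 2 * n + 1}.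
       (\<exists>!m. is_braided_mult (Uq p) (factors p 0 N) m) \<and>
       yd_algebra (Uq p) (HH p N) \<and>
       presented_by (HH p N) {1..N} (HH_gen p N) (HH_relators p {1..N})) \<and>
     (\<forall>J\<in>{{2 * n | n. n \<ge> 1}, {2 * n + 1 | n. n \<ge> 1}}.
       yd_algebra (Uq p) (HH_inf p J) \<and>
       presented_by (HH_inf p J) {1..} (HH_inf_gen p J) (HH_relators p {1..}))"
proof -
 interpret U: uq p "qq p" "inverse (qq p)" "1 / (qq p - inverse (qq p))" using assms by unfold_locales simp_all
 have "\<exists>!m. is_braided_mult (Uq p) (factors p 0 N) m" for N
  using U.BA_braided[OF U.alt_factors] U.braided_unique[OF U.alt_factors] by blast
 moreover have "yd_algebra (Uq p) (HH p N)" for N by (rule yd_data.yd_algebra_X[OF U.HH_yd_data])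
 \<comment> \<open>The even and the odd indices are each cofinal; 2 (k + 1) and 2 (k + 1) + 1 lie
   above k, the shift ensuring n \<ge> 1.\<close>
 moreover have "\<exists>N\<in>{2 * n | n. n \<ge> 1}. k \<le> N" for k :: nat by (intro bexI[of _ "2 * Suc k"] CollectI exI[of _ "Suc k"]) simp_all
 moreover have "\<exists>N\<in>{2 * n + 1 | n. n \<ge> 1}. k \<le> N" for k :: nat by (intro bexI[of _ "2 * Suc k + 1"] CollectI exI[of _ "Suc k"]) simp_all
 ultimately show ?thesis using U.yd_Cd_Cz U.HH_presented HH_inf[OF assms] by blast
qed

end
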